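(* Let $k$ be a commutative ring, $\mathbf{a}$ an essentially small $k$-linear category and $\kappa$ an infinite regular cardinal. The following conditions are equivalent for a $k$-linear Grothendieck topology $\mathcal{T}$ on $\mathbf{a}$: (i) $\mathcal{T}$ is $\kappa$-noetherian; (ii) $\mathcal{T}=\mathrm{top}(\mathcal{S})$ for a $\kappa$-bounded pretopology $\mathcal{S}$; (iii) for every functor $J:\mathbf{j}\to\mathsf{Sh}(\mathbf{a},\mathcal{T})$ from a $\kappa$-filtered category $\mathbf{j}$, the canonical morphism $\mathrm{colim}(\mathtt{I}\circ J)\to\mathtt{I}(\mathrm{colim}\,J)$ is an isomorphism, where $\mathtt{I}:\mathsf{Sh}(\mathbf{a},\mathcal{T})\to\mathsf{PSh}\,\mathbf{a}$ is the inclusion.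
   Context: $\mathsf{PSh}\,\mathbf{a}$ is the category of $k$-linear functors $\mathbf{a}^{op}\to\mathsf{Mod}_k$, with Yoneda embedding $\mathtt{Y}$. A sieve on $A$ is a $k$-linear subfunctor $R\subset\mathbf{a}(-,A)$; for $f:B\to A$, $f^{-1}R$ is the sieve on $B$ of all $g$ with $f\circ g\in R$. A ($k$-linear Grothendieck) topology assigns to each $A$ a set $\mathcal{T}(A)$ of sieves on $A$ with: (T1) $\mathbf{a}(-,A)\in\mathcal{T}(A)$; (T2) $R\in\mathcal{T}(A)$ and $f:B\to A$ imply $f^{-1}R\in\mathcal{T}(B)$; (T3) if $S$ is a sieve on $A$ and $R\in\mathcal{T}(A)$ with $f^{-1}S\in\mathcal{T}(B)$ for all $B$ and $f\in R(B)$, then $S\in\mathcal{T}(A)$. $\mathsf{Sh}(\mathbf{a},\mathcal{T})\subset\mathsf{PSh}\,\mathbf{a}$ is the full subcategory of $F$ with $F(A)\to\mathrm{Nat}(R,F)$ an isomorphism for all $A$, $R\in\mathcal{T}(A)$; it is a Grothendieck category, the inclusion $\mathtt{I}$ has an exact left adjoint $\mathtt{S}$, and $\mathtt{Z}=\mathtt{S}\circ\mathtt{Y}$. An object $M$ of a Grothendieck category $\mathbf{C}$ is $\kappa$-compact if $\mathbf{C}(M,-):\mathbf{C}\to\mathsf{Ab}$ commutes with $\kappa$-filtered colimits. $\mathcal{T}$ is $\kappa$-noetherian if $\mathtt{Z}(X)$ is $\kappa$-compact in $\mathsf{Sh}(\mathbf{a},\mathcal{T})$ for every $X\in\mathbf{a}$.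 Formal morphisms: for set-indexed families of objects of $\mathbf{a}$, a formal morphism $f:\amalg_\alpha A_\alpha\to\amalg_\beta B_\beta$ is an element of $\prod_\alpha\bigoplus_\beta\mathbf{a}(A_\alpha,B_\beta)$ (equivalently a morphism $\bigoplus_\alpha\mathtt{Y}(A_\alpha)\to\bigoplus_\beta\mathtt{Y}(B_\beta)$), composed accordingly. For $v=(v_\alpha):\amalg_\alpha V_\alpha\to A$, $R_v$ is the sieve on $A$ generated by all $v_\alpha$. A (formal) sequence is a pair of formal morphisms $\amalg_\gamma Z_\gamma\xrightarrow{p}\amalg_\beta Y_\beta\xrightarrow{q}X$ with $X\in\mathbf{a}$, $q\circ p=0$. A class of sequences is $\kappa$-bounded if all labelling sets of the formal coproducts occurring in its sequences have cardinality $<\kappa$. For a class $\mathcal{S}$ of sequences, $\mathcal{C}o(\mathcal{S})=\mathcal{C}o^1(\mathcal{S})$ is the class of right-hand morphisms $q$; $\mathcal{C}o^0(\mathcal{S})$ is the class of identity morphisms in $\mathbf{a}$; for $i>1$, $\mathcal{C}o^i(\mathcal{S})$ consists of all $(v_\alpha\circ w(\alpha)_\delta):\amalg_\alpha\amalg_{\delta\in D(\alpha)}W_\delta(\alpha)\to X$ with $v:\amalg_\alpha V_\alpha\to X$ in $\mathcal{C}o^{i-1}(\mathcal{S})$ and, for each $\alpha$, $w(\alpha):\amalg_{\delta\in D(\alpha)}W_\delta(\alpha)\to V_\alpha$ in $\mathcal{C}o(\mathcal{S})$. Set $\widetilde{\mathcal{C}o}(\mathcal{S})=\bigcup_{i\in\mathbb{N}}\mathcal{C}o^i(\mathcal{S})$;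 a subscript $X$ means target $X$. A pretopology is a class $\mathcal{S}$ of sequences such that: (PTa) for each $q:\amalg_\beta Y_\beta\to X$ in $\mathcal{C}o(\mathcal{S})$ and $f:A\to X$ in $\mathbf{a}$ there exist $q':\amalg_\delta C_\delta\to A$ in $\widetilde{\mathcal{C}o}_A(\mathcal{S})$ and a formal morphism $f':\amalg_\delta C_\delta\to\amalg_\beta Y_\beta$ with $q\circ f'=f\circ q'$; (PTb) for each sequence $(p,q)$ in $\mathcal{S}$ and $f:A\to\amalg_\beta Y_\beta$ with $A\in\mathbf{a}$, $q\circ f=0$, there exist $q':\amalg_\alpha B_\alpha\to A$ in $\widetilde{\mathcal{C}o}_A(\mathcal{S})$ and $f':\amalg_\alpha B_\alpha\to\amalg_\gamma Z_\gamma$ with $p\circ f'=f\circ q'$. $\mathrm{top}(\mathcal{S})$ is the Grothendieck topology of all sieves $R\subset\mathbf{a}(-,X)$ containing $R_r$ for some $r\in\widetilde{\mathcal{C}o}_X(\mathcal{S})$. *)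

theory Defs
  imports "HOL-Algebra.Module" "HOL-Library.FuncSet"
begin

unbundle cardinal_syntax

section \<open>Size\<close>

text \<open>
  A universe is given by the collection \<open>U\<close> of the subsets of a type that count as small; a set
  of any other type is small if it injects into a member of \<open>U\<close>.  If the type has strongly
  inaccessible cardinality, the subsets of smaller cardinality form a Grothendieck universe;
  the subsets of an infinite type always satisfy the three conditions.
  Closure under power sets is not imposed here: the only powers needed are those with exponent
  the set of morphisms of the base category, see \<open>essentially_small\<close> below.
\<close>

locale universe =
  fixes U :: "'u set set"
  assumes ordLeq_closed: "\<And>X Y. X \<in> U \<Longrightarrow> |Y| \<le>o |X| \<Longrightarrow> Y \<in> U"
    and infinite_mem: "\<exists>X\<in>U. infinite X"
    and UN_closed: "\<And>I X. I \<in> U \<Longrightarrow> (\<And>i. i \<in> I \<Longrightarrow> X i \<in> U) \<Longrightarrow> (\<Union>i\<in>I. X i) \<in> U"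

definition small :: "'u set set \<Rightarrow> 'x set \<Rightarrow> bool" where
  "small U X \<longleftrightarrow> (\<exists>Y\<in>U. |X| \<le>o |Y| )"


section \<open>Categories and functors\<close>

text \<open>
  Hom-sets are not required to be disjoint, so composition takes its three objects as arguments:
  \<open>Comp C A B D g f\<close> is the composite of \<open>f : A \<rightarrow> B\<close> and \<open>g : B \<rightarrow> D\<close>.
\<close>

record ('o, 'm) category =
  Obj :: "'o set"
  Hom :: "'o \<Rightarrow> 'o \<Rightarrow> 'm set"
  Ident :: "'o \<Rightarrow> 'm"
  Comp :: "'o \<Rightarrow> 'o \<Rightarrow> 'o \<Rightarrow> 'm \<Rightarrow> 'm \<Rightarrow> 'm"

locale category =
  fixes C :: "('o, 'm, 'z) category_scheme"
  assumes Ident_closed: "A \<in> Obj C \<Longrightarrow> Ident C A \<in> Hom C A A"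
    and Comp_closed: "\<lbrakk>A \<in> Obj C; B \<in> Obj C; D \<in> Obj C; f \<in> Hom C A B; g \<in> Hom C B D\<rbrakk>
      \<Longrightarrow> Comp C A B D g f \<in> Hom C A D"
    and Comp_Ident_left: "\<lbrakk>A \<in> Obj C; B \<in> Obj C; f \<in> Hom C A B\<rbrakk> \<Longrightarrow> Comp C A B B (Ident C B) f = f"
    and Comp_Ident_right: "\<lbrakk>A \<in> Obj C; B \<in> Obj C; f \<in> Hom C A B\<rbrakk> \<Longrightarrow> Comp C A A B f (Ident C A) = f"
    and Comp_assoc: "\<lbrakk>A \<in> Obj C; B \<in> Obj C; D \<in> Obj C; E \<in> Obj C;
        f \<in> Hom C A B; g \<in> Hom C B D; h \<in> Hom C D E\<rbrakk>
      \<Longrightarrow> Comp C A D E h (Comp C A B D g f) = Comp C A B E (Comp C B D E h g) f"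

definition is_iso :: "('o, 'm, 'z) category_scheme \<Rightarrow> 'o \<Rightarrow> 'o \<Rightarrow> 'm \<Rightarrow> bool" where
  "is_iso C A B f \<longleftrightarrow> f \<in> Hom C A B \<and>
     (\<exists>g\<in>Hom C B A. Comp C A B A g f = Ident C A \<and> Comp C B A B f g = Ident C B)"

definition small_category :: "'u set set \<Rightarrow> ('o, 'm, 'z) category_scheme \<Rightarrow> bool" where
  "small_category U C \<longleftrightarrow> category C \<and> small U (Obj C) \<and>
     (\<forall>A\<in>Obj C. \<forall>B\<in>Obj C. small U (Hom C A B))"

definition full_subcategory ::
  "('o, 'm, 'z) category_scheme \<Rightarrow> ('o \<Rightarrow> bool) \<Rightarrow> ('o, 'm, 'z) category_scheme" where
  "full_subcategory C P = C\<lparr>Obj := {A \<in> Obj C. P A}\<rparr>"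

record ('o, 'm, 'p, 'n) functor_data =
  map_obj :: "'o \<Rightarrow> 'p"
  map_arr :: "'o \<Rightarrow> 'o \<Rightarrow> 'm \<Rightarrow> 'n"

locale is_functor = C: category C + D: category D
  for C :: "('o, 'm, 'z) category_scheme" and D :: "('p, 'n, 'y) category_scheme" +
  fixes F :: "('o, 'm, 'p, 'n) functor_data"
  assumes map_obj_closed: "A \<in> Obj C \<Longrightarrow> map_obj F A \<in> Obj D"
    and map_arr_closed: "\<lbrakk>A \<in> Obj C; B \<in> Obj C; f \<in> Hom C A B\<rbrakk>
      \<Longrightarrow> map_arr F A B f \<in> Hom D (map_obj F A) (map_obj F B)"
    and map_Ident: "A \<in> Obj C \<Longrightarrow> map_arr F A A (Ident C A) = Ident D (map_obj F A)"
    and map_Comp: "\<lbrakk>A \<in> Obj C; B \<in> Obj C; E \<in> Obj C; f \<in> Hom C A B; g \<in> Hom C B E\<rbrakk>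
      \<Longrightarrow> map_arr F A E (Comp C A B E g f) =
          Comp D (map_obj F A) (map_obj F B) (map_obj F E) (map_arr F B E g) (map_arr F A B f)"

definition comp_functor ::
  "('p, 'n, 'q, 'l) functor_data \<Rightarrow> ('o, 'm, 'p, 'n) functor_data \<Rightarrow> ('o, 'm, 'q, 'l) functor_data" where
  "comp_functor G F = \<lparr>map_obj = \<lambda>A. map_obj G (map_obj F A),
     map_arr = \<lambda>A B f. map_arr G (map_obj F A) (map_obj F B) (map_arr F A B f)\<rparr>"

definition inclusion_functor :: "('o, 'm, 'o, 'm) functor_data" where
  "inclusion_functor = \<lparr>map_obj = \<lambda>A. A, map_arr = \<lambda>A B f. f\<rparr>"


section \<open>Filtered colimits\<close>

definition is_cocone :: "('i, 'a, 'y) category_scheme \<Rightarrow> ('o, 'm, 'z) category_scheme \<Rightarrow>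
    ('i, 'a, 'o, 'm) functor_data \<Rightarrow> 'o \<Rightarrow> ('i \<Rightarrow> 'm) \<Rightarrow> bool" where
  "is_cocone j C J L l \<longleftrightarrow> L \<in> Obj C \<and> (\<forall>x\<in>Obj j. l x \<in> Hom C (map_obj J x) L) \<and>
     (\<forall>x\<in>Obj j. \<forall>y\<in>Obj j. \<forall>u\<in>Hom j x y.
        Comp C (map_obj J x) (map_obj J y) L (l y) (map_arr J x y u) = l x)"

definition is_colimit :: "('i, 'a, 'y) category_scheme \<Rightarrow> ('o, 'm, 'z) category_scheme \<Rightarrow>
    ('i, 'a, 'o, 'm) functor_data \<Rightarrow> 'o \<Rightarrow> ('i \<Rightarrow> 'm) \<Rightarrow> bool" where
  "is_colimit j C J L l \<longleftrightarrow> is_cocone j C J L l \<and>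
     (\<forall>M m. is_cocone j C J M m \<longrightarrow>
        (\<exists>!h. h \<in> Hom C L M \<and> (\<forall>x\<in>Obj j. Comp C (map_obj J x) L M h (l x) = m x)))"

text \<open>The canonical morphism \<open>colim (F \<circ> J) \<rightarrow> F (colim J)\<close> is an isomorphism.\<close>

definition commutes_with_colimit :: "('i, 'a, 'y) category_scheme \<Rightarrow>
    ('o, 'm, 'z) category_scheme \<Rightarrow> ('p, 'n, 'w) category_scheme \<Rightarrow>
    ('o, 'm, 'p, 'n) functor_data \<Rightarrow> ('i, 'a, 'o, 'm) functor_data \<Rightarrow> bool" where
  "commutes_with_colimit j C D F J \<longleftrightarrow>
     (\<forall>L l P p. is_colimit j C J L l \<longrightarrow> is_colimit j D (comp_functor F J) P p \<longrightarrow>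
        (\<exists>h. is_iso D P (map_obj F L) h \<and>
          (\<forall>x\<in>Obj j. Comp D (map_obj F (map_obj J x)) P (map_obj F L) h (p x) =
             map_arr F (map_obj J x) L (l x))))"

text \<open>
  Every set of fewer than \<open>\<kappa>\<close> objects has an upper bound (in particular there is an object), and
  every set of fewer than \<open>\<kappa>\<close> parallel arrows can be coequalised.
\<close>

definition filtered :: "'c rel \<Rightarrow> ('i, 'a, 'y) category_scheme \<Rightarrow> bool" where
  "filtered \<kappa> j \<longleftrightarrow>
     (\<forall>X. X \<subseteq> Obj j \<and> |X| <o \<kappa> \<longrightarrow> (\<exists>z\<in>Obj j. \<forall>x\<in>X. Hom j x z \<noteq> {})) \<and>
     (\<forall>x\<in>Obj j. \<forall>y\<in>Obj j. \<forall>M. M \<subseteq> Hom j x y \<and> |M| <o \<kappa> \<longrightarrow>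
        (\<exists>z\<in>Obj j. \<exists>h\<in>Hom j y z. \<forall>f\<in>M. \<forall>g\<in>M. Comp j x y z h f = Comp j x y z h g))"


section \<open>Linear categories\<close>

record ('o, 'm, 'k) linear_category = "('o, 'm) category" +
  HomMod :: "'o \<Rightarrow> 'o \<Rightarrow> ('k, 'm) module"

locale linear_category = category C + cring K
  for K :: "'k ring" and C :: "('o, 'm, 'k) linear_category" +
  assumes carrier_HomMod: "\<lbrakk>A \<in> Obj C; B \<in> Obj C\<rbrakk> \<Longrightarrow> carrier (HomMod C A B) = Hom C A B"
    and module_HomMod: "\<lbrakk>A \<in> Obj C; B \<in> Obj C\<rbrakk> \<Longrightarrow> module K (HomMod C A B)"
    and Comp_add_left: "\<lbrakk>A \<in> Obj C; B \<in> Obj C; D \<in> Obj C;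
        f \<in> Hom C A B; g \<in> Hom C B D; g' \<in> Hom C B D\<rbrakk> \<Longrightarrow>
      Comp C A B D (g \<oplus>\<^bsub>HomMod C B D\<^esub> g') f = Comp C A B D g f \<oplus>\<^bsub>HomMod C A D\<^esub> Comp C A B D g' f"
    and Comp_add_right: "\<lbrakk>A \<in> Obj C; B \<in> Obj C; D \<in> Obj C;
        f \<in> Hom C A B; f' \<in> Hom C A B; g \<in> Hom C B D\<rbrakk> \<Longrightarrow>
      Comp C A B D g (f \<oplus>\<^bsub>HomMod C A B\<^esub> f') = Comp C A B D g f \<oplus>\<^bsub>HomMod C A D\<^esub> Comp C A B D g f'"
    and Comp_smult_left: "\<lbrakk>A \<in> Obj C; B \<in> Obj C; D \<in> Obj C;
        c \<in> carrier K; f \<in> Hom C A B; g \<in> Hom C B D\<rbrakk> \<Longrightarrow>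
      Comp C A B D (c \<odot>\<^bsub>HomMod C B D\<^esub> g) f = c \<odot>\<^bsub>HomMod C A D\<^esub> Comp C A B D g f"
    and Comp_smult_right: "\<lbrakk>A \<in> Obj C; B \<in> Obj C; D \<in> Obj C;
        c \<in> carrier K; f \<in> Hom C A B; g \<in> Hom C B D\<rbrakk> \<Longrightarrow>
      Comp C A B D g (c \<odot>\<^bsub>HomMod C A B\<^esub> f) = c \<odot>\<^bsub>HomMod C A D\<^esub> Comp C A B D g f"

text \<open>
  Every object is isomorphic to one from a set \<open>Sk\<close> of objects such that the set \<open>E\<close> of morphisms
  between members of \<open>Sk\<close> is small and \<open>X\<^sup>E\<close> is small for every small \<open>X\<close>.  The last clause is
  automatic in a Grothendieck universe.  The subsets of any type \<open>'u\<close> with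
  \<open>|'u|\<^sup>|\<^sup>E\<^sup>| \<le> |'u|\<close> satisfy it as well.
\<close>

definition essentially_small :: "'u set set \<Rightarrow> ('o, 'm, 'z) category_scheme \<Rightarrow> bool" where
  "essentially_small U C \<longleftrightarrow>
     (\<exists>Sk \<subseteq> Obj C. (\<forall>A\<in>Obj C. \<exists>B\<in>Sk. \<exists>f. is_iso C A B f) \<and>
        (let E = (SIGMA A:Sk. SIGMA B:Sk. Hom C A B)
         in small U E \<and> (\<forall>X\<in>U. small U (Func E X))))"

definition op_category :: "('o, 'm, 'k) linear_category \<Rightarrow> ('o, 'm, 'k) linear_category" where
  "op_category C = \<lparr>Obj = Obj C, Hom = \<lambda>A B. Hom C B A, Ident = Ident C,
     Comp = \<lambda>A B D g f. Comp C D B A f g, HomMod = \<lambda>A B. HomMod C B A\<rparr>"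

locale linear_functor = is_functor C D F + C: linear_category K C + D: linear_category K D
  for K :: "'k ring" and C :: "('o, 'm, 'k) linear_category"
    and D :: "('p, 'n, 'k) linear_category" and F :: "('o, 'm, 'p, 'n) functor_data" +
  assumes map_add: "\<lbrakk>A \<in> Obj C; B \<in> Obj C; f \<in> Hom C A B; g \<in> Hom C A B\<rbrakk> \<Longrightarrow>
      map_arr F A B (f \<oplus>\<^bsub>HomMod C A B\<^esub> g) =
      map_arr F A B f \<oplus>\<^bsub>HomMod D (map_obj F A) (map_obj F B)\<^esub> map_arr F A B g"
    and map_smult: "\<lbrakk>A \<in> Obj C; B \<in> Obj C; c \<in> carrier K; f \<in> Hom C A B\<rbrakk> \<Longrightarrow>
      map_arr F A B (c \<odot>\<^bsub>HomMod C A B\<^esub> f) =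
      c \<odot>\<^bsub>HomMod D (map_obj F A) (map_obj F B)\<^esub> map_arr F A B f"

text \<open>
  The ring multiplication and unit of a \<open>module\<close> record play no role for modules; they are left
  undefined below.
\<close>

definition linear_maps :: "'k ring \<Rightarrow> ('k, 'x) module \<Rightarrow> ('k, 'y) module \<Rightarrow> ('x \<Rightarrow> 'y) set" where
  "linear_maps K M N = {f \<in> carrier M \<rightarrow>\<^sub>E carrier N.
     (\<forall>x\<in>carrier M. \<forall>y\<in>carrier M. f (x \<oplus>\<^bsub>M\<^esub> y) = f x \<oplus>\<^bsub>N\<^esub> f y) \<and>
     (\<forall>c\<in>carrier K. \<forall>x\<in>carrier M. f (c \<odot>\<^bsub>M\<^esub> x) = c \<odot>\<^bsub>N\<^esub> f x)}"

definition Mod :: "'u set set \<Rightarrow> 'k ring \<Rightarrow> (('k, 'u) module, 'u \<Rightarrow> 'u, 'k) linear_category" where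
  "Mod U K =
     \<lparr>Obj = {M. module K M \<and> carrier M \<in> U},
      Hom = linear_maps K,
      Ident = \<lambda>M. restrict (\<lambda>x. x) (carrier M),
      Comp = \<lambda>M N P g f. compose (carrier M) g f,
      HomMod = \<lambda>M N. \<lparr>carrier = linear_maps K M N, mult = undefined, one = undefined,
        zero = restrict (\<lambda>x. \<zero>\<^bsub>N\<^esub>) (carrier M),
        add = \<lambda>f g. restrict (\<lambda>x. f x \<oplus>\<^bsub>N\<^esub> g x) (carrier M),
        smult = \<lambda>c f. restrict (\<lambda>x. c \<odot>\<^bsub>N\<^esub> f x) (carrier M)\<rparr>\<rparr>"

definition nat_trans :: "('o, 'm, 'z) category_scheme \<Rightarrow> ('p, 'n, 'y) category_scheme \<Rightarrow>
    ('o, 'm, 'p, 'n) functor_data \<Rightarrow> ('o, 'm, 'p, 'n) functor_data \<Rightarrow> ('o \<Rightarrow> 'n) set" where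
  "nat_trans C D F G = {t \<in> (\<Pi>\<^sub>E A\<in>Obj C. Hom D (map_obj F A) (map_obj G A)).
     \<forall>A\<in>Obj C. \<forall>B\<in>Obj C. \<forall>f\<in>Hom C A B.
       Comp D (map_obj F A) (map_obj F B) (map_obj G B) (t B) (map_arr F A B f) =
       Comp D (map_obj F A) (map_obj G A) (map_obj G B) (map_arr G A B f) (t A)}"

definition linear_functor_category :: "'k ring \<Rightarrow> ('o, 'm, 'k) linear_category \<Rightarrow>
    ('p, 'n, 'k) linear_category \<Rightarrow>
    (('o, 'm, 'p, 'n) functor_data, 'o \<Rightarrow> 'n, 'k) linear_category" where
  "linear_functor_category K C D =
     \<lparr>Obj = {F. linear_functor K C D F},
      Hom = nat_trans C D,
      Ident = \<lambda>F. \<lambda>A\<in>Obj C. Ident D (map_obj F A),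
      Comp = \<lambda>F G H s t. \<lambda>A\<in>Obj C.
        Comp D (map_obj F A) (map_obj G A) (map_obj H A) (s A) (t A),
      HomMod = \<lambda>F G. \<lparr>carrier = nat_trans C D F G, mult = undefined, one = undefined,
        zero = (\<lambda>A\<in>Obj C. \<zero>\<^bsub>HomMod D (map_obj F A) (map_obj G A)\<^esub>),
        add = \<lambda>s t. \<lambda>A\<in>Obj C. s A \<oplus>\<^bsub>HomMod D (map_obj F A) (map_obj G A)\<^esub> t A,
        smult = \<lambda>c t. \<lambda>A\<in>Obj C. c \<odot>\<^bsub>HomMod D (map_obj F A) (map_obj G A)\<^esub> t A\<rparr>\<rparr>"

definition Ab :: "('x monoid, 'x \<Rightarrow> 'x) category" where
  "Ab = \<lparr>Obj = {G. comm_group G},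
     Hom = \<lambda>G H. hom G H \<inter> extensional (carrier G),
     Ident = \<lambda>G. restrict (\<lambda>x. x) (carrier G),
     Comp = \<lambda>G H I g f. compose (carrier G) g f\<rparr>"

definition hom_functor :: "('o, 'm, 'k) linear_category \<Rightarrow> 'o \<Rightarrow>
    ('o, 'm, 'm monoid, 'm \<Rightarrow> 'm) functor_data" where
  "hom_functor C M = \<lparr>
     map_obj = \<lambda>A. \<lparr>carrier = Hom C M A, mult = add (HomMod C M A), one = zero (HomMod C M A)\<rparr>,
     map_arr = \<lambda>A B g. \<lambda>f\<in>Hom C M A. Comp C M A B g f\<rparr>"

text \<open>
  Here \<open>Ab\<close> consists of the abelian groups with elements in the arrow type of \<open>C\<close>.  For
  \<open>C = Sh\<close> below this type is infinite and at least as large as the type \<open>'u\<close> of the universe,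
  so that \<open>Ab\<close> contains the colimits of the groups \<open>C(M, J x)\<close> over index categories in \<open>'u\<close>.
  Index categories have their objects and arrows in the type of the universe; every small category
  is isomorphic to such a category.
\<close>

definition compact_object ::
  "'u set set \<Rightarrow> 'c rel \<Rightarrow> ('o, 'm, 'k) linear_category \<Rightarrow> 'o \<Rightarrow> bool" where
  "compact_object U \<kappa> C M \<longleftrightarrow> M \<in> Obj C \<and>
     (\<forall>(j :: ('u, 'u) category) J.
        small_category U j \<longrightarrow> filtered \<kappa> j \<longrightarrow> is_functor j C J \<longrightarrow>
        commutes_with_colimit j C Ab (hom_functor C M) J)"


section \<open>Presheaves, topologies and sheaves\<close>

text \<open>
  The base category has its morphisms in the type \<open>'u\<close> of the universe, so that representable
  presheaves and sieves take values in \<open>Mod U K\<close>.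
\<close>

type_synonym ('o, 'k, 'u) presheaf = "('o, 'u, ('k, 'u) module, 'u \<Rightarrow> 'u) functor_data"

definition PSh :: "'u set set \<Rightarrow> 'k ring \<Rightarrow> ('o, 'u, 'k) linear_category \<Rightarrow>
    (('o, 'k, 'u) presheaf, 'o \<Rightarrow> 'u \<Rightarrow> 'u, 'k) linear_category" where
  "PSh U K a = linear_functor_category K (op_category a) (Mod U K)"

text \<open>
  A sieve on \<open>A\<close> is given by its values; they are required to be empty off \<open>Obj a\<close> so that equal
  subfunctors are equal as functions.
\<close>

definition is_sieve ::
  "'k ring \<Rightarrow> ('o, 'm, 'k) linear_category \<Rightarrow> 'o \<Rightarrow> ('o \<Rightarrow> 'm set) \<Rightarrow> bool" where
  "is_sieve K a A R \<longleftrightarrow> (\<forall>B. B \<notin> Obj a \<longrightarrow> R B = {}) \<and>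
     (\<forall>B\<in>Obj a. submodule (R B) K (HomMod a B A)) \<and>
     (\<forall>B\<in>Obj a. \<forall>D\<in>Obj a. \<forall>f\<in>R B. \<forall>g\<in>Hom a D B. Comp a D B A f g \<in> R D)"

definition max_sieve :: "('o, 'm, 'k) linear_category \<Rightarrow> 'o \<Rightarrow> 'o \<Rightarrow> 'm set" where
  "max_sieve a A = (\<lambda>B. if B \<in> Obj a then Hom a B A else {})"

definition pullback_sieve ::
  "('o, 'm, 'k) linear_category \<Rightarrow> 'o \<Rightarrow> 'o \<Rightarrow> 'm \<Rightarrow> ('o \<Rightarrow> 'm set) \<Rightarrow> 'o \<Rightarrow> 'm set" where
  "pullback_sieve a B A f R =
     (\<lambda>D. if D \<in> Obj a then {g \<in> Hom a D B. Comp a D B A f g \<in> R D} else {})"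

definition sieve_presheaf ::
  "('o, 'u, 'k) linear_category \<Rightarrow> 'o \<Rightarrow> ('o \<Rightarrow> 'u set) \<Rightarrow> ('o, 'k, 'u) presheaf" where
  "sieve_presheaf a A R = \<lparr>map_obj = \<lambda>B. (HomMod a B A)\<lparr>carrier := R B\<rparr>,
     map_arr = \<lambda>B D g. \<lambda>f\<in>R B. Comp a D B A f g\<rparr>"

definition Yoneda :: "('o, 'u, 'k) linear_category \<Rightarrow> 'o \<Rightarrow> ('o, 'k, 'u) presheaf" where
  "Yoneda a A = \<lparr>map_obj = \<lambda>B. HomMod a B A, map_arr = \<lambda>B D g. \<lambda>f\<in>Hom a B A. Comp a D B A f g\<rparr>"

locale linear_topology =
  fixes K :: "'k ring" and a :: "('o, 'm, 'k) linear_category" and T :: "'o \<Rightarrow> ('o \<Rightarrow> 'm set) set"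
  assumes sieves: "\<lbrakk>A \<in> Obj a; R \<in> T A\<rbrakk> \<Longrightarrow> is_sieve K a A R"
    and T1: "A \<in> Obj a \<Longrightarrow> max_sieve a A \<in> T A"
    and T2: "\<lbrakk>A \<in> Obj a; B \<in> Obj a; R \<in> T A; f \<in> Hom a B A\<rbrakk> \<Longrightarrow> pullback_sieve a B A f R \<in> T B"
    and T3: "\<lbrakk>A \<in> Obj a; is_sieve K a A S; R \<in> T A;
        \<And>B f. B \<in> Obj a \<Longrightarrow> f \<in> R B \<Longrightarrow> pullback_sieve a B A f S \<in> T B\<rbrakk> \<Longrightarrow> S \<in> T A"

text \<open>
  The map \<open>F(A) \<rightarrow> Nat(R, F)\<close> sends \<open>x\<close> to the transformation \<open>f \<mapsto> F(f)(x)\<close>.  It is always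
  \<open>K\<close>-linear, so it is an isomorphism iff it is bijective.
\<close>

definition is_sheaf :: "'u set set \<Rightarrow> 'k ring \<Rightarrow> ('o, 'u, 'k) linear_category \<Rightarrow>
    ('o \<Rightarrow> ('o \<Rightarrow> 'u set) set) \<Rightarrow> ('o, 'k, 'u) presheaf \<Rightarrow> bool" where
  "is_sheaf U K a T F \<longleftrightarrow> F \<in> Obj (PSh U K a) \<and>
     (\<forall>A\<in>Obj a. \<forall>R\<in>T A.
        bij_betw (\<lambda>x. \<lambda>B\<in>Obj a. \<lambda>f\<in>R B. map_arr F A B f x)
          (carrier (map_obj F A)) (Hom (PSh U K a) (sieve_presheaf a A R) F))"

definition Sh :: "'u set set \<Rightarrow> 'k ring \<Rightarrow> ('o, 'u, 'k) linear_category \<Rightarrow>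
    ('o \<Rightarrow> ('o \<Rightarrow> 'u set) set) \<Rightarrow>
    (('o, 'k, 'u) presheaf, 'o \<Rightarrow> 'u \<Rightarrow> 'u, 'k) linear_category" where
  "Sh U K a T = full_subcategory (PSh U K a) (is_sheaf U K a T)"

text \<open>The value at \<open>P\<close> of a left adjoint of the inclusion, via the universal property of the unit.\<close>

definition is_sheafification :: "'u set set \<Rightarrow> 'k ring \<Rightarrow> ('o, 'u, 'k) linear_category \<Rightarrow>
    ('o \<Rightarrow> ('o \<Rightarrow> 'u set) set) \<Rightarrow> ('o, 'k, 'u) presheaf \<Rightarrow> ('o, 'k, 'u) presheaf \<Rightarrow>
    ('o \<Rightarrow> 'u \<Rightarrow> 'u) \<Rightarrow> bool" where
  "is_sheafification U K a T P Z u \<longleftrightarrow>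
     Z \<in> Obj (Sh U K a T) \<and> u \<in> Hom (PSh U K a) P Z \<and>
     (\<forall>F\<in>Obj (Sh U K a T). \<forall>g\<in>Hom (PSh U K a) P F.
        \<exists>!h. h \<in> Hom (Sh U K a T) Z F \<and> Comp (PSh U K a) P Z F h u = g)"

definition sheafify :: "'u set set \<Rightarrow> 'k ring \<Rightarrow> ('o, 'u, 'k) linear_category \<Rightarrow>
    ('o \<Rightarrow> ('o \<Rightarrow> 'u set) set) \<Rightarrow> ('o, 'k, 'u) presheaf \<Rightarrow> ('o, 'k, 'u) presheaf" where
  "sheafify U K a T P = (SOME Z. \<exists>u. is_sheafification U K a T P Z u)"

definition noetherian_topology :: "'u set set \<Rightarrow> 'c rel \<Rightarrow> 'k ring \<Rightarrow>
    ('o, 'u, 'k) linear_category \<Rightarrow> ('o \<Rightarrow> ('o \<Rightarrow> 'u set) set) \<Rightarrow> bool" where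
  "noetherian_topology U \<kappa> K a T \<longleftrightarrow>
     (\<forall>X\<in>Obj a. compact_object U \<kappa> (Sh U K a T) (sheafify U K a T (Yoneda a X)))"


section \<open>Formal morphisms\<close>

text \<open>
  A formal coproduct is a family of objects.  A formal morphism is a matrix, of which only the
  entries at labels of source and target matter; \<open>formal_eq\<close> is equality of formal morphisms.
\<close>

record ('l, 'o) family =
  labels :: "'l set"
  summand :: "'l \<Rightarrow> 'o"

definition one_object :: "'l \<Rightarrow> 'o \<Rightarrow> ('l, 'o) family" where
  "one_object l X = \<lparr>labels = {l}, summand = \<lambda>_. X\<rparr>"

abbreviation single :: "'o \<Rightarrow> (unit, 'o) family" where
  "single \<equiv> one_object ()"

definition formal_morphisms :: "('o, 'm, 'k) linear_category \<Rightarrow> ('l, 'o) family \<Rightarrow>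
    ('n, 'o) family \<Rightarrow> ('l \<Rightarrow> 'n \<Rightarrow> 'm) set" where
  "formal_morphisms a V W = {f. \<forall>x\<in>labels V.
     (\<forall>y\<in>labels W. f x y \<in> Hom a (summand V x) (summand W y)) \<and>
     finite {y \<in> labels W. f x y \<noteq> \<zero>\<^bsub>HomMod a (summand V x) (summand W y)\<^esub>}}"

definition formal_eq :: "('l, 'o) family \<Rightarrow> ('n, 'o) family \<Rightarrow>
    ('l \<Rightarrow> 'n \<Rightarrow> 'm) \<Rightarrow> ('l \<Rightarrow> 'n \<Rightarrow> 'm) \<Rightarrow> bool" where
  "formal_eq V W f g \<longleftrightarrow> (\<forall>x\<in>labels V. \<forall>y\<in>labels W. f x y = g x y)"

definition formal_zero :: "('o, 'm, 'k) linear_category \<Rightarrow> ('l, 'o) family \<Rightarrow>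
    ('n, 'o) family \<Rightarrow> 'l \<Rightarrow> 'n \<Rightarrow> 'm" where
  "formal_zero a V W = (\<lambda>x y. \<zero>\<^bsub>HomMod a (summand V x) (summand W y)\<^esub>)"

definition formal_comp :: "('o, 'm, 'k) linear_category \<Rightarrow> ('l, 'o) family \<Rightarrow>
    ('n, 'o) family \<Rightarrow> ('p, 'o) family \<Rightarrow> ('n \<Rightarrow> 'p \<Rightarrow> 'm) \<Rightarrow> ('l \<Rightarrow> 'n \<Rightarrow> 'm) \<Rightarrow> 'l \<Rightarrow> 'p \<Rightarrow> 'm" where
  "formal_comp a V W Z g f = (\<lambda>x z.
     finsum (HomMod a (summand V x) (summand Z z))
       (\<lambda>y. Comp a (summand V x) (summand W y) (summand Z z) (g y z) (f x y))
       {y \<in> labels W. f x y \<noteq> \<zero>\<^bsub>HomMod a (summand V x) (summand W y)\<^esub>})"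

definition generated_sieve :: "'k ring \<Rightarrow> ('o, 'm, 'k) linear_category \<Rightarrow> ('l, 'o) family \<Rightarrow>
    ('l \<Rightarrow> unit \<Rightarrow> 'm) \<Rightarrow> 'o \<Rightarrow> 'o \<Rightarrow> 'm set" where
  "generated_sieve K a V v A =
     (\<lambda>B. \<Inter>{R B | R. is_sieve K a A R \<and> (\<forall>x\<in>labels V. v x () \<in> R (summand V x))})"


section \<open>Pretopologies\<close>

record ('o, 'l, 'm) formal_sequence =
  seq_Z :: "('l, 'o) family"
  seq_p :: "'l \<Rightarrow> 'l \<Rightarrow> 'm"
  seq_Y :: "('l, 'o) family"
  seq_q :: "'l \<Rightarrow> unit \<Rightarrow> 'm"
  seq_X :: 'o

definition small_family ::
  "'u set set \<Rightarrow> ('o, 'm, 'k) linear_category \<Rightarrow> ('u, 'o) family \<Rightarrow> bool" where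
  "small_family U a V \<longleftrightarrow> labels V \<in> U \<and> summand V ` labels V \<subseteq> Obj a"

definition is_sequence ::
  "'u set set \<Rightarrow> ('o, 'm, 'k) linear_category \<Rightarrow> ('o, 'u, 'm) formal_sequence \<Rightarrow> bool" where
  "is_sequence U a s \<longleftrightarrow>
     small_family U a (seq_Z s) \<and> small_family U a (seq_Y s) \<and> seq_X s \<in> Obj a \<and>
     seq_p s \<in> formal_morphisms a (seq_Z s) (seq_Y s) \<and>
     seq_q s \<in> formal_morphisms a (seq_Y s) (single (seq_X s)) \<and>
     formal_eq (seq_Z s) (single (seq_X s))
       (formal_comp a (seq_Z s) (seq_Y s) (single (seq_X s)) (seq_q s) (seq_p s))
       (formal_zero a (seq_Z s) (single (seq_X s)))"

definition bounded_sequences :: "'c rel \<Rightarrow> ('o, 'l, 'm) formal_sequence set \<Rightarrow> bool" where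
  "bounded_sequences \<kappa> S \<longleftrightarrow> (\<forall>s\<in>S. |labels (seq_Z s)| <o \<kappa> \<and> |labels (seq_Y s)| <o \<kappa>)"

text \<open>
  \<open>Co a S i V v X\<close> says that \<open>v : \<Coprod> V \<rightarrow> X\<close> belongs to \<open>Co\<^sup>i(S)\<close>.  The labels of a member of
  \<open>Co\<^sup>i(S)\<close> are lists of length \<open>i\<close>: the pair formed by a label \<open>l\<close> of \<open>V\<close> and a label \<open>d\<close> of
  \<open>W(l)\<close> is encoded as \<open>l @ [d]\<close>.  In \<open>Co_Suc\<close> the morphism \<open>w(l)\<close> is the right-hand
  morphism of \<open>t l\<close>.
\<close>

inductive Co :: "('o, 'm, 'k) linear_category \<Rightarrow> ('o, 'l, 'm) formal_sequence set \<Rightarrow> nat \<Rightarrow>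
    ('l list, 'o) family \<Rightarrow> ('l list \<Rightarrow> unit \<Rightarrow> 'm) \<Rightarrow> 'o \<Rightarrow> bool"
  for a :: "('o, 'm, 'k) linear_category" and S :: "('o, 'l, 'm) formal_sequence set" where
  Co_0: "X \<in> Obj a \<Longrightarrow> Co a S 0 (one_object [] X) (\<lambda>_ _. Ident a X) X"
| Co_1: "s \<in> S \<Longrightarrow>
    Co a S 1 \<lparr>labels = {[y] | y. y \<in> labels (seq_Y s)}, summand = \<lambda>l. summand (seq_Y s) (last l)\<rparr>
      (\<lambda>l _. seq_q s (last l) ()) (seq_X s)"
| Co_Suc: "\<lbrakk>i \<ge> 1; Co a S i V v X; \<And>l. l \<in> labels V \<Longrightarrow> t l \<in> S \<and> seq_X (t l) = summand V l\<rbrakk> \<Longrightarrow>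
    Co a S (Suc i)
      \<lparr>labels = {l @ [d] | l d. l \<in> labels V \<and> d \<in> labels (seq_Y (t l))},
       summand = \<lambda>l. summand (seq_Y (t (butlast l))) (last l)\<rparr>
      (\<lambda>l _. Comp a (summand (seq_Y (t (butlast l))) (last l)) (summand V (butlast l)) X
         (v (butlast l) ()) (seq_q (t (butlast l)) (last l) ()))
      X"

locale pretopology =
  fixes U :: "'u set set" and a :: "('o, 'm, 'k) linear_category"
    and S :: "('o, 'u, 'm) formal_sequence set"
  assumes sequences: "s \<in> S \<Longrightarrow> is_sequence U a s"
    and PTa: "\<lbrakk>s \<in> S; A \<in> Obj a; f \<in> Hom a A (seq_X s)\<rbrakk> \<Longrightarrow>
      \<exists>i V q' f'. Co a S i V q' A \<and> f' \<in> formal_morphisms a V (seq_Y s) \<and>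
        formal_eq V (single (seq_X s))
          (formal_comp a V (seq_Y s) (single (seq_X s)) (seq_q s) f')
          (formal_comp a V (single A) (single (seq_X s)) (\<lambda>_ _. f) q')"
    and PTb: "\<lbrakk>s \<in> S; A \<in> Obj a; g \<in> formal_morphisms a (single A) (seq_Y s);
        formal_eq (single A) (single (seq_X s))
          (formal_comp a (single A) (seq_Y s) (single (seq_X s)) (seq_q s) g)
          (formal_zero a (single A) (single (seq_X s)))\<rbrakk> \<Longrightarrow>
      \<exists>i V q' g'. Co a S i V q' A \<and> g' \<in> formal_morphisms a V (seq_Z s) \<and>
        formal_eq V (seq_Y s)
          (formal_comp a V (seq_Z s) (seq_Y s) (seq_p s) g')
          (formal_comp a V (single A) (seq_Y s) g q')"

definition top_of :: "'k ring \<Rightarrow> ('o, 'm, 'k) linear_category \<Rightarrow>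
    ('o, 'l, 'm) formal_sequence set \<Rightarrow> 'o \<Rightarrow> ('o \<Rightarrow> 'm set) set" where
  "top_of K a S X = {R. is_sieve K a X R \<and>
     (\<exists>i V v. Co a S i V v X \<and> (\<forall>B. generated_sieve K a V v X B \<subseteq> R B))}"

end

theory Submission
  imports Defs
begin

text \<open>
  All three conditions are compared with the statement that \<open>\<kappa>\<close>-filtered colimits of sheaves are
  computed in presheaves, where colimits are elementwise.

  By Yoneda, a morphism from Z(X) to a sheaf F is an element of F(X); hence the objects Z(X) are
  \<open>\<kappa>\<close>-compact exactly if the colimits of sheaves and of presheaves have the same sections.

  If the topology is generated by a \<open>\<kappa>\<close>-bounded pretopology, a matching family on a cover with
  values in a presheaf colimit of sheaves is determined by fewer than \<open>\<kappa>\<close> sections subject to fewer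
  than \<open>\<kappa>\<close> relations, so it lives at a single stage of the colimit and can be glued there.

  Conversely, let N be a subpresheaf of M. The sheaf associated with M/N is the \<open>\<kappa>\<close>-filtered colimit
  of the sheaves associated with the quotients of M by the subpresheaves generated by fewer than \<open>\<kappa>\<close>
  elements of N, and this colimit is elementwise. For a covering sieve N of M = Y(X), the identity of X
  vanishes in the colimit, hence at some stage, so every cover contains a cover by fewer than \<open>\<kappa>\<close>
  arrows. If M is the sum of the domains of such a cover and N is the kernel of \<open>M \<rightarrow> Y(X)\<close>, the identity
  of X lifts to a section over some stage, so N is locally generated by fewer than \<open>\<kappa>\<close> elements.
  The sequences that are exact in this local sense form the required bounded pretopology.
\<close>

section \<open>Small sets\<close>

lemma small_set_iff: "universe U \<Longrightarrow> small U (X :: 'u set) \<longleftrightarrow> X \<in> U"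
  unfolding small_def using universe.ordLeq_closed ordLeq_reflexive card_of_refl
  by (metis card_of_Card_order ordIso_iff_ordLeq)

lemma card_of_ordLeq_inj: "inj_on f A \<Longrightarrow> f ` A \<subseteq> B \<Longrightarrow> |A| \<le>o |B|"
  by (intro card_of_ordLeqI) auto

lemma small_ordLeq: "small U X \<Longrightarrow> |Y| \<le>o |X| \<Longrightarrow> small U Y"
  unfolding small_def using ordLeq_transitive by blast

lemma small_subset: "small U X \<Longrightarrow> Y \<subseteq> X \<Longrightarrow> small U Y"
  using small_ordLeq card_of_mono1 by blast

lemma small_image: "small U X \<Longrightarrow> small U (f ` X)"
  using small_ordLeq card_of_image by blast

lemma small_inj: "inj_on f X \<Longrightarrow> small U (f ` X) \<Longrightarrow> small U X"
  by (meson card_of_ordLeq small_ordLeq subset_refl)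

lemma small_embed:
  fixes U :: "'u set set"
  assumes "universe U" "small U X"
  obtains h :: "'x \<Rightarrow> 'u" where "inj_on h X" "h ` X \<in> U"
proof -
  obtain Y where Y: "Y \<in> U" "|X| \<le>o |Y|" using assms(2) unfolding small_def by blast
  then obtain h where h: "inj_on h X" "h ` X \<subseteq> Y" using card_of_ordLeq by metis
  have "|h ` X| \<le>o |Y|" using h(2) by (simp add: card_of_mono1)
  then have "h ` X \<in> U" using universe.ordLeq_closed[OF assms(1) Y(1)] by blast
  then show thesis using that h(1) by blast
qed

lemma small_finite:
  assumes "universe U" "finite X"
  shows "small U X"
proof -
  obtain Y where "Y \<in> U" "infinite Y" using universe.infinite_mem[OF assms(1)] by blast
  then show ?thesis unfolding small_def
    using card_of_ordLeq_finite card_of_ordLeq_infinite assms(2) by (metis ordLeq_total card_of_Well_order)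
qed

lemma small_UN:
  fixes U :: "'u set set"
  assumes U: "universe U" and I: "small U I" and X: "\<And>i. i \<in> I \<Longrightarrow> small U (X i)"
  shows "small U (SIGMA i:I. X i)"
proof -
  obtain c :: "_ \<Rightarrow> 'u" where c: "inj_on c I" "c ` I \<in> U" using small_embed[OF U I] .
  have "\<exists>h :: _ \<Rightarrow> 'u. inj_on h (X i) \<and> h ` X i \<in> U" if "i \<in> I" for i
    using small_embed[OF U X[OF that]] by metis
  then obtain h :: "_ \<Rightarrow> _ \<Rightarrow> 'u" where h: "\<And>i. i \<in> I \<Longrightarrow> inj_on (h i) (X i) \<and> h i ` X i \<in> U"
    by metis
  obtain W where W: "W \<in> U" "infinite W" using universe.infinite_mem[OF U] by blast
  define V where "V = (\<Union>i\<in>c ` I. h (inv_into I c i) ` X (inv_into I c i))"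
  have "V \<in> U" unfolding V_def
    by (rule universe.UN_closed[OF U c(2)]) (use h c(1) in \<open>auto simp: inv_into_f_f\<close>)
  obtain e :: "bool \<Rightarrow> 'u" where e: "inj_on e UNIV" "range e \<in> U"
    using small_embed[OF U small_finite[OF U finite_UNIV]] .
  have e2: "e False \<noteq> e True" using e(1) by (auto dest: injD)
  define V1 where "V1 = (\<Union>b\<in>range e. if b = e True then V else c ` I)"
  have V1: "V1 \<in> U" unfolding V1_def
    by (rule universe.UN_closed[OF U e(2)]) (use \<open>V \<in> U\<close> c in auto)
  define V2 where "V2 = (\<Union>b\<in>range e. if b = e True then V1 else W)"
  have V2: "V2 \<in> U" unfolding V2_def
    by (rule universe.UN_closed[OF U e(2)]) (use V1 W in auto)
  have sub: "V \<subseteq> V2" "c ` I \<subseteq> V2" "W \<subseteq> V2" unfolding V1_def V2_def using e2 by force+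
  have inf: "infinite V2" using sub W finite_subset by blast
  have "inj_on (\<lambda>(i, x). (c i, h i x)) (SIGMA i:I. X i)"
    using c(1) h by (auto simp: inj_on_def)
  moreover have "(\<lambda>(i, x). (c i, h i x)) ` (SIGMA i:I. X i) \<subseteq> V2 \<times> V2"
  proof -
    have "h i x \<in> V" if "i \<in> I" "x \<in> X i" for i x
      unfolding V_def using that c(1) by (auto intro!: bexI[of _ i])
    then show ?thesis using sub by auto
  qed
  ultimately have "|SIGMA i:I. X i| \<le>o |V2 \<times> V2|" by (intro card_of_ordLeqI) auto
  also have "|V2 \<times> V2| \<le>o |V2|" using card_of_Times_same_infinite[OF inf] ordIso_iff_ordLeq by blast
  finally show ?thesis using V2 unfolding small_def by blast
qed

lemma small_Union:
  fixes U :: "'u set set"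
  assumes "universe U" "small U I" "\<And>i. i \<in> I \<Longrightarrow> small U (X i)"
  shows "small U (\<Union>i\<in>I. X i)"
  by (rule small_ordLeq[OF small_UN card_of_UNION_Sigma]) (use assms in auto)

lemma small_Un:
  assumes "universe U" "small U X" "small U Y"
  shows "small U (X \<union> Y)"
proof -
  have "small U (\<Union>b\<in>{True, False}. if b then X else Y)"
    by (rule small_Union[OF assms(1) small_finite[OF assms(1)]]) (use assms in auto)
  then show ?thesis by (simp add: Un_commute)
qed

lemma card_of_lists_infinite:
  assumes "infinite X"
  shows "|lists X| \<le>o |X|"
proof -
  have n: "|{l \<in> lists X. length l = n}| \<le>o |X|" for n
  proof (induction n)
    case 0
    have "{l \<in> lists X. length l = 0} = {[]}" by auto
    moreover obtain x where "x \<in> X" using assms by fastforce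
    ultimately show ?case using card_of_ordLeq[of "{[] :: 'a list}" X] by auto
  next
    case (Suc n)
    have s: "{l \<in> lists X. length l = Suc n} \<subseteq> (\<lambda>(x, l). x # l) ` (X \<times> {l \<in> lists X. length l = n})"
      by (auto simp: length_Suc_conv image_iff)
    have "|{l \<in> lists X. length l = Suc n}| \<le>o |X \<times> {l \<in> lists X. length l = n}|"
      by (rule ordLeq_transitive[OF card_of_mono1[OF s] card_of_image])
    also have "|X \<times> {l \<in> lists X. length l = n}| \<le>o |X \<times> X|"
      using card_of_Times_mono2 Suc by blast
    also have "|X \<times> X| \<le>o |X|" using card_of_Times_same_infinite[OF assms] ordIso_iff_ordLeq by blast
    finally show ?case .
  qed
  have "lists X = (\<Union>n\<in>(UNIV :: nat set). {l \<in> lists X. length l = n})" by auto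
  moreover have "|\<Union>n\<in>(UNIV :: nat set). {l \<in> lists X. length l = n}| \<le>o |X|"
    by (rule card_of_UNION_ordLeq_infinite[OF assms]) (use n assms infinite_iff_card_of_nat in auto)
  ultimately show ?thesis by simp
qed

section \<open>Modules and presheaves\<close>

abbreviation el :: "('o, 'm, ('u, 'x) partial_object_scheme, 'q) functor_data \<Rightarrow> 'o \<Rightarrow> 'u set" where
  "el F A \<equiv> carrier (map_obj F A)"

lemma linear_mapsD:
  assumes "f \<in> linear_maps K M N"
  shows "f \<in> extensional (carrier M)" "\<And>x. x \<in> carrier M \<Longrightarrow> f x \<in> carrier N"
    "\<And>x y. x \<in> carrier M \<Longrightarrow> y \<in> carrier M \<Longrightarrow>
      f (x \<oplus>\<^bsub>M\<^esub> y) = f x \<oplus>\<^bsub>N\<^esub> f y"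
    "\<And>c x. c \<in> carrier K \<Longrightarrow> x \<in> carrier M \<Longrightarrow>
      f (c \<odot>\<^bsub>M\<^esub> x) = c \<odot>\<^bsub>N\<^esub> f x"
  using assms unfolding linear_maps_def by (auto simp: PiE_def)

lemma linear_mapsI:
  assumes "f \<in> extensional (carrier M)" "\<And>x. x \<in> carrier M \<Longrightarrow> f x \<in> carrier N"
    "\<And>x y. x \<in> carrier M \<Longrightarrow> y \<in> carrier M \<Longrightarrow>
      f (x \<oplus>\<^bsub>M\<^esub> y) = f x \<oplus>\<^bsub>N\<^esub> f y"
    "\<And>c x. c \<in> carrier K \<Longrightarrow> x \<in> carrier M \<Longrightarrow>
      f (c \<odot>\<^bsub>M\<^esub> x) = c \<odot>\<^bsub>N\<^esub> f x"
  shows "f \<in> linear_maps K M N"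
  using assms unfolding linear_maps_def by (auto simp: PiE_def)

lemma module_add_closed: "\<lbrakk>module K M; x \<in> carrier M; y \<in> carrier M\<rbrakk> \<Longrightarrow>
    x \<oplus>\<^bsub>M\<^esub> y \<in> carrier M"
  by (meson abelian_group.axioms(1) abelian_monoid.a_closed module_def)

lemma module_zero_closed: "module K M \<Longrightarrow> \<zero>\<^bsub>M\<^esub> \<in> carrier M"
  by (meson abelian_group.axioms(1) abelian_monoid.zero_closed module_def)

lemma module_smult_closed:
  "\<lbrakk>module K M; c \<in> carrier K; x \<in> carrier M\<rbrakk> \<Longrightarrow> c \<odot>\<^bsub>M\<^esub> x \<in> carrier M"
  by (rule module.smult_closed)

lemma module_add_self_zero:
  assumes "module K M" "x \<in> carrier M" "x \<oplus>\<^bsub>M\<^esub> x = x"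
  shows "x = \<zero>\<^bsub>M\<^esub>"
proof -
  interpret module K M by fact
  show ?thesis using assms by (metis M.add.r_cancel_one')
qed

lemma additive_zero:
  assumes "module K M" "module K N" "\<And>x. x \<in> carrier M \<Longrightarrow> f x \<in> carrier N"
    "\<And>x y. x \<in> carrier M \<Longrightarrow> y \<in> carrier M \<Longrightarrow>
      f (x \<oplus>\<^bsub>M\<^esub> y) = f x \<oplus>\<^bsub>N\<^esub> f y"
  shows "f \<zero>\<^bsub>M\<^esub> = \<zero>\<^bsub>N\<^esub>"
proof -
  interpret M: module K M by fact
  have "f \<zero>\<^bsub>M\<^esub> \<oplus>\<^bsub>N\<^esub> f \<zero>\<^bsub>M\<^esub> = f \<zero>\<^bsub>M\<^esub>"
      using assms(4)[of "\<zero>\<^bsub>M\<^esub>" "\<zero>\<^bsub>M\<^esub>"] by simp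
  then show ?thesis using module_add_self_zero[OF assms(2)] assms(3) by simp
qed

lemma additive_neg:
  assumes "module K M" "module K N" "\<And>x. x \<in> carrier M \<Longrightarrow> f x \<in> carrier N"
    "\<And>x y. x \<in> carrier M \<Longrightarrow> y \<in> carrier M \<Longrightarrow>
      f (x \<oplus>\<^bsub>M\<^esub> y) = f x \<oplus>\<^bsub>N\<^esub> f y" "x \<in> carrier M"
  shows "f (\<ominus>\<^bsub>M\<^esub> x) = \<ominus>\<^bsub>N\<^esub> f x"
proof -
  interpret M: module K M by fact
  interpret N: module K N by fact
  have "f (\<ominus>\<^bsub>M\<^esub> x) \<oplus>\<^bsub>N\<^esub> f x = \<zero>\<^bsub>N\<^esub>"
    using assms(4)[of "\<ominus>\<^bsub>M\<^esub> x" x] assms(5) additive_zero[OF assms(1-4)] by (simp add: M.M.l_neg)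
  then show ?thesis using assms(3,5) N.M.minus_equality[of "f x" "f (\<ominus>\<^bsub>M\<^esub> x)"]
    by (metis M.M.a_inv_closed N.M.minus_equality)
qed

lemma linear_maps_zero: "\<lbrakk>module K M; module K N; f \<in> linear_maps K M N\<rbrakk> \<Longrightarrow>
      f \<zero>\<^bsub>M\<^esub> = \<zero>\<^bsub>N\<^esub>"
  by (rule additive_zero) (auto dest: linear_mapsD)

lemma module_diff_eq_zero:
  assumes "module K M" "x \<in> carrier M" "y \<in> carrier M"
  shows "x \<ominus>\<^bsub>M\<^esub> y = \<zero>\<^bsub>M\<^esub> \<longleftrightarrow> x = y"
proof -
  interpret M: module K M by fact
  show ?thesis using assms(2,3) by (simp add: M.M.minus_eq) (metis M.M.add.inv_closed M.M.add.inv_solve_right' M.M.l_zero M.M.zero_closed)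
qed

lemma module_neg_smult:
  assumes "module K M" "x \<in> carrier M"
  shows "\<ominus>\<^bsub>M\<^esub> x = (\<ominus>\<^bsub>K\<^esub> \<one>\<^bsub>K\<^esub>) \<odot>\<^bsub>M\<^esub> x"
proof -
  interpret M: module K M by fact
  show ?thesis using assms(2) M.smult_l_minus[of "\<one>\<^bsub>K\<^esub>" x] by simp
qed

lemma abelian_groupI_neg:
  assumes "\<And>x y. x \<in> carrier G \<Longrightarrow> y \<in> carrier G \<Longrightarrow> x \<oplus>\<^bsub>G\<^esub> y \<in> carrier G"
      "\<zero>\<^bsub>G\<^esub> \<in> carrier G"
    "\<And>x y z. \<lbrakk>x \<in> carrier G; y \<in> carrier G; z \<in> carrier G\<rbrakk> \<Longrightarrow>
      (x \<oplus>\<^bsub>G\<^esub> y) \<oplus>\<^bsub>G\<^esub> z = x \<oplus>\<^bsub>G\<^esub> (y \<oplus>\<^bsub>G\<^esub> z)"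
    "\<And>x y. x \<in> carrier G \<Longrightarrow> y \<in> carrier G \<Longrightarrow> x \<oplus>\<^bsub>G\<^esub> y = y \<oplus>\<^bsub>G\<^esub> x"
    "\<And>x. x \<in> carrier G \<Longrightarrow> \<zero>\<^bsub>G\<^esub> \<oplus>\<^bsub>G\<^esub> x = x"
    "\<And>x. x \<in> carrier G \<Longrightarrow> \<exists>y\<in>carrier G. y \<oplus>\<^bsub>G\<^esub> x = \<zero>\<^bsub>G\<^esub>"
  shows "abelian_group G"
  by (rule abelian_groupI) (use assms in auto)

lemma module_linear_maps:
  assumes "cring K" "module K M" "module K N"
  shows "module K \<lparr>carrier = linear_maps K M N, mult = undefined, one = undefined,
        zero = restrict (\<lambda>x. \<zero>\<^bsub>N\<^esub>) (carrier M),
        add = \<lambda>f g. restrict (\<lambda>x. f x \<oplus>\<^bsub>N\<^esub> g x) (carrier M),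
        smult = \<lambda>c f. restrict (\<lambda>x. c \<odot>\<^bsub>N\<^esub> f x) (carrier M)\<rparr>" (is "module K ?H")
proof -
  interpret M: module K M by fact
  interpret N: module K N by fact
  note D = linear_mapsD
  have ext: "f = restrict f (carrier M)" if "f \<in> linear_maps K M N" for f
    using D(1)[OF that] by (simp add: extensional_restrict)
  have neg: "\<exists>g\<in>linear_maps K M N. restrict (\<lambda>x. g x \<oplus>\<^bsub>N\<^esub> f x) (carrier M) = restrict (\<lambda>x. \<zero>\<^bsub>N\<^esub>) (carrier M)"
    if f: "f \<in> linear_maps K M N" for f
  proof (rule bexI[of _ "restrict (\<lambda>x. \<ominus>\<^bsub>N\<^esub> f x) (carrier M)"])
    show "restrict (\<lambda>x. restrict (\<lambda>x. \<ominus>\<^bsub>N\<^esub> f x) (carrier M) x \<oplus>\<^bsub>N\<^esub> f x) (carrier M) =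
      restrict (\<lambda>x. \<zero>\<^bsub>N\<^esub>) (carrier M)"
      using D(2)[OF f] by (auto simp: restrict_def N.M.l_neg)
    show "restrict (\<lambda>x. \<ominus>\<^bsub>N\<^esub> f x) (carrier M) \<in> linear_maps K M N"
      by (rule linear_mapsI) (use D[OF f] in \<open>auto simp: N.M.minus_add N.smult_r_minus\<close>)
  qed
  show ?thesis
  proof (rule moduleI)
    show "abelian_group ?H"
    proof (rule abelian_groupI_neg)
      fix x y assume "x \<in> carrier ?H" "y \<in> carrier ?H"
      then show "x \<oplus>\<^bsub>?H\<^esub> y \<in> carrier ?H"
        by (auto intro!: linear_mapsI simp: D N.M.a_ac N.smult_r_distr)
    next
      show "\<zero>\<^bsub>?H\<^esub> \<in> carrier ?H" by (auto intro!: linear_mapsI)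
    next
      fix x y z assume "x \<in> carrier ?H" "y \<in> carrier ?H" "z \<in> carrier ?H"
      then show "(x \<oplus>\<^bsub>?H\<^esub> y) \<oplus>\<^bsub>?H\<^esub> z = x \<oplus>\<^bsub>?H\<^esub> (y \<oplus>\<^bsub>?H\<^esub> z)"
        by (auto simp: D N.M.a_assoc restrict_def)
    next
      fix x y assume "x \<in> carrier ?H" "y \<in> carrier ?H"
      then show "x \<oplus>\<^bsub>?H\<^esub> y = y \<oplus>\<^bsub>?H\<^esub> x"
        by (auto simp: D N.M.a_comm restrict_def)
    next
      fix x assume x: "x \<in> carrier ?H"
      have "restrict (\<lambda>y. \<zero>\<^bsub>N\<^esub> \<oplus>\<^bsub>N\<^esub> x y) (carrier M) = restrict x (carrier M)"
        using x by (auto simp: D restrict_def)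
      then show "\<zero>\<^bsub>?H\<^esub> \<oplus>\<^bsub>?H\<^esub> x = x" using ext x by (simp cong: restrict_cong)
    next
      fix x assume "x \<in> carrier ?H"
      then show "\<exists>y\<in>carrier ?H. y \<oplus>\<^bsub>?H\<^esub> x = \<zero>\<^bsub>?H\<^esub>" using neg by simp
    qed
    fix c x assume "c \<in> carrier K" "x \<in> carrier ?H"
    then show "c \<odot>\<^bsub>?H\<^esub> x \<in> carrier ?H"
      by (auto intro!: linear_mapsI simp: D N.smult_r_distr N.smult_assoc1[symmetric] M.R.m_comm)
  next
    fix x assume x: "x \<in> carrier ?H"
    have "restrict (\<lambda>y. \<one>\<^bsub>K\<^esub> \<odot>\<^bsub>N\<^esub> x y) (carrier M) = restrict x (carrier M)"
      using x by (auto simp: D restrict_def)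
    then show "\<one>\<^bsub>K\<^esub> \<odot>\<^bsub>?H\<^esub> x = x" using ext x by simp
  qed (use assms(1) in \<open>auto simp: D N.smult_l_distr N.smult_r_distr N.smult_assoc1 restrict_def\<close>)
qed

lemma linear_category_Mod:
  assumes "cring K"
  shows "linear_category K (Mod U K)"
proof -
  interpret cring K by fact
  note D = linear_mapsD
  show ?thesis
  proof (intro linear_category.intro category.intro linear_category_axioms.intro)
    fix A B D f g
    assume "A \<in> Obj (Mod U K)" "B \<in> Obj (Mod U K)" "D \<in> Obj (Mod U K)"
      "f \<in> Hom (Mod U K) A B" "g \<in> Hom (Mod U K) B D"
    then show "Comp (Mod U K) A B D g f \<in> Hom (Mod U K) A D"
      by (auto simp: Mod_def compose_def D module_add_closed[where K = K] module_smult_closed intro!: linear_mapsI)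
  next
    fix A B f assume "A \<in> Obj (Mod U K)" "B \<in> Obj (Mod U K)" "f \<in> Hom (Mod U K) A B"
    then show "Comp (Mod U K) A B B (Ident (Mod U K) B) f = f"
      "Comp (Mod U K) A A B f (Ident (Mod U K) A) = f"
      by (auto simp: Mod_def compose_def D intro!: extensionalityI[of _ "carrier A"])
  next
    fix A B D E f g h
    assume "A \<in> Obj (Mod U K)" "B \<in> Obj (Mod U K)" "D \<in> Obj (Mod U K)" "E \<in> Obj (Mod U K)"
      "f \<in> Hom (Mod U K) A B" "g \<in> Hom (Mod U K) B D" "h \<in> Hom (Mod U K) D E"
    then show "Comp (Mod U K) A D E h (Comp (Mod U K) A B D g f) =
      Comp (Mod U K) A B E (Comp (Mod U K) B D E h g) f"
      by (auto simp: Mod_def compose_def D intro!: extensionalityI[of _ "carrier A"])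
  next
    fix A B assume "A \<in> Obj (Mod U K)" "B \<in> Obj (Mod U K)"
    then show "module K (HomMod (Mod U K) A B)"
      by (simp add: Mod_def module_linear_maps[OF assms])
  next
    fix A assume "A \<in> Obj (Mod U K)"
    then show "Ident (Mod U K) A \<in> Hom (Mod U K) A A"
      by (auto simp: Mod_def module_add_closed[where K = K] module_smult_closed intro!: linear_mapsI)
  next
    fix A B assume "A \<in> Obj (Mod U K)" "B \<in> Obj (Mod U K)"
    then show "carrier (HomMod (Mod U K) A B) = Hom (Mod U K) A B" by (simp add: Mod_def)
  next
    fix A B D f f' g
    assume "A \<in> Obj (Mod U K)" "B \<in> Obj (Mod U K)" "D \<in> Obj (Mod U K)"
      "f \<in> Hom (Mod U K) A B" "f' \<in> Hom (Mod U K) A B" "g \<in> Hom (Mod U K) B D"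
    then show "Comp (Mod U K) A B D g (f \<oplus>\<^bsub>HomMod (Mod U K) A B\<^esub> f') =
      Comp (Mod U K) A B D g f \<oplus>\<^bsub>HomMod (Mod U K) A D\<^esub> Comp (Mod U K) A B D g f'"
      by (auto simp: Mod_def compose_def D restrict_def fun_eq_iff)
  next
    fix A B D f g g'
    assume "A \<in> Obj (Mod U K)" "B \<in> Obj (Mod U K)" "D \<in> Obj (Mod U K)"
      "f \<in> Hom (Mod U K) A B" "g \<in> Hom (Mod U K) B D" "g' \<in> Hom (Mod U K) B D"
    then show "Comp (Mod U K) A B D (g \<oplus>\<^bsub>HomMod (Mod U K) B D\<^esub> g') f =
      Comp (Mod U K) A B D g f \<oplus>\<^bsub>HomMod (Mod U K) A D\<^esub> Comp (Mod U K) A B D g' f"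
      by (auto simp: Mod_def compose_def D restrict_def fun_eq_iff)
  next
    fix A B D c f g
    assume "A \<in> Obj (Mod U K)" "B \<in> Obj (Mod U K)" "D \<in> Obj (Mod U K)" "c \<in> carrier K"
      "f \<in> Hom (Mod U K) A B" "g \<in> Hom (Mod U K) B D"
    then show "Comp (Mod U K) A B D (c \<odot>\<^bsub>HomMod (Mod U K) B D\<^esub> g) f =
        c \<odot>\<^bsub>HomMod (Mod U K) A D\<^esub> Comp (Mod U K) A B D g f"
      "Comp (Mod U K) A B D g (c \<odot>\<^bsub>HomMod (Mod U K) A B\<^esub> f) =
        c \<odot>\<^bsub>HomMod (Mod U K) A D\<^esub> Comp (Mod U K) A B D g f"
      by (auto simp: Mod_def compose_def D restrict_def fun_eq_iff)
  qed (rule assms)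
qed

lemma linear_category_op:
  assumes "linear_category K a"
  shows "linear_category K (op_category a)"
proof -
  interpret linear_category K a by fact
  show ?thesis
  proof (intro linear_category.intro category.intro linear_category_axioms.intro)
    show "cring K" by (rule is_cring)
  qed (auto simp: op_category_def Ident_closed Comp_closed Comp_Ident_left Comp_Ident_right Comp_assoc
      carrier_HomMod module_HomMod Comp_add_left Comp_add_right Comp_smult_left Comp_smult_right)
qed

context linear_category
begin

lemma Hom_add_closed: "\<lbrakk>A \<in> Obj C; B \<in> Obj C; f \<in> Hom C A B; g \<in> Hom C A B\<rbrakk> \<Longrightarrow>
    f \<oplus>\<^bsub>HomMod C A B\<^esub> g \<in> Hom C A B"
  using module_add_closed[OF module_HomMod] carrier_HomMod by metis

lemma Hom_smult_closed: "\<lbrakk>A \<in> Obj C; B \<in> Obj C; c \<in> carrier K; f \<in> Hom C A B\<rbrakk> \<Longrightarrow>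
    c \<odot>\<^bsub>HomMod C A B\<^esub> f \<in> Hom C A B"
  using module_smult_closed[OF module_HomMod] carrier_HomMod by metis

lemma Hom_zero_closed: "\<lbrakk>A \<in> Obj C; B \<in> Obj C\<rbrakk> \<Longrightarrow> \<zero>\<^bsub>HomMod C A B\<^esub> \<in> Hom C A B"
  using module_zero_closed[OF module_HomMod] carrier_HomMod by metis

end

lemma PSh_ObjI:
  assumes "linear_category K a"
    and "\<And>A. A \<in> Obj a \<Longrightarrow> module K (map_obj F A)"
    and "\<And>A. A \<in> Obj a \<Longrightarrow> el F A \<in> U"
    and "\<And>A B f. \<lbrakk>A \<in> Obj a; B \<in> Obj a; f \<in> Hom a B A\<rbrakk> \<Longrightarrow>
      map_arr F A B f \<in> linear_maps K (map_obj F A) (map_obj F B)"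
    and "\<And>A x. \<lbrakk>A \<in> Obj a; x \<in> el F A\<rbrakk> \<Longrightarrow> map_arr F A A (Ident a A) x = x"
    and "\<And>A B D f g x. \<lbrakk>A \<in> Obj a; B \<in> Obj a; D \<in> Obj a; f \<in> Hom a B A; g \<in> Hom a D B;
      x \<in> el F A\<rbrakk> \<Longrightarrow>
      map_arr F A D (Comp a D B A f g) x = map_arr F B D g (map_arr F A B f x)"
    and "\<And>A B f g x. \<lbrakk>A \<in> Obj a; B \<in> Obj a; f \<in> Hom a B A; g \<in> Hom a B A;
      x \<in> el F A\<rbrakk> \<Longrightarrow>
      map_arr F A B (f \<oplus>\<^bsub>HomMod a B A\<^esub> g) x = map_arr F A B f x \<oplus>\<^bsub>map_obj F B\<^esub> map_arr F A B g x"
    and "\<And>A B c f x. \<lbrakk>A \<in> Obj a; B \<in> Obj a; c \<in> carrier K; f \<in> Hom a B A;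
      x \<in> el F A\<rbrakk> \<Longrightarrow>
      map_arr F A B (c \<odot>\<^bsub>HomMod a B A\<^esub> f) x = c \<odot>\<^bsub>map_obj F B\<^esub> map_arr F A B f x"
  shows "F \<in> Obj (PSh U K a)"
proof -
  interpret linear_category K a by fact
  interpret op: linear_category K "op_category a" by (rule linear_category_op) fact
  interpret Mo: linear_category K "Mod U K" by (rule linear_category_Mod) (rule is_cring)
  have e: "map_arr F A B f \<in> extensional (el F A)"
    if "A \<in> Obj a" "B \<in> Obj a" "f \<in> Hom a B A" for A B f
    using assms(4)[OF that] linear_mapsD(1) by blast
  have "linear_functor K (op_category a) (Mod U K) F"
  proof (unfold_locales, goal_cases)
    case (1 A)
    then show ?case using assms(2,3) by (simp add: Mod_def op_category_def)
  next
    case (2 A B f)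
    then show ?case using assms(4) by (simp add: Mod_def op_category_def)
  next
    case (3 A)
    then have A: "A \<in> Obj a" by (simp add: op_category_def)
    show ?case
      using A by (auto simp: Mod_def op_category_def assms(5) intro!: extensionalityI[OF e] Ident_closed)
  next
    case (4 A B E f g)
    then have A: "A \<in> Obj a" "B \<in> Obj a" "E \<in> Obj a" "f \<in> Hom a B A" "g \<in> Hom a E B"
      by (simp_all add: op_category_def)
    show ?case
      using A by (auto simp: Mod_def op_category_def assms(6) compose_def intro!: extensionalityI[OF e] Comp_closed)
  next
    case (5 A B f g)
    then have A: "A \<in> Obj a" "B \<in> Obj a" "f \<in> Hom a B A" "g \<in> Hom a B A"
      by (simp_all add: op_category_def)
    show ?case
      using A by (auto simp: Mod_def op_category_def assms(7) intro!: extensionalityI[OF e] Hom_add_closed)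
  next
    case (6 A B c f)
    then have A: "A \<in> Obj a" "B \<in> Obj a" "f \<in> Hom a B A" "c \<in> carrier K"
      by (simp_all add: op_category_def)
    show ?case
      using A by (auto simp: Mod_def op_category_def assms(8) intro!: extensionalityI[OF e] Hom_smult_closed)
  qed
  then show ?thesis by (simp add: PSh_def linear_functor_category_def)
qed

lemma PSh_ObjD:
  assumes "F \<in> Obj (PSh U K a)"
  shows PSh_module: "A \<in> Obj a \<Longrightarrow> module K (map_obj F A)"
    and PSh_carrier: "A \<in> Obj a \<Longrightarrow> el F A \<in> U"
    and PSh_linear: "\<lbrakk>A \<in> Obj a; B \<in> Obj a; f \<in> Hom a B A\<rbrakk> \<Longrightarrow>
      map_arr F A B f \<in> linear_maps K (map_obj F A) (map_obj F B)"
    and PSh_closed: "\<lbrakk>A \<in> Obj a; B \<in> Obj a; f \<in> Hom a B A; x \<in> el F A\<rbrakk> \<Longrightarrow>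
      map_arr F A B f x \<in> el F B"
    and PSh_Ident: "\<lbrakk>A \<in> Obj a; x \<in> el F A\<rbrakk> \<Longrightarrow> map_arr F A A (Ident a A) x = x"
    and PSh_Comp: "\<lbrakk>A \<in> Obj a; B \<in> Obj a; D \<in> Obj a; f \<in> Hom a B A; g \<in> Hom a D B;
      x \<in> el F A\<rbrakk> \<Longrightarrow>
      map_arr F A D (Comp a D B A f g) x = map_arr F B D g (map_arr F A B f x)"
    and PSh_hom_add: "\<lbrakk>A \<in> Obj a; B \<in> Obj a; f \<in> Hom a B A; g \<in> Hom a B A;
      x \<in> el F A\<rbrakk> \<Longrightarrow>
      map_arr F A B (f \<oplus>\<^bsub>HomMod a B A\<^esub> g) x = map_arr F A B f x \<oplus>\<^bsub>map_obj F B\<^esub> map_arr F A B g x"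
    and PSh_hom_smult: "\<lbrakk>A \<in> Obj a; B \<in> Obj a; c \<in> carrier K; f \<in> Hom a B A;
      x \<in> el F A\<rbrakk> \<Longrightarrow>
      map_arr F A B (c \<odot>\<^bsub>HomMod a B A\<^esub> f) x = c \<odot>\<^bsub>map_obj F B\<^esub> map_arr F A B f x"
proof -
  have F: "linear_functor K (op_category a) (Mod U K) F"
    using assms by (simp add: PSh_def linear_functor_category_def)
  interpret linear_functor K "op_category a" "Mod U K" F by (rule F)
  show m: "A \<in> Obj a \<Longrightarrow> module K (map_obj F A)" for A
    using map_obj_closed[of A] by (simp add: Mod_def op_category_def)
  show "A \<in> Obj a \<Longrightarrow> el F A \<in> U"
    using map_obj_closed[of A] by (simp add: Mod_def op_category_def)
  show l: "\<lbrakk>A \<in> Obj a; B \<in> Obj a; f \<in> Hom a B A\<rbrakk> \<Longrightarrow>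
      map_arr F A B f \<in> linear_maps K (map_obj F A) (map_obj F B)" for A B f
    using map_arr_closed[of A B f] by (simp add: Mod_def op_category_def)
  show "\<lbrakk>A \<in> Obj a; B \<in> Obj a; f \<in> Hom a B A; x \<in> el F A\<rbrakk> \<Longrightarrow>
      map_arr F A B f x \<in> el F B"
    using l linear_mapsD(2) by metis
  show "\<lbrakk>A \<in> Obj a; x \<in> el F A\<rbrakk> \<Longrightarrow> map_arr F A A (Ident a A) x = x"
    using map_Ident[of A] by (simp add: Mod_def op_category_def)
  show "\<lbrakk>A \<in> Obj a; B \<in> Obj a; D \<in> Obj a; f \<in> Hom a B A; g \<in> Hom a D B;
      x \<in> el F A\<rbrakk> \<Longrightarrow>
      map_arr F A D (Comp a D B A f g) x = map_arr F B D g (map_arr F A B f x)"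
    using map_Comp[of A B D f g] by (simp add: Mod_def op_category_def compose_def)
  show "\<lbrakk>A \<in> Obj a; B \<in> Obj a; f \<in> Hom a B A; g \<in> Hom a B A;
      x \<in> el F A\<rbrakk> \<Longrightarrow>
      map_arr F A B (f \<oplus>\<^bsub>HomMod a B A\<^esub> g) x = map_arr F A B f x \<oplus>\<^bsub>map_obj F B\<^esub> map_arr F A B g x"
    using map_add[of A B f g] by (simp add: Mod_def op_category_def)
  show "\<lbrakk>A \<in> Obj a; B \<in> Obj a; c \<in> carrier K; f \<in> Hom a B A;
      x \<in> el F A\<rbrakk> \<Longrightarrow>
      map_arr F A B (c \<odot>\<^bsub>HomMod a B A\<^esub> f) x = c \<odot>\<^bsub>map_obj F B\<^esub> map_arr F A B f x"
    using map_smult[of A B c f] by (simp add: Mod_def op_category_def)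
qed

lemma PSh_add:
  assumes "F \<in> Obj (PSh U K a)" "A \<in> Obj a" "B \<in> Obj a" "f \<in> Hom a B A"
    "x \<in> el F A" "y \<in> el F A"
  shows "map_arr F A B f (x \<oplus>\<^bsub>map_obj F A\<^esub> y) = map_arr F A B f x \<oplus>\<^bsub>map_obj F B\<^esub> map_arr F A B f y"
  using linear_mapsD(3)[OF PSh_linear[OF assms(1-4)]] assms by blast

lemma PSh_smult:
  assumes "F \<in> Obj (PSh U K a)" "A \<in> Obj a" "B \<in> Obj a" "f \<in> Hom a B A"
    "c \<in> carrier K" "x \<in> el F A"
  shows "map_arr F A B f (c \<odot>\<^bsub>map_obj F A\<^esub> x) = c \<odot>\<^bsub>map_obj F B\<^esub> map_arr F A B f x"
  using linear_mapsD(4)[OF PSh_linear[OF assms(1-4)]] assms by blast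

lemma PSh_zero:
  assumes "F \<in> Obj (PSh U K a)" "A \<in> Obj a" "B \<in> Obj a" "f \<in> Hom a B A"
  shows "map_arr F A B f \<zero>\<^bsub>map_obj F A\<^esub> = \<zero>\<^bsub>map_obj F B\<^esub>"
  using linear_maps_zero[OF PSh_module PSh_module PSh_linear] assms by metis

lemma compose_eq_iff: "compose X g h = compose X g' h' \<longleftrightarrow> (\<forall>x\<in>X. g (h x) = g' (h' x))"
  by (auto simp: compose_def restrict_def fun_eq_iff)

lemma PSh_Hom_iff:
  "t \<in> Hom (PSh U K a) F G \<longleftrightarrow> t \<in> extensional (Obj a) \<and>
    (\<forall>A\<in>Obj a. t A \<in> linear_maps K (map_obj F A) (map_obj G A)) \<and>
    (\<forall>A\<in>Obj a. \<forall>B\<in>Obj a. \<forall>f\<in>Hom a B A. \<forall>x\<in>el F A.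
      t B (map_arr F A B f x) = map_arr G A B f (t A x))"
  by (auto simp: PSh_def linear_functor_category_def nat_trans_def op_category_def Mod_def PiE_def
      compose_eq_iff)

lemma PSh_HomD:
  assumes "t \<in> Hom (PSh U K a) F G"
  shows PSh_Hom_linear: "A \<in> Obj a \<Longrightarrow> t A \<in> linear_maps K (map_obj F A) (map_obj G A)"
    and PSh_Hom_closed: "A \<in> Obj a \<Longrightarrow> x \<in> el F A \<Longrightarrow> t A x \<in> el G A"
    and PSh_Hom_add: "\<lbrakk>A \<in> Obj a; x \<in> el F A; y \<in> el F A\<rbrakk> \<Longrightarrow>
      t A (x \<oplus>\<^bsub>map_obj F A\<^esub> y) = t A x \<oplus>\<^bsub>map_obj G A\<^esub> t A y"
    and PSh_Hom_smult: "\<lbrakk>A \<in> Obj a; c \<in> carrier K; x \<in> el F A\<rbrakk> \<Longrightarrow>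
      t A (c \<odot>\<^bsub>map_obj F A\<^esub> x) = c \<odot>\<^bsub>map_obj G A\<^esub> t A x"
    and PSh_Hom_nat: "\<lbrakk>A \<in> Obj a; B \<in> Obj a; f \<in> Hom a B A; x \<in> el F A\<rbrakk> \<Longrightarrow>
      t B (map_arr F A B f x) = map_arr G A B f (t A x)"
proof -
  show l: "A \<in> Obj a \<Longrightarrow> t A \<in> linear_maps K (map_obj F A) (map_obj G A)" for A
    using assms unfolding PSh_Hom_iff by blast
  show "\<lbrakk>A \<in> Obj a; B \<in> Obj a; f \<in> Hom a B A; x \<in> el F A\<rbrakk> \<Longrightarrow>
      t B (map_arr F A B f x) = map_arr G A B f (t A x)"
    using assms unfolding PSh_Hom_iff by blast
  show "A \<in> Obj a \<Longrightarrow> x \<in> el F A \<Longrightarrow> t A x \<in> el G A"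
    "\<lbrakk>A \<in> Obj a; x \<in> el F A; y \<in> el F A\<rbrakk> \<Longrightarrow>
      t A (x \<oplus>\<^bsub>map_obj F A\<^esub> y) = t A x \<oplus>\<^bsub>map_obj G A\<^esub> t A y"
    "\<lbrakk>A \<in> Obj a; c \<in> carrier K; x \<in> el F A\<rbrakk> \<Longrightarrow>
      t A (c \<odot>\<^bsub>map_obj F A\<^esub> x) = c \<odot>\<^bsub>map_obj G A\<^esub> t A x"
    using linear_mapsD[OF l] by blast+
qed

lemma PSh_Hom_zero:
  assumes "F \<in> Obj (PSh U K a)" "G \<in> Obj (PSh U K a)" "t \<in> Hom (PSh U K a) F G" "A \<in> Obj a"
  shows "t A \<zero>\<^bsub>map_obj F A\<^esub> = \<zero>\<^bsub>map_obj G A\<^esub>"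
  by (rule linear_maps_zero[OF PSh_module[OF assms(1,4)] PSh_module[OF assms(2,4)] PSh_Hom_linear[OF assms(3,4)]])

lemma PSh_Hom_diff:
  assumes F: "F \<in> Obj (PSh U K a)" and G: "G \<in> Obj (PSh U K a)" and t: "t \<in> Hom (PSh U K a) F G"
    and A: "A \<in> Obj a" and x: "x \<in> el F A" and y: "y \<in> el F A"
  shows "x \<ominus>\<^bsub>map_obj F A\<^esub> y \<in> el F A"
    "t A (x \<ominus>\<^bsub>map_obj F A\<^esub> y) = t A x \<ominus>\<^bsub>map_obj G A\<^esub> t A y"
    "t A (x \<ominus>\<^bsub>map_obj F A\<^esub> y) = \<zero>\<^bsub>map_obj G A\<^esub> \<longleftrightarrow> t A x = t A y"
proof -
  interpret F: module K "map_obj F A" by (rule PSh_module[OF F A])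
  interpret G: module K "map_obj G A" by (rule PSh_module[OF G A])
  note tD = PSh_HomD(2,3)[OF t A]
  have my: "\<ominus>\<^bsub>map_obj F A\<^esub> y \<in> el F A" using y by simp
  show "x \<ominus>\<^bsub>map_obj F A\<^esub> y \<in> el F A" using x y by simp
  show d: "t A (x \<ominus>\<^bsub>map_obj F A\<^esub> y) = t A x \<ominus>\<^bsub>map_obj G A\<^esub> t A y"
    using additive_neg[OF F.module_axioms G.module_axioms tD y] tD(2)[OF x my] by (simp add: F.M.minus_eq G.M.minus_eq)
  show "t A (x \<ominus>\<^bsub>map_obj F A\<^esub> y) = \<zero>\<^bsub>map_obj G A\<^esub> \<longleftrightarrow> t A x = t A y"
    unfolding d by (rule module_diff_eq_zero[OF G.module_axioms tD(1)[OF x] tD(1)[OF y]])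
qed

lemma PSh_Hom_eqI:
  assumes "s \<in> Hom (PSh U K a) F G" "t \<in> Hom (PSh U K a) F G"
    "\<And>A x. A \<in> Obj a \<Longrightarrow> x \<in> el F A \<Longrightarrow> s A x = t A x"
  shows "s = t"
proof (rule extensionalityI[of _ "Obj a"])
  fix A assume "A \<in> Obj a"
  then show "s A = t A"
    using assms PSh_Hom_linear linear_mapsD(1) by (metis extensionalityI)
qed (use assms PSh_Hom_iff in blast)+

definition mk_nat :: "('o, 'm, 'z) category_scheme \<Rightarrow> ('o, 'm, ('k, 'u) module, 'u \<Rightarrow> 'u) functor_data \<Rightarrow>
    ('o \<Rightarrow> 'u \<Rightarrow> 'u) \<Rightarrow> 'o \<Rightarrow> 'u \<Rightarrow> 'u" where
  "mk_nat a F t = (\<lambda>A\<in>Obj a. \<lambda>x\<in>el F A. t A x)"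

lemma mk_nat_apply: "A \<in> Obj a \<Longrightarrow> x \<in> el F A \<Longrightarrow> mk_nat a F t A x = t A x"
  by (simp add: mk_nat_def)

lemma mk_nat_Hom:
  assumes F: "F \<in> Obj (PSh U K a)"
    and "\<And>A x. A \<in> Obj a \<Longrightarrow> x \<in> el F A \<Longrightarrow> t A x \<in> el G A"
    and "\<And>A x y. \<lbrakk>A \<in> Obj a; x \<in> el F A; y \<in> el F A\<rbrakk> \<Longrightarrow>
      t A (x \<oplus>\<^bsub>map_obj F A\<^esub> y) = t A x \<oplus>\<^bsub>map_obj G A\<^esub> t A y"
    and "\<And>A c x. \<lbrakk>A \<in> Obj a; c \<in> carrier K; x \<in> el F A\<rbrakk> \<Longrightarrow>
      t A (c \<odot>\<^bsub>map_obj F A\<^esub> x) = c \<odot>\<^bsub>map_obj G A\<^esub> t A x"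
    and "\<And>A B f x. \<lbrakk>A \<in> Obj a; B \<in> Obj a; f \<in> Hom a B A; x \<in> el F A\<rbrakk> \<Longrightarrow>
      t B (map_arr F A B f x) = map_arr G A B f (t A x)"
  shows "mk_nat a F t \<in> Hom (PSh U K a) F G"
  unfolding PSh_Hom_iff mk_nat_def using assms PSh_closed[OF F]
  by (auto intro!: linear_mapsI simp: module_add_closed[OF PSh_module[OF F]]
      module_smult_closed[OF PSh_module[OF F]])

lemma PSh_Comp_apply:
  "A \<in> Obj a \<Longrightarrow> x \<in> el F A \<Longrightarrow> Comp (PSh U K a) F G H s t A x = s A (t A x)"
  by (simp add: PSh_def linear_functor_category_def op_category_def Mod_def compose_def)

lemma PSh_Ident_apply:
  "A \<in> Obj a \<Longrightarrow> x \<in> el F A \<Longrightarrow> Ident (PSh U K a) F A x = x"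
  by (simp add: PSh_def linear_functor_category_def op_category_def Mod_def)

lemma PSh_Ident_closed:
  assumes "F \<in> Obj (PSh U K a)"
  shows "Ident (PSh U K a) F \<in> Hom (PSh U K a) F F"
proof -
  have "Ident (PSh U K a) F = mk_nat a F (\<lambda>A x. x)"
    by (simp add: PSh_def linear_functor_category_def op_category_def Mod_def mk_nat_def cong: restrict_cong)
  then show ?thesis using mk_nat_Hom[OF assms, of "\<lambda>A x. x" F] by simp
qed

lemma PSh_Comp_closed:
  assumes F: "F \<in> Obj (PSh U K a)" and "t \<in> Hom (PSh U K a) F G" "s \<in> Hom (PSh U K a) G H"
  shows "Comp (PSh U K a) F G H s t \<in> Hom (PSh U K a) F H"
proof -
  have "Comp (PSh U K a) F G H s t = mk_nat a F (\<lambda>A x. s A (t A x))"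
    by (simp add: PSh_def linear_functor_category_def op_category_def Mod_def mk_nat_def compose_def)
  then show ?thesis using mk_nat_Hom[OF F, of "\<lambda>A x. s A (t A x)" H] PSh_HomD[OF assms(2)] PSh_HomD[OF assms(3)]
    by simp
qed

lemma category_PSh: "category (PSh U K a)"
proof (unfold_locales, goal_cases)
  case (1 A)
  then show ?case by (rule PSh_Ident_closed)
next
  case (2 A B D f g)
  then show ?case using PSh_Comp_closed by metis
next
  case (3 A B f)
  then have "Comp (PSh U K a) A B B (Ident (PSh U K a) B) f \<in> Hom (PSh U K a) A B"
    using PSh_Comp_closed PSh_Ident_closed by metis
  then show ?case
    by (rule PSh_Hom_eqI) (use 3 in \<open>simp_all add: PSh_Comp_apply PSh_Ident_apply PSh_Hom_closed\<close>)
next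
  case (4 A B f)
  then have "Comp (PSh U K a) A A B f (Ident (PSh U K a) A) \<in> Hom (PSh U K a) A B"
    using PSh_Comp_closed PSh_Ident_closed by metis
  then show ?case
    by (rule PSh_Hom_eqI) (use 4 in \<open>simp_all add: PSh_Comp_apply PSh_Ident_apply\<close>)
next
  case (5 A B D E f g h)
  then show ?case
    by (intro PSh_Hom_eqI[of _ U K a A E])
      (auto simp: PSh_Comp_apply PSh_Hom_closed intro: PSh_Comp_closed)
qed

lemma category_full_subcategory:
  assumes "category C"
  shows "category (full_subcategory C P)"
proof -
  interpret category C by fact
  show ?thesis
    by unfold_locales (auto simp: full_subcategory_def Ident_closed Comp_closed Comp_Ident_left
        Comp_Ident_right Comp_assoc)
qed

lemma category_Sh: "category (Sh U K a T)"
  unfolding Sh_def by (intro category_full_subcategory category_PSh)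

lemma Sh_simps [simp]: "Hom (Sh U K a T) = Hom (PSh U K a)" "Comp (Sh U K a T) = Comp (PSh U K a)"
  "Ident (Sh U K a T) = Ident (PSh U K a)" "HomMod (Sh U K a T) = HomMod (PSh U K a)"
  by (simp_all add: Sh_def full_subcategory_def)

lemma Sh_Obj_iff: "F \<in> Obj (Sh U K a T) \<longleftrightarrow> is_sheaf U K a T F"
  by (auto simp: Sh_def full_subcategory_def is_sheaf_def)

lemma Sh_Obj_PSh: "F \<in> Obj (Sh U K a T) \<Longrightarrow> F \<in> Obj (PSh U K a)"
  by (simp add: Sh_Obj_iff is_sheaf_def)

section \<open>Presheaves from families of setoids\<close>

text \<open>
  Elements are taken from an arbitrary type, up to an equivalence relation; the encoding only has
  to separate equivalence classes, so that the quotient can be transported into the universe.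
\<close>

locale presheaf_setoid = universe U + linear_category K a
  for U :: "'u set set" and K :: "'k ring" and a :: "('o, 'u, 'k) linear_category" +
  fixes Q :: "'o \<Rightarrow> 'q set" and eq :: "'o \<Rightarrow> 'q \<Rightarrow> 'q \<Rightarrow> bool"
    and ad :: "'o \<Rightarrow> 'q \<Rightarrow> 'q \<Rightarrow> 'q"
    and ze :: "'o \<Rightarrow> 'q" and sm :: "'o \<Rightarrow> 'k \<Rightarrow> 'q \<Rightarrow> 'q"
        and ac :: "'o \<Rightarrow> 'o \<Rightarrow> 'u \<Rightarrow> 'q \<Rightarrow> 'q"
    and enc :: "'o \<Rightarrow> 'q \<Rightarrow> 'v"
  assumes eq_refl: "A \<in> Obj a \<Longrightarrow> x \<in> Q A \<Longrightarrow> eq A x x"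
    and eq_sym: "\<lbrakk>A \<in> Obj a; x \<in> Q A; y \<in> Q A; eq A x y\<rbrakk> \<Longrightarrow> eq A y x"
    and eq_trans: "\<lbrakk>A \<in> Obj a; x \<in> Q A; y \<in> Q A; z \<in> Q A; eq A x y; eq A y z\<rbrakk> \<Longrightarrow> eq A x z"
    and ad_closed: "\<lbrakk>A \<in> Obj a; x \<in> Q A; y \<in> Q A\<rbrakk> \<Longrightarrow> ad A x y \<in> Q A"
    and ad_cong: "\<lbrakk>A \<in> Obj a; x \<in> Q A; x' \<in> Q A; y \<in> Q A; eq A x x'\<rbrakk> \<Longrightarrow> eq A (ad A x y) (ad A x' y)"
    and ze_closed: "A \<in> Obj a \<Longrightarrow> ze A \<in> Q A"
    and sm_closed: "\<lbrakk>A \<in> Obj a; c \<in> carrier K; x \<in> Q A\<rbrakk> \<Longrightarrow> sm A c x \<in> Q A"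
    and sm_cong: "\<lbrakk>A \<in> Obj a; c \<in> carrier K; x \<in> Q A; x' \<in> Q A; eq A x x'\<rbrakk> \<Longrightarrow>
      eq A (sm A c x) (sm A c x')"
    and ac_closed: "\<lbrakk>A \<in> Obj a; B \<in> Obj a; f \<in> Hom a B A; x \<in> Q A\<rbrakk> \<Longrightarrow> ac A B f x \<in> Q B"
    and ac_cong: "\<lbrakk>A \<in> Obj a; B \<in> Obj a; f \<in> Hom a B A; x \<in> Q A; x' \<in> Q A; eq A x x'\<rbrakk> \<Longrightarrow>
      eq B (ac A B f x) (ac A B f x')"
    and ad_assoc: "\<lbrakk>A \<in> Obj a; x \<in> Q A; y \<in> Q A; z \<in> Q A\<rbrakk> \<Longrightarrow>
        eq A (ad A (ad A x y) z) (ad A x (ad A y z))"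
    and ad_comm: "\<lbrakk>A \<in> Obj a; x \<in> Q A; y \<in> Q A\<rbrakk> \<Longrightarrow> eq A (ad A x y) (ad A y x)"
    and ad_zero: "A \<in> Obj a \<Longrightarrow> x \<in> Q A \<Longrightarrow> eq A (ad A (ze A) x) x"
    and ad_neg: "A \<in> Obj a \<Longrightarrow> x \<in> Q A \<Longrightarrow> \<exists>y\<in>Q A. eq A (ad A y x) (ze A)"
    and sm_ad_left: "\<lbrakk>A \<in> Obj a; c \<in> carrier K; d \<in> carrier K; x \<in> Q A\<rbrakk> \<Longrightarrow>
      eq A (sm A (c \<oplus>\<^bsub>K\<^esub> d) x) (ad A (sm A c x) (sm A d x))"
    and sm_ad_right: "\<lbrakk>A \<in> Obj a; c \<in> carrier K; x \<in> Q A; y \<in> Q A\<rbrakk> \<Longrightarrow>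
      eq A (sm A c (ad A x y)) (ad A (sm A c x) (sm A c y))"
    and sm_assoc: "\<lbrakk>A \<in> Obj a; c \<in> carrier K; d \<in> carrier K; x \<in> Q A\<rbrakk> \<Longrightarrow>
      eq A (sm A (c \<otimes>\<^bsub>K\<^esub> d) x) (sm A c (sm A d x))"
    and sm_one: "A \<in> Obj a \<Longrightarrow> x \<in> Q A \<Longrightarrow> eq A (sm A \<one>\<^bsub>K\<^esub> x) x"
    and ac_ad: "\<lbrakk>A \<in> Obj a; B \<in> Obj a; f \<in> Hom a B A; x \<in> Q A; y \<in> Q A\<rbrakk> \<Longrightarrow>
      eq B (ac A B f (ad A x y)) (ad B (ac A B f x) (ac A B f y))"
    and ac_sm: "\<lbrakk>A \<in> Obj a; B \<in> Obj a; f \<in> Hom a B A; c \<in> carrier K; x \<in> Q A\<rbrakk> \<Longrightarrow>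
      eq B (ac A B f (sm A c x)) (sm B c (ac A B f x))"
    and ac_Ident: "A \<in> Obj a \<Longrightarrow> x \<in> Q A \<Longrightarrow> eq A (ac A A (Ident a A) x) x"
    and ac_Comp: "\<lbrakk>A \<in> Obj a; B \<in> Obj a; D \<in> Obj a; f \<in> Hom a B A; g \<in> Hom a D B; x \<in> Q A\<rbrakk> \<Longrightarrow>
      eq D (ac A D (Comp a D B A f g) x) (ac B D g (ac A B f x))"
    and ac_hom_add: "\<lbrakk>A \<in> Obj a; B \<in> Obj a; f \<in> Hom a B A; g \<in> Hom a B A; x \<in> Q A\<rbrakk> \<Longrightarrow>
      eq B (ac A B (f \<oplus>\<^bsub>HomMod a B A\<^esub> g) x) (ad B (ac A B f x) (ac A B g x))"
    and ac_hom_smult: "\<lbrakk>A \<in> Obj a; B \<in> Obj a; f \<in> Hom a B A; c \<in> carrier K; x \<in> Q A\<rbrakk> \<Longrightarrow>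
      eq B (ac A B (c \<odot>\<^bsub>HomMod a B A\<^esub> f) x) (sm B c (ac A B f x))"
    and enc_small: "A \<in> Obj a \<Longrightarrow> small U (enc A ` Q A)"
    and enc_eq: "\<lbrakk>A \<in> Obj a; x \<in> Q A; y \<in> Q A; enc A x = enc A y\<rbrakk> \<Longrightarrow> eq A x y"
begin

lemma quotient_presheaf:
  obtains F :: "('o, 'k, 'u) presheaf" and \<pi> where "F \<in> Obj (PSh U K a)"
    "\<And>A x. A \<in> Obj a \<Longrightarrow> x \<in> Q A \<Longrightarrow> \<pi> A x \<in> el F A"
    "\<And>A z. A \<in> Obj a \<Longrightarrow> z \<in> el F A \<Longrightarrow> \<exists>x\<in>Q A. \<pi> A x = z"
    "\<And>A x y. \<lbrakk>A \<in> Obj a; x \<in> Q A; y \<in> Q A\<rbrakk> \<Longrightarrow>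
      \<pi> A x = \<pi> A y \<longleftrightarrow> eq A x y"
    "\<And>A x y. \<lbrakk>A \<in> Obj a; x \<in> Q A; y \<in> Q A\<rbrakk> \<Longrightarrow>
      \<pi> A (ad A x y) = \<pi> A x \<oplus>\<^bsub>map_obj F A\<^esub> \<pi> A y"
    "\<And>A. A \<in> Obj a \<Longrightarrow> \<pi> A (ze A) = \<zero>\<^bsub>map_obj F A\<^esub>"
    "\<And>A c x. \<lbrakk>A \<in> Obj a; c \<in> carrier K; x \<in> Q A\<rbrakk> \<Longrightarrow>
      \<pi> A (sm A c x) = c \<odot>\<^bsub>map_obj F A\<^esub> \<pi> A x"
    "\<And>A B f x. \<lbrakk>A \<in> Obj a; B \<in> Obj a; f \<in> Hom a B A; x \<in> Q A\<rbrakk> \<Longrightarrow>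
      map_arr F A B f (\<pi> A x) = \<pi> B (ac A B f x)"
proof -
  have U: "universe U" by (rule universe_axioms)
  have "\<exists>h :: 'v \<Rightarrow> 'u. inj_on h (enc A ` Q A) \<and> h ` enc A ` Q A \<in> U" if "A \<in> Obj a" for A
    using small_embed[OF U enc_small[OF that]] by metis
  then obtain h :: "'o \<Rightarrow> 'v \<Rightarrow> 'u" where h: "\<And>A. A \<in> Obj a \<Longrightarrow> inj_on (h A) (enc A ` Q A)"
    "\<And>A. A \<in> Obj a \<Longrightarrow> h A ` enc A ` Q A \<in> U" by metis
  define rep where "rep A x = (SOME y. y \<in> Q A \<and> eq A x y)" for A x
  have rep: "rep A x \<in> Q A" "eq A x (rep A x)" if "A \<in> Obj a" "x \<in> Q A" for A x
    using someI[of "\<lambda>y. y \<in> Q A \<and> eq A x y" x] eq_refl[OF that] that unfolding rep_def by auto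
  define \<pi> where "\<pi> A x = h A (enc A (rep A x))" for A x
  have pieq: "\<pi> A x = \<pi> A y \<longleftrightarrow> eq A x y" if A: "A \<in> Obj a" and x: "x \<in> Q A" and y: "y \<in> Q A" for A x y
  proof
    assume "\<pi> A x = \<pi> A y"
    then have "enc A (rep A x) = enc A (rep A y)"
      using h(1)[OF A] rep(1)[OF A x] rep(1)[OF A y] unfolding \<pi>_def by (auto dest: inj_onD)
    then have "eq A (rep A x) (rep A y)" using enc_eq A rep(1) x y by blast
    then show "eq A x y" by (meson A eq_sym eq_trans rep x y)
  next
    assume "eq A x y"
    then have "(z \<in> Q A \<and> eq A x z) = (z \<in> Q A \<and> eq A y z)" for z
      using A x y eq_sym eq_trans by blast
    then show "\<pi> A x = \<pi> A y" unfolding \<pi>_def rep_def by simp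
  qed
  define sec where "sec A z = (SOME x. x \<in> Q A \<and> \<pi> A x = z)" for A z
  have sec: "sec A (\<pi> A x) \<in> Q A" "eq A (sec A (\<pi> A x)) x" if "A \<in> Obj a" "x \<in> Q A" for A x
    using someI[of "\<lambda>y. y \<in> Q A \<and> \<pi> A y = \<pi> A x" x] that pieq unfolding sec_def by auto
  define F :: "('o, 'k, 'u) presheaf" where "F = \<lparr>map_obj = \<lambda>A. \<lparr>carrier = \<pi> A ` Q A, mult = undefined, one = undefined,
      zero = \<pi> A (ze A), add = \<lambda>y z. \<pi> A (ad A (sec A y) (sec A z)),
      smult = \<lambda>c y. \<pi> A (sm A c (sec A y))\<rparr>,
    map_arr = \<lambda>A B f. restrict (\<lambda>y. \<pi> B (ac A B f (sec A y))) (\<pi> A ` Q A)\<rparr>"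
  have car: "el F A = \<pi> A ` Q A" for A unfolding F_def by simp
  have adr: "eq A (ad A x y) (ad A x y')"
    if "A \<in> Obj a" "x \<in> Q A" "y \<in> Q A" "y' \<in> Q A" "eq A y y'" for A x y y'
    using that ad_comm[of A x y] ad_comm[of A y' x] ad_cong[of A y y' x] eq_trans ad_closed by meson
  have pad: "\<pi> A x \<oplus>\<^bsub>map_obj F A\<^esub> \<pi> A y = \<pi> A (ad A x y)" if A: "A \<in> Obj a" and x: "x \<in> Q A"
      and y: "y \<in> Q A" for A x y
  proof -
    note s = sec[OF A x] sec[OF A y]
    have "eq A (ad A (sec A (\<pi> A x)) (sec A (\<pi> A y))) (ad A x (sec A (\<pi> A y)))"
      using s A x ad_cong by blast
    moreover have "eq A (ad A x (sec A (\<pi> A y))) (ad A x y)" using s A x y adr by blast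
    ultimately have "eq A (ad A (sec A (\<pi> A x)) (sec A (\<pi> A y))) (ad A x y)"
      using s A x y eq_trans ad_closed by meson
    then show ?thesis using s A x y ad_closed pieq unfolding F_def by simp
  qed
  have pze: "\<zero>\<^bsub>map_obj F A\<^esub> = \<pi> A (ze A)" for A unfolding F_def by simp
  have psm: "c \<odot>\<^bsub>map_obj F A\<^esub> \<pi> A x = \<pi> A (sm A c x)" if A: "A \<in> Obj a" and c: "c \<in> carrier K"
      and x: "x \<in> Q A" for A c x
    using sec[OF A x] A c x sm_cong sm_closed pieq unfolding F_def by simp
  have pac: "map_arr F A B f (\<pi> A x) = \<pi> B (ac A B f x)"
    if A: "A \<in> Obj a" and B: "B \<in> Obj a" and f: "f \<in> Hom a B A" and x: "x \<in> Q A" for A B f x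
    using sec[OF A x] A B f x ac_cong ac_closed pieq unfolding F_def by simp
  have md: "module K (map_obj F A)" if A: "A \<in> Obj a" for A
  proof (rule moduleI)
    show "cring K" by (rule is_cring)
    show "abelian_group (map_obj F A)"
    proof (rule abelian_groupI_neg)
      fix x assume "x \<in> el F A"
      then obtain q where q: "q \<in> Q A" "x = \<pi> A q" using car by auto
      then obtain q' where "q' \<in> Q A" "eq A (ad A q' q) (ze A)" using ad_neg A by blast
      then show "\<exists>y\<in>el F A. y \<oplus>\<^bsub>map_obj F A\<^esub> x = \<zero>\<^bsub>map_obj F A\<^esub>"
        using q A car pad pze pieq ad_closed ze_closed by (intro bexI[of _ "\<pi> A q'"]) auto
    qed (auto simp: car pad pze A ad_closed ze_closed pieq ad_assoc ad_comm ad_zero)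
  qed (auto simp: car pad psm A sm_closed ad_closed pieq sm_ad_left sm_ad_right sm_assoc sm_one)
  have "F \<in> Obj (PSh U K a)"
  proof (rule PSh_ObjI)
    fix A assume A: "A \<in> Obj a"
    show "el F A \<in> U"
    proof -
      have "\<pi> A ` Q A \<subseteq> h A ` enc A ` Q A" unfolding \<pi>_def using rep(1)[OF A] by blast
      then show ?thesis unfolding car using ordLeq_closed[OF h(2)[OF A]] card_of_mono1 by blast
    qed
  next
    fix A B f assume "A \<in> Obj a" "B \<in> Obj a" "f \<in> Hom a B A"
    then show "map_arr F A B f \<in> linear_maps K (map_obj F A) (map_obj F B)"
    proof (intro linear_mapsI, goal_cases)
      case 1
      then show ?case by (simp add: F_def)
    qed (auto simp: car pad psm pac ad_closed sm_closed ac_closed pieq ac_ad ac_sm)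
  qed (auto simp: car pad psm pac md ad_closed sm_closed ac_closed pieq ac_Ident ac_Comp ac_hom_add
      ac_hom_smult Ident_closed Comp_closed Hom_add_closed Hom_smult_closed linear_category_axioms)
  then show thesis
    by (rule that) (auto simp: car pieq pad pze psm pac)
qed

end

section \<open>Sieves and topologies\<close>

locale site = universe U + linear_category K a + linear_topology K a T
  for U :: "'u set set" and K :: "'k ring" and a :: "('o, 'u, 'k) linear_category"
    and T :: "'o \<Rightarrow> ('o \<Rightarrow> 'u set) set" +
  assumes ess_small: "essentially_small U a"

context linear_category
begin

lemma sieveD:
  assumes "is_sieve K C A R" "A \<in> Obj C"
  shows sieve_Obj: "f \<in> R B \<Longrightarrow> B \<in> Obj C"
    and sieve_Hom: "f \<in> R B \<Longrightarrow> f \<in> Hom C B A"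
    and sieve_zero: "B \<in> Obj C \<Longrightarrow> \<zero>\<^bsub>HomMod C B A\<^esub> \<in> R B"
    and sieve_add: "f \<in> R B \<Longrightarrow> g \<in> R B \<Longrightarrow> f \<oplus>\<^bsub>HomMod C B A\<^esub> g \<in> R B"
    and sieve_smult: "c \<in> carrier K \<Longrightarrow> f \<in> R B \<Longrightarrow> c \<odot>\<^bsub>HomMod C B A\<^esub> f \<in> R B"
    and sieve_Comp: "\<lbrakk>D \<in> Obj C; f \<in> R B; g \<in> Hom C D B\<rbrakk> \<Longrightarrow> Comp C D B A f g \<in> R D"
proof -
  show o: "f \<in> R B \<Longrightarrow> B \<in> Obj C" for f B using assms unfolding is_sieve_def by blast
  have s: "submodule (R B) K (HomMod C B A)" if "B \<in> Obj C" for B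
    using that assms unfolding is_sieve_def by blast
  note E = module.submoduleE[OF module_HomMod s]
  show "f \<in> R B \<Longrightarrow> f \<in> Hom C B A" for f B using E(1)[of B] o carrier_HomMod assms(2) by blast
  show "B \<in> Obj C \<Longrightarrow> \<zero>\<^bsub>HomMod C B A\<^esub> \<in> R B"
    using subgroup.one_closed[OF submodule.axioms(1)[OF s]] by auto
  show "f \<in> R B \<Longrightarrow> g \<in> R B \<Longrightarrow> f \<oplus>\<^bsub>HomMod C B A\<^esub> g \<in> R B" for f g B
    using E(5)[of B] o assms(2) by blast
  show "c \<in> carrier K \<Longrightarrow> f \<in> R B \<Longrightarrow> c \<odot>\<^bsub>HomMod C B A\<^esub> f \<in> R B"
    using E(4)[of B] o assms(2) by blast
  show "\<lbrakk>D \<in> Obj C; f \<in> R B; g \<in> Hom C D B\<rbrakk> \<Longrightarrow> Comp C D B A f g \<in> R D"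
    using assms o unfolding is_sieve_def by blast
qed

lemma sieveI:
  assumes "A \<in> Obj C" "\<And>B f. f \<in> R B \<Longrightarrow> B \<in> Obj C" "\<And>B f. f \<in> R B \<Longrightarrow> f \<in> Hom C B A"
    "\<And>B. B \<in> Obj C \<Longrightarrow> \<zero>\<^bsub>HomMod C B A\<^esub> \<in> R B"
    "\<And>B f g. f \<in> R B \<Longrightarrow> g \<in> R B \<Longrightarrow> f \<oplus>\<^bsub>HomMod C B A\<^esub> g \<in> R B"
    "\<And>B f c. c \<in> carrier K \<Longrightarrow> f \<in> R B \<Longrightarrow> c \<odot>\<^bsub>HomMod C B A\<^esub> f \<in> R B"
    "\<And>B D f g. \<lbrakk>B \<in> Obj C; D \<in> Obj C; f \<in> R B; g \<in> Hom C D B\<rbrakk> \<Longrightarrow>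
      Comp C D B A f g \<in> R D"
  shows "is_sieve K C A R"
  unfolding is_sieve_def
proof (intro conjI ballI allI impI)
  fix B assume B: "B \<in> Obj C"
  interpret H: module K "HomMod C B A" by (rule module_HomMod[OF B assms(1)])
  show "submodule (R B) K (HomMod C B A)"
  proof (rule H.submoduleI)
    show "R B \<subseteq> carrier (HomMod C B A)" using carrier_HomMod[OF B assms(1)] assms(3) by auto
    then show "\<ominus>\<^bsub>HomMod C B A\<^esub> f \<in> R B" if "f \<in> R B" for f
      using assms(6)[of "\<ominus>\<^bsub>K\<^esub> \<one>\<^bsub>K\<^esub>" f B] that module_neg_smult[OF H.module_axioms, of f] by auto
    show "\<zero>\<^bsub>HomMod C B A\<^esub> \<in> R B" by (rule assms(4)[OF B])
    show "f \<oplus>\<^bsub>HomMod C B A\<^esub> g \<in> R B" if "f \<in> R B" "g \<in> R B" for f g by (rule assms(5)[OF that])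
    show "c \<odot>\<^bsub>HomMod C B A\<^esub> f \<in> R B" if "c \<in> carrier K" "f \<in> R B" for c f by (rule assms(6)[OF that])
  qed
next
  fix B assume "B \<notin> Obj C"
  then show "R B = {}" using assms(2) by auto
next
  fix B D f g assume "B \<in> Obj C" "D \<in> Obj C" "f \<in> R B" "g \<in> Hom C D B"
  then show "Comp C D B A f g \<in> R D" by (rule assms(7))
qed

lemma sieve_max: "A \<in> Obj C \<Longrightarrow> is_sieve K C A (max_sieve C A)"
  by (rule sieveI) (auto simp: max_sieve_def Hom_zero_closed Hom_add_closed Hom_smult_closed Comp_closed split: if_splits)

lemma sieve_Int:
  assumes "A \<in> Obj C" "is_sieve K C A R" "is_sieve K C A S"
  shows "is_sieve K C A (\<lambda>B. R B \<inter> S B)"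
  by (rule sieveI) (use assms in \<open>auto intro: sieve_Obj sieve_Hom sieve_zero sieve_add sieve_smult sieve_Comp\<close>)

lemma sieve_pullback:
  assumes "A \<in> Obj C" "B \<in> Obj C" "f \<in> Hom C B A" "is_sieve K C A R"
  shows "is_sieve K C B (pullback_sieve C B A f R)"
proof -
  note s = sieve_zero[OF assms(4,1)] sieve_add[OF assms(4,1)] sieve_smult[OF assms(4,1)]
    sieve_Comp[OF assms(4,1)]
  have z: "Comp C D B A f \<zero>\<^bsub>HomMod C D B\<^esub> = \<zero>\<^bsub>HomMod C D A\<^esub>" if D: "D \<in> Obj C" for D
    using assms D by (intro additive_zero[OF module_HomMod module_HomMod])
      (auto simp: carrier_HomMod Comp_closed Comp_add_right)
  show ?thesis
  proof (rule sieveI)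
    fix D E g h assume "D \<in> Obj C" "E \<in> Obj C" "g \<in> pullback_sieve C B A f R D" "h \<in> Hom C E D"
    then show "Comp C E D B g h \<in> pullback_sieve C B A f R E"
      using assms Comp_assoc[of E D B A h g f] s(4)[of E "Comp C D B A f g" D h]
      by (auto simp: pullback_sieve_def Comp_closed)
  qed (use assms s z in \<open>auto simp: pullback_sieve_def Hom_zero_closed Hom_add_closed Hom_smult_closed
      Comp_add_right Comp_smult_right split: if_splits\<close>)
qed

end

context site
begin

abbreviation PS where
  "PS \<equiv> PSh U K a"

lemma T_superset:
  assumes "A \<in> Obj a" "R \<in> T A" "is_sieve K a A S" "\<And>B f. B \<in> Obj a \<Longrightarrow> f \<in> R B \<Longrightarrow> f \<in> S B"
  shows "S \<in> T A"
proof (rule T3[OF assms(1,3,2)])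
  fix B f assume B: "B \<in> Obj a" "f \<in> R B"
  have f: "f \<in> Hom a B A" using B sieve_Hom[OF sieves] assms by blast
  have "pullback_sieve a B A f S = max_sieve a B"
    using assms(4)[OF B] sieve_Comp[OF assms(3,1)] f by (auto simp: pullback_sieve_def max_sieve_def fun_eq_iff)
  then show "pullback_sieve a B A f S \<in> T B" using T1 B by simp
qed

lemma T_Int:
  assumes "A \<in> Obj a" "R \<in> T A" "S \<in> T A"
  shows "(\<lambda>B. R B \<inter> S B) \<in> T A"
proof (rule T3[OF assms(1) _ assms(2)])
  show "is_sieve K a A (\<lambda>B. R B \<inter> S B)" using assms sieve_Int sieves by blast
  fix B f assume B: "B \<in> Obj a" "f \<in> R B"
  have f: "f \<in> Hom a B A" using B sieve_Hom[OF sieves] assms by blast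
  have "pullback_sieve a B A f (\<lambda>B. R B \<inter> S B) = pullback_sieve a B A f S"
    using sieve_Comp[OF sieves[OF assms(1,2)] assms(1)] B f by (auto simp: pullback_sieve_def fun_eq_iff)
  then show "pullback_sieve a B A f (\<lambda>B. R B \<inter> S B) \<in> T B" using T2 B assms f by simp
qed

lemma pullback_iff: "g \<in> pullback_sieve a B A f R D \<longleftrightarrow>
    D \<in> Obj a \<and> g \<in> Hom a D B \<and> Comp a D B A f g \<in> R D"
  by (simp add: pullback_sieve_def)

section \<open>Sheaves\<close>

definition matching :: "('o, 'k, 'u) presheaf \<Rightarrow> 'o \<Rightarrow> ('o \<Rightarrow> 'u set) \<Rightarrow> ('o \<Rightarrow> 'u \<Rightarrow> 'u) \<Rightarrow> bool" where
  "matching F A R s \<longleftrightarrow> (\<forall>B\<in>Obj a. \<forall>f\<in>R B. s B f \<in> el F B \<and>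
     (\<forall>g\<in>R B. s B (f \<oplus>\<^bsub>HomMod a B A\<^esub> g) = s B f \<oplus>\<^bsub>map_obj F B\<^esub> s B g) \<and>
     (\<forall>c\<in>carrier K. s B (c \<odot>\<^bsub>HomMod a B A\<^esub> f) = c \<odot>\<^bsub>map_obj F B\<^esub> s B f) \<and>
     (\<forall>D\<in>Obj a. \<forall>g\<in>Hom a D B. s D (Comp a D B A f g) = map_arr F B D g (s B f)))"

definition separated :: "('o, 'k, 'u) presheaf \<Rightarrow> bool" where
  "separated F \<longleftrightarrow> (\<forall>A\<in>Obj a. \<forall>R\<in>T A. \<forall>x\<in>el F A.
     (\<forall>B\<in>Obj a. \<forall>f\<in>R B. map_arr F A B f x = \<zero>\<^bsub>map_obj F B\<^esub>) \<longrightarrow> x = \<zero>\<^bsub>map_obj F A\<^esub>)"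

lemma matchingD:
  assumes "matching F A R s" "B \<in> Obj a" "f \<in> R B"
  shows "s B f \<in> el F B" "g \<in> R B \<Longrightarrow>
      s B (f \<oplus>\<^bsub>HomMod a B A\<^esub> g) = s B f \<oplus>\<^bsub>map_obj F B\<^esub> s B g"
    "c \<in> carrier K \<Longrightarrow> s B (c \<odot>\<^bsub>HomMod a B A\<^esub> f) = c \<odot>\<^bsub>map_obj F B\<^esub> s B f"
    "D \<in> Obj a \<Longrightarrow> g \<in> Hom a D B \<Longrightarrow> s D (Comp a D B A f g) = map_arr F B D g (s B f)"
  using assms unfolding matching_def by blast+

lemma matching_restrict:
  assumes F: "F \<in> Obj PS" and A: "A \<in> Obj a" and R: "is_sieve K a A R" and x: "x \<in> el F A"
  shows "matching F A R (\<lambda>B f. map_arr F A B f x)"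
  unfolding matching_def using PSh_closed[OF F] PSh_hom_add[OF F] PSh_hom_smult[OF F] PSh_Comp[OF F] A x
    sieve_Hom[OF R A] by auto

lemma separatedD:
  assumes F: "F \<in> Obj PS" and sep: "separated F" and A: "A \<in> Obj a" and R: "R \<in> T A"
    and x: "x \<in> el F A" and y: "y \<in> el F A"
    and eq: "\<And>B f. B \<in> Obj a \<Longrightarrow> f \<in> R B \<Longrightarrow> map_arr F A B f x = map_arr F A B f y"
  shows "x = y"
proof -
  note md = PSh_module[OF F]
  interpret M: module K "map_obj F A" by (rule md[OF A])
  have "map_arr F A B f (x \<ominus>\<^bsub>map_obj F A\<^esub> y) = \<zero>\<^bsub>map_obj F B\<^esub>" if B: "B \<in> Obj a" "f \<in> R B" for B f
  proof -
    interpret MB: module K "map_obj F B" by (rule md[OF B(1)])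
    have f: "f \<in> Hom a B A" using B sieve_Hom[OF sieves] A R by blast
    note l = linear_mapsD[OF PSh_linear[OF F A B(1) f]]
    have "map_arr F A B f (\<ominus>\<^bsub>map_obj F A\<^esub> y) = \<ominus>\<^bsub>map_obj F B\<^esub> map_arr F A B f y"
      using additive_neg[OF M.module_axioms MB.module_axioms l(2,3) y] by simp
    then show ?thesis using l(2)[OF y] l(3)[OF x] eq[OF B] y by (simp add: M.M.minus_eq MB.M.r_neg)
  qed
  then have "x \<ominus>\<^bsub>map_obj F A\<^esub> y = \<zero>\<^bsub>map_obj F A\<^esub>"
    using sep A R x y unfolding separated_def by (meson M.M.minus_closed)
  then show ?thesis using module_diff_eq_zero[OF M.module_axioms x y] by simp
qed

lemma matching_iff_Hom:
  assumes "is_sieve K a A R" "A \<in> Obj a"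
  shows "t \<in> Hom PS (sieve_presheaf a A R) F \<longleftrightarrow>
    t \<in> extensional (Obj a) \<and> (\<forall>B\<in>Obj a. t B \<in> extensional (R B)) \<and> matching F A R t"
  unfolding PSh_Hom_iff matching_def linear_maps_def sieve_presheaf_def PiE_def Pi_def
  using sieve_Comp[OF assms] by (auto 0 3)

lemma is_sheaf_iff:
  "is_sheaf U K a T F \<longleftrightarrow> F \<in> Obj PS \<and> separated F \<and>
    (\<forall>A\<in>Obj a. \<forall>R\<in>T A. \<forall>s. matching F A R s \<longrightarrow>
      (\<exists>x\<in>el F A. \<forall>B\<in>Obj a. \<forall>f\<in>R B. map_arr F A B f x = s B f))" (is "?L \<longleftrightarrow> ?R")
proof
  assume L: ?L
  then have F: "F \<in> Obj PS" by (simp add: is_sheaf_def)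
  have bij: "bij_betw (\<lambda>x. \<lambda>B\<in>Obj a. \<lambda>f\<in>R B. map_arr F A B f x)
          (el F A) (Hom PS (sieve_presheaf a A R) F)" if "A \<in> Obj a" "R \<in> T A" for A R
    using L that unfolding is_sheaf_def by blast
  show ?R
  proof (intro conjI ballI allI impI)
    show "F \<in> Obj PS" by fact
    show "separated F"
      unfolding separated_def
    proof (intro ballI impI)
      fix A R x assume A: "A \<in> Obj a" and R: "R \<in> T A" and x: "x \<in> el F A"
        and z: "\<forall>B\<in>Obj a. \<forall>f\<in>R B. map_arr F A B f x = \<zero>\<^bsub>map_obj F B\<^esub>"
      have "(\<lambda>B\<in>Obj a. \<lambda>f\<in>R B. map_arr F A B f x) = (\<lambda>B\<in>Obj a. \<lambda>f\<in>R B. map_arr F A B f \<zero>\<^bsub>map_obj F A\<^esub>)"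
        using z PSh_zero[OF F A] sieve_Hom[OF sieves[OF A R] A] by (auto simp: restrict_def fun_eq_iff)
      then show "x = \<zero>\<^bsub>map_obj F A\<^esub>"
        using bij_betw_imp_inj_on[OF bij[OF A R]] x module_zero_closed[OF PSh_module[OF F A]]
        by (auto dest: inj_onD)
    qed
    fix A R s assume A: "A \<in> Obj a" and R: "R \<in> T A" and s: "matching F A R s"
    have sv: "is_sieve K a A R" using sieves A R by blast
    have "matching F A R (\<lambda>B\<in>Obj a. \<lambda>f\<in>R B. s B f)"
      using s sieve_add[OF sv A] sieve_smult[OF sv A] sieve_Comp[OF sv A] unfolding matching_def by auto
    then have "(\<lambda>B\<in>Obj a. \<lambda>f\<in>R B. s B f) \<in> Hom PS (sieve_presheaf a A R) F"
      using matching_iff_Hom[OF sv A] by auto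
    then obtain x where x: "x \<in> el F A"
      "(\<lambda>B\<in>Obj a. \<lambda>f\<in>R B. map_arr F A B f x) = (\<lambda>B\<in>Obj a. \<lambda>f\<in>R B. s B f)"
      using bij[OF A R] unfolding bij_betw_def by (metis (no_types, lifting) imageE)
    have "map_arr F A B f x = s B f" if "B \<in> Obj a" "f \<in> R B" for B f
      using fun_cong[OF fun_cong[OF x(2), of B], of f] that by auto
    then show "\<exists>x\<in>el F A. \<forall>B\<in>Obj a. \<forall>f\<in>R B. map_arr F A B f x = s B f" using x(1) by blast
  qed
next
  assume R: ?R
  then have F: "F \<in> Obj PS" and sep: "separated F" by blast+
  show ?L unfolding is_sheaf_def
  proof (intro conjI ballI F)
    fix A R assume A: "A \<in> Obj a" and RT: "R \<in> T A"
    have sv: "is_sieve K a A R" using sieves A RT by blast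
    let ?m = "\<lambda>x. \<lambda>B\<in>Obj a. \<lambda>f\<in>R B. map_arr F A B f x"
    show "bij_betw ?m (el F A) (Hom PS (sieve_presheaf a A R) F)"
    proof (rule bij_betw_imageI)
      show "inj_on ?m (el F A)"
      proof (rule inj_onI)
        fix x y assume xy: "x \<in> el F A" "y \<in> el F A" "?m x = ?m y"
        have "map_arr F A B f x = map_arr F A B f y" if "B \<in> Obj a" "f \<in> R B" for B f
          using fun_cong[OF fun_cong[OF xy(3), of B], of f] that by simp
        then show "x = y" using separatedD[OF F sep A RT xy(1,2)] by blast
      qed
      show "?m ` el F A = Hom PS (sieve_presheaf a A R) F"
      proof (intro equalityI subsetI)
        fix t assume "t \<in> ?m ` el F A"
        then obtain x where x: "x \<in> el F A" "t = ?m x" by blast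
        have "matching F A R t"
          using matching_restrict[OF F A sv x(1)] sieve_add[OF sv A] sieve_smult[OF sv A] sieve_Comp[OF sv A]
          unfolding matching_def x(2) by auto
        then show "t \<in> Hom PS (sieve_presheaf a A R) F"
          using matching_iff_Hom[OF sv A] x(2) by auto
      next
        fix t assume "t \<in> Hom PS (sieve_presheaf a A R) F"
        then have t: "t \<in> extensional (Obj a)" "\<And>B. B \<in> Obj a \<Longrightarrow> t B \<in> extensional (R B)" "matching F A R t"
          using matching_iff_Hom[OF sv A] by auto
        then obtain x where x: "x \<in> el F A" "\<And>B f. B \<in> Obj a \<Longrightarrow> f \<in> R B \<Longrightarrow> map_arr F A B f x = t B f"
          using R A RT by blast
        have "t = ?m x"
        proof (rule extensionalityI[OF t(1)])
          fix B assume B: "B \<in> Obj a"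
          show "t B = ?m x B"
            by (rule extensionalityI[OF t(2)[OF B]]) (use x(2) B in auto)
        qed simp
        then show "t \<in> ?m ` el F A" using x(1) by blast
      qed
    qed
  qed
qed

lemma sheaf_PSh: "is_sheaf U K a T F \<Longrightarrow> F \<in> Obj PS"
  and sheaf_separated: "is_sheaf U K a T F \<Longrightarrow> separated F"
  and sheaf_glue: "\<lbrakk>is_sheaf U K a T F; A \<in> Obj a; R \<in> T A; matching F A R s\<rbrakk> \<Longrightarrow>
      \<exists>x\<in>el F A. \<forall>B\<in>Obj a. \<forall>f\<in>R B. map_arr F A B f x = s B f"
  unfolding is_sheaf_iff by blast+

section \<open>Smallness of the base category\<close>

definition mors_of :: "'o set \<Rightarrow> ('o \<times> 'o \<times> 'u) set" where
  "mors_of Sk = (SIGMA A:Sk. SIGMA B:Sk. Hom a A B)"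

definition skel :: "'o set" where
  "skel = (SOME Sk. Sk \<subseteq> Obj a \<and> (\<forall>A\<in>Obj a. \<exists>B\<in>Sk. \<exists>f. is_iso a A B f) \<and>
     small U (mors_of Sk) \<and> (\<forall>X\<in>U. small U (Func (mors_of Sk) X)))"

abbreviation mors :: "('o \<times> 'o \<times> 'u) set" where
  "mors \<equiv> mors_of skel"

lemma skel_props: "skel \<subseteq> Obj a \<and> (\<forall>A\<in>Obj a. \<exists>B\<in>skel. \<exists>f. is_iso a A B f) \<and>
     small U mors \<and> (\<forall>X\<in>U. small U (Func mors X))"
  unfolding skel_def
  by (rule someI_ex) (use ess_small in \<open>auto simp: essentially_small_def Let_def mors_of_def\<close>)

lemma skel_Obj: "A \<in> skel \<Longrightarrow> A \<in> Obj a"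
  and mors_small: "small U mors"
  using skel_props by auto

lemma univ: "universe U"
  by (rule universe_axioms)

lemma Func_small:
  assumes "small U (X :: 'x set)"
  shows "small U (Func mors X)"
proof -
  obtain h :: "'x \<Rightarrow> 'u" where h: "inj_on h X" "h ` X \<in> U" using small_embed[OF univ assms] .
  let ?c = "\<lambda>f e. if e \<in> mors then h (f e) else undefined"
  have "inj_on ?c (Func mors X)"
  proof (rule inj_onI, rule ext)
    fix f g e assume fg: "f \<in> Func mors X" "g \<in> Func mors X" "?c f = ?c g"
    show "f e = g e"
    proof (cases "e \<in> mors")
      case True
      then have "h (f e) = h (g e)" using fun_cong[OF fg(3), of e] by simp
      then show ?thesis using fg True h(1) by (auto simp: Func_def dest: inj_onD)
    next
      case False
      then have "f e = undefined" "g e = undefined" using fg(1,2) unfolding Func_def by blast+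
      then show ?thesis by simp
    qed
  qed
  moreover have "?c ` Func mors X \<subseteq> Func mors (h ` X)" by (auto simp: Func_def)
  ultimately have "|Func mors X| \<le>o |Func mors (h ` X)|" by (rule card_of_ordLeq_inj)
  then show ?thesis using small_ordLeq skel_props h(2) by metis
qed

lemma skel_ordLeq: "|skel| \<le>o |mors|"
proof (rule card_of_ordLeqI)
  show "inj_on (\<lambda>A. (A, A, Ident a A)) skel" by (auto simp: inj_on_def)
  show "(A, A, Ident a A) \<in> mors" if "A \<in> skel" for A
    using that Ident_closed skel_Obj by (auto simp: mors_of_def)
qed

lemma skel_small: "small U skel"
  by (rule small_ordLeq[OF mors_small skel_ordLeq])

definition sk :: "'o \<Rightarrow> 'o" where
  "sk A = (SOME B. B \<in> skel \<and> (\<exists>f. is_iso a A B f))"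

definition skj :: "'o \<Rightarrow> 'u" where
  "skj A = (SOME f. is_iso a A (sk A) f)"

definition ski :: "'o \<Rightarrow> 'u" where
  "ski A = (SOME g. g \<in> Hom a (sk A) A \<and> Comp a A (sk A) A g (skj A) = Ident a A \<and>
     Comp a (sk A) A (sk A) (skj A) g = Ident a (sk A))"

lemma sk:
  assumes "A \<in> Obj a"
  shows "sk A \<in> skel" "sk A \<in> Obj a" "skj A \<in> Hom a A (sk A)" "ski A \<in> Hom a (sk A) A"
    "Comp a A (sk A) A (ski A) (skj A) = Ident a A" "Comp a (sk A) A (sk A) (skj A) (ski A) = Ident a (sk A)"
proof -
  have "\<exists>B. B \<in> skel \<and> (\<exists>f. is_iso a A B f)" using skel_props assms by blast
  then have 1: "sk A \<in> skel \<and> (\<exists>f. is_iso a A (sk A) f)" unfolding sk_def by (rule someI_ex)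
  then have 2: "is_iso a A (sk A) (skj A)" unfolding skj_def by (auto intro: someI_ex)
  have "\<exists>g. g \<in> Hom a (sk A) A \<and> Comp a A (sk A) A g (skj A) = Ident a A \<and>
     Comp a (sk A) A (sk A) (skj A) g = Ident a (sk A)" using 2 unfolding is_iso_def by blast
  then have 3: "ski A \<in> Hom a (sk A) A \<and> Comp a A (sk A) A (ski A) (skj A) = Ident a A \<and>
     Comp a (sk A) A (sk A) (skj A) (ski A) = Ident a (sk A)" unfolding ski_def by (rule someI_ex)
  show "sk A \<in> skel" "sk A \<in> Obj a" "skj A \<in> Hom a A (sk A)" "ski A \<in> Hom a (sk A) A"
    "Comp a A (sk A) A (ski A) (skj A) = Ident a A" "Comp a (sk A) A (sk A) (skj A) (ski A) = Ident a (sk A)"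
    using 1 2 3 skel_Obj unfolding is_iso_def by auto
qed

lemma ski_skj:
  assumes "A \<in> Obj a" "B \<in> Obj a" "f \<in> Hom a B A"
  shows "Comp a B (sk A) A (ski A) (Comp a B A (sk A) (skj A) f) = f"
  using assms sk[OF assms(1)] by (simp add: Comp_assoc Comp_Ident_left)

lemma skj_ski:
  assumes "A \<in> Obj a" "B \<in> Obj a" "f \<in> Hom a B A"
  shows "Comp a B (sk B) A (Comp a (sk B) B A f (ski B)) (skj B) = f"
  using assms sk[OF assms(2)] by (simp add: Comp_assoc[symmetric] Comp_Ident_right)

lemma Hom_mem_U:
  assumes A: "A \<in> Obj a" and B: "B \<in> Obj a"
  shows "Hom a A B \<in> U"
proof -
  let ?c = "\<lambda>f. (sk A, sk B, Comp a (sk A) B (sk B) (skj B) (Comp a (sk A) A B f (ski A)))"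
  note s = sk[OF A] sk[OF B]
  have "inj_on ?c (Hom a A B)"
  proof (rule inj_onI)
    fix f g assume f: "f \<in> Hom a A B" and g: "g \<in> Hom a A B" and e: "?c f = ?c g"
    have c: "Comp a (sk A) A B f (ski A) \<in> Hom a (sk A) B" "Comp a (sk A) A B g (ski A) \<in> Hom a (sk A) B"
      using s A B f g Comp_closed by blast+
    have "Comp a (sk A) B (sk B) (skj B) (Comp a (sk A) A B f (ski A)) =
      Comp a (sk A) B (sk B) (skj B) (Comp a (sk A) A B g (ski A))" using e unfolding prod.inject by blast
    then have "Comp a (sk A) A B f (ski A) = Comp a (sk A) A B g (ski A)"
      using ski_skj[OF B s(2) c(1)] ski_skj[OF B s(2) c(2)] by argo
    then show "f = g" using skj_ski[OF B A f] skj_ski[OF B A g] by argo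
  qed
  moreover have "?c ` Hom a A B \<subseteq> mors" using s A B by (auto simp: mors_of_def intro!: Comp_closed[where B = A] Comp_closed[where B = B])
  ultimately have "|Hom a A B| \<le>o |mors|" by (rule card_of_ordLeq_inj)
  then show ?thesis using small_ordLeq[OF mors_small] small_set_iff[OF univ] by blast
qed

section \<open>Subpresheaves and quotients\<close>

definition subpresheaf :: "('o, 'k, 'u) presheaf \<Rightarrow> ('o \<Rightarrow> 'u set) \<Rightarrow> bool" where
  "subpresheaf M N \<longleftrightarrow> (\<forall>A\<in>Obj a. N A \<subseteq> el M A \<and> \<zero>\<^bsub>map_obj M A\<^esub> \<in> N A \<and>
     (\<forall>x\<in>N A. (\<forall>y\<in>N A. x \<oplus>\<^bsub>map_obj M A\<^esub> y \<in> N A) \<and>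
       (\<forall>c\<in>carrier K. c \<odot>\<^bsub>map_obj M A\<^esub> x \<in> N A) \<and>
       (\<forall>B\<in>Obj a. \<forall>f\<in>Hom a B A. map_arr M A B f x \<in> N B)))"

lemma subpresheafD:
  assumes "subpresheaf M N" "A \<in> Obj a"
  shows "x \<in> N A \<Longrightarrow> x \<in> el M A" "\<zero>\<^bsub>map_obj M A\<^esub> \<in> N A"
    "x \<in> N A \<Longrightarrow> y \<in> N A \<Longrightarrow> x \<oplus>\<^bsub>map_obj M A\<^esub> y \<in> N A"
    "c \<in> carrier K \<Longrightarrow> x \<in> N A \<Longrightarrow> c \<odot>\<^bsub>map_obj M A\<^esub> x \<in> N A"
    "\<lbrakk>x \<in> N A; B \<in> Obj a; f \<in> Hom a B A\<rbrakk> \<Longrightarrow> map_arr M A B f x \<in> N B"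
  using assms unfolding subpresheaf_def by blast+

definition lclosure :: "('o, 'k, 'u) presheaf \<Rightarrow> ('o \<Rightarrow> 'u set) \<Rightarrow> 'o \<Rightarrow> 'u set" where
  "lclosure M N A = {x \<in> el M A. \<exists>R\<in>T A. \<forall>B\<in>Obj a. \<forall>f\<in>R B. map_arr M A B f x \<in> N B}"

lemma sieve_transporter:
  assumes M: "M \<in> Obj PS" and N: "subpresheaf M N" and A: "A \<in> Obj a" and x: "x \<in> el M A"
  shows "is_sieve K a A (\<lambda>B. if B \<in> Obj a then {f \<in> Hom a B A. map_arr M A B f x \<in> N B} else {})"
proof -
  have z: "map_arr M A B \<zero>\<^bsub>HomMod a B A\<^esub> x = \<zero>\<^bsub>map_obj M B\<^esub>" if B: "B \<in> Obj a" for B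
    using A B x PSh_closed[OF M A B] PSh_hom_add[OF M A B]
    by (intro additive_zero[OF module_HomMod[OF B A] PSh_module[OF M B], of "\<lambda>f. map_arr M A B f x"])
      (auto simp: carrier_HomMod)
  show ?thesis
    by (rule sieveI) (use A x subpresheafD[OF N] in \<open>auto simp: z Hom_zero_closed Hom_add_closed Hom_smult_closed
      Comp_closed PSh_hom_add[OF M] PSh_hom_smult[OF M] PSh_Comp[OF M] split: if_splits\<close>)
qed

lemma lclosure_transporter:
  assumes M: "M \<in> Obj PS" and N: "subpresheaf M N" and A: "A \<in> Obj a" and x: "x \<in> lclosure M N A"
  shows "(\<lambda>B. if B \<in> Obj a then {f \<in> Hom a B A. map_arr M A B f x \<in> N B} else {}) \<in> T A"
proof -
  obtain R where R: "R \<in> T A" "\<And>B f. B \<in> Obj a \<Longrightarrow> f \<in> R B \<Longrightarrow> map_arr M A B f x \<in> N B"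
    and xc: "x \<in> el M A"
    using x unfolding lclosure_def by blast
  show ?thesis
    by (rule T_superset[OF A R(1) sieve_transporter[OF M N A xc]])
      (use R sieve_Hom[OF sieves[OF A R(1)] A] in auto)
qed

lemma lclosure_closed:
  assumes M: "M \<in> Obj PS" and N: "subpresheaf M N" and A: "A \<in> Obj a" and R: "R \<in> T A"
    and x: "x \<in> el M A" and c: "\<And>B f. B \<in> Obj a \<Longrightarrow> f \<in> R B \<Longrightarrow> map_arr M A B f x \<in> lclosure M N B"
  shows "x \<in> lclosure M N A"
proof -
  let ?S = "\<lambda>x A B. if B \<in> Obj a then {f \<in> Hom a B A. map_arr M A B f x \<in> N B} else {}"
  have "?S x A \<in> T A"
  proof (rule T3[OF A sieve_transporter[OF M N A x] R])
    fix B f assume B: "B \<in> Obj a" "f \<in> R B"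
    have f: "f \<in> Hom a B A" using sieve_Hom[OF sieves[OF A R] A] B by blast
    have "pullback_sieve a B A f (?S x A) = ?S (map_arr M A B f x) B"
      using A B f x by (auto simp: pullback_sieve_def fun_eq_iff Comp_closed PSh_Comp[OF M])
    then show "pullback_sieve a B A f (?S x A) \<in> T B" using lclosure_transporter[OF M N B(1) c[OF B]] by simp
  qed
  then show ?thesis using x unfolding lclosure_def by (auto intro!: bexI[of _ "?S x A"] split: if_splits)
qed

lemma subset_lclosure:
  assumes M: "M \<in> Obj PS" and N: "subpresheaf M N" and A: "A \<in> Obj a" and x: "x \<in> N A"
  shows "x \<in> lclosure M N A"
  using subpresheafD[OF N A] x T1[OF A] unfolding lclosure_def
  by (auto intro!: bexI[of _ "max_sieve a A"] simp: max_sieve_def)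

lemma subpresheaf_lclosure:
  assumes M: "M \<in> Obj PS" and N: "subpresheaf M N"
  shows "subpresheaf M (lclosure M N)"
  unfolding subpresheaf_def
proof (intro ballI conjI)
  fix A assume A: "A \<in> Obj a"
  show "lclosure M N A \<subseteq> el M A" by (auto simp: lclosure_def)
  show "\<zero>\<^bsub>map_obj M A\<^esub> \<in> lclosure M N A" by (rule subset_lclosure[OF M N A subpresheafD(2)[OF N A]])
  fix x assume x: "x \<in> lclosure M N A"
  then obtain R where R: "R \<in> T A" "\<And>B f. B \<in> Obj a \<Longrightarrow> f \<in> R B \<Longrightarrow> map_arr M A B f x \<in> N B"
    and xc: "x \<in> el M A"
    unfolding lclosure_def by blast
  note RH = sieve_Hom[OF sieves[OF A R(1)] A]
  {
    fix y assume "y \<in> lclosure M N A"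
    then obtain S where S: "S \<in> T A" "\<And>B f. B \<in> Obj a \<Longrightarrow> f \<in> S B \<Longrightarrow> map_arr M A B f y \<in> N B"
      and yc: "y \<in> el M A"
      unfolding lclosure_def by blast
    show "x \<oplus>\<^bsub>map_obj M A\<^esub> y \<in> lclosure M N A"
      unfolding lclosure_def using T_Int[OF A R(1) S(1)] xc yc R S RH
      by (auto intro!: bexI[of _ "\<lambda>B. R B \<inter> S B"] module_add_closed[OF PSh_module[OF M A]]
          simp: PSh_add[OF M A] subpresheafD[OF N])
  next
    fix c assume "c \<in> carrier K"
    then show "c \<odot>\<^bsub>map_obj M A\<^esub> x \<in> lclosure M N A"
      unfolding lclosure_def using xc R RH
      by (auto intro!: bexI[of _ R] module_smult_closed[OF PSh_module[OF M A]]
          simp: PSh_smult[OF M A] subpresheafD[OF N])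
  next
    fix B f assume B: "B \<in> Obj a" and f: "f \<in> Hom a B A"
    then show "map_arr M A B f x \<in> lclosure M N B"
      unfolding lclosure_def using T2[OF A B R(1) f] A xc R
      by (auto intro!: bexI[of _ "pullback_sieve a B A f R"] PSh_closed[OF M]
          simp: pullback_sieve_def PSh_Comp[OF M, symmetric])
  }
qed

lemma presheaf_diff:
  assumes M: "M \<in> Obj PS" and A: "A \<in> Obj a" and B: "B \<in> Obj a" and f: "f \<in> Hom a B A"
    and x: "x \<in> el M A" and y: "y \<in> el M A"
  shows "map_arr M A B f (x \<ominus>\<^bsub>map_obj M A\<^esub> y) = map_arr M A B f x \<ominus>\<^bsub>map_obj M B\<^esub> map_arr M A B f y"
proof -
  note l = linear_mapsD[OF PSh_linear[OF M A B f]]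
  interpret MA: module K "map_obj M A" by (rule PSh_module[OF M A])
  interpret MB: module K "map_obj M B" by (rule PSh_module[OF M B])
  show ?thesis using additive_neg[OF MA.module_axioms MB.module_axioms l(2,3) y] l(3)[OF x] y
    by (simp add: MA.M.minus_eq MB.M.minus_eq)
qed

lemma quotient_by_subpresheaf:
  assumes M: "M \<in> Obj PS" and N: "subpresheaf M N"
  obtains F q where "F \<in> Obj PS" "q \<in> Hom PS M F"
    "\<And>A z. A \<in> Obj a \<Longrightarrow> z \<in> el F A \<Longrightarrow> \<exists>x\<in>el M A. q A x = z"
    "\<And>A x. A \<in> Obj a \<Longrightarrow> x \<in> el M A \<Longrightarrow>
      q A x = \<zero>\<^bsub>map_obj F A\<^esub> \<longleftrightarrow> x \<in> N A"
proof -
  let ?Q = "\<lambda>A. el M A"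
  let ?eq = "\<lambda>A x y. x \<ominus>\<^bsub>map_obj M A\<^esub> y \<in> N A"
  note md = PSh_module[OF M]
  note ND = subpresheafD[OF N]
  have eqI: "?eq A x y" if "A \<in> Obj a" "x \<in> ?Q A" "x = y" for A x y
    using module_diff_eq_zero[OF md, of A x y] ND(2) that by simp
  have negN: "\<ominus>\<^bsub>map_obj M A\<^esub> x \<in> N A" if A: "A \<in> Obj a" "x \<in> N A" for A x
    using module_neg_smult[OF md[OF A(1)] ND(1)[OF A]] ND(4)[OF A(1) _ A(2)] by simp
  interpret presheaf_setoid U K a ?Q ?eq "\<lambda>A x y. x \<oplus>\<^bsub>map_obj M A\<^esub> y" "\<lambda>A. \<zero>\<^bsub>map_obj M A\<^esub>"
    "\<lambda>A c x. c \<odot>\<^bsub>map_obj M A\<^esub> x" "map_arr M" "\<lambda>A x. x"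
  proof (unfold_locales, goal_cases)
    case (2 A x y)
    interpret MA: module K "map_obj M A" by (rule md[OF 2(1)])
    have "y \<ominus>\<^bsub>map_obj M A\<^esub> x = \<ominus>\<^bsub>map_obj M A\<^esub> (x \<ominus>\<^bsub>map_obj M A\<^esub> y)"
      using 2 by (simp add: MA.M.minus_eq MA.M.minus_add MA.M.a_comm)
    then show ?case using negN 2 by simp
  next
    case (3 A x y z)
    interpret MA: module K "map_obj M A" by (rule md[OF 3(1)])
    have "x \<ominus>\<^bsub>map_obj M A\<^esub> z = (x \<ominus>\<^bsub>map_obj M A\<^esub> y) \<oplus>\<^bsub>map_obj M A\<^esub> (y \<ominus>\<^bsub>map_obj M A\<^esub> z)"
      using 3 by (simp add: MA.M.minus_eq MA.M.a_assoc MA.M.r_neg1)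
    then show ?case using ND(3) 3 by simp
  next
    case (5 A x x' y)
    interpret MA: module K "map_obj M A" by (rule md[OF 5(1)])
    have "(x \<oplus>\<^bsub>map_obj M A\<^esub> y) \<ominus>\<^bsub>map_obj M A\<^esub> (x' \<oplus>\<^bsub>map_obj M A\<^esub> y) = x \<ominus>\<^bsub>map_obj M A\<^esub> x'"
      using 5 by (simp add: MA.M.minus_eq MA.M.a_assoc MA.M.minus_add MA.M.a_lcomm[of y] MA.M.r_neg)
    then show ?case using 5 by simp
  next
    case (8 A c x x')
    interpret MA: module K "map_obj M A" by (rule md[OF 8(1)])
    have "c \<odot>\<^bsub>map_obj M A\<^esub> x \<ominus>\<^bsub>map_obj M A\<^esub> c \<odot>\<^bsub>map_obj M A\<^esub> x' = c \<odot>\<^bsub>map_obj M A\<^esub> (x \<ominus>\<^bsub>map_obj M A\<^esub> x')"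
      using 8 by (simp add: MA.M.minus_eq MA.smult_r_distr MA.smult_r_minus)
    then show ?case using 8 ND(4) by simp
  next
    case (10 A B f x x')
    then show ?case using presheaf_diff[OF M, of A B f x x'] ND(5)[of A _ B f] by metis
  next
    case (14 A x)
    interpret MA: module K "map_obj M A" by (rule md[OF 14(1)])
    show ?case
      by (rule bexI[of _ "\<ominus>\<^bsub>map_obj M A\<^esub> x"]) (use 14 MA.M.l_neg ND(2) in \<open>auto intro!: eqI\<close>)
  next
    case (25 A)
    show ?case using small_set_iff[OF univ] PSh_carrier[OF M 25] by simp
  qed (auto intro!: eqI module_add_closed[OF md] module_smult_closed[OF md] module_zero_closed[OF md] PSh_closed[OF M]
      simp: PSh_add[OF M] PSh_smult[OF M] PSh_Ident[OF M] PSh_Comp[OF M] PSh_hom_add[OF M] PSh_hom_smult[OF M]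
      abelian_monoid.a_assoc abelian_monoid.a_comm Comp_closed Hom_add_closed Hom_smult_closed Ident_closed
      module.smult_l_distr[OF md] module.smult_r_distr[OF md] module.smult_assoc1[OF md] module.smult_one[OF md]
      abelian_monoid.a_assoc[OF abelian_group.axioms(1)[OF module.axioms(2)[OF md]]]
      abelian_monoid.a_comm[OF abelian_group.axioms(1)[OF module.axioms(2)[OF md]]]
      abelian_monoid.l_zero[OF abelian_group.axioms(1)[OF module.axioms(2)[OF md]]])
  obtain F :: "('o, 'k, 'u) presheaf" and p where F: "F \<in> Obj PS"
    "\<And>A x. A \<in> Obj a \<Longrightarrow> x \<in> ?Q A \<Longrightarrow> p A x \<in> el F A"
    "\<And>A z. A \<in> Obj a \<Longrightarrow> z \<in> el F A \<Longrightarrow> \<exists>x\<in>?Q A. p A x = z"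
    "\<And>A x y. \<lbrakk>A \<in> Obj a; x \<in> ?Q A; y \<in> ?Q A\<rbrakk> \<Longrightarrow>
      p A x = p A y \<longleftrightarrow> ?eq A x y"
    "\<And>A x y. \<lbrakk>A \<in> Obj a; x \<in> ?Q A; y \<in> ?Q A\<rbrakk> \<Longrightarrow>
      p A (x \<oplus>\<^bsub>map_obj M A\<^esub> y) = p A x \<oplus>\<^bsub>map_obj F A\<^esub> p A y"
    "\<And>A. A \<in> Obj a \<Longrightarrow> p A \<zero>\<^bsub>map_obj M A\<^esub> = \<zero>\<^bsub>map_obj F A\<^esub>"
    "\<And>A c x. \<lbrakk>A \<in> Obj a; c \<in> carrier K; x \<in> ?Q A\<rbrakk> \<Longrightarrow>
      p A (c \<odot>\<^bsub>map_obj M A\<^esub> x) = c \<odot>\<^bsub>map_obj F A\<^esub> p A x"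
    "\<And>A B f x. \<lbrakk>A \<in> Obj a; B \<in> Obj a; f \<in> Hom a B A; x \<in> ?Q A\<rbrakk> \<Longrightarrow>
      map_arr F A B f (p A x) = p B (map_arr M A B f x)"
    by (rule quotient_presheaf) blast
  show thesis
  proof (rule that[OF F(1), of "mk_nat a M p"])
    show "mk_nat a M p \<in> Hom PS M F" by (rule mk_nat_Hom[OF M]) (use F in auto)
    show "\<exists>x\<in>?Q A. mk_nat a M p A x = z" if "A \<in> Obj a" "z \<in> el F A" for A z
      using F(3)[OF that] mk_nat_apply[OF that(1), of _ M p] by force
    show "mk_nat a M p A x = \<zero>\<^bsub>map_obj F A\<^esub> \<longleftrightarrow> x \<in> N A" if A: "A \<in> Obj a" and x: "x \<in> ?Q A" for A x
    proof -
      interpret MA: module K "map_obj M A" by (rule md[OF A])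
      have "mk_nat a M p A x = \<zero>\<^bsub>map_obj F A\<^esub> \<longleftrightarrow>
          x \<ominus>\<^bsub>map_obj M A\<^esub> \<zero>\<^bsub>map_obj M A\<^esub> \<in> N A"
        using F(4)[OF A x MA.M.zero_closed] unfolding F(6)[OF A] mk_nat_apply[OF A x] .
      moreover have "\<ominus>\<^bsub>map_obj M A\<^esub> \<zero>\<^bsub>map_obj M A\<^esub> = \<zero>\<^bsub>map_obj M A\<^esub>"
        by (rule MA.M.minus_equality) simp_all
      ultimately show ?thesis using x by (simp add: MA.M.minus_eq)
    qed
  qed
qed

section \<open>Sheafification\<close>

lemma matching_ad:
  assumes F: "F \<in> Obj PS" and A: "A \<in> Obj a" and R: "is_sieve K a A R" and S: "is_sieve K a A S"
    and s: "matching F A R s" and t: "matching F A S t"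
  shows "matching F A (\<lambda>B. R B \<inter> S B) (\<lambda>B f. s B f \<oplus>\<^bsub>map_obj F B\<^esub> t B f)"
  unfolding matching_def
proof (intro ballI conjI)
  fix B f assume B: "B \<in> Obj a" and f: "f \<in> R B \<inter> S B"
  interpret MB: module K "map_obj F B" by (rule PSh_module[OF F B])
  have f': "f \<in> R B" "f \<in> S B" using f by auto
  note sD = matchingD[OF s B] and tD = matchingD[OF t B]
  show "s B f \<oplus>\<^bsub>map_obj F B\<^esub> t B f \<in> el F B" using sD(1)[OF f'(1)] tD(1)[OF f'(2)] by simp
  show "s B (f \<oplus>\<^bsub>HomMod a B A\<^esub> g) \<oplus>\<^bsub>map_obj F B\<^esub> t B (f \<oplus>\<^bsub>HomMod a B A\<^esub> g) =
      s B f \<oplus>\<^bsub>map_obj F B\<^esub> t B f \<oplus>\<^bsub>map_obj F B\<^esub> (s B g \<oplus>\<^bsub>map_obj F B\<^esub> t B g)"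
        if "g \<in> R B \<inter> S B" for g
    using that f' sD(1) tD(1) by (simp add: sD(2) tD(2) MB.M.a_ac)
  show "s B (c \<odot>\<^bsub>HomMod a B A\<^esub> f) \<oplus>\<^bsub>map_obj F B\<^esub> t B (c \<odot>\<^bsub>HomMod a B A\<^esub> f) =
      c \<odot>\<^bsub>map_obj F B\<^esub> (s B f \<oplus>\<^bsub>map_obj F B\<^esub> t B f)" if "c \<in> carrier K" for c
    using that f' sD(1) tD(1) by (simp add: sD(3) tD(3) MB.smult_r_distr)
  show "s D (Comp a D B A f g) \<oplus>\<^bsub>map_obj F D\<^esub> t D (Comp a D B A f g) =
      map_arr F B D g (s B f \<oplus>\<^bsub>map_obj F B\<^esub> t B f)" if D: "D \<in> Obj a" and g: "g \<in> Hom a D B" for D g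
    using f' sD(1) tD(1) sD(4)[OF f'(1) D g] tD(4)[OF f'(2) D g] by (simp add: PSh_add[OF F B D g])
qed

lemma matching_sm:
  assumes F: "F \<in> Obj PS" and c: "c \<in> carrier K" and s: "matching F A R s"
  shows "matching F A R (\<lambda>B f. c \<odot>\<^bsub>map_obj F B\<^esub> s B f)"
  unfolding matching_def
proof (intro ballI conjI)
  fix B f assume B: "B \<in> Obj a" and f: "f \<in> R B"
  interpret MB: module K "map_obj F B" by (rule PSh_module[OF F B])
  note sD = matchingD[OF s B]
  show "c \<odot>\<^bsub>map_obj F B\<^esub> s B f \<in> el F B" using sD(1)[OF f] c by simp
  show "c \<odot>\<^bsub>map_obj F B\<^esub> s B (f \<oplus>\<^bsub>HomMod a B A\<^esub> g) =
      c \<odot>\<^bsub>map_obj F B\<^esub> s B f \<oplus>\<^bsub>map_obj F B\<^esub> c \<odot>\<^bsub>map_obj F B\<^esub> s B g" if "g \<in> R B"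
        for g
    using that f sD(1) c by (simp add: sD(2) MB.smult_r_distr)
  show "c \<odot>\<^bsub>map_obj F B\<^esub> s B (d \<odot>\<^bsub>HomMod a B A\<^esub> f) = d \<odot>\<^bsub>map_obj F B\<^esub> (c \<odot>\<^bsub>map_obj F B\<^esub> s B f)"
    if "d \<in> carrier K" for d
    using that f sD(1) c by (simp add: sD(3) MB.smult_assoc1[symmetric] m_comm)
  show "c \<odot>\<^bsub>map_obj F D\<^esub> s D (Comp a D B A f g) = map_arr F B D g (c \<odot>\<^bsub>map_obj F B\<^esub> s B f)"
    if D: "D \<in> Obj a" and g: "g \<in> Hom a D B" for D g
    using f sD(1) sD(4)[OF f D g] c by (simp add: PSh_smult[OF F B D g])
qed

lemma matching_pullback:
  assumes F: "F \<in> Obj PS" and A: "A \<in> Obj a" and B: "B \<in> Obj a" and f: "f \<in> Hom a B A"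
    and s: "matching F A R s"
  shows "matching F B (pullback_sieve a B A f R) (\<lambda>D g. s D (Comp a D B A f g))"
  unfolding matching_def using A B f
  by (auto simp: pullback_iff Comp_add_right Comp_smult_right matchingD[OF s] Comp_assoc)

lemma matching_zero:
  assumes F: "F \<in> Obj PS"
  shows "matching F A R (\<lambda>B f. \<zero>\<^bsub>map_obj F B\<^esub>)"
proof -
  have "\<zero>\<^bsub>map_obj F B\<^esub> \<oplus>\<^bsub>map_obj F B\<^esub> \<zero>\<^bsub>map_obj F B\<^esub> = \<zero>\<^bsub>map_obj F B\<^esub>" if "B \<in> Obj a" for B
    using abelian_monoid.l_zero[OF abelian_group.axioms(1)[OF module.axioms(2)[OF PSh_module[OF F that]]]]
      module_zero_closed[OF PSh_module[OF F that]] by simp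
  then show ?thesis unfolding matching_def
    by (simp add: PSh_zero[OF F] module_zero_closed[OF PSh_module[OF F]] module.smult_r_null[OF PSh_module[OF F]])
qed

lemma extend_along_local_iso:
  assumes M: "M \<in> Obj PS" and Z: "Z \<in> Obj PS" and u: "u \<in> Hom PS M Z"
    and loc: "\<And>A z. A \<in> Obj a \<Longrightarrow> z \<in> el Z A \<Longrightarrow>
      \<exists>R\<in>T A. \<forall>B\<in>Obj a. \<forall>f\<in>R B. \<exists>x\<in>el M B. map_arr Z A B f z = u B x"
    and Gs: "is_sheaf U K a T G" and g: "g \<in> Hom PS M G"
    and ker: "\<And>A x. \<lbrakk>A \<in> Obj a; x \<in> el M A; u A x = \<zero>\<^bsub>map_obj Z A\<^esub>\<rbrakk> \<Longrightarrow>
        g A x = \<zero>\<^bsub>map_obj G A\<^esub>"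
  shows "\<exists>!h. h \<in> Hom PS Z G \<and> Comp PS M Z G h u = g"
proof -
  note G = sheaf_PSh[OF Gs] and sep = sheaf_separated[OF Gs] and uD = PSh_HomD[OF u] and gD = PSh_HomD[OF g]
  have wd: "g A x = g A y" if "A \<in> Obj a" "x \<in> el M A" "y \<in> el M A" "u A x = u A y" for A x y
    using ker[OF that(1) PSh_Hom_diff(1)[OF M Z u that(1-3)]] PSh_Hom_diff(3)[OF M Z u that(1-3)]
      PSh_Hom_diff(3)[OF M G g that(1-3)] that(4) by simp
  let ?P = "\<lambda>A z y. \<forall>B\<in>Obj a. \<forall>f\<in>Hom a B A. \<forall>x\<in>el M B. map_arr Z A B f z = u B x \<longrightarrow> map_arr G A B f y = g B x"
  have eqI: "y = y'" if A: "A \<in> Obj a" and z: "z \<in> el Z A" and y: "y \<in> el G A" "?P A z y" and y': "y' \<in> el G A" and R: "R \<in> T A"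
    and e: "\<And>B f x. \<lbrakk>B \<in> Obj a; f \<in> Hom a B A; f \<in> R B; x \<in> el M B; map_arr Z A B f z = u B x\<rbrakk> \<Longrightarrow>
        map_arr G A B f y' = g B x"
    for A z y y' R
  proof -
    obtain S where S: "S \<in> T A" "\<forall>B\<in>Obj a. \<forall>f\<in>S B. \<exists>x\<in>el M B. map_arr Z A B f z = u B x"
      using loc[OF A z] by blast
    show ?thesis
    proof (rule separatedD[OF G sep A T_Int[OF A R S(1)] y(1) y'])
      fix B f assume B: "B \<in> Obj a" and f: "f \<in> R B \<inter> S B"
      have fH: "f \<in> Hom a B A" using f sieve_Hom[OF sieves[OF A R] A] by blast
      obtain x where x: "x \<in> el M B" "map_arr Z A B f z = u B x" using S(2) B f by blast
      show "map_arr G A B f y = map_arr G A B f y'" using y(2) e[OF B fH _ x] B fH f x by simp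
    qed
  qed
  have "\<exists>y. y \<in> el G A \<and> ?P A z y" if A: "A \<in> Obj a" and z: "z \<in> el Z A" for A z
  proof -
    obtain S where S: "S \<in> T A" "\<forall>B\<in>Obj a. \<forall>f\<in>S B. \<exists>x\<in>el M B. map_arr Z A B f z = u B x"
      using loc[OF A z] by blast
    note sv = sieves[OF A S(1)]
    define s where "s B f = g B (SOME x. x \<in> el M B \<and> map_arr Z A B f z = u B x)" for B f
    have s: "s B f = g B x" if B: "B \<in> Obj a" and x: "x \<in> el M B" "map_arr Z A B f z = u B x" for B f x
    proof -
      have "\<exists>x. x \<in> el M B \<and> map_arr Z A B f z = u B x" using x by blast
      from someI_ex[OF this] show ?thesis unfolding s_def using wd[OF B _ x(1)] x(2) by simp
    qed
    have "matching G A S s"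
      unfolding matching_def
    proof (intro ballI conjI)
      fix B f assume B: "B \<in> Obj a" and f: "f \<in> S B"
      note fH = sieve_Hom[OF sv A f]
      obtain x where x: "x \<in> el M B" "map_arr Z A B f z = u B x" using S(2) B f by blast
      show "s B f \<in> el G B" using s[OF B x] gD(2)[OF B x(1)] by simp
      show "s B (f \<oplus>\<^bsub>HomMod a B A\<^esub> f') = s B f \<oplus>\<^bsub>map_obj G B\<^esub> s B f'" if f': "f' \<in> S B" for f'
      proof -
        obtain x' where x': "x' \<in> el M B" "map_arr Z A B f' z = u B x'" using S(2) B f' by blast
        show ?thesis
          using s[OF B module_add_closed[OF PSh_module[OF M B] x(1) x'(1)], of "f \<oplus>\<^bsub>HomMod a B A\<^esub> f'"]
            PSh_hom_add[OF Z A B fH sieve_Hom[OF sv A f'] z] x x' uD(3)[OF B x(1) x'(1)] gD(3)[OF B x(1) x'(1)] s[OF B x] s[OF B x']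
          by simp
      qed
      show "s B (c \<odot>\<^bsub>HomMod a B A\<^esub> f) = c \<odot>\<^bsub>map_obj G B\<^esub> s B f" if c: "c \<in> carrier K" for c
        using s[OF B module_smult_closed[OF PSh_module[OF M B] c x(1)], of "c \<odot>\<^bsub>HomMod a B A\<^esub> f"]
          PSh_hom_smult[OF Z A B c fH z] x(2) uD(4)[OF B c x(1)] gD(4)[OF B c x(1)] s[OF B x] by simp
      show "s D (Comp a D B A f k) = map_arr G B D k (s B f)" if D: "D \<in> Obj a" and k: "k \<in> Hom a D B" for D k
        using s[OF D PSh_closed[OF M B D k x(1)], of "Comp a D B A f k"]
          PSh_Comp[OF Z A B D fH k z] x(2) uD(5)[OF B D k x(1)] gD(5)[OF B D k x(1)] s[OF B x] by simp
    qed
    then obtain y where y: "y \<in> el G A" "\<And>B f. B \<in> Obj a \<Longrightarrow> f \<in> S B \<Longrightarrow> map_arr G A B f y = s B f"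
      using sheaf_glue[OF Gs A S(1)] by blast
    have "map_arr G A B f y = g B x"
      if B: "B \<in> Obj a" and f: "f \<in> Hom a B A" and x: "x \<in> el M B" "map_arr Z A B f z = u B x" for B f x
    proof (rule separatedD[OF G sep B T2[OF A B S(1) f] PSh_closed[OF G A B f y(1)] gD(2)[OF B x(1)]])
      fix D k assume D: "D \<in> Obj a" and "k \<in> pullback_sieve a B A f S D"
      then have k: "k \<in> Hom a D B" "Comp a D B A f k \<in> S D" by (auto simp: pullback_iff)
      show "map_arr G B D k (map_arr G A B f y) = map_arr G B D k (g B x)"
        using s[OF D PSh_closed[OF M B D k(1) x(1)], of "Comp a D B A f k"] y(2)[OF D k(2)] PSh_Comp[OF G A B D f k(1) y(1)]
          PSh_Comp[OF Z A B D f k(1) z] x(2) uD(5)[OF B D k(1) x(1)] gD(5)[OF B D k(1) x(1)] by simp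
    qed
    then show ?thesis using y(1) by blast
  qed
  then obtain h0 where h0: "\<And>A z. A \<in> Obj a \<Longrightarrow> z \<in> el Z A \<Longrightarrow> h0 A z \<in> el G A \<and> ?P A z (h0 A z)"
    by metis
  have h0c: "h0 A z \<in> el G A" if "A \<in> Obj a" "z \<in> el Z A" for A z using h0[OF that] by blast
  have h0e: "map_arr G A B f (h0 A z) = g B x"
    if "A \<in> Obj a" "z \<in> el Z A" "B \<in> Obj a" "f \<in> Hom a B A" "x \<in> el M B" "map_arr Z A B f z = u B x" for A z B f x
    using h0[OF that(1,2)] that(3-6) by blast
  have h0I: "h0 A z = y'" if "A \<in> Obj a" "z \<in> el Z A" "y' \<in> el G A" "R \<in> T A"
    "\<And>B f x. \<lbrakk>B \<in> Obj a; f \<in> Hom a B A; f \<in> R B; x \<in> el M B; map_arr Z A B f z = u B x\<rbrakk> \<Longrightarrow>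
      map_arr G A B f y' = g B x"
    for A z y' R
    by (rule eqI[OF that(1,2) h0c[OF that(1,2)] conjunct2[OF h0[OF that(1,2)]] that(3-5)])
  define h where "h = mk_nat a Z h0"
  have ha: "h A z = h0 A z" if "A \<in> Obj a" "z \<in> el Z A" for A z
    using mk_nat_apply[OF that] by (simp add: h_def)
  have hH: "h \<in> Hom PS Z G"
    unfolding h_def
  proof (rule mk_nat_Hom[OF Z h0c], assumption, assumption)
    fix A z w assume A: "A \<in> Obj a" and z: "z \<in> el Z A" and w: "w \<in> el Z A"
    obtain R where R: "R \<in> T A" "\<forall>B\<in>Obj a. \<forall>f\<in>R B. \<exists>x\<in>el M B. map_arr Z A B f z = u B x"
      using loc[OF A z] by blast
    obtain S where S: "S \<in> T A" "\<forall>B\<in>Obj a. \<forall>f\<in>S B. \<exists>x\<in>el M B. map_arr Z A B f w = u B x"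
      using loc[OF A w] by blast
    show "h0 A (z \<oplus>\<^bsub>map_obj Z A\<^esub> w) = h0 A z \<oplus>\<^bsub>map_obj G A\<^esub> h0 A w"
    proof (rule h0I[OF A module_add_closed[OF PSh_module[OF Z A] z w]
          module_add_closed[OF PSh_module[OF G A] h0c[OF A z] h0c[OF A w]] T_Int[OF A R(1) S(1)]])
      fix B f x assume B: "B \<in> Obj a" and fH: "f \<in> Hom a B A" and f: "f \<in> R B \<inter> S B" and x: "x \<in> el M B"
        "map_arr Z A B f (z \<oplus>\<^bsub>map_obj Z A\<^esub> w) = u B x"
      obtain x1 x2 where x1: "x1 \<in> el M B" "map_arr Z A B f z = u B x1" and x2: "x2 \<in> el M B" "map_arr Z A B f w = u B x2"
        using R(2) S(2) B f by blast
      have "g B x = g B (x1 \<oplus>\<^bsub>map_obj M B\<^esub> x2)"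
        by (rule wd[OF B x(1) module_add_closed[OF PSh_module[OF M B] x1(1) x2(1)]])
          (use x(2) PSh_add[OF Z A B fH z w] x1 x2 uD(3)[OF B x1(1) x2(1)] in simp)
      then show "map_arr G A B f (h0 A z \<oplus>\<^bsub>map_obj G A\<^esub> h0 A w) = g B x"
        using PSh_add[OF G A B fH h0c[OF A z] h0c[OF A w]] h0e[OF A z B fH x1] h0e[OF A w B fH x2] gD(3)[OF B x1(1) x2(1)] by simp
    qed
  next
    fix A c z assume A: "A \<in> Obj a" and c: "c \<in> carrier K" and z: "z \<in> el Z A"
    obtain R where R: "R \<in> T A" "\<forall>B\<in>Obj a. \<forall>f\<in>R B. \<exists>x\<in>el M B. map_arr Z A B f z = u B x"
      using loc[OF A z] by blast
    show "h0 A (c \<odot>\<^bsub>map_obj Z A\<^esub> z) = c \<odot>\<^bsub>map_obj G A\<^esub> h0 A z"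
    proof (rule h0I[OF A module_smult_closed[OF PSh_module[OF Z A] c z] module_smult_closed[OF PSh_module[OF G A] c h0c[OF A z]] R(1)])
      fix B f x assume B: "B \<in> Obj a" and fH: "f \<in> Hom a B A" and f: "f \<in> R B" and x: "x \<in> el M B"
        "map_arr Z A B f (c \<odot>\<^bsub>map_obj Z A\<^esub> z) = u B x"
      obtain x1 where x1: "x1 \<in> el M B" "map_arr Z A B f z = u B x1" using R(2) B f by blast
      have "g B x = g B (c \<odot>\<^bsub>map_obj M B\<^esub> x1)"
        by (rule wd[OF B x(1) module_smult_closed[OF PSh_module[OF M B] c x1(1)]])
          (use x(2) PSh_smult[OF Z A B fH c z] x1 uD(4)[OF B c x1(1)] in simp)
      then show "map_arr G A B f (c \<odot>\<^bsub>map_obj G A\<^esub> h0 A z) = g B x"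
        using PSh_smult[OF G A B fH c h0c[OF A z]] h0e[OF A z B fH x1] gD(4)[OF B c x1(1)] by simp
    qed
  next
    fix A B k z assume A: "A \<in> Obj a" and B: "B \<in> Obj a" and k: "k \<in> Hom a B A" and z: "z \<in> el Z A"
    show "h0 B (map_arr Z A B k z) = map_arr G A B k (h0 A z)"
    proof (rule h0I[OF B PSh_closed[OF Z A B k z] PSh_closed[OF G A B k h0c[OF A z]] T1[OF B]])
      fix D f x assume D: "D \<in> Obj a" and f: "f \<in> Hom a D B" and x: "x \<in> el M D" "map_arr Z B D f (map_arr Z A B k z) = u D x"
      show "map_arr G B D f (map_arr G A B k (h0 A z)) = g D x"
        using h0e[OF A z D Comp_closed[OF D B A f k] x(1)] PSh_Comp[OF Z A B D k f z] PSh_Comp[OF G A B D k f h0c[OF A z]] x(2) by simp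
    qed
  qed
  have hu: "Comp PS M Z G h u = g"
  proof (rule PSh_Hom_eqI[OF PSh_Comp_closed[OF M u hH] g])
    fix A x assume A: "A \<in> Obj a" and x: "x \<in> el M A"
    note ux = uD(2)[OF A x]
    have "map_arr G A A (Ident a A) (h0 A (u A x)) = g A x"
      by (rule h0e[OF A ux A Ident_closed[OF A] x PSh_Ident[OF Z A ux]])
    then show "Comp PS M Z G h u A x = g A x"
      using PSh_Comp_apply[OF A x] ha[OF A ux] PSh_Ident[OF G A h0c[OF A ux]] by simp
  qed
  show ?thesis
  proof (rule ex1I[of _ h])
    fix h' assume h': "h' \<in> Hom PS Z G \<and> Comp PS M Z G h' u = g"
    note h'D = PSh_HomD[OF conjunct1[OF h']]
    show "h' = h"
    proof (rule PSh_Hom_eqI)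
      fix A z assume A: "A \<in> Obj a" and z: "z \<in> el Z A"
      have "h0 A z = h' A z"
      proof (rule h0I[OF A z h'D(2)[OF A z] T1[OF A]])
        fix B f x assume B: "B \<in> Obj a" and f: "f \<in> Hom a B A" and x: "x \<in> el M B" "map_arr Z A B f z = u B x"
        show "map_arr G A B f (h' A z) = g B x"
          using h'D(5)[OF A B f z] x PSh_Comp_apply[OF B x(1), of U K Z G h' u] h' by simp
      qed
      then show "h' A z = h A z" using ha[OF A z] by simp
    qed (use h' hH in auto)
  qed (use hH hu in auto)
qed

lemma sheafify_separated:
  assumes F: "F \<in> Obj PS" and sep: "separated F"
  obtains Z u where "is_sheaf U K a T Z" "u \<in> Hom PS F Z"
    "\<And>A x. \<lbrakk>A \<in> Obj a; x \<in> el F A; u A x = \<zero>\<^bsub>map_obj Z A\<^esub>\<rbrakk> \<Longrightarrow>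
      x = \<zero>\<^bsub>map_obj F A\<^esub>"
    "\<And>A z. A \<in> Obj a \<Longrightarrow> z \<in> el Z A \<Longrightarrow>
      \<exists>R\<in>T A. \<forall>B\<in>Obj a. \<forall>f\<in>R B. \<exists>x\<in>el F B. map_arr Z A B f z = u B x"
proof -
  let ?Q = "\<lambda>A. {(R, s). R \<in> T A \<and> matching F A R s}"
  let ?eq = "\<lambda>A p p'. \<forall>B\<in>Obj a. \<forall>f\<in>fst p B \<inter> fst p' B. snd p B f = snd p' B f"
  let ?ad = "\<lambda>A p p'. (\<lambda>B. fst p B \<inter> fst p' B, \<lambda>B f. snd p B f \<oplus>\<^bsub>map_obj F B\<^esub> snd p' B f)"
  let ?ze = "\<lambda>A. (max_sieve a A, \<lambda>B f. \<zero>\<^bsub>map_obj F B\<^esub>)"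
  let ?sm = "\<lambda>A c p. (fst p, \<lambda>B f. c \<odot>\<^bsub>map_obj F B\<^esub> snd p B f)"
  let ?ac = "\<lambda>A B g p. (pullback_sieve a B A g (fst p), \<lambda>D f. snd p D (Comp a D B A g f))"
  let ?enc = "\<lambda>A p e. if e \<in> mors then (case e of (B, A', g) \<Rightarrow>
      (if A' = sk A \<and> Comp a B (sk A) A (ski A) g \<in> fst p B then Some (snd p B (Comp a B (sk A) A (ski A) g)) else None))
      else undefined"
  note md = PSh_module[OF F]
  have sv: "is_sieve K a A R" if "A \<in> Obj a" "(R, s) \<in> ?Q A" for A R s using that sieves by auto
  have car: "s B f \<in> el F B" if "A \<in> Obj a" "(R, s) \<in> ?Q A" "B \<in> Obj a" "f \<in> R B" for A R s B f
    using matchingD(1) that by blast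
  note am = abelian_group.axioms(1)[OF module.axioms(2)[OF md]]
  interpret presheaf_setoid U K a ?Q ?eq ?ad ?ze ?sm ?ac ?enc
  proof (unfold_locales, goal_cases)
    case (3 A p p' p'')
    obtain R s R' s' R'' s'' where p: "p = (R, s)" "p' = (R', s')" "p'' = (R'', s'')" by (metis surj_pair)
    note A = 3(1) and q = 3(2-6)[unfolded p]
    show ?case unfolding p fst_conv snd_conv
    proof (intro ballI)
      fix B f assume B: "B \<in> Obj a" and f: "f \<in> R B \<inter> R'' B"
      have fH: "f \<in> Hom a B A" using f sieve_Hom[OF sv[OF A q(1)] A] by blast
      show "s B f = s'' B f"
      proof (rule separatedD[OF F sep B T2[OF A B, of R' f]])
        show "R' \<in> T A" "f \<in> Hom a B A" using q fH by auto
        show "s B f \<in> el F B" "s'' B f \<in> el F B" using car A q B f by blast+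
        fix D g assume D: "D \<in> Obj a" and g: "g \<in> pullback_sieve a B A f R' D"
        then have g: "g \<in> Hom a D B" "Comp a D B A f g \<in> R' D" by (auto simp: pullback_iff)
        have "Comp a D B A f g \<in> R D" "Comp a D B A f g \<in> R'' D"
          using sieve_Comp[OF sv[OF A q(1)] A D _ g(1)] sieve_Comp[OF sv[OF A q(3)] A D _ g(1)] f by auto
        then have "s D (Comp a D B A f g) = s'' D (Comp a D B A f g)" using q(4,5) g D by simp
        then show "map_arr F B D g (s B f) = map_arr F B D g (s'' B f)"
          using q f matchingD(4)[of F A R s B f D g] matchingD(4)[of F A R'' s'' B f D g] B D g by auto
      qed
    qed
  next
    case (4 A p p')
    then show ?case using T_Int matching_ad[OF F] sieves by auto
  next
    case (6 A)
    then show ?case using T1 matching_zero[OF F] by auto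
  next
    case (7 A c p)
    then show ?case using matching_sm[OF F] by auto
  next
    case (9 A B f p)
    then show ?case using T2 matching_pullback[OF F] by auto
  next
    case (14 A p)
    obtain R s where p: "p = (R, s)" by (metis surj_pair)
    have "(R, \<lambda>B f. (\<ominus>\<^bsub>K\<^esub> \<one>\<^bsub>K\<^esub>) \<odot>\<^bsub>map_obj F B\<^esub> s B f) \<in> ?Q A"
      using 14 p matching_sm[OF F, of "\<ominus>\<^bsub>K\<^esub> \<one>\<^bsub>K\<^esub>"] by auto
    moreover have "(\<ominus>\<^bsub>K\<^esub> \<one>\<^bsub>K\<^esub>) \<odot>\<^bsub>map_obj F B\<^esub> s B f \<oplus>\<^bsub>map_obj F B\<^esub> s B f = \<zero>\<^bsub>map_obj F B\<^esub>"
      if "B \<in> Obj a" "f \<in> R B" for B f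
      using car[OF 14(1), of R s B f] 14 p that module_neg_smult[OF md, of B "s B f"]
        abelian_group.l_neg[OF module.axioms(2)[OF md], of B "s B f"] by simp
    ultimately show ?case unfolding p by (intro bexI[of _ "(R,
      \<lambda>B f. (\<ominus>\<^bsub>K\<^esub> \<one>\<^bsub>K\<^esub>) \<odot>\<^bsub>map_obj F B\<^esub> s B f)"]) auto
  next
    case (25 A)
    let ?V = "insert None (Some ` (\<Union>B\<in>skel. el F B))"
    have "small U (\<Union>B\<in>skel. el F B)"
      by (rule small_Union[OF univ skel_small]) (use skel_Obj PSh_carrier[OF F] small_set_iff[OF univ] in auto)
    then have "small U ?V" using small_Un[OF univ small_finite[OF univ, of "{None}"] small_image] by simp
    then have V: "small U (Func mors ?V)" by (rule Func_small)
    have "?enc A p \<in> Func mors ?V" if "p \<in> ?Q A" for p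
    proof -
      obtain R s where p: "p = (R, s)" by (metis surj_pair)
      show ?thesis using car[OF 25, of R s] that skel_Obj unfolding Func_def p
        by (auto simp: mors_of_def intro!: imageI UN_I)
    qed
    then show ?case by (intro small_subset[OF V]) blast
  next
    case (26 A p p')
    obtain R s R' s' where p: "p = (R, s)" "p' = (R', s')" by (metis surj_pair)
    note A = 26(1) and q = 26(2,3)[unfolded p]
    show ?case unfolding p fst_conv snd_conv
    proof (intro ballI)
      fix B f assume B: "B \<in> Obj a" and f: "f \<in> R B \<inter> R' B"
      have fH: "f \<in> Hom a B A" using f sieve_Hom[OF sv[OF A q(1)] A] by blast
      note kA = sk[OF A] and kB = sk[OF B]
      define f' where "f' = Comp a (sk B) B A f (ski B)"
      have f'H: "f' \<in> Hom a (sk B) A" using f'_def Comp_closed kB A B fH by blast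
      define g where "g = Comp a (sk B) A (sk A) (skj A) f'"
      have gH: "g \<in> Hom a (sk B) (sk A)" using g_def Comp_closed kA kB A f'H by blast
      have g: "Comp a (sk B) (sk A) A (ski A) g = f'" unfolding g_def using ski_skj[OF A _ f'H] kB by blast
      have f'R: "f' \<in> R (sk B)" "f' \<in> R' (sk B)" unfolding f'_def
        using sieve_Comp[OF sv[OF A q(1)] A _ _ kB(4)] sieve_Comp[OF sv[OF A q(2)] A _ _ kB(4)] f kB by auto
      have "(sk B, sk A, g) \<in> mors" using gH kA kB by (auto simp: mors_of_def)
      then have "s (sk B) f' = s' (sk B) f'"
        using fun_cong[OF 26(4)[unfolded p], of "(sk B, sk A, g)"] g f'R by simp
      moreover have "s B f = map_arr F (sk B) B (skj B) (s (sk B) f')"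
        using matchingD(4)[of F A R s "sk B" f' B "skj B"] q f'R kB B skj_ski[OF A B fH] f'_def by auto
      moreover have "s' B f = map_arr F (sk B) B (skj B) (s' (sk B) f')"
        using matchingD(4)[of F A R' s' "sk B" f' B "skj B"] q f'R kB B skj_ski[OF A B fH] f'_def by auto
      ultimately show "s B f = s' B f" by simp
    qed
  qed (auto simp: pullback_iff car matchingD Comp_Ident_left Comp_assoc Comp_add_left Comp_smult_left
      abelian_monoid.a_assoc[OF am] abelian_monoid.a_comm[OF am] abelian_monoid.l_zero[OF am]
      module.smult_l_distr[OF md] module.smult_r_distr[OF md] module.smult_assoc1[OF md] module.smult_one[OF md])
  obtain Z :: "('o, 'k, 'u) presheaf" and p where Z: "Z \<in> Obj PS"
    and pc: "\<And>A x. A \<in> Obj a \<Longrightarrow> x \<in> ?Q A \<Longrightarrow> p A x \<in> el Z A"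
    and ps: "\<And>A z. A \<in> Obj a \<Longrightarrow> z \<in> el Z A \<Longrightarrow> \<exists>x\<in>?Q A. p A x = z"
    and pe: "\<And>A x y. \<lbrakk>A \<in> Obj a; x \<in> ?Q A; y \<in> ?Q A\<rbrakk> \<Longrightarrow>
      p A x = p A y \<longleftrightarrow> ?eq A x y"
    and pad: "\<And>A x y. \<lbrakk>A \<in> Obj a; x \<in> ?Q A; y \<in> ?Q A\<rbrakk> \<Longrightarrow>
      p A (?ad A x y) = p A x \<oplus>\<^bsub>map_obj Z A\<^esub> p A y"
    and pz: "\<And>A. A \<in> Obj a \<Longrightarrow> p A (?ze A) = \<zero>\<^bsub>map_obj Z A\<^esub>"
    and psm: "\<And>A c x. \<lbrakk>A \<in> Obj a; c \<in> carrier K; x \<in> ?Q A\<rbrakk> \<Longrightarrow>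
      p A (?sm A c x) = c \<odot>\<^bsub>map_obj Z A\<^esub> p A x"
    and pac: "\<And>A B f x. \<lbrakk>A \<in> Obj a; B \<in> Obj a; f \<in> Hom a B A; x \<in> ?Q A\<rbrakk> \<Longrightarrow>
      map_arr Z A B f (p A x) = p B (?ac A B f x)"
    by (rule quotient_presheaf) (rule that)
  have psR: thesis if "A \<in> Obj a" "z \<in> el Z A"
    "\<And>R s. (R, s) \<in> ?Q A \<Longrightarrow> z = p A (R, s) \<Longrightarrow> thesis" for A z thesis
  proof -
    note r = that
    obtain x where "x \<in> ?Q A" "p A x = z" using ps[OF r(1,2)] by (elim bexE)
    then show thesis using r(3)[of "fst x" "snd x"] by (simp add: case_prod_unfold)
  qed
  define t where "t A x = (max_sieve a A, \<lambda>B f. map_arr F A B f x)" for A x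
  have tQ: "t A x \<in> ?Q A" if "A \<in> Obj a" "x \<in> el F A" for A x
    using matching_restrict[OF F that(1) sieve_max[OF that(1)] that(2)] T1[OF that(1)] by (simp add: t_def)
  define u where "u = mk_nat a F (\<lambda>A x. p A (t A x))"
  have ua: "u A x = p A (t A x)" if "A \<in> Obj a" "x \<in> el F A" for A x
    using mk_nat_apply[OF that] by (simp add: u_def)
  have uH: "u \<in> Hom PS F Z" unfolding u_def
  proof (rule mk_nat_Hom[OF F])
    fix A x assume A: "A \<in> Obj a" and x: "x \<in> el F A"
    show "p A (t A x) \<in> el Z A" by (rule pc[OF A tQ[OF A x]])
    show "p A (t A (x \<oplus>\<^bsub>map_obj F A\<^esub> y)) = p A (t A x) \<oplus>\<^bsub>map_obj Z A\<^esub> p A (t A y)"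
      if y: "y \<in> el F A" for y
    proof -
      have "p A (t A (x \<oplus>\<^bsub>map_obj F A\<^esub> y)) = p A (?ad A (t A x) (t A y))"
        by (rule pe[OF A tQ[OF A module_add_closed[OF md[OF A] x y]] ad_closed[OF A tQ[OF A x] tQ[OF A y]], THEN iffD2])
          (use x y in \<open>auto simp: t_def max_sieve_def PSh_add[OF F A]\<close>)
      then show ?thesis using pad[OF A tQ[OF A x] tQ[OF A y]] by simp
    qed
    show "p A (t A (c \<odot>\<^bsub>map_obj F A\<^esub> x)) = c \<odot>\<^bsub>map_obj Z A\<^esub> p A (t A x)" if c: "c \<in> carrier K" for c
    proof -
      have "p A (t A (c \<odot>\<^bsub>map_obj F A\<^esub> x)) = p A (?sm A c (t A x))"
        by (rule pe[OF A tQ[OF A module_smult_closed[OF md[OF A] c x]] sm_closed[OF A c tQ[OF A x]], THEN iffD2])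
          (use c x in \<open>auto simp: t_def max_sieve_def PSh_smult[OF F A]\<close>)
      then show ?thesis using psm[OF A c tQ[OF A x]] by simp
    qed
    show "p B (t B (map_arr F A B f x)) = map_arr Z A B f (p A (t A x))" if B: "B \<in> Obj a" and f: "f \<in> Hom a B A" for B f
    proof -
      have "p B (t B (map_arr F A B f x)) = p B (?ac A B f (t A x))"
        by (rule pe[OF B tQ[OF B PSh_closed[OF F A B f x]] ac_closed[OF A B f tQ[OF A x]], THEN iffD2])
          (use A B x f in \<open>auto simp: t_def max_sieve_def pullback_iff PSh_Comp[OF F]\<close>)
      then show ?thesis using pac[OF A B f tQ[OF A x]] by simp
    qed
  qed
  have uinj: "x = y" if A: "A \<in> Obj a" and x: "x \<in> el F A" and y: "y \<in> el F A"
    and e: "u A x = u A y" for A x y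
  proof -
    have "?eq A (t A x) (t A y)" using e ua pe[OF A tQ[OF A x] tQ[OF A y]] A x y by simp
    then have "map_arr F A A (Ident a A) x = map_arr F A A (Ident a A) y"
      using A Ident_closed[OF A] by (auto simp: t_def max_sieve_def)
    then show ?thesis using PSh_Ident[OF F A] x y by simp
  qed
  have key: "map_arr Z A B f (p A (R, s)) = u B (s B f)"
    if A: "A \<in> Obj a" and q: "(R, s) \<in> ?Q A" and B: "B \<in> Obj a" and f: "f \<in> R B" for A R s B f
  proof -
    have fH: "f \<in> Hom a B A" using f sieve_Hom[OF sv[OF A q] A] by blast
    have c: "s B f \<in> el F B" using car[OF A q B f] .
    have "p B (?ac A B f (R, s)) = p B (t B (s B f))"
      by (rule pe[OF B ac_closed[OF A B fH q] tQ[OF B c], THEN iffD2])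
        (use q f B in \<open>auto simp: t_def max_sieve_def pullback_iff matchingD\<close>)
    then show ?thesis using pac[OF A B fH q] ua[OF B c] by simp
  qed
  have Zsep: "separated Z"
    unfolding separated_def
  proof (intro ballI impI)
    fix A R' x assume A: "A \<in> Obj a" and R': "R' \<in> T A" and x: "x \<in> el Z A"
      and z: "\<forall>B\<in>Obj a. \<forall>f\<in>R' B. map_arr Z A B f x = \<zero>\<^bsub>map_obj Z B\<^esub>"
    obtain R s where q: "(R, s) \<in> ?Q A" "x = p A (R, s)" by (rule psR[OF A x])
    have "s B f = \<zero>\<^bsub>map_obj F B\<^esub>" if B: "B \<in> Obj a" and f: "f \<in> R B" for B f
    proof -
      have fH: "f \<in> Hom a B A" using f sieve_Hom[OF sv[OF A q(1)] A] by blast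
      show ?thesis
      proof (rule separatedD[OF F sep B T2[OF A B R' fH] car[OF A q(1) B f]])
        show "\<zero>\<^bsub>map_obj F B\<^esub> \<in> el F B" by (rule module_zero_closed[OF md[OF B]])
        fix D g assume D: "D \<in> Obj a" and g: "g \<in> pullback_sieve a B A f R' D"
        then have g: "g \<in> Hom a D B" "Comp a D B A f g \<in> R' D" by (auto simp: pullback_iff)
        have fg: "Comp a D B A f g \<in> R D" using sieve_Comp[OF sv[OF A q(1)] A D f g(1)] .
        have "u D (s D (Comp a D B A f g)) = \<zero>\<^bsub>map_obj Z D\<^esub>"
          using key[OF A q(1) D fg] z D g(2) q(2) by simp
        then have "s D (Comp a D B A f g) = \<zero>\<^bsub>map_obj F D\<^esub>"
          using uinj[OF D car[OF A q(1) D fg] module_zero_closed[OF md[OF D]]] PSh_Hom_zero[OF F Z uH D] by simp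
        then show "map_arr F B D g (s B f) = map_arr F B D g \<zero>\<^bsub>map_obj F B\<^esub>"
          using matchingD(4)[of F A R s B f D g] q(1) B f D g PSh_zero[OF F B D g(1)] by simp
      qed
    qed
    then have "?eq A (R, s) (?ze A)" by simp
    then show "x = \<zero>\<^bsub>map_obj Z A\<^esub>" using pe[OF A q(1) ze_closed[OF A]] q(2) pz[OF A] by simp
  qed
  have sh: "is_sheaf U K a T Z"
    unfolding is_sheaf_iff
  proof (intro conjI ballI allI impI Z Zsep)
    fix A R m assume A: "A \<in> Obj a" and R: "R \<in> T A" and m: "matching Z A R m"
    have svR: "is_sieve K a A R" using sieves A R by blast
    note RH = sieve_Hom[OF svR A]
    define R2 where "R2 B = {f \<in> R B. \<exists>x\<in>el F B. m B f = u B x}" for B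
    define s where "s B f = (SOME x. x \<in> el F B \<and> m B f = u B x)" for B f
    have s: "s B f \<in> el F B" "m B f = u B (s B f)" if "f \<in> R2 B" for B f
    proof -
      have "\<exists>x. x \<in> el F B \<and> m B f = u B x" using that unfolding R2_def by blast
      then have "s B f \<in> el F B \<and> m B f = u B (s B f)" unfolding s_def by (rule someI_ex)
      then show "s B f \<in> el F B" "m B f = u B (s B f)" by auto
    qed
    have R2R: "f \<in> R B" if "f \<in> R2 B" for f B using that unfolding R2_def by blast
    have su: "s B f = x" if "B \<in> Obj a" "f \<in> R2 B" "x \<in> el F B" "m B f = u B x" for B f x
      using uinj[OF that(1) s(1)[OF that(2)] that(3)] s(2)[OF that(2)] that(4) by simp
    have o: "B \<in> Obj a" if "f \<in> R2 B" for f B using that sieve_Obj[OF svR A] R2R by blast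
    note uD = PSh_HomD[OF uH]
    have add: "f \<oplus>\<^bsub>HomMod a B A\<^esub> g \<in> R2 B \<and>
        s B (f \<oplus>\<^bsub>HomMod a B A\<^esub> g) = s B f \<oplus>\<^bsub>map_obj F B\<^esub> s B g"
      if f: "f \<in> R2 B" and g: "g \<in> R2 B" for B f g
    proof -
      have e: "m B (f \<oplus>\<^bsub>HomMod a B A\<^esub> g) = u B (s B f \<oplus>\<^bsub>map_obj F B\<^esub> s B g)"
        using matchingD(2)[OF m o[OF f] R2R[OF f] R2R[OF g]] s[OF f] s[OF g] uD(3)[OF o[OF f]] by simp
      have c: "s B f \<oplus>\<^bsub>map_obj F B\<^esub> s B g \<in> el F B"
        using module_add_closed[OF md[OF o[OF f]]] s f g by blast
      have "f \<oplus>\<^bsub>HomMod a B A\<^esub> g \<in> R2 B" using e c sieve_add[OF svR A R2R[OF f] R2R[OF g]] unfolding R2_def by blast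
      then show ?thesis using su[OF o[OF f] _ c e] by blast
    qed
    have smu: "c \<odot>\<^bsub>HomMod a B A\<^esub> f \<in> R2 B \<and>
        s B (c \<odot>\<^bsub>HomMod a B A\<^esub> f) = c \<odot>\<^bsub>map_obj F B\<^esub> s B f"
      if c: "c \<in> carrier K" and f: "f \<in> R2 B" for B f c
    proof -
      have e: "m B (c \<odot>\<^bsub>HomMod a B A\<^esub> f) = u B (c \<odot>\<^bsub>map_obj F B\<^esub> s B f)"
        using matchingD(3)[OF m o[OF f] R2R[OF f] c] s[OF f] uD(4)[OF o[OF f] c] by simp
      have c': "c \<odot>\<^bsub>map_obj F B\<^esub> s B f \<in> el F B"
        using module_smult_closed[OF md[OF o[OF f]] c] s f by blast
      have "c \<odot>\<^bsub>HomMod a B A\<^esub> f \<in> R2 B" using e c' sieve_smult[OF svR A c R2R[OF f]] unfolding R2_def by blast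
      then show ?thesis using su[OF o[OF f] _ c' e] by blast
    qed
    have act: "Comp a D B A f g \<in> R2 D \<and> s D (Comp a D B A f g) = map_arr F B D g (s B f)"
      if f: "f \<in> R2 B" and D: "D \<in> Obj a" and g: "g \<in> Hom a D B" for B f D g
    proof -
      have e: "m D (Comp a D B A f g) = u D (map_arr F B D g (s B f))"
        using matchingD(4)[OF m o[OF f] R2R[OF f] D g] s[OF f] uD(5)[OF o[OF f] D g] by simp
      have c': "map_arr F B D g (s B f) \<in> el F D"
        using PSh_closed[OF F o[OF f] D g] s f by blast
      have "Comp a D B A f g \<in> R2 D" using e c' sieve_Comp[OF svR A D R2R[OF f] g] unfolding R2_def by blast
      then show ?thesis using su[OF D _ c' e] by blast
    qed
    have R2sv: "is_sieve K a A R2"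
    proof (rule sieveI[OF A])
      fix B assume B: "B \<in> Obj a"
      have z: "\<zero>\<^bsub>HomMod a B A\<^esub> \<in> R B" by (rule sieve_zero[OF svR A B])
      interpret H: module K "HomMod a B A" by (rule module_HomMod[OF B A])
      have "m B \<zero>\<^bsub>HomMod a B A\<^esub> \<oplus>\<^bsub>map_obj Z B\<^esub> m B \<zero>\<^bsub>HomMod a B A\<^esub> = m B \<zero>\<^bsub>HomMod a B A\<^esub>"
        using matchingD(2)[OF m B z z] by simp
      then have "m B \<zero>\<^bsub>HomMod a B A\<^esub> = \<zero>\<^bsub>map_obj Z B\<^esub>"
        using module_add_self_zero[OF PSh_module[OF Z B]] matchingD(1)[OF m B z] by blast
      then have "m B \<zero>\<^bsub>HomMod a B A\<^esub> = u B \<zero>\<^bsub>map_obj F B\<^esub>" using PSh_Hom_zero[OF F Z uH B] by simp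
      then show "\<zero>\<^bsub>HomMod a B A\<^esub> \<in> R2 B" using z module_zero_closed[OF md[OF B]] unfolding R2_def by blast
    next
      show "B \<in> Obj a" "f \<in> Hom a B A" if "f \<in> R2 B" for B f using o[OF that] RH[OF R2R[OF that]] by auto
      show "f \<oplus>\<^bsub>HomMod a B A\<^esub> g \<in> R2 B" if "f \<in> R2 B" "g \<in> R2 B" for B f g using add[OF that] by blast
      show "c \<odot>\<^bsub>HomMod a B A\<^esub> f \<in> R2 B" if "c \<in> carrier K" "f \<in> R2 B" for B f c using smu[OF that] by blast
      show "Comp a D B A f g \<in> R2 D" if "B \<in> Obj a" "D \<in> Obj a" "f \<in> R2 B" "g \<in> Hom a D B" for B D f g
        using act[OF that(3,2,4)] by blast
    qed
    have R2T: "R2 \<in> T A"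
    proof (rule T3[OF A R2sv R])
      fix B f assume B: "B \<in> Obj a" and f: "f \<in> R B"
      have fH: "f \<in> Hom a B A" using RH f by blast
      obtain S r where q: "(S, r) \<in> ?Q B" "m B f = p B (S, r)"
        by (rule psR[OF B matchingD(1)[OF m B f]])
      show "pullback_sieve a B A f R2 \<in> T B"
      proof (rule T_superset[OF B _ sieve_pullback[OF A B fH R2sv]])
        show "S \<in> T B" using q by simp
        fix D g assume D: "D \<in> Obj a" and g: "g \<in> S D"
        have gH: "g \<in> Hom a D B" using sieve_Hom[OF sv[OF B q(1)] B] g by blast
        have "m D (Comp a D B A f g) = u D (r D g)"
          using matchingD(4)[OF m B f D gH] key[OF B q(1) D g] q(2) by simp
        then have "Comp a D B A f g \<in> R2 D"
          using sieve_Comp[OF svR A D f gH] car[OF B q(1) D g] unfolding R2_def by blast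
        then show "g \<in> pullback_sieve a B A f R2 D" using D gH by (simp add: pullback_iff)
      qed
    qed
    have qs: "(R2, s) \<in> ?Q A" using R2T s(1) add smu act by (auto simp: matching_def)
    define x where "x = p A (R2, s)"
    have xc: "x \<in> el Z A" unfolding x_def using pc[OF A qs] .
    have "map_arr Z A B f x = m B f" if B: "B \<in> Obj a" and f: "f \<in> R B" for B f
    proof -
      have fH: "f \<in> Hom a B A" using RH f by blast
      show ?thesis
      proof (rule separatedD[OF Z Zsep B T2[OF A B R2T fH]])
        show "map_arr Z A B f x \<in> el Z B" using PSh_closed[OF Z A B fH xc] .
        show "m B f \<in> el Z B" using matchingD(1)[OF m B f] .
        fix D g assume D: "D \<in> Obj a" and g: "g \<in> pullback_sieve a B A f R2 D"
        then have g: "g \<in> Hom a D B" "Comp a D B A f g \<in> R2 D" by (auto simp: pullback_iff)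
        show "map_arr Z B D g (map_arr Z A B f x) = map_arr Z B D g (m B f)"
          using key[OF A qs D g(2)] s(2)[OF g(2)] matchingD(4)[OF m B f D g(1)]
            PSh_Comp[OF Z A B D fH g(1) xc] by (simp add: x_def)
      qed
    qed
    then show "\<exists>x\<in>el Z A. \<forall>B\<in>Obj a. \<forall>f\<in>R B. map_arr Z A B f x = m B f" using xc by blast
  qed
  show thesis
  proof (rule that[OF sh uH])
    show "x = \<zero>\<^bsub>map_obj F A\<^esub>" if "A \<in> Obj a" "x \<in> el F A" "u A x = \<zero>\<^bsub>map_obj Z A\<^esub>" for A x
      using uinj[OF that(1,2) module_zero_closed[OF md[OF that(1)]]] PSh_Hom_zero[OF F Z uH that(1)] that(3) by simp
    fix A z assume A: "A \<in> Obj a" and z: "z \<in> el Z A"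
    obtain R s where q: "(R, s) \<in> ?Q A" "z = p A (R, s)" by (rule psR[OF A z])
    show "\<exists>R\<in>T A. \<forall>B\<in>Obj a. \<forall>f\<in>R B. \<exists>x\<in>el F B. map_arr Z A B f z = u B x"
      by (rule bexI[of _ R]) (use q key[OF A q(1)] car[OF A q(1)] in blast)+
  qed
qed

lemma sheafify_quotient:
  assumes M: "M \<in> Obj PS" and N: "subpresheaf M N"
  obtains Z u where "is_sheaf U K a T Z" "u \<in> Hom PS M Z"
    "\<And>A x. A \<in> Obj a \<Longrightarrow> x \<in> el M A \<Longrightarrow>
      u A x = \<zero>\<^bsub>map_obj Z A\<^esub> \<longleftrightarrow> x \<in> lclosure M N A"
    "\<And>G g. \<lbrakk>is_sheaf U K a T G; g \<in> Hom PS M G; (\<And>A x. A \<in> Obj a \<Longrightarrow> x \<in> N A \<Longrightarrow>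
      g A x = \<zero>\<^bsub>map_obj G A\<^esub>)\<rbrakk> \<Longrightarrow>
      \<exists>!h. h \<in> Hom PS Z G \<and> Comp PS M Z G h u = g"
proof -
  let ?L = "lclosure M N"
  have L: "subpresheaf M ?L" by (rule subpresheaf_lclosure[OF M N])
  obtain F q where F: "F \<in> Obj PS" and q: "q \<in> Hom PS M F"
    and qs: "\<And>A z. A \<in> Obj a \<Longrightarrow> z \<in> el F A \<Longrightarrow> \<exists>x\<in>el M A. q A x = z"
    and qz: "\<And>A x. A \<in> Obj a \<Longrightarrow> x \<in> el M A \<Longrightarrow>
        q A x = \<zero>\<^bsub>map_obj F A\<^esub> \<longleftrightarrow> x \<in> ?L A"
    by (rule quotient_by_subpresheaf[OF M L]) blast
  note qD = PSh_HomD[OF q]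
  have sep: "separated F"
    unfolding separated_def
  proof (intro ballI impI)
    fix A R z assume A: "A \<in> Obj a" and R: "R \<in> T A" and z: "z \<in> el F A"
      and e: "\<forall>B\<in>Obj a. \<forall>f\<in>R B. map_arr F A B f z = \<zero>\<^bsub>map_obj F B\<^esub>"
    obtain x where x: "x \<in> el M A" "q A x = z" using qs[OF A z] by blast
    have "x \<in> ?L A"
    proof (rule lclosure_closed[OF M N A R x(1)])
      fix B f assume B: "B \<in> Obj a" and f: "f \<in> R B"
      have fH: "f \<in> Hom a B A" using f sieve_Hom[OF sieves[OF A R] A] by blast
      have "q B (map_arr M A B f x) = \<zero>\<^bsub>map_obj F B\<^esub>" using qD(5)[OF A B fH x(1)] x(2) e B f by simp
      then show "map_arr M A B f x \<in> ?L B" using qz[OF B PSh_closed[OF M A B fH x(1)]] by simp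
    qed
    then show "z = \<zero>\<^bsub>map_obj F A\<^esub>" using qz[OF A x(1)] x(2) by simp
  qed
  obtain Z u where Z: "is_sheaf U K a T Z" and u: "u \<in> Hom PS F Z"
    and ui: "\<And>A x. \<lbrakk>A \<in> Obj a; x \<in> el F A; u A x = \<zero>\<^bsub>map_obj Z A\<^esub>\<rbrakk> \<Longrightarrow>
      x = \<zero>\<^bsub>map_obj F A\<^esub>"
    and ul: "\<And>A z. A \<in> Obj a \<Longrightarrow> z \<in> el Z A \<Longrightarrow>
      \<exists>R\<in>T A. \<forall>B\<in>Obj a. \<forall>f\<in>R B. \<exists>x\<in>el F B. map_arr Z A B f z = u B x"
    by (rule sheafify_separated[OF F sep]) blast
  have ZP: "Z \<in> Obj PS" by (rule sheaf_PSh[OF Z])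
  define v where "v = Comp PS M F Z u q"
  have v: "v \<in> Hom PS M Z" unfolding v_def by (rule PSh_Comp_closed[OF M q u])
  have va: "v A x = u A (q A x)" if "A \<in> Obj a" "x \<in> el M A" for A x
    unfolding v_def by (rule PSh_Comp_apply[OF that])
  show thesis
  proof (rule that[OF Z v])
    show vz: "v A x = \<zero>\<^bsub>map_obj Z A\<^esub> \<longleftrightarrow> x \<in> ?L A" if A: "A \<in> Obj a" and x: "x \<in> el M A" for A x
      using va[OF A x] ui[OF A qD(2)[OF A x]] qz[OF A x] PSh_Hom_zero[OF F ZP u A] by auto
    fix G g assume Gs: "is_sheaf U K a T G" and g: "g \<in> Hom PS M G"
      and gz: "\<And>A x. A \<in> Obj a \<Longrightarrow> x \<in> N A \<Longrightarrow> g A x = \<zero>\<^bsub>map_obj G A\<^esub>"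
    have G: "G \<in> Obj PS" by (rule sheaf_PSh[OF Gs])
    note gD = PSh_HomD[OF g]
    have gL: "g A x = \<zero>\<^bsub>map_obj G A\<^esub>" if A: "A \<in> Obj a" and x: "x \<in> ?L A" for A x
    proof -
      obtain R where R: "R \<in> T A" "\<And>B f. B \<in> Obj a \<Longrightarrow> f \<in> R B \<Longrightarrow> map_arr M A B f x \<in> N B"
        and xc: "x \<in> el M A"
        using x unfolding lclosure_def by blast
      have "map_arr G A B f (g A x) = \<zero>\<^bsub>map_obj G B\<^esub>" if B: "B \<in> Obj a" and f: "f \<in> R B" for B f
        using gD(5)[OF A B sieve_Hom[OF sieves[OF A R(1)] A f] xc] gz[OF B R(2)[OF B f]] by simp
      then show ?thesis using sheaf_separated[OF Gs] A R(1) gD(2)[OF A xc] unfolding separated_def by blast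
    qed
    show "\<exists>!h. h \<in> Hom PS Z G \<and> Comp PS M Z G h v = g"
    proof (rule extend_along_local_iso[OF M ZP v _ Gs g])
      show "g A x = \<zero>\<^bsub>map_obj G A\<^esub>" if "A \<in> Obj a" "x \<in> el M A" "v A x = \<zero>\<^bsub>map_obj Z A\<^esub>" for A x
        using gL[OF that(1)] vz[OF that(1,2)] that(3) by blast
      fix A z assume A: "A \<in> Obj a" and z: "z \<in> el Z A"
      have "\<exists>x\<in>el M B. y = v B x" if B: "B \<in> Obj a" and y: "\<exists>x\<in>el F B. y = u B x" for B y
        using qs[OF B] va[OF B] y by metis
      then show "\<exists>R\<in>T A. \<forall>B\<in>Obj a. \<forall>f\<in>R B. \<exists>x\<in>el M B. map_arr Z A B f z = v B x"
        using ul[OF A z] by meson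
    qed
  qed
qed

end

section \<open>Filtered colimits\<close>

context site
begin

lemmas base_Ident_closed = Ident_closed
lemmas base_Comp_closed = Comp_closed
lemmas base_Comp_assoc = Comp_assoc
lemmas base_Comp_Ident_left = Comp_Ident_left

end

lemma finite_ordLess_card:
  assumes "Card_order \<kappa>" "cinfinite \<kappa>" "finite X"
  shows "|X| <o \<kappa>"
  using assms finite_ordLess_infinite[OF card_of_Well_order card_order_on_well_order_on]
  by (metis Field_card_of cinfinite_def)

lemma colimit_iso:
  assumes "category C" and L: "is_colimit j C J L l" and M: "is_colimit j C J M m"
    and J: "\<And>x. x \<in> Obj j \<Longrightarrow> map_obj J x \<in> Obj C"
  obtains h where "is_iso C L M h" "\<And>x. x \<in> Obj j \<Longrightarrow> Comp C (map_obj J x) L M h (l x) = m x"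
proof -
  interpret category C by fact
  have Lc: "is_cocone j C J L l" and Mc: "is_cocone j C J M m" using L M by (auto simp: is_colimit_def)
  then have LO: "L \<in> Obj C" and MO: "M \<in> Obj C" and lH: "\<And>x. x \<in> Obj j \<Longrightarrow> l x \<in> Hom C (map_obj J x) L"
    and mH: "\<And>x. x \<in> Obj j \<Longrightarrow> m x \<in> Hom C (map_obj J x) M" by (auto simp: is_cocone_def)
  obtain h where h: "h \<in> Hom C L M" "\<And>x. x \<in> Obj j \<Longrightarrow> Comp C (map_obj J x) L M h (l x) = m x"
    using L Mc unfolding is_colimit_def by blast
  obtain g where g: "g \<in> Hom C M L" "\<And>x. x \<in> Obj j \<Longrightarrow> Comp C (map_obj J x) M L g (m x) = l x"
    using M Lc unfolding is_colimit_def by blast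
  have u: "k = Ident C N" if "is_colimit j C J N n" "k \<in> Hom C N N"
    "\<And>x. x \<in> Obj j \<Longrightarrow> Comp C (map_obj J x) N N k (n x) = n x" for N n k
  proof -
    have c: "is_cocone j C J N n" using that(1) by (simp add: is_colimit_def)
    then have "N \<in> Obj C" "\<And>x. x \<in> Obj j \<Longrightarrow> n x \<in> Hom C (map_obj J x) N" by (auto simp: is_cocone_def)
    then have "Ident C N \<in> Hom C N N" "\<And>x. x \<in> Obj j \<Longrightarrow> Comp C (map_obj J x) N N (Ident C N) (n x) = n x"
      using J by (auto simp: Ident_closed Comp_Ident_left)
    then show ?thesis using that c unfolding is_colimit_def by blast
  qed
  have "Comp C L M L g h = Ident C L"
    by (rule u[OF L]) (use LO MO h g lH J in \<open>auto simp: Comp_closed Comp_assoc[symmetric]\<close>)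
  moreover have "Comp C M L M h g = Ident C M"
    by (rule u[OF M]) (use LO MO h g mH J in \<open>auto simp: Comp_closed Comp_assoc[symmetric]\<close>)
  ultimately have "is_iso C L M h" using h g by (auto simp: is_iso_def)
  then show thesis using that h(2) by blast
qed

locale filtered_category = category j
  for \<kappa> :: "'c rel" and j :: "('i, 'm, 'z) category_scheme" +
  assumes kappa: "Card_order \<kappa>" "cinfinite \<kappa>" and filt: "filtered \<kappa> j"
begin

lemmas index_Comp_closed = Comp_closed
lemmas index_Comp_assoc = Comp_assoc

lemma bound:
  assumes "X \<subseteq> Obj j" "|X| <o \<kappa>"
  obtains z where "z \<in> Obj j" "\<And>x. x \<in> X \<Longrightarrow> Hom j x z \<noteq> {}"
proof -
  have "\<exists>z\<in>Obj j. \<forall>x\<in>X. Hom j x z \<noteq> {}"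
    using conjunct1[OF filt[unfolded filtered_def], rule_format, OF conjI[OF assms]] .
  then show thesis using that by blast
qed

lemma nonempty: obtains x where "x \<in> Obj j"
  by (rule bound[of "{}"]) (auto intro: finite_ordLess_card[OF kappa])

lemma span:
  assumes "x \<in> Obj j" "y \<in> Obj j"
  obtains z u v where "z \<in> Obj j" "u \<in> Hom j x z" "v \<in> Hom j y z"
proof -
  obtain z where z: "z \<in> Obj j" "\<And>w. w \<in> {x, y} \<Longrightarrow> Hom j w z \<noteq> {}"
    by (rule bound[of "{x, y}"]) (use assms in \<open>auto intro: finite_ordLess_card[OF kappa]\<close>)
  have "Hom j x z \<noteq> {}" "Hom j y z \<noteq> {}" using z(2) by auto
  then obtain u v where "u \<in> Hom j x z" "v \<in> Hom j y z" by auto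
  then show thesis by (rule that[OF z(1)])
qed

lemma coequalize:
  assumes "x \<in> Obj j" "y \<in> Obj j" "M \<subseteq> Hom j x y" "|M| <o \<kappa>"
  obtains z h where "z \<in> Obj j" "h \<in> Hom j y z"
    "\<And>f g. f \<in> M \<Longrightarrow> g \<in> M \<Longrightarrow> Comp j x y z h f = Comp j x y z h g"
proof -
  have "\<exists>z\<in>Obj j. \<exists>h\<in>Hom j y z. \<forall>f\<in>M. \<forall>g\<in>M. Comp j x y z h f = Comp j x y z h g"
    using conjunct2[OF filt[unfolded filtered_def], rule_format, OF assms(1,2) conjI[OF assms(3,4)]] .
  then show thesis using that by blast
qed

lemma coequalize2:
  assumes "x \<in> Obj j" "y \<in> Obj j" "u \<in> Hom j x y" "v \<in> Hom j x y"
  obtains z h where "z \<in> Obj j" "h \<in> Hom j y z" "Comp j x y z h u = Comp j x y z h v"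
  by (rule coequalize[OF assms(1,2), of "{u, v}"])
    (use assms in \<open>auto intro: finite_ordLess_card[OF kappa]\<close>)

lemma square:
  assumes "x \<in> Obj j" "z \<in> Obj j" "z' \<in> Obj j" "u \<in> Hom j x z" "u' \<in> Hom j x z'"
  obtains w p p' where "w \<in> Obj j" "p \<in> Hom j z w" "p' \<in> Hom j z' w" "Comp j x z w p u = Comp j x z' w p' u'"
proof -
  obtain w p p' where 1: "w \<in> Obj j" "p \<in> Hom j z w" "p' \<in> Hom j z' w" using span assms by metis
  obtain w' h where "w' \<in> Obj j" "h \<in> Hom j w w'"
    "Comp j x w w' h (Comp j x z w p u) = Comp j x w w' h (Comp j x z' w p' u')"
    by (rule coequalize2[of x w "Comp j x z w p u" "Comp j x z' w p' u'"]) (use 1 assms Comp_closed in auto)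
  then show thesis using that[of w' "Comp j z w w' h p" "Comp j z' w w' h p'"] 1 assms
    by (simp add: Comp_closed Comp_assoc)
qed

lemma square2:
  assumes "x \<in> Obj j" "y \<in> Obj j" "z \<in> Obj j" "z' \<in> Obj j" "u \<in> Hom j x z" "u' \<in> Hom j x z'"
    "v \<in> Hom j y z" "v' \<in> Hom j y z'"
  obtains w p p' where "w \<in> Obj j" "p \<in> Hom j z w" "p' \<in> Hom j z' w"
    "Comp j x z w p u = Comp j x z' w p' u'" "Comp j y z w p v = Comp j y z' w p' v'"
proof -
  obtain w p p' where 1: "w \<in> Obj j" "p \<in> Hom j z w" "p' \<in> Hom j z' w" "Comp j x z w p u = Comp j x z' w p' u'"
    by (rule square[OF assms(1,3,4,5,6)])
  obtain w' h where 2: "w' \<in> Obj j" "h \<in> Hom j w w'"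
    "Comp j y w w' h (Comp j y z w p v) = Comp j y w w' h (Comp j y z' w p' v')"
    by (rule coequalize2[of y w "Comp j y z w p v" "Comp j y z' w p' v'"]) (use 1 assms Comp_closed in auto)
  show thesis
  proof (rule that[OF 2(1), of "Comp j z w w' h p" "Comp j z' w w' h p'"])
    show "Comp j x z w' (Comp j z w w' h p) u = Comp j x z' w' (Comp j z' w w' h p') u'"
      using 1 2(1,2) assms by (simp add: Comp_assoc[symmetric])
    show "Comp j y z w' (Comp j z w w' h p) v = Comp j y z' w' (Comp j z' w w' h p') v'"
      using 1 2 assms by (simp add: Comp_assoc[symmetric])
  qed (use 1 2(1,2) assms Comp_closed in blast)+
qed

lemma descend:
  assumes D: "\<And>x y u e. \<lbrakk>x \<in> Obj j; y \<in> Obj j; u \<in> Hom j x y; e \<in> S x\<rbrakk> \<Longrightarrow> D x y u e \<in> S y"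
    and l: "\<And>x y u e. \<lbrakk>x \<in> Obj j; y \<in> Obj j; u \<in> Hom j x y; e \<in> S x\<rbrakk> \<Longrightarrow>
      l y (D x y u e) = l x e"
    and m: "\<And>x y u e. \<lbrakk>x \<in> Obj j; y \<in> Obj j; u \<in> Hom j x y; e \<in> S x\<rbrakk> \<Longrightarrow>
      m y (D x y u e) = m x e"
    and inj: "\<And>x e d. \<lbrakk>x \<in> Obj j; e \<in> S x; d \<in> S x; l x e = l x d\<rbrakk> \<Longrightarrow>
      \<exists>y\<in>Obj j. \<exists>u\<in>Hom j x y. D x y u e = D x y u d"
  obtains h where "\<And>x e. x \<in> Obj j \<Longrightarrow> e \<in> S x \<Longrightarrow> h (l x e) = m x e"
proof -
  have wd: "m x e = m y d" if xy: "x \<in> Obj j" "y \<in> Obj j" "e \<in> S x" "d \<in> S y" "l x e = l y d" for x y e d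
  proof -
    obtain z u v where z: "z \<in> Obj j" "u \<in> Hom j x z" "v \<in> Hom j y z" by (rule span[OF xy(1,2)])
    have c: "D x z u e \<in> S z" "D y z v d \<in> S z" using D z xy by blast+
    have "l z (D x z u e) = l z (D y z v d)" using l z xy by simp
    then obtain w k where w: "w \<in> Obj j" "k \<in> Hom j z w" "D z w k (D x z u e) = D z w k (D y z v d)"
      using inj[OF z(1) c] by blast
    have "m x e = m w (D z w k (D x z u e))"
      using m[OF xy(1) z(1,2) xy(3)] m[OF z(1) w(1,2) c(1)] by simp
    moreover have "m y d = m w (D z w k (D y z v d))"
      using m[OF xy(2) z(1,3) xy(4)] m[OF z(1) w(1,2) c(2)] by simp
    ultimately show ?thesis using w(3) by simp
  qed
  define h where "h z = (THE w. \<exists>x e. x \<in> Obj j \<and> e \<in> S x \<and> z = l x e \<and> w = m x e)" for z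
  have "h (l x e) = m x e" if "x \<in> Obj j" "e \<in> S x" for x e
    unfolding h_def
  proof (rule the_equality)
    fix w assume "\<exists>y d. y \<in> Obj j \<and> d \<in> S y \<and> l x e = l y d \<and> w = m y d"
    then obtain y d where "y \<in> Obj j" "d \<in> S y" "l x e = l y d" "w = m y d" by auto
    then show "w = m x e" using wd[OF that(1) _ that(2)] by simp
  qed (use that in auto)
  then show thesis using that by blast
qed

end

lemma is_functor_Sh_PSh:
  assumes "is_functor j (Sh U K a T) J"
  shows "is_functor j (PSh U K a) J"
proof -
  interpret is_functor j "Sh U K a T" J by fact
  interpret P: category "PSh U K a" by (rule category_PSh)
  show ?thesis
    by unfold_locales (use Sh_Obj_PSh[OF map_obj_closed] map_arr_closed map_Ident map_Comp in auto)
qed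

locale presheaf_diagram = site U K a T + filtered_category \<kappa> j + is_functor j "PSh U K a" J
  for U :: "'u set set" and K :: "'k ring" and a :: "('o, 'u, 'k) linear_category"
    and T :: "'o \<Rightarrow> ('o \<Rightarrow> 'u set) set" and \<kappa> :: "'c rel" and j :: "('u, 'u) category"
    and J :: "('u, 'u, ('o, 'k, 'u) presheaf, 'o \<Rightarrow> 'u \<Rightarrow> 'u) functor_data" +
  assumes small_j: "small_category U j"
begin

lemmas J_PSh = map_obj_closed
lemmas J_Hom = map_arr_closed

abbreviation Jm :: "'u \<Rightarrow> 'o \<Rightarrow> ('k, 'u) module" where
  "Jm x A \<equiv> map_obj (map_obj J x) A"

abbreviation Jel :: "'u \<Rightarrow> 'o \<Rightarrow> 'u set" where
  "Jel x A \<equiv> el (map_obj J x) A"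

lemmas JD = PSh_HomD[OF J_Hom]

lemma J_Ident: "\<lbrakk>x \<in> Obj j; A \<in> Obj a; e \<in> Jel x A\<rbrakk> \<Longrightarrow> map_arr J x x (Ident j x) A e = e"
  by (simp add: map_Ident PSh_Ident_apply)

lemma J_Comp: "\<lbrakk>x \<in> Obj j; y \<in> Obj j; z \<in> Obj j; u \<in> Hom j x y; v \<in> Hom j y z; A \<in> Obj a;
    e \<in> Jel x A\<rbrakk> \<Longrightarrow>
    map_arr J x z (Comp j x y z v u) A e = map_arr J y z v A (map_arr J x y u A e)"
  by (simp add: map_Comp PSh_Comp_apply)

lemma J_zero: "\<lbrakk>x \<in> Obj j; y \<in> Obj j; u \<in> Hom j x y; A \<in> Obj a\<rbrakk> \<Longrightarrow>
    map_arr J x y u A \<zero>\<^bsub>Jm x A\<^esub> = \<zero>\<^bsub>Jm y A\<^esub>"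
  by (rule PSh_Hom_zero[OF J_PSh J_PSh J_Hom])

text \<open>
  For filtered index categories this elementwise condition characterizes colimits of presheaves.
\<close>

definition fcolim :: "('o, 'k, 'u) presheaf \<Rightarrow> ('u \<Rightarrow> 'o \<Rightarrow> 'u \<Rightarrow> 'u) \<Rightarrow> bool" where
  "fcolim L l \<longleftrightarrow> is_cocone j PS J L l \<and>
     (\<forall>A\<in>Obj a. \<forall>z\<in>el L A. \<exists>x\<in>Obj j. \<exists>e\<in>Jel x A. l x A e = z) \<and>
     (\<forall>A\<in>Obj a. \<forall>x\<in>Obj j. \<forall>e\<in>Jel x A. l x A e = \<zero>\<^bsub>map_obj L A\<^esub> \<longrightarrow>
       (\<exists>y\<in>Obj j. \<exists>u\<in>Hom j x y. map_arr J x y u A e = \<zero>\<^bsub>Jm y A\<^esub>))"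

lemma cocone_iff: "is_cocone j PS J L l \<longleftrightarrow> L \<in> Obj PS \<and>
   (\<forall>x\<in>Obj j. l x \<in> Hom PS (map_obj J x) L) \<and>
   (\<forall>x\<in>Obj j. \<forall>y\<in>Obj j. \<forall>u\<in>Hom j x y. \<forall>A\<in>Obj a. \<forall>e\<in>Jel x A. l y A (map_arr J x y u A e) = l x A e)"
  (is "?L \<longleftrightarrow> ?R")
proof
  assume L: ?L
  then show ?R unfolding is_cocone_def
    using PSh_Comp_apply by (metis (no_types, lifting))
next
  assume R: ?R
  then have lH: "\<And>x. x \<in> Obj j \<Longrightarrow> l x \<in> Hom PS (map_obj J x) L" by blast
  show ?L unfolding is_cocone_def
  proof (intro conjI ballI)
    fix x y u assume x: "x \<in> Obj j" and y: "y \<in> Obj j" and u: "u \<in> Hom j x y"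
    show "Comp PS (map_obj J x) (map_obj J y) L (l y) (map_arr J x y u) = l x"
      by (rule PSh_Hom_eqI[OF PSh_Comp_closed[OF J_PSh[OF x] J_Hom[OF x y u] lH[OF y]] lH[OF x]])
        (use R x y u in \<open>simp add: PSh_Comp_apply\<close>)
  qed (use R in blast)+
qed

lemma fcolimD:
  assumes "fcolim L l"
  shows fc_PSh: "L \<in> Obj PS" and fc_Hom: "x \<in> Obj j \<Longrightarrow> l x \<in> Hom PS (map_obj J x) L"
    and fc_cocone: "\<lbrakk>x \<in> Obj j; y \<in> Obj j; u \<in> Hom j x y; A \<in> Obj a; e \<in> Jel x A\<rbrakk> \<Longrightarrow>
        l y A (map_arr J x y u A e) = l x A e"
    and fc_surj: "\<lbrakk>A \<in> Obj a; z \<in> el L A\<rbrakk> \<Longrightarrow> \<exists>x\<in>Obj j. \<exists>e\<in>Jel x A. l x A e = z"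
    and fc_zero: "\<lbrakk>A \<in> Obj a; x \<in> Obj j; e \<in> Jel x A; l x A e = \<zero>\<^bsub>map_obj L A\<^esub>\<rbrakk> \<Longrightarrow>
      \<exists>y\<in>Obj j. \<exists>u\<in>Hom j x y. map_arr J x y u A e = \<zero>\<^bsub>Jm y A\<^esub>"
  using assms unfolding fcolim_def cocone_iff by blast+

lemma fc_inj:
  assumes L: "fcolim L l" and A: "A \<in> Obj a" and x: "x \<in> Obj j" and e: "e \<in> Jel x A" and d: "d \<in> Jel x A"
    and eq: "l x A e = l x A d"
  shows "\<exists>y\<in>Obj j. \<exists>u\<in>Hom j x y. map_arr J x y u A e = map_arr J x y u A d"
proof -
  note lx = PSh_Hom_diff[OF J_PSh[OF x] fc_PSh[OF L] fc_Hom[OF L x] A e d]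
  obtain y u where y: "y \<in> Obj j" and u: "u \<in> Hom j x y"
    and z: "map_arr J x y u A (e \<ominus>\<^bsub>Jm x A\<^esub> d) = \<zero>\<^bsub>Jm y A\<^esub>"
    using fc_zero[OF L A x lx(1)] lx(3) eq by blast
  then show ?thesis using PSh_Hom_diff(3)[OF J_PSh[OF x] J_PSh[OF y] J_Hom[OF x y u] A e d] by blast
qed

lemma fc_surj2:
  assumes L: "fcolim L l" and A: "A \<in> Obj a" and z: "z \<in> el L A" and w: "w \<in> el L A"
  obtains x e d where "x \<in> Obj j" "e \<in> Jel x A" "d \<in> Jel x A" "l x A e = z" "l x A d = w"
proof -
  obtain x e where x: "x \<in> Obj j" "e \<in> Jel x A" "l x A e = z" using fc_surj[OF L A z] by blast
  obtain y d where y: "y \<in> Obj j" "d \<in> Jel y A" "l y A d = w" using fc_surj[OF L A w] by blast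
  obtain t u v where t: "t \<in> Obj j" "u \<in> Hom j x t" "v \<in> Hom j y t" by (rule span[OF x(1) y(1)])
  show thesis
    by (rule that[OF t(1) JD(2)[OF x(1) t(1,2) A x(2)] JD(2)[OF y(1) t(1,3) A y(2)]])
      (use fc_cocone[OF L] x y t A in auto)
qed

lemma fcolim_is_colimit:
  assumes L: "fcolim L l"
  shows "is_colimit j PS J L l"
  unfolding is_colimit_def
proof (intro conjI allI impI)
  show "is_cocone j PS J L l" using L by (simp add: fcolim_def)
  fix M m assume "is_cocone j PS J M m"
  then have M: "M \<in> Obj PS" and mH: "\<And>x. x \<in> Obj j \<Longrightarrow> m x \<in> Hom PS (map_obj J x) M"
    and mc: "\<And>x y u A e. \<lbrakk>x \<in> Obj j; y \<in> Obj j; u \<in> Hom j x y; A \<in> Obj a; e \<in> Jel x A\<rbrakk> \<Longrightarrow>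
      m y A (map_arr J x y u A e) = m x A e"
    unfolding cocone_iff by blast+
  have "\<exists>h. \<forall>x\<in>Obj j. \<forall>e\<in>Jel x A. h (l x A e) = m x A e" if A: "A \<in> Obj a" for A
  proof -
    obtain h where "\<And>x e. x \<in> Obj j \<Longrightarrow> e \<in> Jel x A \<Longrightarrow> h (l x A e) = m x A e"
    proof (rule descend[of "\<lambda>x. Jel x A" "\<lambda>x y u. map_arr J x y u A" "\<lambda>x. l x A" "\<lambda>x. m x A"])
      show "map_arr J x y u A e \<in> Jel y A" if "x \<in> Obj j" "y \<in> Obj j" "u \<in> Hom j x y" "e \<in> Jel x A" for x y u e
        using JD(2)[OF that(1-3) A that(4)] .
      show "l y A (map_arr J x y u A e) = l x A e" if "x \<in> Obj j" "y \<in> Obj j" "u \<in> Hom j x y" "e \<in> Jel x A" for x y u e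
        using fc_cocone[OF L that(1-3) A that(4)] .
      show "m y A (map_arr J x y u A e) = m x A e" if "x \<in> Obj j" "y \<in> Obj j" "u \<in> Hom j x y" "e \<in> Jel x A" for x y u e
        using mc[OF that(1-3) A that(4)] .
      show "\<exists>y\<in>Obj j. \<exists>u\<in>Hom j x y. map_arr J x y u A e = map_arr J x y u A d"
        if "x \<in> Obj j" "e \<in> Jel x A" "d \<in> Jel x A" "l x A e = l x A d" for x e d
        using fc_inj[OF L A that] .
    qed (rule that)
    then show ?thesis by blast
  qed
  then obtain h where h: "\<And>A x e. \<lbrakk>A \<in> Obj a; x \<in> Obj j; e \<in> Jel x A\<rbrakk> \<Longrightarrow> h A (l x A e) = m x A e"
    by metis
  note LP = fc_PSh[OF L]
  note lD = PSh_HomD[OF fc_Hom[OF L]] and mD = PSh_HomD[OF mH]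
  have hH: "mk_nat a L h \<in> Hom PS L M"
  proof (rule mk_nat_Hom[OF LP])
    fix A z assume A: "A \<in> Obj a" and z: "z \<in> el L A"
    obtain x e where x: "x \<in> Obj j" and e: "e \<in> Jel x A" and ze: "l x A e = z" using fc_surj[OF L A z] by blast
    show "h A z \<in> el M A" using h[OF A x e] mD(2)[OF x A e] ze by simp
    show "h A (c \<odot>\<^bsub>map_obj L A\<^esub> z) = c \<odot>\<^bsub>map_obj M A\<^esub> h A z" if c: "c \<in> carrier K" for c
      using h[OF A x e] h[OF A x module_smult_closed[OF PSh_module[OF J_PSh[OF x] A] c e]]
        lD(4)[OF x A c e] mD(4)[OF x A c e] ze by simp
    show "h B (map_arr L A B f z) = map_arr M A B f (h A z)" if B: "B \<in> Obj a" and f: "f \<in> Hom a B A" for B f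
      using h[OF A x e] h[OF B x PSh_closed[OF J_PSh[OF x] A B f e]]
        lD(5)[OF x A B f e] mD(5)[OF x A B f e] ze by simp
    show "h A (z \<oplus>\<^bsub>map_obj L A\<^esub> w) = h A z \<oplus>\<^bsub>map_obj M A\<^esub> h A w" if w: "w \<in> el L A" for w
    proof -
      obtain x e d where x: "x \<in> Obj j" and e: "e \<in> Jel x A" and d: "d \<in> Jel x A" and zw: "l x A e = z" "l x A d = w"
        by (rule fc_surj2[OF L A z w])
      show ?thesis
        using h[OF A x e] h[OF A x d] h[OF A x module_add_closed[OF PSh_module[OF J_PSh[OF x] A] e d]]
          lD(3)[OF x A e d] mD(3)[OF x A e d] zw by simp
    qed
  qed
  have ha: "mk_nat a L h A (l x A e) = m x A e" if "A \<in> Obj a" "x \<in> Obj j" "e \<in> Jel x A" for A x e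
    using mk_nat_apply[OF that(1) lD(2)[OF that(2,1,3)], of h] h[OF that] by simp
  show "\<exists>!h. h \<in> Hom PS L M \<and> (\<forall>x\<in>Obj j. Comp PS (map_obj J x) L M h (l x) = m x)"
  proof (rule ex1I[of _ "mk_nat a L h"], intro conjI ballI hH)
    fix x assume x: "x \<in> Obj j"
    show "Comp PS (map_obj J x) L M (mk_nat a L h) (l x) = m x"
      by (rule PSh_Hom_eqI[OF PSh_Comp_closed[OF J_PSh[OF x] fc_Hom[OF L x] hH] mH[OF x]])
        (use ha x in \<open>simp add: PSh_Comp_apply\<close>)
  next
    fix g assume g: "g \<in> Hom PS L M \<and> (\<forall>x\<in>Obj j. Comp PS (map_obj J x) L M g (l x) = m x)"
    show "g = mk_nat a L h"
    proof (rule PSh_Hom_eqI[OF conjunct1[OF g] hH])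
      fix A z assume A: "A \<in> Obj a" and z: "z \<in> el L A"
      obtain x e where x: "x \<in> Obj j" and e: "e \<in> Jel x A" and ze: "l x A e = z" using fc_surj[OF L A z] by blast
      have "Comp PS (map_obj J x) L M g (l x) A e = m x A e" using g x by simp
      then show "g A z = mk_nat a L h A z" using ha[OF A x e] ze PSh_Comp_apply[OF A e] by metis
    qed
  qed
qed

lemma fcolim_exists: obtains P p where "fcolim P p"
proof -
  let ?Q = "\<lambda>A. {(x, e). x \<in> Obj j \<and> e \<in> Jel x A}"
  define at where "at A q t e \<longleftrightarrow> t \<in> Obj j \<and> (\<exists>u\<in>Hom j (fst q) t. e = map_arr J (fst q) t u A (snd q))"
    for A :: 'o and q :: "'u \<times> 'u" and t e
  define eqv where "eqv A p q \<longleftrightarrow> (\<exists>t e. at A p t e \<and> at A q t e)" for A p q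
  have "\<exists>t u v. t \<in> Obj j \<and> u \<in> Hom j x t \<and> v \<in> Hom j y t" if "x \<in> Obj j" "y \<in> Obj j" for x y
    by (rule span[OF that]) blast
  then obtain bt bu bv where b: "\<And>x y. x \<in> Obj j \<Longrightarrow> y \<in> Obj j \<Longrightarrow> bt x y \<in> Obj j"
    "\<And>x y. x \<in> Obj j \<Longrightarrow> y \<in> Obj j \<Longrightarrow> bu x y \<in> Hom j x (bt x y)"
    "\<And>x y. x \<in> Obj j \<Longrightarrow> y \<in> Obj j \<Longrightarrow> bv x y \<in> Hom j y (bt x y)" by metis
  obtain x0 where x0: "x0 \<in> Obj j" by (rule nonempty)
  define ad where "ad A p q = (bt (fst p) (fst q), map_arr J (fst p) (bt (fst p) (fst q)) (bu (fst p) (fst q)) A (snd p)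
    \<oplus>\<^bsub>map_obj (map_obj J (bt (fst p) (fst q))) A\<^esub> map_arr J (fst q) (bt (fst p) (fst q)) (bv (fst p) (fst q)) A (snd q))"
    for A p q
  define ze where "ze A = (x0, \<zero>\<^bsub>map_obj (map_obj J x0) A\<^esub>)" for A
  define sm where "sm A c p = (fst p, c \<odot>\<^bsub>map_obj (map_obj J (fst p)) A\<^esub> snd p)" for A c p
  define ac where "ac A B f p = (fst p, map_arr (map_obj J (fst p)) A B f (snd p))" for A B f p
  note md = PSh_module[OF J_PSh]
  note mac = module_add_closed[OF md] and msc = module_smult_closed[OF md] and mzc = module_zero_closed[OF md]
  have at_closed: "e \<in> Jel t A" if "A \<in> Obj a" "q \<in> ?Q A" "at A q t e" for A q t e
    using that JD(2) unfolding at_def by auto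
  have at_Obj: "t \<in> Obj j" if "at A q t e" for A q t e using that unfolding at_def by blast
  have at_up: "at A q t' (map_arr J t t' w A e)"
    if "A \<in> Obj a" "q \<in> ?Q A" and e: "at A q t e" and "t' \<in> Obj j" "w \<in> Hom j t t'" for A q t e t' w
  proof -
    obtain u where u: "t \<in> Obj j" "u \<in> Hom j (fst q) t" "e = map_arr J (fst q) t u A (snd q)"
      using e unfolding at_def by blast
    show ?thesis unfolding at_def
      using that u J_Comp[of "fst q" t t' u w A "snd q"] Comp_closed[of "fst q" t t' u w]
      by (intro conjI bexI[of _ "Comp j (fst q) t t' w u"]) auto
  qed
  have at_self: "at A (t, e) t e" if "A \<in> Obj a" "(t, e) \<in> ?Q A" for A t e
    unfolding at_def using that J_Ident Ident_closed by (auto intro!: bexI[of _ "Ident j t"])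
  have at2: thesis if A: "A \<in> Obj a" and p: "p \<in> ?Q A" and q: "q \<in> ?Q A"
    and r: "\<And>t e d. at A p t e \<Longrightarrow> at A q t d \<Longrightarrow> thesis" for A p q thesis
  proof -
    obtain t u v where t: "t \<in> Obj j" "u \<in> Hom j (fst p) t" "v \<in> Hom j (fst q) t"
      by (rule span[of "fst p" "fst q"]) (use p q in auto)
    show thesis by (rule r[of t "map_arr J (fst p) t u A (snd p)" "map_arr J (fst q) t v A (snd q)"])
        (use t in \<open>auto simp: at_def\<close>)
  qed
  have at_at: thesis if A: "A \<in> Obj a" and p: "p \<in> ?Q A" and e: "at A p t e" and d: "at A p t' d"
    and r: "\<And>s w w'. \<lbrakk>s \<in> Obj j; w \<in> Hom j t s; w' \<in> Hom j t' s;
        map_arr J t s w A e = map_arr J t' s w' A d\<rbrakk> \<Longrightarrow>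
      thesis" for A p t e t' d thesis
  proof -
    obtain u where u: "t \<in> Obj j" "u \<in> Hom j (fst p) t" "e = map_arr J (fst p) t u A (snd p)"
      using e unfolding at_def by blast
    obtain v where v: "t' \<in> Obj j" "v \<in> Hom j (fst p) t'" "d = map_arr J (fst p) t' v A (snd p)"
      using d unfolding at_def by blast
    have p': "fst p \<in> Obj j" "snd p \<in> Jel (fst p) A" using p by auto
    obtain s w w' where s: "s \<in> Obj j" "w \<in> Hom j t s" "w' \<in> Hom j t' s"
      "Comp j (fst p) t s w u = Comp j (fst p) t' s w' v"
      by (rule square[OF p'(1) u(1) v(1) u(2) v(2)])
    show thesis
      by (rule r[OF s(1-3)])
        (use J_Comp[OF p'(1) u(1) s(1) u(2) s(2) A p'(2)] J_Comp[OF p'(1) v(1) s(1) v(2) s(3) A p'(2)] s u v in simp)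
  qed
  have eqv_at: "eqv A p (t, e)" if A: "A \<in> Obj a" and p: "p \<in> ?Q A" and e: "at A p t e" for A p t e
    unfolding eqv_def using e at_self[OF A, of t e] at_closed[OF that] at_Obj[OF e] by auto
  have eqv_trans: "eqv A p r" if A: "A \<in> Obj a" and p: "p \<in> ?Q A" and q: "q \<in> ?Q A" and r: "r \<in> ?Q A"
    and pq: "eqv A p q" and qr: "eqv A q r" for A p q r
  proof -
    obtain t e where t: "at A p t e" "at A q t e" using pq unfolding eqv_def by blast
    obtain t' e' where t': "at A q t' e'" "at A r t' e'" using qr unfolding eqv_def by blast
    obtain s w w' where s: "s \<in> Obj j" "w \<in> Hom j t s" "w' \<in> Hom j t' s" "map_arr J t s w A e = map_arr J t' s w' A e'"
      by (rule at_at[OF A q t(2) t'(1)])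
    show ?thesis unfolding eqv_def using at_up[OF A p t(1) s(1,2)] at_up[OF A r t'(2) s(1,3)] s(4) by auto
  qed
  have eqv_sym: "eqv A q p" if "eqv A p q" for A p q using that unfolding eqv_def by blast
  have ad_closed: "ad A p q \<in> ?Q A" if "A \<in> Obj a" "p \<in> ?Q A" "q \<in> ?Q A" for A p q
    using that b JD(2) mac unfolding ad_def by auto
  have ad_at: "eqv A (ad A p q) (t, e \<oplus>\<^bsub>Jm t A\<^esub> d)"
    if A: "A \<in> Obj a" and p: "p \<in> ?Q A" and q: "q \<in> ?Q A" and e: "at A p t e" and d: "at A q t d" for A p q t e d
  proof -
    obtain u where u: "t \<in> Obj j" "u \<in> Hom j (fst p) t" "e = map_arr J (fst p) t u A (snd p)"
      using e unfolding at_def by blast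
    obtain v where v: "v \<in> Hom j (fst q) t" "d = map_arr J (fst q) t v A (snd q)"
      using d unfolding at_def by blast
    have p': "fst p \<in> Obj j" "snd p \<in> Jel (fst p) A" and q': "fst q \<in> Obj j" "snd q \<in> Jel (fst q) A" using p q by auto
    let ?t = "bt (fst p) (fst q)" and ?u = "bu (fst p) (fst q)" and ?v = "bv (fst p) (fst q)"
    note b' = b[OF p'(1) q'(1)]
    obtain s w w' where s: "s \<in> Obj j" "w \<in> Hom j ?t s" "w' \<in> Hom j t s"
      "Comp j (fst p) ?t s w ?u = Comp j (fst p) t s w' u" "Comp j (fst q) ?t s w ?v = Comp j (fst q) t s w' v"
      by (rule square2[OF p'(1) q'(1) b'(1) u(1) b'(2) u(2) b'(3) v(1)])
    let ?e = "map_arr J (fst p) ?t ?u A (snd p)" and ?d = "map_arr J (fst q) ?t ?v A (snd q)"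
    have c: "?e \<in> Jel ?t A" "?d \<in> Jel ?t A" "e \<in> Jel t A" "d \<in> Jel t A"
      using JD(2)[OF p'(1) b'(1,2) A p'(2)] JD(2)[OF q'(1) b'(1,3) A q'(2)] at_closed[OF A p e] at_closed[OF A q d]
      by auto
    have 1: "map_arr J ?t s w A ?e = map_arr J t s w' A e"
      using J_Comp[OF p'(1) b'(1) s(1) b'(2) s(2) A p'(2)] J_Comp[OF p'(1) u(1) s(1) u(2) s(3) A p'(2)] s u by simp
    have 2: "map_arr J ?t s w A ?d = map_arr J t s w' A d"
      using J_Comp[OF q'(1) b'(1) s(1) b'(3) s(2) A q'(2)] J_Comp[OF q'(1) u(1) s(1) v(1) s(3) A q'(2)] s v by simp
    have "map_arr J ?t s w A (snd (ad A p q)) = map_arr J t s w' A (e \<oplus>\<^bsub>Jm t A\<^esub> d)"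
      using JD(3)[OF b'(1) s(1,2) A c(1,2)] JD(3)[OF u(1) s(1,3) A c(3,4)] 1 2 unfolding ad_def by simp
    moreover have "at A (ad A p q) s (map_arr J ?t s w A (snd (ad A p q)))"
      unfolding at_def using s by (auto simp: ad_def)
    moreover have "at A (t, e \<oplus>\<^bsub>Jm t A\<^esub> d) s (map_arr J t s w' A (e \<oplus>\<^bsub>Jm t A\<^esub> d))"
      unfolding at_def using s by auto
    ultimately show ?thesis unfolding eqv_def by auto
  qed
  have ad_at_eq: "eqv A (ad A p q) r" if A: "A \<in> Obj a" and p: "p \<in> ?Q A" and q: "q \<in> ?Q A" and r: "r \<in> ?Q A"
    and e: "at A p t e" and d: "at A q t d" and f: "at A r t (e \<oplus>\<^bsub>Jm t A\<^esub> d)" for A p q r t e d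
    using eqv_trans[OF A ad_closed[OF A p q] _ r ad_at[OF A p q e d] eqv_sym[OF eqv_at[OF A r f]]]
      at_closed[OF A r f] at_Obj[OF f] by auto
  have ad_cong: "eqv A (ad A p q) (ad A p' q)"
    if A: "A \<in> Obj a" and p: "p \<in> ?Q A" and p': "p' \<in> ?Q A" and q: "q \<in> ?Q A" and pp: "eqv A p p'" for A p p' q
  proof -
    obtain t e where t: "at A p t e" "at A p' t e" using pp unfolding eqv_def by blast
    have "fst q \<in> Obj j" using q by auto
    then obtain s w v where s: "s \<in> Obj j" "w \<in> Hom j t s" "v \<in> Hom j (fst q) s"
      using span[OF at_Obj[OF t(1)]] by metis
    let ?e = "map_arr J t s w A e" and ?d = "map_arr J (fst q) s v A (snd q)"
    have d: "at A q s ?d" using s by (auto simp: at_def)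
    note 1 = ad_at[OF A p q at_up[OF A p t(1) s(1,2)] d] and 2 = ad_at[OF A p' q at_up[OF A p' t(2) s(1,2)] d]
    have "(s, ?e \<oplus>\<^bsub>Jm s A\<^esub> ?d) \<in> ?Q A"
      using s mac[OF s(1) A at_closed[OF A p at_up[OF A p t(1) s(1,2)]] at_closed[OF A q d]] by simp
    then show ?thesis
      by (rule eqv_trans[OF A ad_closed[OF A p q] _ ad_closed[OF A p' q] 1 eqv_sym[OF 2]])
  qed
  have at_sm: "at A (sm A c p) t (c \<odot>\<^bsub>Jm t A\<^esub> e)" if "A \<in> Obj a" "p \<in> ?Q A" "c \<in> carrier K" "at A p t e" for A c p t e
    using that JD(4)[of "fst p" t _ A c "snd p"] unfolding at_def sm_def by auto
  have at_ac: "at B (ac A B f p) t (map_arr (map_obj J t) A B f e)"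
    if "A \<in> Obj a" "B \<in> Obj a" "f \<in> Hom a B A" "p \<in> ?Q A" "at A p t e" for A B f p t e
    using that JD(5)[of "fst p" t _ A B f "snd p"] unfolding at_def ac_def by auto
  have sm_closed: "sm A c p \<in> ?Q A" if "A \<in> Obj a" "c \<in> carrier K" "p \<in> ?Q A" for A c p
    using that msc unfolding sm_def by auto
  have ac_closed: "ac A B f p \<in> ?Q B" if "A \<in> Obj a" "B \<in> Obj a" "f \<in> Hom a B A" "p \<in> ?Q A" for A B f p
    using that PSh_closed[OF J_PSh] unfolding ac_def by auto
  have at1: "\<exists>t e. at A p t e" if "A \<in> Obj a" "p \<in> ?Q A" for A p using at2[OF that that(2)] by blast
  have same: "eqv A p q" if "A \<in> Obj a" "p \<in> ?Q A" "p = q" for A p q using at1[OF that(1,2)] that(3) unfolding eqv_def by blast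
  interpret presheaf_setoid U K a ?Q eqv ad ze sm ac "\<lambda>A q. q"
  proof (unfold_locales, goal_cases)
    case (1 A x)
    then show ?case using same by simp
  next
    case (2 A x y)
    then show ?case using eqv_sym by blast
  next
    case (3 A x y z)
    show ?case by (rule eqv_trans) (use 3 in auto)
  next
    case (4 A x y)
    then show ?case by (rule ad_closed)
  next
    case (5 A x x' y)
    then show ?case by (intro ad_cong)
  next
    case (6 A)
    then show ?case using x0 mzc by (simp add: ze_def)
  next
    case (7 A c x)
    then show ?case by (rule sm_closed)
  next
    case (8 A c x x')
    then show ?case using at_sm unfolding eqv_def by blast
  next
    case (9 A B f x)
    then show ?case by (rule ac_closed)
  next
    case (10 A B f x x')
    then show ?case using at_ac unfolding eqv_def by blast
  next
    case (11 A x y z)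
    obtain t e d where t: "at A x t e" "at A y t d" by (rule at2[OF 11(1,2,3)])
    have "fst z \<in> Obj j" using 11 by auto
    then obtain s w v where s: "s \<in> Obj j" "w \<in> Hom j t s" "v \<in> Hom j (fst z) s"
      using span[OF at_Obj[OF t(1)]] by metis
    let ?c = "map_arr J (fst z) s v A (snd z)"
    let ?e = "map_arr J t s w A e" and ?d = "map_arr J t s w A d"
    have c: "at A z s ?c" using s by (auto simp: at_def)
    note e = at_up[OF 11(1,2) t(1) s(1,2)] and d = at_up[OF 11(1,3) t(2) s(1,2)]
    note cl = at_closed[OF 11(1,2) e] at_closed[OF 11(1,3) d] at_closed[OF 11(1,4) c]
    let ?p = "\<lambda>a b. a \<oplus>\<^bsub>Jm s A\<^esub> b"
    have m: "(s, x) \<in> ?Q A" if "x \<in> Jel s A" for x using that s by simp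
    interpret M: module K "Jm s A" by (rule md[OF s(1) 11(1)])
    have 1: "eqv A (ad A (ad A x y) z) (ad A (s, ?p ?e ?d) z)"
      by (rule ad_cong[OF 11(1) ad_closed[OF 11(1,2,3)] m 11(4) ad_at[OF 11(1-3) e d]]) (use cl in auto)
    have 2: "eqv A (ad A (s, ?p ?e ?d) z) (s, ?p (?p ?e ?d) ?c)"
      by (rule ad_at[OF 11(1) m 11(4) at_self[OF 11(1) m] c]) (use cl in auto)
    have 3: "eqv A (ad A (ad A y z) x) (ad A (s, ?p ?d ?c) x)"
      by (rule ad_cong[OF 11(1) ad_closed[OF 11(1,3,4)] m 11(2) ad_at[OF 11(1,3,4) d c]]) (use cl in auto)
    have 4: "eqv A (ad A (s, ?p ?d ?c) x) (s, ?p (?p ?d ?c) ?e)"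
      by (rule ad_at[OF 11(1) m 11(2) at_self[OF 11(1) m] e]) (use cl in auto)
    have 5: "eqv A (ad A x (ad A y z)) (ad A (ad A y z) x)"
    proof -
      obtain t e d where t: "at A x t e" "at A (ad A y z) t d" by (rule at2[OF 11(1,2) ad_closed[OF 11(1,3,4)]])
      interpret M': module K "Jm t A" by (rule md[OF at_Obj[OF t(1)] 11(1)])
      have cl': "e \<in> Jel t A" "d \<in> Jel t A" by (rule at_closed[OF 11(1,2) t(1)] at_closed[OF 11(1) ad_closed[OF 11(1,3,4)] t(2)])+
      have q: "(t, e \<oplus>\<^bsub>Jm t A\<^esub> d) \<in> ?Q A" using at_Obj[OF t(1)] cl' by simp
      show ?thesis
        by (rule eqv_trans[OF 11(1) ad_closed[OF 11(1,2) ad_closed[OF 11(1,3,4)]] q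
              ad_closed[OF 11(1) ad_closed[OF 11(1,3,4)] 11(2)] ad_at[OF 11(1,2) ad_closed[OF 11(1,3,4)] t]
              eqv_sym[OF ad_at[OF 11(1) ad_closed[OF 11(1,3,4)] 11(2) t(2,1), unfolded M'.M.a_comm[OF cl'(2,1)]]]])
    qed
    have e6: "?p (?p ?e ?d) ?c = ?p (?p ?d ?c) ?e" using cl by (simp add: M.M.a_ac)
    have q1: "(s, ?p ?e ?d) \<in> ?Q A" "(s, ?p ?d ?c) \<in> ?Q A" "(s, ?p (?p ?d ?c) ?e) \<in> ?Q A" using cl s by auto
    have L: "eqv A (ad A (ad A x y) z) (s, ?p (?p ?d ?c) ?e)"
      using eqv_trans[OF 11(1) ad_closed[OF 11(1) ad_closed[OF 11(1,2,3)] 11(4)] ad_closed[OF 11(1) q1(1) 11(4)] q1(3) 1]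
        2 e6 by simp
    have R: "eqv A (ad A x (ad A y z)) (s, ?p (?p ?d ?c) ?e)"
      using eqv_trans[OF 11(1) ad_closed[OF 11(1,2) ad_closed[OF 11(1,3,4)]] ad_closed[OF 11(1) ad_closed[OF 11(1,3,4)] 11(2)] q1(3) 5
        eqv_trans[OF 11(1) ad_closed[OF 11(1) ad_closed[OF 11(1,3,4)] 11(2)] ad_closed[OF 11(1) q1(2) 11(2)] q1(3) 3 4]] .
    show ?case
      by (rule eqv_trans[OF 11(1) ad_closed[OF 11(1) ad_closed[OF 11(1,2,3)] 11(4)] q1(3)
            ad_closed[OF 11(1,2) ad_closed[OF 11(1,3,4)]] L eqv_sym[OF R]])
  next
    case (12 A x y)
    obtain t e d where t: "at A x t e" "at A y t d" by (rule at2[OF 12])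
    interpret M: module K "Jm t A" by (rule md[OF at_Obj[OF t(1)] 12(1)])
    have cl: "e \<in> Jel t A" "d \<in> Jel t A" by (rule at_closed[OF 12(1,2) t(1)] at_closed[OF 12(1,3) t(2)])+
    have q: "(t, e \<oplus>\<^bsub>Jm t A\<^esub> d) \<in> ?Q A" using at_Obj[OF t(1)] cl by simp
    show ?case
      by (rule eqv_trans[OF 12(1) ad_closed[OF 12] q ad_closed[OF 12(1,3,2)] ad_at[OF 12 t]
            eqv_sym[OF ad_at[OF 12(1,3,2) t(2,1), unfolded M.M.a_comm[OF cl(2,1)]]]])
  next
    case (13 A x)
    have z: "ze A \<in> ?Q A" using x0 mzc 13 by (simp add: ze_def)
    obtain t e d where t: "at A (ze A) t e" "at A x t d" by (rule at2[OF 13(1) z 13(2)])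
    interpret M: module K "Jm t A" by (rule md[OF at_Obj[OF t(1)] 13(1)])
    have "e = \<zero>\<^bsub>Jm t A\<^esub>" using t(1) J_zero x0 13 unfolding at_def ze_def by auto
    then show ?case using ad_at_eq[OF 13(1) z 13(2,2) t] t(2) at_closed[OF 13 t(2)] by simp
  next
    case (14 A x)
    let ?y = "sm A (\<ominus>\<^bsub>K\<^esub> \<one>\<^bsub>K\<^esub>) x"
    have y: "?y \<in> ?Q A" by (rule sm_closed[OF 14(1) _ 14(2)]) simp
    have z: "ze A \<in> ?Q A" using x0 mzc 14 by (simp add: ze_def)
    obtain t e d where t: "at A (ze A) t e" "at A x t d" by (rule at2[OF 14(1) z 14(2)])
    interpret M: module K "Jm t A" by (rule md[OF at_Obj[OF t(1)] 14(1)])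
    have e: "e = \<zero>\<^bsub>Jm t A\<^esub>" using t(1) J_zero x0 14 unfolding at_def ze_def by auto
    have d: "d \<in> Jel t A" using at_closed[OF 14 t(2)] .
    have "at A ?y t ((\<ominus>\<^bsub>K\<^esub> \<one>\<^bsub>K\<^esub>) \<odot>\<^bsub>Jm t A\<^esub> d)" by (rule at_sm[OF 14 _ t(2)]) simp
    then have "at A ?y t (\<ominus>\<^bsub>Jm t A\<^esub> d)" using module_neg_smult[OF M.module_axioms d] by simp
    then have "eqv A (ad A ?y x) (ze A)"
      by (rule ad_at_eq[OF 14(1) y 14(2) z _ t(2)]) (use t(1) e d in \<open>simp add: M.M.l_neg\<close>)
    then show ?case by (rule bexI[OF _ y])
  next
    case (15 A c d x)
    obtain t e where t: "at A x t e" using at1[OF 15(1,4)] by blast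
    have e: "e \<in> Jel t A" by (rule at_closed[OF 15(1,4) t])
    note cd = a_closed[OF 15(2,3)]
    have "at A (sm A (c \<oplus>\<^bsub>K\<^esub> d) x)
        t (c \<odot>\<^bsub>Jm t A\<^esub> e \<oplus>\<^bsub>Jm t A\<^esub> d \<odot>\<^bsub>Jm t A\<^esub> e)"
      using at_sm[OF 15(1,4) cd t] module.smult_l_distr[OF md[OF at_Obj[OF t] 15(1)] 15(2,3) e] by simp
    then show ?case
      by (rule eqv_sym[OF ad_at_eq[OF 15(1) sm_closed[OF 15(1,2,4)] sm_closed[OF 15(1,3,4)] sm_closed[OF 15(1) cd 15(4)]
            at_sm[OF 15(1,4,2) t] at_sm[OF 15(1,4,3) t]]])
  next
    case (16 A c x y)
    obtain t e d where t: "at A x t e" "at A y t d" by (rule at2[OF 16(1,3,4)])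
    have cl: "e \<in> Jel t A" "d \<in> Jel t A" by (rule at_closed[OF 16(1,3) t(1)] at_closed[OF 16(1,4) t(2)])+
    obtain s v where "at A (ad A x y) s v" "at A (t, e \<oplus>\<^bsub>Jm t A\<^esub> d) s v"
      using ad_at[OF 16(1,3,4) t] unfolding eqv_def by blast
    note sv = this
    have q: "(t, e \<oplus>\<^bsub>Jm t A\<^esub> d) \<in> ?Q A" using mac at_Obj[OF t(1)] cl 16 by auto
    have "eqv A (sm A c (ad A x y)) (sm A c (t, e \<oplus>\<^bsub>Jm t A\<^esub> d))"
      using at_sm[OF 16(1) ad_closed[OF 16(1,3,4)] 16(2) sv(1)] at_sm[OF 16(1) q 16(2) sv(2)] unfolding eqv_def by blast
    moreover have "eqv A (sm A c (t, e \<oplus>\<^bsub>Jm t A\<^esub> d)) (ad A (sm A c x) (sm A c y))"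
      by (rule eqv_sym[OF ad_at_eq[OF 16(1) sm_closed[OF 16(1,2,3)] sm_closed[OF 16(1,2,4)] sm_closed[OF 16(1,2) q]
            at_sm[OF 16(1,3,2) t(1)] at_sm[OF 16(1,4,2) t(2)]]])
        (use at_sm[OF 16(1) q 16(2) at_self[OF 16(1) q]] 16 cl in \<open>simp add: module.smult_r_distr[OF md[OF at_Obj[OF t(1)]]]\<close>)
    ultimately show ?case
      by (rule eqv_trans[OF 16(1) sm_closed[OF 16(1,2) ad_closed[OF 16(1,3,4)]] sm_closed[OF 16(1,2) q]
            ad_closed[OF 16(1) sm_closed[OF 16(1,2,3)] sm_closed[OF 16(1,2,4)]]])
  next
    case (17 A c d x)
    then show ?case by (intro same sm_closed m_closed) (auto simp: sm_def module.smult_assoc1[OF md])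
  next
    case (18 A x)
    then show ?case by (intro same sm_closed one_closed) (auto simp: sm_def module.smult_one[OF md])
  next
    case (19 A B f x y)
    obtain t e d where t: "at A x t e" "at A y t d" by (rule at2[OF 19(1,4,5)])
    have cl: "e \<in> Jel t A" "d \<in> Jel t A" by (rule at_closed[OF 19(1,4) t(1)] at_closed[OF 19(1,5) t(2)])+
    obtain s v where "at A (ad A x y) s v" "at A (t, e \<oplus>\<^bsub>Jm t A\<^esub> d) s v"
      using ad_at[OF 19(1,4,5) t] unfolding eqv_def by blast
    note sv = this
    have q: "(t, e \<oplus>\<^bsub>Jm t A\<^esub> d) \<in> ?Q A" using mac at_Obj[OF t(1)] cl 19 by auto
    have "eqv B (ac A B f (ad A x y)) (ac A B f (t, e \<oplus>\<^bsub>Jm t A\<^esub> d))"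
      using at_ac[OF 19(1-3) ad_closed[OF 19(1,4,5)] sv(1)] at_ac[OF 19(1-3) q sv(2)] unfolding eqv_def by blast
    moreover have "eqv B (ac A B f (t, e \<oplus>\<^bsub>Jm t A\<^esub> d)) (ad B (ac A B f x) (ac A B f y))"
      by (rule eqv_sym[OF ad_at_eq[OF 19(2) ac_closed[OF 19(1-3,4)] ac_closed[OF 19(1-3,5)] ac_closed[OF 19(1-3) q]
            at_ac[OF 19(1-4) t(1)] at_ac[OF 19(1-3,5) t(2)]]])
        (use at_ac[OF 19(1-3) q at_self[OF 19(1) q]] 19 cl in \<open>simp add: PSh_add[OF J_PSh[OF at_Obj[OF t(1)]]]\<close>)
    ultimately show ?case
      by (rule eqv_trans[OF 19(2) ac_closed[OF 19(1-3) ad_closed[OF 19(1,4,5)]] ac_closed[OF 19(1-3) q]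
            ad_closed[OF 19(2) ac_closed[OF 19(1-3,4)] ac_closed[OF 19(1-3,5)]]])
  next
    case (20 A B f c x)
    then show ?case by (intro same ac_closed sm_closed) (auto simp: ac_def sm_def PSh_smult[OF J_PSh])
  next
    case (21 A x)
    then show ?case by (intro same ac_closed base_Ident_closed) (auto simp: ac_def PSh_Ident[OF J_PSh])
  next
    case (22 A B D f g x)
    then show ?case by (intro same ac_closed base_Comp_closed) (auto simp: ac_def PSh_Comp[OF J_PSh])
  next
    case (23 A B f g x)
    obtain t e where t: "at A x t e" using at1[OF 23(1,5)] by blast
    have e: "e \<in> Jel t A" by (rule at_closed[OF 23(1,5) t])
    note fg = Hom_add_closed[OF 23(2,1,3,4)]
    have "at B (ac A B (f \<oplus>\<^bsub>HomMod a B A\<^esub> g) x) t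
      (map_arr (map_obj J t) A B f e \<oplus>\<^bsub>Jm t B\<^esub> map_arr (map_obj J t) A B g e)"
      using at_ac[OF 23(1,2) fg 23(5) t] PSh_hom_add[OF J_PSh[OF at_Obj[OF t]] 23(1-4) e] by simp
    then show ?case
      by (rule eqv_sym[OF ad_at_eq[OF 23(2) ac_closed[OF 23(1-3,5)] ac_closed[OF 23(1,2,4,5)] ac_closed[OF 23(1,2) fg 23(5)]
            at_ac[OF 23(1-3,5) t] at_ac[OF 23(1,2,4,5) t]]])
  next
    case (24 A B f c x)
    then show ?case by (intro same ac_closed Hom_smult_closed) (auto simp: ac_def sm_def PSh_hom_smult[OF J_PSh])
  next
    case (25 A)
    have "?Q A = (SIGMA x:Obj j. Jel x A)" by auto
    moreover have "small U (SIGMA x:Obj j. Jel x A)"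
      by (rule small_UN[OF univ])
        (use small_j PSh_carrier[OF J_PSh] small_set_iff[OF univ] 25 in \<open>auto simp: small_category_def\<close>)
    ultimately show ?case by simp
  next
    case (26 A x y)
    then show ?case using same by simp
  qed
  obtain P :: "('o, 'k, 'u) presheaf" and \<pi> where P: "P \<in> Obj PS"
    and pc: "\<And>A x. A \<in> Obj a \<Longrightarrow> x \<in> ?Q A \<Longrightarrow> \<pi> A x \<in> el P A"
    and ps: "\<And>A z. A \<in> Obj a \<Longrightarrow> z \<in> el P A \<Longrightarrow> \<exists>x\<in>?Q A. \<pi> A x = z"
    and pe: "\<And>A x y. \<lbrakk>A \<in> Obj a; x \<in> ?Q A; y \<in> ?Q A\<rbrakk> \<Longrightarrow>
      \<pi> A x = \<pi> A y \<longleftrightarrow> eqv A x y"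
    and pad: "\<And>A x y. \<lbrakk>A \<in> Obj a; x \<in> ?Q A; y \<in> ?Q A\<rbrakk> \<Longrightarrow>
      \<pi> A (ad A x y) = \<pi> A x \<oplus>\<^bsub>map_obj P A\<^esub> \<pi> A y"
    and pz: "\<And>A. A \<in> Obj a \<Longrightarrow> \<pi> A (ze A) = \<zero>\<^bsub>map_obj P A\<^esub>"
    and psm: "\<And>A c x. \<lbrakk>A \<in> Obj a; c \<in> carrier K; x \<in> ?Q A\<rbrakk> \<Longrightarrow>
      \<pi> A (sm A c x) = c \<odot>\<^bsub>map_obj P A\<^esub> \<pi> A x"
    and pac: "\<And>A B f x. \<lbrakk>A \<in> Obj a; B \<in> Obj a; f \<in> Hom a B A; x \<in> ?Q A\<rbrakk> \<Longrightarrow>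
      map_arr P A B f (\<pi> A x) = \<pi> B (ac A B f x)"
    by (rule quotient_presheaf) (rule that)
  have Q: "(x, e) \<in> ?Q A" if "x \<in> Obj j" "e \<in> Jel x A" for x e A using that by simp
  define p where "p x = mk_nat a (map_obj J x) (\<lambda>A e. \<pi> A (x, e))" for x
  have pa: "p x A e = \<pi> A (x, e)" if "A \<in> Obj a" "e \<in> Jel x A" for x A e
    using mk_nat_apply[OF that] by (simp add: p_def)
  have pH: "p x \<in> Hom PS (map_obj J x) P" if x: "x \<in> Obj j" for x
    unfolding p_def
  proof (rule mk_nat_Hom[OF J_PSh[OF x]])
    fix A e assume A: "A \<in> Obj a" and e: "e \<in> Jel x A"
    show "\<pi> A (x, e) \<in> el P A" by (rule pc[OF A Q[OF x e]])
    show "\<pi> A (x, e \<oplus>\<^bsub>Jm x A\<^esub> d) = \<pi> A (x, e) \<oplus>\<^bsub>map_obj P A\<^esub> \<pi> A (x, d)"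
        if d: "d \<in> Jel x A" for d
    proof -
      have "eqv A (ad A (x, e) (x, d)) (x, e \<oplus>\<^bsub>Jm x A\<^esub> d)"
        by (rule ad_at[OF A Q[OF x e] Q[OF x d] at_self[OF A Q[OF x e]] at_self[OF A Q[OF x d]]])
      then show ?thesis
        using pe[OF A ad_closed[OF A Q[OF x e] Q[OF x d]] Q[OF x mac[OF x A e d]]] pad[OF A Q[OF x e] Q[OF x d]] by simp
    qed
    show "\<pi> A (x, c \<odot>\<^bsub>Jm x A\<^esub> e) = c \<odot>\<^bsub>map_obj P A\<^esub> \<pi> A (x, e)" if c: "c \<in> carrier K" for c
      using psm[OF A c Q[OF x e]] by (simp add: sm_def)
    show "\<pi> B (x, map_arr (map_obj J x) A B f e) = map_arr P A B f (\<pi> A (x, e))" if B: "B \<in> Obj a" and f: "f \<in> Hom a B A" for B f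
      using pac[OF A B f Q[OF x e]] by (simp add: ac_def)
  qed
  have "fcolim P p"
    unfolding fcolim_def cocone_iff
  proof (intro conjI ballI impI P pH, assumption)
    fix x y u A e assume x: "x \<in> Obj j" and y: "y \<in> Obj j" and u: "u \<in> Hom j x y" and A: "A \<in> Obj a" and e: "e \<in> Jel x A"
    have e': "map_arr J x y u A e \<in> Jel y A" by (rule JD(2)[OF x y u A e])
    have "at A (x, e) y (map_arr J x y u A e)" using y u by (auto simp: at_def)
    then have "eqv A (x, e) (y, map_arr J x y u A e)" by (rule eqv_at[OF A Q[OF x e]])
    then show "p y A (map_arr J x y u A e) = p x A e"
      using pa[OF A e] pa[OF A e'] pe[OF A Q[OF x e] Q[OF y e']] by simp
  next
    fix A z assume A: "A \<in> Obj a" and z: "z \<in> el P A"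
    obtain q where q: "q \<in> ?Q A" "\<pi> A q = z" using ps[OF A z] by (elim bexE)
    then show "\<exists>x\<in>Obj j. \<exists>e\<in>Jel x A. p x A e = z"
      using pa[OF A] by (intro bexI[of _ "fst q"] bexI[of _ "snd q"]) auto
  next
    fix A x e assume A: "A \<in> Obj a" and x: "x \<in> Obj j" and e: "e \<in> Jel x A" and z: "p x A e = \<zero>\<^bsub>map_obj P A\<^esub>"
    have zc: "ze A \<in> ?Q A" by (rule ze_closed[OF A])
    have "eqv A (x, e) (ze A)" using pe[OF A Q[OF x e] zc] pz[OF A] pa[OF A e] z by simp
    then obtain t d where t: "at A (x, e) t d" "at A (ze A) t d" unfolding eqv_def by blast
    have "d = \<zero>\<^bsub>Jm t A\<^esub>" using t(2) J_zero x0 A unfolding at_def ze_def by auto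
    then show "\<exists>y\<in>Obj j. \<exists>u\<in>Hom j x y. map_arr J x y u A e = \<zero>\<^bsub>Jm y A\<^esub>"
      using t(1) unfolding at_def fst_conv snd_conv by (metis (no_types, lifting))
  qed
  then show thesis by (rule that)
qed

lemma fcolim_iso:
  assumes P: "fcolim P p" and h: "is_iso PS P L h" and L: "L \<in> Obj PS"
    and l: "\<And>x. x \<in> Obj j \<Longrightarrow> Comp PS (map_obj J x) P L h (p x) = l x"
  shows "fcolim L l"
proof -
  obtain g where g: "g \<in> Hom PS L P" "Comp PS P L P g h = Ident PS P"
    "Comp PS L P L h g = Ident PS L" and hH: "h \<in> Hom PS P L"
    using h unfolding is_iso_def by blast
  note PP = fc_PSh[OF P] and pH = fc_Hom[OF P]
  note gD = PSh_HomD[OF g(1)] and pD = PSh_HomD[OF pH]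
  have gh: "g A (h A z) = z" if "A \<in> Obj a" "z \<in> el P A" for A z
    using PSh_Comp_apply[OF that, of U K L P g h] PSh_Ident_apply[OF that, of U K] g(2) by metis
  have hg: "h A (g A z) = z" if "A \<in> Obj a" "z \<in> el L A" for A z
    using PSh_Comp_apply[OF that, of U K P L h g] PSh_Ident_apply[OF that, of U K] g(3) by metis
  have la: "l x A e = h A (p x A e)" if "x \<in> Obj j" "A \<in> Obj a" "e \<in> Jel x A" for x A e
    using PSh_Comp_apply[OF that(2,3), of U K P L h "p x"] l[OF that(1)] by metis
  have lH: "l x \<in> Hom PS (map_obj J x) L" if "x \<in> Obj j" for x
    using PSh_Comp_closed[OF J_PSh[OF that] pH[OF that] hH] l[OF that] by simp
  show ?thesis
    unfolding fcolim_def cocone_iff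
  proof (intro conjI ballI impI L lH, assumption)
    fix x y u A e assume x: "x \<in> Obj j" and y: "y \<in> Obj j" and u: "u \<in> Hom j x y" and A: "A \<in> Obj a" and e: "e \<in> Jel x A"
    show "l y A (map_arr J x y u A e) = l x A e"
      using la[OF x A e] la[OF y A JD(2)[OF x y u A e]] fc_cocone[OF P x y u A e] by simp
  next
    fix A z assume A: "A \<in> Obj a" and z: "z \<in> el L A"
    obtain x e where "x \<in> Obj j" "e \<in> Jel x A" "p x A e = g A z" using fc_surj[OF P A gD(2)[OF A z]] by blast
    then show "\<exists>x\<in>Obj j. \<exists>e\<in>Jel x A. l x A e = z" using la A hg[OF A z] by metis
  next
    fix A x e assume A: "A \<in> Obj a" and x: "x \<in> Obj j" and e: "e \<in> Jel x A" and z: "l x A e = \<zero>\<^bsub>map_obj L A\<^esub>"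
    have "p x A e = \<zero>\<^bsub>map_obj P A\<^esub>"
      using gh[OF A pD(2)[OF x A e]] la[OF x A e] z PSh_Hom_zero[OF L PP g(1) A] by simp
    then show "\<exists>y\<in>Obj j. \<exists>u\<in>Hom j x y. map_arr J x y u A e = \<zero>\<^bsub>Jm y A\<^esub>"
      by (rule fc_zero[OF P A x e])
  qed
qed

lemma colimit_fcolim:
  assumes "is_colimit j PS J L l"
  shows "fcolim L l"
proof -
  obtain P p where P: "fcolim P p" by (rule fcolim_exists)
  obtain h where "is_iso PS P L h" "\<And>x. x \<in> Obj j \<Longrightarrow> Comp PS (map_obj J x) P L h (p x) = l x"
    by (rule colimit_iso[OF category_PSh fcolim_is_colimit[OF P] assms J_PSh]) (assumption, rule that)
  then show ?thesis using fcolim_iso[OF P] assms by (simp add: is_colimit_def is_cocone_def)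
qed

end

section \<open>The Yoneda lemma and the representing property of sheafified representables\<close>

lemma is_iso_PShI:
  assumes P: "P \<in> Obj (PSh U K a)" and L: "L \<in> Obj (PSh U K a)" and h: "h \<in> Hom (PSh U K a) P L"
    and bij: "\<And>A. A \<in> Obj a \<Longrightarrow> bij_betw (h A) (el P A) (el L A)"
  shows "is_iso (PSh U K a) P L h"
proof -
  note hD = PSh_HomD[OF h]
  define k where "k A = inv_into (el P A) (h A)" for A
  have kc: "k A z \<in> el P A" and hk: "h A (k A z) = z"
    if "A \<in> Obj a" "z \<in> el L A" for A z
    using bij[OF that(1)] that(2) unfolding k_def bij_betw_def by (auto simp: inv_into_into f_inv_into_f)
  have kh: "k A (h A x) = x" if "A \<in> Obj a" "x \<in> el P A" for A x
    using bij[OF that(1)] that(2) unfolding k_def bij_betw_def by auto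
  have kI: "k A z = x" if "A \<in> Obj a" "x \<in> el P A" "h A x = z" for A x z
    using kh that by blast
  note md = PSh_module[OF P]
  have kH: "mk_nat a L k \<in> Hom (PSh U K a) L P"
  proof (rule mk_nat_Hom[OF L kc], assumption, assumption)
    fix A z assume A: "A \<in> Obj a" and z: "z \<in> el L A"
    show "k A (z \<oplus>\<^bsub>map_obj L A\<^esub> w) = k A z \<oplus>\<^bsub>map_obj P A\<^esub> k A w" if w: "w \<in> el L A" for w
      by (rule kI[OF A module_add_closed[OF md[OF A] kc[OF A z] kc[OF A w]]])
        (simp add: hD(3)[OF A kc[OF A z] kc[OF A w]] hk[OF A] z w)
    show "k A (c \<odot>\<^bsub>map_obj L A\<^esub> z) = c \<odot>\<^bsub>map_obj P A\<^esub> k A z" if c: "c \<in> carrier K" for c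
      by (rule kI[OF A module_smult_closed[OF md[OF A] c kc[OF A z]]])
        (simp add: hD(4)[OF A c kc[OF A z]] hk[OF A] z)
    show "k B (map_arr L A B f z) = map_arr P A B f (k A z)" if B: "B \<in> Obj a" and f: "f \<in> Hom a B A" for B f
      by (rule kI[OF B PSh_closed[OF P A B f kc[OF A z]]])
        (simp add: hD(5)[OF A B f kc[OF A z]] hk[OF A] z)
  qed
  have "Comp (PSh U K a) P L P (mk_nat a L k) h = Ident (PSh U K a) P"
    by (rule PSh_Hom_eqI[OF PSh_Comp_closed[OF P h kH] PSh_Ident_closed[OF P]])
      (simp add: PSh_Comp_apply PSh_Ident_apply mk_nat_apply hD kh)
  moreover have "Comp (PSh U K a) L P L h (mk_nat a L k) = Ident (PSh U K a) L"
    by (rule PSh_Hom_eqI[OF PSh_Comp_closed[OF L kH h] PSh_Ident_closed[OF L]])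
      (simp add: PSh_Comp_apply PSh_Ident_apply mk_nat_apply hk)
  ultimately show ?thesis unfolding is_iso_def using h kH by blast
qed

context site
begin

lemma Yoneda_simps [simp]:
  "map_obj (Yoneda a X) B = HomMod a B X"
  "f \<in> Hom a B X \<Longrightarrow> map_arr (Yoneda a X) B D g f = Comp a D B X f g"
  by (simp_all add: Yoneda_def)

lemma Yoneda_PSh:
  assumes X: "X \<in> Obj a"
  shows "Yoneda a X \<in> Obj PS"
proof (rule PSh_ObjI)
  fix A B f assume A: "A \<in> Obj a" "B \<in> Obj a" "f \<in> Hom a B A"
  show "map_arr (Yoneda a X) A B f \<in> linear_maps K (map_obj (Yoneda a X) A) (map_obj (Yoneda a X) B)"
    by (rule linear_mapsI)
      (use A X in \<open>auto simp: carrier_HomMod Comp_closed Comp_add_left Comp_smult_left Hom_add_closed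
        Hom_smult_closed, auto simp: Yoneda_def\<close>)
qed (use X in \<open>auto simp: module_HomMod carrier_HomMod Hom_mem_U Comp_Ident_right Comp_assoc Comp_closed
    Comp_add_right Comp_smult_right Hom_add_closed Hom_smult_closed Ident_closed linear_category_axioms\<close>)

lemma Yoneda_elem:
  assumes F: "F \<in> Obj PS" and X: "X \<in> Obj a" and x: "x \<in> el F X"
  shows "mk_nat a (Yoneda a X) (\<lambda>B f. map_arr F X B f x) \<in> Hom PS (Yoneda a X) F"
  by (rule mk_nat_Hom[OF Yoneda_PSh[OF X]])
    (use X x in \<open>auto simp: carrier_HomMod PSh_closed[OF F] PSh_hom_add[OF F] PSh_hom_smult[OF F] PSh_Comp[OF F]\<close>)

lemma Yoneda_Hom:
  assumes g: "g \<in> Hom PS (Yoneda a X) F" and X: "X \<in> Obj a" and B: "B \<in> Obj a" and f: "f \<in> Hom a B X"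
  shows "g B f = map_arr F X B f (g X (Ident a X))"
  using PSh_Hom_nat[OF g X B f, of "Ident a X"] X B f Ident_closed[OF X] by (simp add: carrier_HomMod Comp_Ident_left)

lemma subpresheaf_zero:
  assumes M: "M \<in> Obj PS"
  shows "subpresheaf M (\<lambda>A. {\<zero>\<^bsub>map_obj M A\<^esub>})"
proof -
  have "abelian_monoid (map_obj M A)" if "A \<in> Obj a" for A
    by (rule abelian_group.axioms(1)[OF module.axioms(2)[OF PSh_module[OF M that]]])
  then show ?thesis unfolding subpresheaf_def
    by (auto simp: module_zero_closed[OF PSh_module[OF M]] module.smult_r_null[OF PSh_module[OF M]] PSh_zero[OF M]
        abelian_monoid.l_zero)
qed

lemma sheafify_spec:
  assumes M: "M \<in> Obj PS"
  obtains u where "is_sheafification U K a T M (sheafify U K a T M) u"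
proof -
  obtain Z u where Z: "is_sheaf U K a T Z" "u \<in> Hom PS M Z"
    and uu: "\<And>G g. \<lbrakk>is_sheaf U K a T G; g \<in> Hom PS M G; (\<And>A x. A \<in> Obj a \<Longrightarrow>
        x \<in> {\<zero>\<^bsub>map_obj M A\<^esub>} \<Longrightarrow> g A x = \<zero>\<^bsub>map_obj G A\<^esub>)\<rbrakk> \<Longrightarrow>
      \<exists>!h. h \<in> Hom PS Z G \<and> Comp PS M Z G h u = g"
    by (rule sheafify_quotient[OF M subpresheaf_zero[OF M]]) blast
  have "\<exists>!h. h \<in> Hom PS Z G \<and> Comp PS M Z G h u = g"
    if G: "is_sheaf U K a T G" and g: "g \<in> Hom PS M G" for G g
    by (rule uu[OF G g]) (simp add: PSh_Hom_zero[OF M sheaf_PSh[OF G] g])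
  then have "is_sheafification U K a T M Z u"
    unfolding is_sheafification_def using Z by (simp add: Sh_Obj_iff)
  then have "\<exists>u. is_sheafification U K a T M (sheafify U K a T M) u"
    unfolding sheafify_def using someI[of "\<lambda>Z. \<exists>u. is_sheafification U K a T M Z u" Z] by blast
  then show thesis using that by blast
qed

lemma sheafified_Yoneda:
  assumes X: "X \<in> Obj a"
  defines "Z \<equiv> sheafify U K a T (Yoneda a X)"
  obtains e where "is_sheaf U K a T Z" "e \<in> el Z X"
    "\<And>F h h'. \<lbrakk>is_sheaf U K a T F; h \<in> Hom PS Z F; h' \<in> Hom PS Z F; h X e = h' X e\<rbrakk> \<Longrightarrow> h = h'"
    "\<And>F z. is_sheaf U K a T F \<Longrightarrow> z \<in> el F X \<Longrightarrow> \<exists>h\<in>Hom PS Z F. h X e = z"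
proof -
  let ?Y = "Yoneda a X"
  note Y = Yoneda_PSh[OF X]
  have id: "Ident a X \<in> el ?Y X" using Ident_closed[OF X] X by (simp add: carrier_HomMod)
  obtain u where u: "is_sheafification U K a T ?Y Z u" unfolding Z_def by (rule sheafify_spec[OF Y])
  then have Z: "is_sheaf U K a T Z" and uH: "u \<in> Hom PS ?Y Z"
    and uu: "\<And>F g. is_sheaf U K a T F \<Longrightarrow> g \<in> Hom PS ?Y F \<Longrightarrow>
      \<exists>!h. h \<in> Hom PS Z F \<and> Comp PS ?Y Z F h u = g"
    unfolding is_sheafification_def by (auto simp: Sh_Obj_iff)
  let ?e = "u X (Ident a X)"
  have app: "Comp PS ?Y Z F h u X (Ident a X) = h X ?e" for F h by (rule PSh_Comp_apply[OF X id])
  show thesis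
  proof (rule that[OF Z, of ?e])
    show "?e \<in> el Z X" by (rule PSh_Hom_closed[OF uH X id])
    fix F assume F: "is_sheaf U K a T F"
    note FP = sheaf_PSh[OF F]
    {
      fix h h' assume h: "h \<in> Hom PS Z F" and h': "h' \<in> Hom PS Z F" and e: "h X ?e = h' X ?e"
      note hu = PSh_Comp_closed[OF Y uH h] and hu' = PSh_Comp_closed[OF Y uH h']
      have "Comp PS ?Y Z F h u = Comp PS ?Y Z F h' u"
      proof (rule PSh_Hom_eqI[OF hu hu'])
        fix B f assume B: "B \<in> Obj a" and "f \<in> el ?Y B"
        then have f: "f \<in> Hom a B X" using X by (simp add: carrier_HomMod)
        show "Comp PS ?Y Z F h u B f = Comp PS ?Y Z F h' u B f"
          unfolding Yoneda_Hom[OF hu X B f] Yoneda_Hom[OF hu' X B f] app e ..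
      qed
      moreover obtain k where k: "\<forall>m. m \<in> Hom PS Z F \<and> Comp PS ?Y Z F m u = Comp PS ?Y Z F h' u \<longrightarrow> m = k"
        using uu[OF F hu'] by (elim ex1E) blast
      ultimately have "h = k" "h' = k" using h h' by blast+
      then show "h = h'" by simp
    next
      fix z assume z: "z \<in> el F X"
      let ?g = "mk_nat a ?Y (\<lambda>B f. map_arr F X B f z)"
      obtain h where h: "h \<in> Hom PS Z F" "Comp PS ?Y Z F h u = ?g"
        using uu[OF F Yoneda_elem[OF FP X z]] by blast
      have "h X ?e = ?g X (Ident a X)" using app[of F h] h(2) by simp
      also have "\<dots> = z" using mk_nat_apply[OF X id] PSh_Ident[OF FP X z] by simp
      finally show "\<exists>h\<in>Hom PS Z F. h X ?e = z" using h(1) by blast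
    }
  qed
qed

end

section \<open>Compactness and filtered colimits of sheaves\<close>

lemma category_Ab: "category Ab"
proof (unfold_locales, goal_cases)
  case (1 A)
  then show ?case by (auto simp: Ab_def hom_def comm_group_def group_def monoid.m_closed)
next
  case (2 A B D f g)
  then show ?case by (auto simp: Ab_def hom_def compose_def comm_group_def group_def monoid.m_closed Pi_def)
next
  case (3 A B f)
  then show ?case by (auto simp: Ab_def hom_def compose_def Pi_def intro!: extensionalityI[of _ "carrier A"])
next
  case (4 A B f)
  then show ?case by (auto simp: Ab_def hom_def compose_def intro!: extensionalityI[of _ "carrier A"])
next
  case (5 A B D E f g h)
  then show ?case by (auto simp: Ab_def hom_def compose_def Pi_def intro!: extensionalityI[of _ "carrier A"])
qed

lemma (in filtered_category) Ab_colimitI: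
  assumes Dg: "\<And>x. x \<in> Obj j \<Longrightarrow> comm_group (map_obj D x)"
    and DH: "\<And>x y u. \<lbrakk>x \<in> Obj j; y \<in> Obj j; u \<in> Hom j x y\<rbrakk> \<Longrightarrow>
      map_arr D x y u \<in> hom (map_obj D x) (map_obj D y)"
    and L: "comm_group L" and lH: "\<And>x. x \<in> Obj j \<Longrightarrow> l x \<in> hom (map_obj D x) L \<inter> extensional (el D x)"
    and lc: "\<And>x y u e. \<lbrakk>x \<in> Obj j; y \<in> Obj j; u \<in> Hom j x y; e \<in> el D x\<rbrakk> \<Longrightarrow>
      l y (map_arr D x y u e) = l x e"
    and surj: "\<And>z. z \<in> carrier L \<Longrightarrow> \<exists>x\<in>Obj j. \<exists>e\<in>el D x. l x e = z"
    and inj: "\<And>x e d. \<lbrakk>x \<in> Obj j; e \<in> el D x; d \<in> el D x; l x e = l x d\<rbrakk> \<Longrightarrow>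
      \<exists>y\<in>Obj j. \<exists>u\<in>Hom j x y. map_arr D x y u e = map_arr D x y u d"
  shows "is_colimit j Ab D L l"
  unfolding is_colimit_def
proof (intro conjI allI impI)
  have Dc: "map_arr D x y u e \<in> el D y"
    if "x \<in> Obj j" "y \<in> Obj j" "u \<in> Hom j x y" "e \<in> el D x" for x y u e
    using DH[OF that(1-3)] that(4) by (auto simp: hom_def)
  show "is_cocone j Ab D L l"
    unfolding is_cocone_def
  proof (intro conjI ballI)
    fix x y u assume x: "x \<in> Obj j" "y \<in> Obj j" "u \<in> Hom j x y"
    show "Comp Ab (map_obj D x) (map_obj D y) L (l y) (map_arr D x y u) = l x"
      by (rule extensionalityI[of _ "el D x"]) (use lH[OF x(1)] lc[OF x] in \<open>auto simp: Ab_def compose_def\<close>)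
  qed (use L lH in \<open>auto simp: Ab_def\<close>)
  fix M m assume Mc: "is_cocone j Ab D M m"
  then have M: "comm_group M" and mH: "\<And>x. x \<in> Obj j \<Longrightarrow> m x \<in> hom (map_obj D x) M \<inter> extensional (el D x)"
    by (auto simp: is_cocone_def Ab_def)
  have mc: "m y (map_arr D x y u e) = m x e"
    if "x \<in> Obj j" "y \<in> Obj j" "u \<in> Hom j x y" "e \<in> el D x" for x y u e
  proof -
    have "Comp Ab (map_obj D x) (map_obj D y) M (m y) (map_arr D x y u) = m x" using Mc that by (simp add: is_cocone_def)
    then have "Comp Ab (map_obj D x) (map_obj D y) M (m y) (map_arr D x y u) e = m x e" by simp
    then show ?thesis using that by (simp add: Ab_def compose_def)
  qed
  obtain h where h: "\<And>x e. x \<in> Obj j \<Longrightarrow> e \<in> el D x \<Longrightarrow> h (l x e) = m x e"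
  proof (rule descend[of "\<lambda>x. el D x" "map_arr D" l m])
    show "map_arr D x y u e \<in> el D y"
      if "x \<in> Obj j" "y \<in> Obj j" "u \<in> Hom j x y" "e \<in> el D x" for x y u e using Dc[OF that] .
    show "l y (map_arr D x y u e) = l x e"
      if "x \<in> Obj j" "y \<in> Obj j" "u \<in> Hom j x y" "e \<in> el D x" for x y u e using lc[OF that] .
    show "m y (map_arr D x y u e) = m x e"
      if "x \<in> Obj j" "y \<in> Obj j" "u \<in> Hom j x y" "e \<in> el D x" for x y u e using mc[OF that] .
    show "\<exists>y\<in>Obj j. \<exists>u\<in>Hom j x y. map_arr D x y u e = map_arr D x y u d"
      if "x \<in> Obj j" "e \<in> el D x" "d \<in> el D x" "l x e = l x d" for x e d using inj[OF that] .
  qed (rule that)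
  let ?h = "restrict h (carrier L)"
  have lcar: "l x e \<in> carrier L" if "x \<in> Obj j" "e \<in> el D x" for x e
    using lH[OF that(1)] that(2) by (auto simp: hom_def)
  have two: "\<exists>x\<in>Obj j. \<exists>e\<in>el D x. \<exists>d\<in>el D x. l x e = z \<and> l x d = w"
    if z: "z \<in> carrier L" and w: "w \<in> carrier L" for z w
  proof -
    obtain x e where x: "x \<in> Obj j" "e \<in> el D x" "l x e = z" using surj[OF z] by blast
    obtain y d where y: "y \<in> Obj j" "d \<in> el D y" "l y d = w" using surj[OF w] by blast
    obtain t u v where t: "t \<in> Obj j" "u \<in> Hom j x t" "v \<in> Hom j y t" by (rule span[OF x(1) y(1)])
    show ?thesis
      using Dc[OF x(1) t(1,2) x(2)] Dc[OF y(1) t(1,3) y(2)] lc[OF x(1) t(1,2) x(2)] lc[OF y(1) t(1,3) y(2)] x(3) y(3) t(1)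
      by blast
  qed
  have hH: "?h \<in> hom L M"
  proof (rule homI)
    fix z assume z: "z \<in> carrier L"
    then obtain x e where "x \<in> Obj j" "e \<in> el D x" "l x e = z" using surj by blast
    then show "?h z \<in> carrier M" using h mH z by (fastforce simp: hom_def)
  next
    fix z w assume z: "z \<in> carrier L" and w: "w \<in> carrier L"
    obtain x e d where x: "x \<in> Obj j" and e: "e \<in> el D x" and d: "d \<in> el D x"
      and zw: "l x e = z" "l x d = w" using two[OF z w] by blast
    interpret Dx: comm_group "map_obj D x" by (rule Dg[OF x])
    interpret L: comm_group L by (rule L)
    have "l x (e \<otimes>\<^bsub>map_obj D x\<^esub> d) = z \<otimes>\<^bsub>L\<^esub> w"
        "m x (e \<otimes>\<^bsub>map_obj D x\<^esub> d) = m x e \<otimes>\<^bsub>M\<^esub> m x d"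
      using lH[OF x] mH[OF x] e d zw by (auto simp: hom_def)
    then show "?h (z \<otimes>\<^bsub>L\<^esub> w) = ?h z \<otimes>\<^bsub>M\<^esub> ?h w"
      using h[OF x e] h[OF x d] h[OF x Dx.m_closed[OF e d]] zw z w by simp
  qed
  show "\<exists>!h. h \<in> Hom Ab L M \<and> (\<forall>x\<in>Obj j. Comp Ab (map_obj D x) L M h (l x) = m x)"
  proof (rule ex1I[of _ ?h], intro conjI ballI)
    show "?h \<in> Hom Ab L M" using hH by (simp add: Ab_def)
    fix x assume x: "x \<in> Obj j"
    show "Comp Ab (map_obj D x) L M ?h (l x) = m x"
      by (rule extensionalityI[of _ "el D x"]) (use mH[OF x] h[OF x] lcar[OF x] in \<open>auto simp: Ab_def compose_def\<close>)
  next
    fix k assume k: "k \<in> Hom Ab L M \<and> (\<forall>x\<in>Obj j. Comp Ab (map_obj D x) L M k (l x) = m x)"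
    show "k = ?h"
    proof (rule extensionalityI[of _ "carrier L"])
      fix z assume z: "z \<in> carrier L"
      then obtain x e where x: "x \<in> Obj j" "e \<in> el D x" "l x e = z" using surj by blast
      have "Comp Ab (map_obj D x) L M k (l x) e = m x e" using k x(1) by simp
      then show "k z = ?h z" using x h[OF x(1,2)] z by (simp add: Ab_def compose_def)
    qed (use k in \<open>auto simp: Ab_def\<close>)
  qed
qed

lemma HomMod_PSh_add:
  assumes "A \<in> Obj a" "x \<in> el Z A"
  shows "(s \<oplus>\<^bsub>HomMod (PSh U K a) Z F\<^esub> t) A x = s A x \<oplus>\<^bsub>map_obj F A\<^esub> t A x"
  using assms by (simp add: PSh_def linear_functor_category_def op_category_def Mod_def)

lemma HomMod_PSh_zero:
  assumes "A \<in> Obj a" "x \<in> el Z A"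
  shows "\<zero>\<^bsub>HomMod (PSh U K a) Z F\<^esub> A x = \<zero>\<^bsub>map_obj F A\<^esub>"
  using assms by (simp add: PSh_def linear_functor_category_def op_category_def Mod_def)

lemma HomMod_PSh_add_closed:
  assumes Z: "Z \<in> Obj (PSh U K a)" and F: "F \<in> Obj (PSh U K a)"
    and s: "s \<in> Hom (PSh U K a) Z F" and t: "t \<in> Hom (PSh U K a) Z F"
  shows "s \<oplus>\<^bsub>HomMod (PSh U K a) Z F\<^esub> t \<in> Hom (PSh U K a) Z F"
proof -
  note sD = PSh_HomD[OF s] and tD = PSh_HomD[OF t]
  have "s \<oplus>\<^bsub>HomMod (PSh U K a) Z F\<^esub> t = mk_nat a Z (\<lambda>A x. s A x \<oplus>\<^bsub>map_obj F A\<^esub> t A x)"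
    by (simp add: PSh_def linear_functor_category_def op_category_def Mod_def mk_nat_def)
  moreover have "mk_nat a Z (\<lambda>A x. s A x \<oplus>\<^bsub>map_obj F A\<^esub> t A x) \<in> Hom (PSh U K a) Z F"
  proof (rule mk_nat_Hom[OF Z])
    fix A x assume A: "A \<in> Obj a" and x: "x \<in> el Z A"
    interpret FA: module K "map_obj F A" by (rule PSh_module[OF F A])
    show "s A x \<oplus>\<^bsub>map_obj F A\<^esub> t A x \<in> el F A" using sD(2) tD(2) A x by simp
    show "s A (x \<oplus>\<^bsub>map_obj Z A\<^esub> y) \<oplus>\<^bsub>map_obj F A\<^esub> t A (x \<oplus>\<^bsub>map_obj Z A\<^esub> y) =
        s A x \<oplus>\<^bsub>map_obj F A\<^esub> t A x \<oplus>\<^bsub>map_obj F A\<^esub> (s A y \<oplus>\<^bsub>map_obj F A\<^esub> t A y)"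
      if y: "y \<in> el Z A" for y
      using sD(2)[OF A x] tD(2)[OF A x] sD(2)[OF A y] tD(2)[OF A y]
      by (simp add: sD(3)[OF A x y] tD(3)[OF A x y] FA.M.a_ac)
    show "s A (c \<odot>\<^bsub>map_obj Z A\<^esub> x) \<oplus>\<^bsub>map_obj F A\<^esub> t A (c \<odot>\<^bsub>map_obj Z A\<^esub> x) =
        c \<odot>\<^bsub>map_obj F A\<^esub> (s A x \<oplus>\<^bsub>map_obj F A\<^esub> t A x)" if c: "c \<in> carrier K" for c
      using sD(2)[OF A x] tD(2)[OF A x] c by (simp add: sD(4)[OF A c x] tD(4)[OF A c x] FA.smult_r_distr)
    show "s B (map_arr Z A B f x) \<oplus>\<^bsub>map_obj F B\<^esub> t B (map_arr Z A B f x) =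
        map_arr F A B f (s A x \<oplus>\<^bsub>map_obj F A\<^esub> t A x)" if B: "B \<in> Obj a" and f: "f \<in> Hom a B A" for B f
      using sD(5)[OF A B f x] tD(5)[OF A B f x] PSh_add[OF F A B f sD(2)[OF A x] tD(2)[OF A x]] by simp
  qed
  ultimately show ?thesis by simp
qed

lemma comm_group_HomMod_PSh:
  assumes Z: "Z \<in> Obj (PSh U K a)" and F: "F \<in> Obj (PSh U K a)"
  shows "comm_group \<lparr>carrier = Hom (PSh U K a) Z F, mult = add (HomMod (PSh U K a) Z F), one = zero (HomMod (PSh U K a) Z F)\<rparr>"
    (is "comm_group ?G")
proof -
  note cl = HomMod_PSh_add_closed[OF Z F]
  have ag: "abelian_group (map_obj F A)" if "A \<in> Obj a" for A using PSh_module[OF F that] by (simp add: module_def)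
  note am = abelian_group.axioms(1)[OF ag]
  have z: "mk_nat a Z (\<lambda>A x. \<zero>\<^bsub>map_obj F A\<^esub>) \<in> Hom (PSh U K a) Z F"
    by (rule mk_nat_Hom[OF Z]) (auto simp: module_zero_closed[OF PSh_module[OF F]] abelian_monoid.l_zero[OF am]
        module.smult_r_null[OF PSh_module[OF F]] PSh_zero[OF F])
  moreover have "\<zero>\<^bsub>HomMod (PSh U K a) Z F\<^esub> = mk_nat a Z (\<lambda>A x. \<zero>\<^bsub>map_obj F A\<^esub>)"
    by (simp add: PSh_def linear_functor_category_def op_category_def Mod_def mk_nat_def)
  ultimately have zc: "\<zero>\<^bsub>HomMod (PSh U K a) Z F\<^esub> \<in> Hom (PSh U K a) Z F" by simp
  show ?thesis
  proof (rule comm_groupI)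
    show "x \<otimes>\<^bsub>?G\<^esub> y \<in> carrier ?G" if "x \<in> carrier ?G" "y \<in> carrier ?G" for x y using that cl by simp
    show "\<one>\<^bsub>?G\<^esub> \<in> carrier ?G" using zc by simp
    show "x \<otimes>\<^bsub>?G\<^esub> y \<otimes>\<^bsub>?G\<^esub> z = x \<otimes>\<^bsub>?G\<^esub> (y \<otimes>\<^bsub>?G\<^esub> z)"
        if "x \<in> carrier ?G" "y \<in> carrier ?G" "z \<in> carrier ?G" for x y z
    proof -
      have 1: "x \<in> Hom (PSh U K a) Z F" "y \<in> Hom (PSh U K a) Z F" "z \<in> Hom (PSh U K a) Z F" using that by auto
      show ?thesis unfolding monoid.simps
        by (rule PSh_Hom_eqI[OF cl[OF cl[OF 1(1,2)] 1(3)] cl[OF 1(1) cl[OF 1(2,3)]]])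
          (simp add: HomMod_PSh_add abelian_monoid.a_assoc[OF am] PSh_Hom_closed[OF 1(1)] PSh_Hom_closed[OF 1(2)] PSh_Hom_closed[OF 1(3)])
    qed
    show "x \<otimes>\<^bsub>?G\<^esub> y = y \<otimes>\<^bsub>?G\<^esub> x" if "x \<in> carrier ?G" "y \<in> carrier ?G" for x y
    proof -
      have 1: "x \<in> Hom (PSh U K a) Z F" "y \<in> Hom (PSh U K a) Z F" using that by auto
      show ?thesis unfolding monoid.simps
        by (rule PSh_Hom_eqI[OF cl[OF 1] cl[OF 1(2,1)]])
          (simp add: HomMod_PSh_add abelian_monoid.a_comm[OF am] PSh_Hom_closed[OF 1(1)] PSh_Hom_closed[OF 1(2)])
    qed
    fix x assume "x \<in> carrier ?G"
    then have x: "x \<in> Hom (PSh U K a) Z F" by simp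
    note xD = PSh_HomD[OF x]
    show "\<one>\<^bsub>?G\<^esub> \<otimes>\<^bsub>?G\<^esub> x = x" unfolding monoid.simps
      by (rule PSh_Hom_eqI[OF cl[OF zc x] x]) (simp add: HomMod_PSh_add HomMod_PSh_zero abelian_monoid.l_zero[OF am] xD(2))
    let ?n = "mk_nat a Z (\<lambda>A y. \<ominus>\<^bsub>map_obj F A\<^esub> x A y)"
    have n: "?n \<in> Hom (PSh U K a) Z F"
    proof (rule mk_nat_Hom[OF Z])
      fix A y assume A: "A \<in> Obj a" and y: "y \<in> el Z A"
      interpret FA: module K "map_obj F A" by (rule PSh_module[OF F A])
      show "\<ominus>\<^bsub>map_obj F A\<^esub> x A y \<in> el F A" using xD(2)[OF A y] by simp
      show "\<ominus>\<^bsub>map_obj F A\<^esub> x A (y \<oplus>\<^bsub>map_obj Z A\<^esub> w) = \<ominus>\<^bsub>map_obj F A\<^esub> x A y \<oplus>\<^bsub>map_obj F A\<^esub> \<ominus>\<^bsub>map_obj F A\<^esub> x A w"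
        if w: "w \<in> el Z A" for w
        using xD(2)[OF A y] xD(2)[OF A w] by (simp add: xD(3)[OF A y w] FA.M.minus_add)
      show "\<ominus>\<^bsub>map_obj F A\<^esub> x A (c \<odot>\<^bsub>map_obj Z A\<^esub> y) = c \<odot>\<^bsub>map_obj F A\<^esub> (\<ominus>\<^bsub>map_obj F A\<^esub> x A y)" if c: "c \<in> carrier K" for c
        using xD(2)[OF A y] c by (simp add: xD(4)[OF A c y] FA.smult_r_minus)
      show "\<ominus>\<^bsub>map_obj F B\<^esub> x B (map_arr Z A B f y) = map_arr F A B f (\<ominus>\<^bsub>map_obj F A\<^esub> x A y)"
        if B: "B \<in> Obj a" and f: "f \<in> Hom a B A" for B f
      proof -
        note l = linear_mapsD[OF PSh_linear[OF F A B f]]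
        show ?thesis
          using additive_neg[OF PSh_module[OF F A] PSh_module[OF F B] l(2,3) xD(2)[OF A y]] xD(5)[OF A B f y] by simp
      qed
    qed
    have "?n \<otimes>\<^bsub>?G\<^esub> x = \<one>\<^bsub>?G\<^esub>" unfolding monoid.simps
      by (rule PSh_Hom_eqI[OF cl[OF n x] zc])
        (simp add: HomMod_PSh_add HomMod_PSh_zero mk_nat_apply abelian_group.l_neg[OF ag] xD(2))
    then show "\<exists>y\<in>carrier ?G. y \<otimes>\<^bsub>?G\<^esub> x = \<one>\<^bsub>?G\<^esub>" using n by auto
  qed
qed

lemma comp_inclusion_functor [simp]: "comp_functor inclusion_functor J = J"
  by (cases J) (simp add: comp_functor_def inclusion_functor_def)

lemma inclusion_functor_simps [simp]: "map_obj inclusion_functor A = A" "map_arr inclusion_functor A B f = f"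
  by (simp_all add: inclusion_functor_def)

locale sheaf_diagram = presheaf_diagram U K a T \<kappa> j J
  for U :: "'u set set" and K :: "'k ring" and a :: "('o, 'u, 'k) linear_category"
    and T :: "'o \<Rightarrow> ('o \<Rightarrow> 'u set) set" and \<kappa> :: "'c rel" and j :: "('u, 'u) category"
    and J :: "('u, 'u, ('o, 'k, 'u) presheaf, 'o \<Rightarrow> 'u \<Rightarrow> 'u) functor_data" +
  assumes J_sheaf: "x \<in> Obj j \<Longrightarrow> is_sheaf U K a T (map_obj J x)"

lemma (in site) sheaf_diagramI:
  assumes "Card_order \<kappa>" "cinfinite \<kappa>" "small_category U j" "filtered \<kappa> j" "is_functor j (Sh U K a T) J"
  shows "sheaf_diagram U K a T \<kappa> j J"
proof -
  interpret F: is_functor j "Sh U K a T" J by fact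
  show ?thesis
    by (intro sheaf_diagram.intro presheaf_diagram.intro filtered_category.intro site_axioms is_functor_Sh_PSh[OF assms(5)]
        sheaf_diagram_axioms.intro presheaf_diagram_axioms.intro filtered_category_axioms.intro assms F.C.category_axioms)
      (use F.map_obj_closed Sh_Obj_iff in blast)
qed

context sheaf_diagram
begin

lemma colimit_Sh_cocone:
  assumes "is_colimit j (Sh U K a T) J L l"
  shows "is_sheaf U K a T L" "is_cocone j PS J L l"
  using assms by (auto simp: is_colimit_def is_cocone_def Sh_Obj_iff sheaf_PSh)

lemma colimit_ShI:
  assumes "is_colimit j PS J L l" "is_sheaf U K a T L"
  shows "is_colimit j (Sh U K a T) J L l"
  using assms unfolding is_colimit_def is_cocone_def by (simp add: Sh_Obj_iff sheaf_PSh)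

lemma Ab_colimit:
  fixes G :: "('o \<Rightarrow> 'u \<Rightarrow> 'u) monoid"
  assumes X: "X \<in> Obj a" and Z: "is_sheaf U K a T Z" and e: "e \<in> el Z X"
    and hinj: "\<And>F h h'. \<lbrakk>is_sheaf U K a T F; h \<in> Hom PS Z F; h' \<in> Hom PS Z F; h X e = h' X e\<rbrakk> \<Longrightarrow> h = h'"
    and hsurj: "\<And>F z. is_sheaf U K a T F \<Longrightarrow> z \<in> el F X \<Longrightarrow> \<exists>h\<in>Hom PS Z F. h X e = z"
    and P: "fcolim P p" and G: "comm_group G"
    and gH: "\<And>x. x \<in> Obj j \<Longrightarrow>
        g x \<in> hom (map_obj (hom_functor (Sh U K a T) Z) (map_obj J x)) G \<inter> extensional (Hom PS Z (map_obj J x))"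
    and t: "bij_betw t (carrier G) (el P X)"
    and tg: "\<And>x h. x \<in> Obj j \<Longrightarrow> h \<in> Hom PS Z (map_obj J x) \<Longrightarrow> t (g x h) = p x X (h X e)"
  shows "is_colimit j Ab (comp_functor (hom_functor (Sh U K a T) Z) J) G g"
proof -
  let ?D = "comp_functor (hom_functor (Sh U K a T) Z) J"
  note ZP = sheaf_PSh[OF Z]
  have D: "map_obj ?D x = \<lparr>carrier = Hom PS Z (map_obj J x), mult = add (HomMod PS Z (map_obj J x)),
      one = zero (HomMod PS Z (map_obj J x))\<rparr>" for x
    by (simp add: comp_functor_def hom_functor_def)
  have Da: "map_arr ?D x y u h = Comp PS Z (map_obj J x) (map_obj J y) (map_arr J x y u) h"
    if "h \<in> Hom PS Z (map_obj J x)" for x y u h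
    using that by (simp add: comp_functor_def hom_functor_def)
  have Dc: "Comp PS Z (map_obj J x) (map_obj J y) (map_arr J x y u) h \<in> Hom PS Z (map_obj J y)"
    if "x \<in> Obj j" "y \<in> Obj j" "u \<in> Hom j x y" "h \<in> Hom PS Z (map_obj J x)" for x y u h
    by (rule PSh_Comp_closed[OF ZP that(4) J_Hom[OF that(1-3)]])
  have Dx: "Comp PS Z (map_obj J x) (map_obj J y) (map_arr J x y u) h X e = map_arr J x y u X (h X e)" for x y u h
    by (rule PSh_Comp_apply[OF X e])
  have ev: "h X e \<in> Jel x X" if "x \<in> Obj j" "h \<in> Hom PS Z (map_obj J x)" for x h
    by (rule PSh_Hom_closed[OF that(2) X e])
  have tinj: "z = w" if "z \<in> carrier G" "w \<in> carrier G" "t z = t w" for z w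
    using t that by (auto simp: bij_betw_def dest: inj_onD)
  have gc: "g x h \<in> carrier G" if "x \<in> Obj j" "h \<in> Hom PS Z (map_obj J x)" for x h
    using gH[OF that(1)] that(2) by (auto simp: hom_def hom_functor_def)
  show ?thesis
  proof (rule Ab_colimitI)
    show "comm_group (map_obj ?D x)" if "x \<in> Obj j" for x unfolding D by (rule comm_group_HomMod_PSh[OF ZP J_PSh[OF that]])
    show "map_arr ?D x y u \<in> hom (map_obj ?D x) (map_obj ?D y)" if x: "x \<in> Obj j" and y: "y \<in> Obj j" and u: "u \<in> Hom j x y" for x y u
    proof (rule homI)
      fix h assume "h \<in> el ?D x"
      then have h: "h \<in> Hom PS Z (map_obj J x)" unfolding D by simp
      show "map_arr ?D x y u h \<in> el ?D y" using Da[OF h] Dc[OF x y u h] unfolding D by simp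
    next
      fix h k assume "h \<in> el ?D x" "k \<in> el ?D x"
      then have h: "h \<in> Hom PS Z (map_obj J x)" and k: "k \<in> Hom PS Z (map_obj J x)" unfolding D by auto
      note hk = HomMod_PSh_add_closed[OF ZP J_PSh[OF x] h k]
      have "Comp PS Z (map_obj J x) (map_obj J y) (map_arr J x y u) (h \<oplus>\<^bsub>HomMod PS Z (map_obj J x)\<^esub> k) =
        Comp PS Z (map_obj J x) (map_obj J y) (map_arr J x y u) h \<oplus>\<^bsub>HomMod PS Z (map_obj J y)\<^esub>
        Comp PS Z (map_obj J x) (map_obj J y) (map_arr J x y u) k"
        by (rule PSh_Hom_eqI[OF Dc[OF x y u hk] HomMod_PSh_add_closed[OF ZP J_PSh[OF y] Dc[OF x y u h] Dc[OF x y u k]]])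
          (simp add: PSh_Comp_apply HomMod_PSh_add JD(3)[OF x y u] PSh_Hom_closed[OF h] PSh_Hom_closed[OF k])
      then show "map_arr ?D x y u (h \<otimes>\<^bsub>map_obj ?D x\<^esub> k) = map_arr ?D x y u h \<otimes>\<^bsub>map_obj ?D y\<^esub> map_arr ?D x y u k"
        unfolding D monoid.simps Da[OF h] Da[OF k] Da[OF hk] .
    qed
    show "comm_group G" by (rule G)
    show "g x \<in> hom (map_obj ?D x) G \<inter> extensional (el ?D x)" if "x \<in> Obj j" for x
      using gH[OF that] by (simp add: comp_functor_def hom_functor_def)
    show "g y (map_arr ?D x y u h) = g x h"
      if x: "x \<in> Obj j" and y: "y \<in> Obj j" and u: "u \<in> Hom j x y" and "h \<in> el ?D x" for x y u h
    proof -
      have h: "h \<in> Hom PS Z (map_obj J x)" using that(4) unfolding D by simp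
      note c = Dc[OF x y u h]
      show ?thesis unfolding Da[OF h]
        by (rule tinj[OF gc[OF y c] gc[OF x h]])
          (simp add: tg[OF y c] tg[OF x h] Dx fc_cocone[OF P x y u X ev[OF x h]])
    qed
    show "\<exists>x\<in>Obj j. \<exists>h\<in>el ?D x. g x h = z" if z: "z \<in> carrier G" for z
    proof -
      have "t z \<in> el P X" using t z by (auto simp: bij_betw_def)
      then obtain x y where x: "x \<in> Obj j" "y \<in> Jel x X" "p x X y = t z" using fc_surj[OF P X] by blast
      obtain h where h: "h \<in> Hom PS Z (map_obj J x)" "h X e = y" using hsurj[OF J_sheaf[OF x(1)] x(2)] by blast
      have "g x h = z" by (rule tinj[OF gc[OF x(1) h(1)] z]) (simp add: tg[OF x(1) h(1)] h x)
      then show ?thesis using x(1) h(1) unfolding D by auto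
    qed
    show "\<exists>y\<in>Obj j. \<exists>u\<in>Hom j x y. map_arr ?D x y u h = map_arr ?D x y u k"
      if x: "x \<in> Obj j" and "h \<in> el ?D x" "k \<in> el ?D x" and eq: "g x h = g x k" for x h k
    proof -
      have h: "h \<in> Hom PS Z (map_obj J x)" and k: "k \<in> Hom PS Z (map_obj J x)" using that unfolding D by auto
      have "p x X (h X e) = p x X (k X e)" using tg[OF x h] tg[OF x k] eq by simp
      then obtain y u where y: "y \<in> Obj j" "u \<in> Hom j x y" "map_arr J x y u X (h X e) = map_arr J x y u X (k X e)"
        using fc_inj[OF P X x ev[OF x h] ev[OF x k]] by blast
      have "map_arr ?D x y u h = map_arr ?D x y u k" unfolding Da[OF h] Da[OF k]
        by (rule hinj[OF J_sheaf[OF y(1)] Dc[OF x y(1,2) h] Dc[OF x y(1,2) k]]) (simp add: Dx y)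
      then show ?thesis using y by blast
    qed
  qed
qed

lemma bij_betw_eval:
  assumes X: "X \<in> Obj a" and Z: "is_sheaf U K a T Z" and e: "e \<in> el Z X"
    and hinj: "\<And>F h h'. \<lbrakk>is_sheaf U K a T F; h \<in> Hom PS Z F; h' \<in> Hom PS Z F; h X e = h' X e\<rbrakk> \<Longrightarrow> h = h'"
    and hsurj: "\<And>F z. is_sheaf U K a T F \<Longrightarrow> z \<in> el F X \<Longrightarrow> \<exists>h\<in>Hom PS Z F. h X e = z"
    and L: "is_sheaf U K a T L"
  shows "bij_betw (\<lambda>h. h X e) (Hom PS Z L) (el L X)"
proof (rule bij_betw_imageI)
  show "inj_on (\<lambda>h. h X e) (Hom PS Z L)" by (rule inj_onI) (rule hinj[OF L])
  have "h X e \<in> el L X" if "h \<in> Hom PS Z L" for h by (rule PSh_Hom_closed[OF that X e])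
  then show "(\<lambda>h. h X e) ` Hom PS Z L = el L X" using hsurj[OF L] by blast
qed

lemma compact_if_fcolim:
  assumes X: "X \<in> Obj a" and fc: "\<And>L l. is_colimit j (Sh U K a T) J L l \<Longrightarrow> fcolim L l"
  shows "commutes_with_colimit j (Sh U K a T) Ab (hom_functor (Sh U K a T) (sheafify U K a T (Yoneda a X))) J"
proof -
  let ?Z = "sheafify U K a T (Yoneda a X)"
  let ?H = "hom_functor (Sh U K a T) ?Z"
  obtain e where e: "is_sheaf U K a T ?Z" "e \<in> el ?Z X"
    "\<And>F h h'. \<lbrakk>is_sheaf U K a T F; h \<in> Hom PS ?Z F; h' \<in> Hom PS ?Z F; h X e = h' X e\<rbrakk> \<Longrightarrow>
      h = h'"
    "\<And>F z. is_sheaf U K a T F \<Longrightarrow> z \<in> el F X \<Longrightarrow> \<exists>h\<in>Hom PS ?Z F. h X e = z"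
    by (rule sheafified_Yoneda[OF X]) (rule that)
  note ZP = sheaf_PSh[OF e(1)]
  show ?thesis unfolding commutes_with_colimit_def
  proof (intro allI impI)
    fix L l P p assume L: "is_colimit j (Sh U K a T) J L l" and P: "is_colimit j Ab (comp_functor ?H J) P p"
    note Ls = colimit_Sh_cocone(1)[OF L] and f = fc[OF L]
    note LP = sheaf_PSh[OF Ls] and lH = fc_Hom[OF f]
    have app: "Comp PS ?Z F G s h X e = s X (h X e)" for F G s h by (rule PSh_Comp_apply[OF X e(2)])
    have "is_colimit j Ab (comp_functor ?H J) (map_obj ?H L) (\<lambda>x. map_arr ?H (map_obj J x) L (l x))"
    proof (rule Ab_colimit[OF X e f, where t = "\<lambda>h. h X e"])
      show "comm_group (map_obj ?H L)" using comm_group_HomMod_PSh[OF ZP LP] by (simp add: hom_functor_def)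
      show "bij_betw (\<lambda>h. h X e) (el ?H L) (el L X)"
        using bij_betw_eval[OF X e Ls] by (simp add: hom_functor_def)
    next
      fix x assume x: "x \<in> Obj j"
      show "map_arr ?H (map_obj J x) L (l x) \<in> hom (map_obj ?H (map_obj J x)) (map_obj ?H L) \<inter>
        extensional (Hom PS ?Z (map_obj J x))"
      proof
        show "map_arr ?H (map_obj J x) L (l x) \<in> hom (map_obj ?H (map_obj J x)) (map_obj ?H L)"
        proof (rule homI)
          fix h assume "h \<in> el ?H (map_obj J x)"
          then show "map_arr ?H (map_obj J x) L (l x) h \<in> el ?H L"
            using PSh_Comp_closed[OF ZP _ lH[OF x]] by (simp add: hom_functor_def)
        next
          fix h k assume "h \<in> el ?H (map_obj J x)" "k \<in> el ?H (map_obj J x)"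
          then have h: "h \<in> Hom PS ?Z (map_obj J x)" and k: "k \<in> Hom PS ?Z (map_obj J x)"
            by (auto simp: hom_functor_def)
          note hk = HomMod_PSh_add_closed[OF ZP J_PSh[OF x] h k]
          note c = PSh_Comp_closed[OF ZP _ lH[OF x]]
          have "Comp PS ?Z (map_obj J x) L (l x) (h \<oplus>\<^bsub>HomMod PS ?Z (map_obj J x)\<^esub> k) =
            Comp PS ?Z (map_obj J x) L (l x) h \<oplus>\<^bsub>HomMod PS ?Z L\<^esub> Comp PS ?Z (map_obj J x) L (l x) k"
            by (rule e(3)[OF Ls c[OF hk] HomMod_PSh_add_closed[OF ZP LP c[OF h] c[OF k]]])
              (simp add: app HomMod_PSh_add X e(2) PSh_Hom_add[OF lH[OF x] X] PSh_Hom_closed[OF h X] PSh_Hom_closed[OF k X])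
          then show "map_arr ?H (map_obj J x) L (l x) (h \<otimes>\<^bsub>map_obj ?H (map_obj J x)\<^esub> k) =
            map_arr ?H (map_obj J x) L (l x) h \<otimes>\<^bsub>map_obj ?H L\<^esub> map_arr ?H (map_obj J x) L (l x) k"
            using h k hk by (simp add: hom_functor_def)
        qed
      qed (simp add: hom_functor_def)
      show "map_arr ?H (map_obj J x) L (l x) h X e = l x X (h X e)" if "h \<in> Hom PS ?Z (map_obj J x)" for h
        using that app by (simp add: hom_functor_def)
    qed
    note Q = this
    have Ob: "map_obj (comp_functor ?H J) x \<in> Obj Ab" if "x \<in> Obj j" for x
      using comm_group_HomMod_PSh[OF ZP J_PSh[OF that]] by (simp add: hom_functor_def comp_functor_def Ab_def)
    obtain h where h: "is_iso Ab P (map_obj ?H L) h"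
      "\<And>x. x \<in> Obj j \<Longrightarrow> Comp Ab (map_obj (comp_functor ?H J) x) P (map_obj ?H L) h (p x) = map_arr ?H (map_obj J x) L (l x)"
      by (rule colimit_iso[OF category_Ab P Q Ob]) (assumption, rule that)
    then show "\<exists>h. is_iso Ab P (map_obj ?H L) h \<and> (\<forall>x\<in>Obj j. Comp Ab (map_obj ?H (map_obj J x)) P (map_obj ?H L) h (p x) =
        map_arr ?H (map_obj J x) L (l x))"
      by (intro exI[of _ h]) (simp add: comp_functor_def)
  qed
qed

lemma fcolim_if_compact:
  assumes comp: "\<And>X. X \<in> Obj a \<Longrightarrow>
      commutes_with_colimit j (Sh U K a T) Ab (hom_functor (Sh U K a T) (sheafify U K a T (Yoneda a X))) J"
    and L: "is_colimit j (Sh U K a T) J L l" and P: "is_colimit j PS J P p"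
  shows "\<exists>h. is_iso PS P L h \<and> (\<forall>x\<in>Obj j. Comp PS (map_obj J x) P L h (p x) = l x)"
proof -
  note Ls = colimit_Sh_cocone(1)[OF L] and Lc = colimit_Sh_cocone(2)[OF L]
  note LP = sheaf_PSh[OF Ls]
  have f: "fcolim P p" by (rule colimit_fcolim[OF P])
  note PP = fc_PSh[OF f] and pH = fc_Hom[OF f]
  have lH: "l x \<in> Hom PS (map_obj J x) L" if "x \<in> Obj j" for x using Lc that by (simp add: cocone_iff)
  obtain h where h: "h \<in> Hom PS P L" "\<And>x. x \<in> Obj j \<Longrightarrow> Comp PS (map_obj J x) P L h (p x) = l x"
    using P Lc unfolding is_colimit_def by blast
  have "bij_betw (h X) (el P X) (el L X)" if X: "X \<in> Obj a" for X
  proof -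
    let ?Z = "sheafify U K a T (Yoneda a X)"
    let ?H = "hom_functor (Sh U K a T) ?Z"
    obtain e where e: "is_sheaf U K a T ?Z" "e \<in> el ?Z X"
      "\<And>F h h'. \<lbrakk>is_sheaf U K a T F; h \<in> Hom PS ?Z F; h' \<in> Hom PS ?Z F; h X e = h' X e\<rbrakk> \<Longrightarrow>
      h = h'"
      "\<And>F z. is_sheaf U K a T F \<Longrightarrow> z \<in> el F X \<Longrightarrow> \<exists>h\<in>Hom PS ?Z F. h X e = z"
      by (rule sheafified_Yoneda[OF X]) (rule that)
    note ZP = sheaf_PSh[OF e(1)]
    define c :: "'u \<Rightarrow> 'o \<Rightarrow> 'u \<Rightarrow> 'u" where "c y = (\<lambda>_ _. y)" for y
    define t :: "('o \<Rightarrow> 'u \<Rightarrow> 'u) \<Rightarrow> 'u" where "t k = k undefined undefined" for k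
    have tc [simp]: "t (c y) = y" for y by (simp add: t_def c_def)
    interpret PX: module K "map_obj P X" by (rule PSh_module[OF PP X])
    let ?S = "el P X"
    define G where "G = \<lparr>carrier = c ` ?S, mult = \<lambda>k m. c (t k \<oplus>\<^bsub>map_obj P X\<^esub> t m),
      one = c \<zero>\<^bsub>map_obj P X\<^esub>\<rparr>"
    have G: "comm_group G"
    proof (rule comm_groupI)
      fix k assume "k \<in> carrier G"
      then obtain y where y: "y \<in> ?S" "k = c y" by (auto simp: G_def)
      then show "\<exists>m\<in>carrier G. m \<otimes>\<^bsub>G\<^esub> k = \<one>\<^bsub>G\<^esub>"
        by (intro bexI[of _ "c (\<ominus>\<^bsub>map_obj P X\<^esub> y)"]) (auto simp: G_def PX.M.l_neg)
    qed (auto simp: G_def PX.M.a_ac)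
    define g where "g x = (\<lambda>h\<in>Hom PS ?Z (map_obj J x). c (p x X (h X e)))" for x
    have ev: "k X e \<in> Jel x X" if "k \<in> Hom PS ?Z (map_obj J x)" for x k
      by (rule PSh_Hom_closed[OF that X e(2)])
    have "is_colimit j Ab (comp_functor ?H J) G g"
    proof (rule Ab_colimit[OF X e f G, where t = t])
      show "bij_betw t (carrier G) ?S"
        by (rule bij_betw_byWitness[of _ c]) (auto simp: G_def)
    next
      fix x assume x: "x \<in> Obj j"
      show "g x \<in> hom (map_obj ?H (map_obj J x)) G \<inter> extensional (Hom PS ?Z (map_obj J x))"
      proof
        show "g x \<in> hom (map_obj ?H (map_obj J x)) G"
        proof (rule homI)
          fix k assume "k \<in> el ?H (map_obj J x)"
          then show "g x k \<in> carrier G"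
            using PSh_Hom_closed[OF pH[OF x] X] ev by (auto simp: hom_functor_def g_def G_def)
        next
          fix k m assume "k \<in> el ?H (map_obj J x)" "m \<in> el ?H (map_obj J x)"
          then have k: "k \<in> Hom PS ?Z (map_obj J x)" and m: "m \<in> Hom PS ?Z (map_obj J x)"
            by (auto simp: hom_functor_def)
          show "g x (k \<otimes>\<^bsub>map_obj ?H (map_obj J x)\<^esub> m) = g x k \<otimes>\<^bsub>G\<^esub> g x m"
            using k m HomMod_PSh_add_closed[OF ZP J_PSh[OF x] k m] PSh_Hom_add[OF pH[OF x] X ev[OF k] ev[OF m]]
            by (simp add: hom_functor_def g_def G_def HomMod_PSh_add X e(2))
        qed
      qed (simp add: g_def)
      show "t (g x k) = p x X (k X e)" if "k \<in> Hom PS ?Z (map_obj J x)" for k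
        using that by (simp add: g_def)
    qed
    then obtain k where k: "is_iso Ab G (map_obj ?H L) k"
      "\<And>x. x \<in> Obj j \<Longrightarrow> Comp Ab (map_obj ?H (map_obj J x)) G (map_obj ?H L) k (g x) = map_arr ?H (map_obj J x) L (l x)"
      using comp[OF X] L unfolding commutes_with_colimit_def by blast
    have Hc: "el ?H F = Hom PS ?Z F" for F by (simp add: hom_functor_def)
    have kb: "bij_betw k (carrier G) (Hom PS ?Z L)"
    proof -
      obtain k' where k': "k' \<in> Hom Ab (map_obj ?H L) G" "Comp Ab G (map_obj ?H L) G k' k = Ident Ab G"
        "Comp Ab (map_obj ?H L) G (map_obj ?H L) k k' = Ident Ab (map_obj ?H L)" and kH: "k \<in> Hom Ab G (map_obj ?H L)"
        using k(1) unfolding is_iso_def by blast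
      have "k' (k y) = y" if "y \<in> carrier G" for y
        using fun_cong[OF k'(2), of y] that by (simp add: Ab_def compose_def)
      moreover have "k (k' y) = y" if "y \<in> Hom PS ?Z L" for y
        using fun_cong[OF k'(3), of y] that by (simp add: Ab_def compose_def Hc)
      moreover have "k ` carrier G \<subseteq> Hom PS ?Z L" using kH by (auto simp: Ab_def hom_def Hc)
      moreover have "k' ` Hom PS ?Z L \<subseteq> carrier G" using k'(1) by (auto simp: Ab_def hom_def Hc)
      ultimately show ?thesis by (intro bij_betw_byWitness[of _ k']) auto
    qed
    have eb: "bij_betw (\<lambda>s. s X e) (Hom PS ?Z L) (el L X)"
      by (rule bij_betw_eval[OF X e Ls])
    have cb: "bij_betw c ?S (carrier G)" by (rule bij_betw_byWitness[of _ t]) (auto simp: G_def)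
    have "bij_betw ((\<lambda>s. s X e) \<circ> (k \<circ> c)) ?S (el L X)"
      by (rule bij_betw_trans[OF bij_betw_trans[OF cb kb] eb])
    moreover have "((\<lambda>s. s X e) \<circ> (k \<circ> c)) y = h X y" if y: "y \<in> ?S" for y
    proof -
      obtain x z where x: "x \<in> Obj j" "z \<in> Jel x X" "p x X z = y" using fc_surj[OF f X y] by blast
      obtain s where s: "s \<in> Hom PS ?Z (map_obj J x)" "s X e = z" using e(4)[OF J_sheaf[OF x(1)] x(2)] by blast
      have "k (g x s) = Comp PS ?Z (map_obj J x) L (l x) s"
        using fun_cong[OF k(2)[OF x(1)], of s] s(1) by (simp add: Ab_def compose_def Hc, simp add: hom_functor_def)
      then have "k (c y) X e = l x X z" using s x(3) PSh_Comp_apply[OF X e(2)] by (simp add: g_def)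
      also have "\<dots> = h X y" using fun_cong[OF fun_cong[OF h(2)[OF x(1)], of X], of z] PSh_Comp_apply[OF X x(2)] x(3) by simp
      finally show ?thesis by simp
    qed
    ultimately show ?thesis using bij_betw_cong[of ?S "(\<lambda>s. s X e) \<circ> (k \<circ> c)" "h X"] by blast
  qed
  then have "is_iso PS P L h" by (rule is_iso_PShI[OF PP LP h(1)])
  then show ?thesis using h(2) by blast
qed

lemma fcolim_if_commutes:
  assumes "commutes_with_colimit j (Sh U K a T) PS inclusion_functor J" "is_colimit j (Sh U K a T) J L l"
  shows "fcolim L l"
proof -
  obtain P p where P: "fcolim P p" by (rule fcolim_exists)
  obtain h where "is_iso PS P L h" "\<And>x. x \<in> Obj j \<Longrightarrow> Comp PS (map_obj J x) P L h (p x) = l x"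
  proof -
    have "\<exists>h. is_iso PS P L h \<and> (\<forall>x\<in>Obj j. Comp PS (map_obj J x) P L h (p x) = l x)"
      using assms fcolim_is_colimit[OF P] unfolding commutes_with_colimit_def by simp
    then show thesis using that by blast
  qed
  then show ?thesis using fcolim_iso[OF P] sheaf_PSh[OF colimit_Sh_cocone(1)[OF assms(2)]] by blast
qed

end

context site
begin

definition commutes_filtered :: "'c rel \<Rightarrow> bool" where
  "commutes_filtered \<kappa> \<longleftrightarrow> (\<forall>(j :: ('u, 'u) category) J.
        small_category U j \<longrightarrow> filtered \<kappa> j \<longrightarrow> is_functor j (Sh U K a T) J \<longrightarrow>
        commutes_with_colimit j (Sh U K a T) PS inclusion_functor J)"

lemma noetherian_iff_commutes:
  assumes \<kappa>: "Card_order \<kappa>" "cinfinite \<kappa>"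
  shows "noetherian_topology U \<kappa> K a T \<longleftrightarrow> commutes_filtered \<kappa>"
proof
  assume noeth: "noetherian_topology U \<kappa> K a T"
  show "commutes_filtered \<kappa>"
    unfolding commutes_filtered_def
  proof (intro allI impI)
    fix j :: "('u, 'u) category" and J
    assume j: "small_category U j" "filtered \<kappa> j" "is_functor j (Sh U K a T) J"
    interpret sheaf_diagram U K a T \<kappa> j J by (rule sheaf_diagramI[OF \<kappa> j])
    have "commutes_with_colimit j (Sh U K a T) Ab (hom_functor (Sh U K a T) (sheafify U K a T (Yoneda a X))) J"
      if "X \<in> Obj a" for X
      using noeth that j unfolding noetherian_topology_def compact_object_def by blast
    then show "commutes_with_colimit j (Sh U K a T) PS inclusion_functor J"
      unfolding commutes_with_colimit_def[of j "Sh U K a T" PS] using fcolim_if_compact by simp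
  qed
next
  assume com: "commutes_filtered \<kappa>"
  show "noetherian_topology U \<kappa> K a T"
    unfolding noetherian_topology_def compact_object_def
  proof (intro ballI conjI allI impI)
    fix X assume X: "X \<in> Obj a"
    show "sheafify U K a T (Yoneda a X) \<in> Obj (Sh U K a T)"
      unfolding Sh_Obj_iff by (rule sheafified_Yoneda[OF X])
    fix j :: "('u, 'u) category" and J
    assume j: "small_category U j" "filtered \<kappa> j" "is_functor j (Sh U K a T) J"
    interpret sheaf_diagram U K a T \<kappa> j J by (rule sheaf_diagramI[OF \<kappa> j])
    show "commutes_with_colimit j (Sh U K a T) Ab (hom_functor (Sh U K a T) (sheafify U K a T (Yoneda a X))) J"
      by (rule compact_if_fcolim[OF X fcolim_if_commutes]) (use com j in \<open>auto simp: commutes_filtered_def\<close>)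
  qed
qed

end

section \<open>Formal morphisms acting on presheaves\<close>

lemma finsum_additive:
  assumes M: "module K M" and N: "module K N" and S: "finite S"
    and C: "C \<subseteq> carrier M" "\<zero>\<^bsub>M\<^esub> \<in> C"
        "\<And>x y. x \<in> C \<Longrightarrow> y \<in> C \<Longrightarrow> x \<oplus>\<^bsub>M\<^esub> y \<in> C"
    and \<phi>: "\<And>x. x \<in> C \<Longrightarrow> \<phi> x \<in> carrier N"
    "\<And>x y. x \<in> C \<Longrightarrow> y \<in> C \<Longrightarrow>
      \<phi> (x \<oplus>\<^bsub>M\<^esub> y) = \<phi> x \<oplus>\<^bsub>N\<^esub> \<phi> y"
    and f: "\<And>i. i \<in> S \<Longrightarrow> f i \<in> C"
  shows "finsum M f S \<in> C \<and> \<phi> (finsum M f S) = finsum N (\<lambda>i. \<phi> (f i)) S"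
proof -
  interpret M: module K M by fact
  interpret N: module K N by fact
  have "\<phi> \<zero>\<^bsub>M\<^esub> \<oplus>\<^bsub>N\<^esub> \<phi> \<zero>\<^bsub>M\<^esub> = \<phi> \<zero>\<^bsub>M\<^esub>"
      using \<phi>(2)[OF C(2,2)] by simp
  then have z: "\<phi> \<zero>\<^bsub>M\<^esub> = \<zero>\<^bsub>N\<^esub>" using module_add_self_zero[OF N \<phi>(1)[OF C(2)]] by simp
  show ?thesis using S f
  proof (induction S rule: finite_induct)
    case empty
    then show ?case using C(2) z by simp
  next
    case (insert i S)
    then have i: "f i \<in> C" "\<And>k. k \<in> S \<Longrightarrow> f k \<in> C" by auto
    have 1: "finsum M f (insert i S) = f i \<oplus>\<^bsub>M\<^esub> finsum M f S"
      using insert.hyps i C(1) by (intro M.M.finsum_insert) auto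
    have 2: "finsum N (\<lambda>i. \<phi> (f i)) (insert i S) = \<phi> (f i) \<oplus>\<^bsub>N\<^esub> finsum N (\<lambda>i. \<phi> (f i)) S"
      using insert.hyps i \<phi>(1) by (intro N.M.finsum_insert) auto
    show ?case unfolding 1 2 using insert.IH i C(3) \<phi>(2) by auto
  qed
qed

context site
begin

definition row :: "'o \<Rightarrow> ('l, 'o) family \<Rightarrow> ('l \<Rightarrow> 'u) \<Rightarrow> bool" where
  "row B V g \<longleftrightarrow> (\<forall>i\<in>labels V. g i \<in> Hom a B (summand V i)) \<and>
     finite {i \<in> labels V. g i \<noteq> \<zero>\<^bsub>HomMod a B (summand V i)\<^esub>}"

text \<open>
  A family of sections \<open>y i\<close> of \<open>F\<close> over the summands of \<open>V\<close> is a morphism from the direct sum of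
  representables to \<open>F\<close>; \<open>ev\<close> applies it to a section of that direct sum.
\<close>

definition ev :: "('o, 'k, 'u) presheaf \<Rightarrow> ('l, 'o)
  family \<Rightarrow> 'o \<Rightarrow> ('l \<Rightarrow> 'u) \<Rightarrow> ('l \<Rightarrow> 'u) \<Rightarrow> 'u" where
  "ev F V B y g = finsum (map_obj F B) (\<lambda>i. map_arr F (summand V i) B (g i) (y i))
     {i \<in> labels V. g i \<noteq> \<zero>\<^bsub>HomMod a B (summand V i)\<^esub>}"

lemma formal_morphisms_row: "f \<in> formal_morphisms a W V \<longleftrightarrow> (\<forall>x\<in>labels W. row (summand W x) V (f x))"
  by (simp add: formal_morphisms_def row_def)

definition sections :: "('o, 'k, 'u) presheaf \<Rightarrow> ('l, 'o) family \<Rightarrow> ('l \<Rightarrow> 'u) \<Rightarrow> bool" where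
  "sections F V y \<longleftrightarrow> (\<forall>i\<in>labels V. summand V i \<in> Obj a \<and> y i \<in> el F (summand V i))"

lemma map_arr_zero_hom:
  assumes F: "F \<in> Obj PS" and A: "A \<in> Obj a" and B: "B \<in> Obj a" and x: "x \<in> el F A"
  shows "map_arr F A B \<zero>\<^bsub>HomMod a B A\<^esub> x = \<zero>\<^bsub>map_obj F B\<^esub>"
  using A B x PSh_closed[OF F A B] PSh_hom_add[OF F A B]
  by (intro additive_zero[OF module_HomMod[OF B A] PSh_module[OF F B], of "\<lambda>f. map_arr F A B f x"])
    (auto simp: carrier_HomMod)

lemma ev_superset:
  assumes F: "F \<in> Obj PS" and B: "B \<in> Obj a" and y: "sections F V y" and g: "row B V g"
    and S: "finite S" "S \<subseteq> labels V" "\<And>i. i \<in> labels V \<Longrightarrow>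
        g i \<noteq> \<zero>\<^bsub>HomMod a B (summand V i)\<^esub> \<Longrightarrow> i \<in> S"
  shows "ev F V B y g = finsum (map_obj F B) (\<lambda>i. map_arr F (summand V i) B (g i) (y i)) S"
proof -
  interpret FB: module K "map_obj F B" by (rule PSh_module[OF F B])
  show ?thesis unfolding ev_def
    by (rule FB.M.add.finprod_mono_neutral_cong_left)
      (use S y g map_arr_zero_hom[OF F _ B] PSh_closed[OF F _ B] in \<open>auto simp: sections_def row_def\<close>)
qed

lemma ev_closed:
  assumes F: "F \<in> Obj PS" and B: "B \<in> Obj a" and y: "sections F V y" and g: "row B V g"
  shows "ev F V B y g \<in> el F B"
proof -
  interpret FB: module K "map_obj F B" by (rule PSh_module[OF F B])
  show ?thesis unfolding ev_def
    by (rule FB.M.finsum_closed) (use y g PSh_closed[OF F _ B] in \<open>auto simp: sections_def row_def\<close>)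
qed

lemma ev_cong:
  assumes F: "F \<in> Obj PS" and B: "B \<in> Obj a" and y: "sections F V y" and g: "row B V g"
    and "\<And>i. i \<in> labels V \<Longrightarrow> g i = h i" "\<And>i. i \<in> labels V \<Longrightarrow> y i = z i"
  shows "ev F V B y g = ev F V B z h"
proof -
  interpret FB: module K "map_obj F B" by (rule PSh_module[OF F B])
  have "{i \<in> labels V. g i \<noteq> \<zero>\<^bsub>HomMod a B (summand V i)\<^esub>} = {i \<in> labels V. h i \<noteq> \<zero>\<^bsub>HomMod a B (summand V i)\<^esub>}"
    using assms(5) by auto
  then show ?thesis unfolding ev_def
    by (intro FB.M.finsum_cong') (use assms PSh_closed[OF F _ B] in \<open>auto simp: sections_def row_def\<close>)
qed

lemma row_add:
  assumes B: "B \<in> Obj a" and V: "\<And>i. i \<in> labels V \<Longrightarrow> summand V i \<in> Obj a" and g: "row B V g" and h: "row B V h"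
  shows "row B V (\<lambda>i. g i \<oplus>\<^bsub>HomMod a B (summand V i)\<^esub> h i)"
proof -
  have "{i \<in> labels V. g i \<oplus>\<^bsub>HomMod a B (summand V i)\<^esub> h i \<noteq> \<zero>\<^bsub>HomMod a B (summand V i)\<^esub>} \<subseteq>
    {i \<in> labels V. g i \<noteq> \<zero>\<^bsub>HomMod a B (summand V i)\<^esub>} \<union> {i \<in> labels V. h i \<noteq> \<zero>\<^bsub>HomMod a B (summand V i)\<^esub>}"
  proof -
    have "\<zero>\<^bsub>HomMod a B (summand V i)\<^esub> \<oplus>\<^bsub>HomMod a B (summand V i)\<^esub> \<zero>\<^bsub>HomMod a B (summand V i)\<^esub> = \<zero>\<^bsub>HomMod a B (summand V i)\<^esub>"
      if "i \<in> labels V" for i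
    proof -
      interpret H: module K "HomMod a B (summand V i)" by (rule module_HomMod[OF B V[OF that]])
      show ?thesis by simp
    qed
    then show ?thesis by auto
  qed
  then show ?thesis using g h V B Hom_add_closed unfolding row_def by (auto intro: finite_subset)
qed

lemma ev_add:
  assumes F: "F \<in> Obj PS" and B: "B \<in> Obj a" and y: "sections F V y" and g: "row B V g" and h: "row B V h"
  shows "ev F V B y (\<lambda>i. g i \<oplus>\<^bsub>HomMod a B (summand V i)\<^esub> h i) = ev F V B y g \<oplus>\<^bsub>map_obj F B\<^esub> ev F V B y h"
proof -
  interpret FB: module K "map_obj F B" by (rule PSh_module[OF F B])
  have V: "\<And>i. i \<in> labels V \<Longrightarrow> summand V i \<in> Obj a" using y by (simp add: sections_def)
  note gh = row_add[OF B V g h]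
  let ?z = "\<lambda>i. \<zero>\<^bsub>HomMod a B (summand V i)\<^esub>"
  let ?S = "{i \<in> labels V. g i \<noteq> ?z i} \<union> {i \<in> labels V. h i \<noteq> ?z i}
    \<union> {i \<in> labels V. g i \<oplus>\<^bsub>HomMod a B (summand V i)\<^esub> h i \<noteq> ?z i}"
  have S: "finite ?S" "?S \<subseteq> labels V" using g h gh unfolding row_def by auto
  have c: "(\<lambda>i. map_arr F (summand V i) B (k i) (y i)) \<in> ?S \<rightarrow> el F B" if "row B V k" for k
    using that y S PSh_closed[OF F _ B] unfolding row_def sections_def by (intro Pi_I) auto
  have "ev F V B y (\<lambda>i. g i \<oplus>\<^bsub>HomMod a B (summand V i)\<^esub> h i) = finsum (map_obj F B)
      (\<lambda>i. map_arr F (summand V i) B (g i \<oplus>\<^bsub>HomMod a B (summand V i)\<^esub> h i) (y i)) ?S"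
    by (rule ev_superset[OF F B y gh S]) auto
  also have "\<dots> = finsum (map_obj F B) (\<lambda>i. map_arr F (summand V i)
    B (g i) (y i) \<oplus>\<^bsub>map_obj F B\<^esub> map_arr F (summand V i) B (h i) (y i)) ?S"
    by (rule FB.M.finsum_cong') (use c[OF g] c[OF h] S(2) y g h PSh_hom_add[OF F _ B] in \<open>auto simp: sections_def row_def Pi_def\<close>)
  also have "\<dots> = finsum (map_obj F B) (\<lambda>i. map_arr F (summand V i) B (g i) (y i)) ?S \<oplus>\<^bsub>map_obj F B\<^esub>
      finsum (map_obj F B) (\<lambda>i. map_arr F (summand V i) B (h i) (y i)) ?S"
    by (rule FB.M.finsum_addf[OF c[OF g] c[OF h]])
  also have "finsum (map_obj F B) (\<lambda>i. map_arr F (summand V i) B (g i) (y i)) ?S = ev F V B y g"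
    by (rule ev_superset[OF F B y g S, symmetric]) auto
  also have "finsum (map_obj F B) (\<lambda>i. map_arr F (summand V i) B (h i) (y i)) ?S = ev F V B y h"
    by (rule ev_superset[OF F B y h S, symmetric]) auto
  finally show ?thesis .
qed

lemma row_smult:
  assumes B: "B \<in> Obj a" and V: "\<And>i. i \<in> labels V \<Longrightarrow> summand V i \<in> Obj a" and g: "row B V g"
      and c: "c \<in> carrier K"
  shows "row B V (\<lambda>i. c \<odot>\<^bsub>HomMod a B (summand V i)\<^esub> g i)"
proof -
  have "{i \<in> labels V. c \<odot>\<^bsub>HomMod a B (summand V i)\<^esub> g i \<noteq> \<zero>\<^bsub>HomMod a B (summand V i)\<^esub>} \<subseteq>
    {i \<in> labels V. g i \<noteq> \<zero>\<^bsub>HomMod a B (summand V i)\<^esub>}"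
    using module.smult_r_null[OF module_HomMod[OF B V] c] by auto
  then show ?thesis using g V B c Hom_smult_closed unfolding row_def by (auto intro: finite_subset)
qed

lemma row_Comp:
  assumes B: "B \<in> Obj a" and D: "D \<in> Obj a" and V: "\<And>i. i \<in> labels V \<Longrightarrow> summand V i \<in> Obj a"
    and g: "row B V g" and k: "k \<in> Hom a D B"
  shows "row D V (\<lambda>i. Comp a D B (summand V i) (g i) k)"
proof -
  have "Comp a D B (summand V i) \<zero>\<^bsub>HomMod a B (summand V i)\<^esub> k = \<zero>\<^bsub>HomMod a D (summand V i)\<^esub>"
      if "i \<in> labels V" for i
    using map_arr_zero_hom[OF Yoneda_PSh[OF V[OF that]] _ D] that B D V k
    by (intro additive_zero[OF module_HomMod[OF B V[OF that]] module_HomMod[OF D V[OF that]], of "\<lambda>f. Comp a D B (summand V i) f k"])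
      (auto simp: carrier_HomMod Comp_closed Comp_add_left)
  then have "{i \<in> labels V. Comp a D B (summand V i) (g i) k \<noteq> \<zero>\<^bsub>HomMod a D (summand V i)\<^esub>} \<subseteq>
    {i \<in> labels V. g i \<noteq> \<zero>\<^bsub>HomMod a B (summand V i)\<^esub>}" by auto
  then show ?thesis using g V B D k Comp_closed unfolding row_def by (auto intro: finite_subset)
qed

lemma ev_additive:
  assumes F: "F \<in> Obj PS" and B: "B \<in> Obj a" and y: "sections F V y" and g: "row B V g"
    and N: "module K N" and \<phi>: "\<And>x. x \<in> el F B \<Longrightarrow> \<phi> x \<in> carrier N"
    "\<And>x w. x \<in> el F B \<Longrightarrow> w \<in> el F B \<Longrightarrow>
      \<phi> (x \<oplus>\<^bsub>map_obj F B\<^esub> w) = \<phi> x \<oplus>\<^bsub>N\<^esub> \<phi> w"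
  shows "\<phi> (ev F V B y g) = finsum N (\<lambda>i. \<phi> (map_arr F (summand V i) B (g i) (y i)))
     {i \<in> labels V. g i \<noteq> \<zero>\<^bsub>HomMod a B (summand V i)\<^esub>}"
  unfolding ev_def
  by (rule conjunct2[OF finsum_additive[OF PSh_module[OF F B] N, where C = "el F B"]])
    (use y g PSh_closed[OF F _ B] \<phi> module_zero_closed[OF PSh_module[OF F B]] module_add_closed[OF PSh_module[OF F B]]
      in \<open>auto simp: sections_def row_def\<close>)

lemma ev_smult:
  assumes F: "F \<in> Obj PS" and B: "B \<in> Obj a" and y: "sections F V y" and g: "row B V g" and c: "c \<in> carrier K"
  shows "ev F V B y (\<lambda>i. c \<odot>\<^bsub>HomMod a B (summand V i)\<^esub> g i) = c \<odot>\<^bsub>map_obj F B\<^esub> ev F V B y g"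
proof -
  interpret FB: module K "map_obj F B" by (rule PSh_module[OF F B])
  have V: "\<And>i. i \<in> labels V \<Longrightarrow> summand V i \<in> Obj a" using y by (simp add: sections_def)
  let ?S = "{i \<in> labels V. g i \<noteq> \<zero>\<^bsub>HomMod a B (summand V i)\<^esub>}"
  have S: "finite ?S" "?S \<subseteq> labels V" using g by (auto simp: row_def)
  have "ev F V B y (\<lambda>i. c \<odot>\<^bsub>HomMod a B (summand V i)\<^esub> g i) =
    finsum (map_obj F B) (\<lambda>i. map_arr F (summand V i) B (c \<odot>\<^bsub>HomMod a B (summand V i)\<^esub> g i) (y i)) ?S"
    by (rule ev_superset[OF F B y row_smult[OF B V g c] S]) (use module.smult_r_null[OF module_HomMod[OF B V] c] in auto)
  also have "\<dots> = finsum (map_obj F B) (\<lambda>i. c \<odot>\<^bsub>map_obj F B\<^esub> map_arr F (summand V i) B (g i) (y i)) ?S"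
    by (rule FB.M.finsum_cong') (use y g c PSh_closed[OF F _ B] PSh_hom_smult[OF F _ B] in \<open>auto simp: sections_def row_def\<close>)
  also have "\<dots> = c \<odot>\<^bsub>map_obj F B\<^esub> ev F V B y g"
    by (rule ev_additive[OF F B y g PSh_module[OF F B], symmetric]) (use c in \<open>auto simp: FB.smult_r_distr\<close>)
  finally show ?thesis .
qed

lemma ev_act:
  assumes F: "F \<in> Obj PS" and B: "B \<in> Obj a" and D: "D \<in> Obj a" and y: "sections F V y" and g: "row B V g" and k: "k \<in> Hom a D B"
  shows "map_arr F B D k (ev F V B y g) = ev F V D y (\<lambda>i. Comp a D B (summand V i) (g i) k)"
proof -
  interpret FD: module K "map_obj F D" by (rule PSh_module[OF F D])
  have V: "\<And>i. i \<in> labels V \<Longrightarrow> summand V i \<in> Obj a" using y by (simp add: sections_def)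
  let ?S = "{i \<in> labels V. g i \<noteq> \<zero>\<^bsub>HomMod a B (summand V i)\<^esub>}"
  have S: "finite ?S" "?S \<subseteq> labels V" using g by (auto simp: row_def)
  note rk = row_Comp[OF B D V g k]
  have z: "Comp a D B (summand V i) \<zero>\<^bsub>HomMod a B (summand V i)\<^esub> k = \<zero>\<^bsub>HomMod a D (summand V i)\<^esub>"
      if "i \<in> labels V" for i
    using that B D V k
    by (intro additive_zero[OF module_HomMod[OF B V[OF that]] module_HomMod[OF D V[OF that]], of "\<lambda>f. Comp a D B (summand V i) f k"])
      (auto simp: carrier_HomMod Comp_closed Comp_add_left)
  have "ev F V D y (\<lambda>i. Comp a D B (summand V i) (g i) k) =
    finsum (map_obj F D) (\<lambda>i. map_arr F (summand V i) D (Comp a D B (summand V i) (g i) k) (y i)) ?S"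
    by (rule ev_superset[OF F D y rk S]) (use z in auto)
  also have "\<dots> = finsum (map_obj F D) (\<lambda>i. map_arr F B D k (map_arr F (summand V i) B (g i) (y i))) ?S"
    by (rule FD.M.finsum_cong') (use y g k B D PSh_closed[OF F] PSh_Comp[OF F _ B D] in \<open>auto simp: sections_def row_def\<close>)
  also have "\<dots> = map_arr F B D k (ev F V B y g)"
    by (rule ev_additive[OF F B y g PSh_module[OF F D], symmetric]) (use PSh_closed[OF F B D k] PSh_add[OF F B D k] in auto)
  finally show ?thesis ..
qed

lemma ev_Hom:
  assumes F: "F \<in> Obj PS" and G: "G \<in> Obj PS" and t: "t \<in> Hom PS F G"
    and B: "B \<in> Obj a" and y: "sections F V y" and g: "row B V g"
  shows "sections G V (\<lambda>i. t (summand V i) (y i))" "t B (ev F V B y g) = ev G V B (\<lambda>i. t (summand V i) (y i)) g"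
proof -
  note tD = PSh_HomD[OF t]
  show "sections G V (\<lambda>i. t (summand V i) (y i))" using y tD(2) by (simp add: sections_def)
  interpret GB: module K "map_obj G B" by (rule PSh_module[OF G B])
  have "t B (ev F V B y g) = finsum (map_obj G B) (\<lambda>i. t B (map_arr F (summand V i) B (g i) (y i)))
     {i \<in> labels V. g i \<noteq> \<zero>\<^bsub>HomMod a B (summand V i)\<^esub>}"
    by (rule ev_additive[OF F B y g PSh_module[OF G B]]) (use tD B in auto)
  also have "\<dots> = ev G V B (\<lambda>i. t (summand V i) (y i)) g"
    unfolding ev_def by (rule GB.M.finsum_cong')
      (use y g B tD PSh_closed[OF G _ B] in \<open>auto simp: sections_def row_def\<close>)
  finally show "t B (ev F V B y g) = ev G V B (\<lambda>i. t (summand V i) (y i)) g" .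
qed

lemma ev_sieve:
  assumes F: "F \<in> Obj PS" and X: "X \<in> Obj a" and R: "is_sieve K a X R" and s: "matching F X R s"
    and B: "B \<in> Obj a" and q: "\<And>i. i \<in> labels V \<Longrightarrow> q i \<in> R (summand V i)" and g: "row B V g"
  shows "sections (Yoneda a X) V q" "sections F V (\<lambda>i. s (summand V i) (q i))" "ev (Yoneda a X) V B q g \<in> R B"
    "s B (ev (Yoneda a X) V B q g) = ev F V B (\<lambda>i. s (summand V i) (q i)) g"
proof -
  note RO = sieve_Obj[OF R X] and RH = sieve_Hom[OF R X]
  show "sections (Yoneda a X) V q" using RO[OF q] RH[OF q] X by (simp add: sections_def carrier_HomMod)
  show "sections F V (\<lambda>i. s (summand V i) (q i))" using q RO matchingD(1)[OF s] by (auto simp: sections_def)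
  interpret FB: module K "map_obj F B" by (rule PSh_module[OF F B])
  have in_R: "Comp a B (summand V i) X (q i) (g i) \<in> R B" if "i \<in> labels V" for i
    using sieve_Comp[OF R X B q[OF that]] g that by (simp add: row_def)
  have m: "map_arr (Yoneda a X) (summand V i) B (g i) (q i) = Comp a B (summand V i) X (q i) (g i)" if "i \<in> labels V" for i
    using RH[OF q[OF that]] by simp
  have "finsum (map_obj (Yoneda a X) B) (\<lambda>i. map_arr (Yoneda a X) (summand V i)
      B (g i) (q i)) {i \<in> labels V. g i \<noteq> \<zero>\<^bsub>HomMod a B (summand V i)\<^esub>} \<in> R B \<and>
    s B (finsum (map_obj (Yoneda a X) B) (\<lambda>i. map_arr (Yoneda a X) (summand V i)
      B (g i) (q i)) {i \<in> labels V. g i \<noteq> \<zero>\<^bsub>HomMod a B (summand V i)\<^esub>})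
     = finsum (map_obj F B) (\<lambda>i. s B (map_arr (Yoneda a X) (summand V i)
       B (g i) (q i))) {i \<in> labels V. g i \<noteq> \<zero>\<^bsub>HomMod a B (summand V i)\<^esub>}"
    by (rule finsum_additive[OF PSh_module[OF Yoneda_PSh[OF X] B] PSh_module[OF F B]])
      (use g in_R m RH X B sieve_zero[OF R X B] sieve_add[OF R X] matchingD[OF s B] in \<open>auto simp: row_def carrier_HomMod\<close>)
  moreover have "finsum (map_obj F B) (\<lambda>i. s B (map_arr (Yoneda a X) (summand V i)
    B (g i) (q i))) {i \<in> labels V. g i \<noteq> \<zero>\<^bsub>HomMod a B (summand V i)\<^esub>}
    = ev F V B (\<lambda>i. s (summand V i) (q i)) g"
    unfolding ev_def
  proof (rule FB.M.finsum_cong')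
    fix i assume "i \<in> {i \<in> labels V. g i \<noteq> \<zero>\<^bsub>HomMod a B (summand V i)\<^esub>}"
    then have i: "i \<in> labels V" by simp
    have gi: "g i \<in> Hom a B (summand V i)" using g i by (simp add: row_def)
    show "s B (map_arr (Yoneda a X) (summand V i) B (g i) (q i)) = map_arr F (summand V i) B (g i) (s (summand V i) (q i))"
      using m[OF i] matchingD(4)[OF s RO[OF q[OF i]] q[OF i] B gi] by simp
  next
    show "(\<lambda>i. map_arr F (summand V i) B (g i) (s (summand V i) (q i))) \<in> {i \<in> labels V. g i \<noteq> \<zero>\<^bsub>HomMod a B (summand V i)\<^esub>} \<rightarrow> el F B"
      using PSh_closed[OF F RO[OF q] B] matchingD(1)[OF s RO[OF q] q] g by (auto simp: row_def)
  qed simp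
  ultimately show "ev (Yoneda a X) V B q g \<in> R B" "s B (ev (Yoneda a X) V B q g) = ev F V B (\<lambda>i. s (summand V i) (q i)) g"
    unfolding ev_def by auto
qed

lemma row_zero:
  assumes "B \<in> Obj a" "\<And>i. i \<in> labels V \<Longrightarrow> summand V i \<in> Obj a"
  shows "row B V (\<lambda>i. \<zero>\<^bsub>HomMod a B (summand V i)\<^esub>)"
  using assms by (simp add: row_def Hom_zero_closed)

lemma ev_zero:
  assumes F: "F \<in> Obj PS" and B: "B \<in> Obj a"
  shows "ev F V B y (\<lambda>i. \<zero>\<^bsub>HomMod a B (summand V i)\<^esub>) = \<zero>\<^bsub>map_obj F B\<^esub>"
proof -
  interpret FB: module K "map_obj F B" by (rule PSh_module[OF F B])
  show ?thesis by (simp add: ev_def)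
qed

lemma ev_null:
  assumes F: "F \<in> Obj PS" and B: "B \<in> Obj a" and V: "\<And>i. i \<in> labels V \<Longrightarrow> summand V i \<in> Obj a" and g: "row B V g"
    and y: "\<And>i. i \<in> labels V \<Longrightarrow> y i = \<zero>\<^bsub>map_obj F (summand V i)\<^esub>"
  shows "ev F V B y g = \<zero>\<^bsub>map_obj F B\<^esub>"
proof -
  interpret FB: module K "map_obj F B" by (rule PSh_module[OF F B])
  have "ev F V B y g = finsum (map_obj F B) (\<lambda>i. \<zero>\<^bsub>map_obj F B\<^esub>) {i \<in> labels V. g i \<noteq> \<zero>\<^bsub>HomMod a B (summand V i)\<^esub>}"
    unfolding ev_def by (rule FB.M.finsum_cong') (use y g PSh_zero[OF F V B] in \<open>auto simp: row_def\<close>)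
  then show ?thesis by simp
qed

definition unit_row :: "('l, 'o) family \<Rightarrow> 'l \<Rightarrow> 'l \<Rightarrow> 'u" where
  "unit_row V i = (\<lambda>k. if k = i then Ident a (summand V i) else \<zero>\<^bsub>HomMod a (summand V i) (summand V k)\<^esub>)"

lemma row_unit:
  assumes V: "\<And>i. i \<in> labels V \<Longrightarrow> summand V i \<in> Obj a" and i: "i \<in> labels V"
  shows "row (summand V i) V (unit_row V i)"
proof -
  have "{k \<in> labels V. unit_row V i k \<noteq> \<zero>\<^bsub>HomMod a (summand V i) (summand V k)\<^esub>} \<subseteq> {i}"
    by (auto simp: unit_row_def)
  then show ?thesis using V i Ident_closed Hom_zero_closed
    by (auto simp: row_def unit_row_def intro: finite_subset)
qed

lemma ev_unit:
  assumes F: "F \<in> Obj PS" and y: "sections F V y" and i: "i \<in> labels V"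
  shows "ev F V (summand V i) y (unit_row V i) = y i"
proof -
  have V: "\<And>i. i \<in> labels V \<Longrightarrow> summand V i \<in> Obj a" and yi: "y i \<in> el F (summand V i)"
    using y i by (auto simp: sections_def)
  interpret FB: module K "map_obj F (summand V i)" by (rule PSh_module[OF F V[OF i]])
  have "ev F V (summand V i) y (unit_row V i) =
    finsum (map_obj F (summand V i)) (\<lambda>k. map_arr F (summand V k) (summand V i) (unit_row V i k) (y k)) {i}"
    by (rule ev_superset[OF F V[OF i] y row_unit[OF V i]]) (use i in \<open>auto simp: unit_row_def split: if_splits\<close>)
  also have "\<dots> = map_arr F (summand V i) (summand V i) (Ident a (summand V i)) (y i)"
    using yi PSh_closed[OF F V[OF i] V[OF i] Ident_closed[OF V[OF i]]] by (simp add: unit_row_def)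
  also have "\<dots> = y i" by (rule PSh_Ident[OF F V[OF i] yi])
  finally show ?thesis .
qed

lemma subpresheaf_image:
  assumes F: "F \<in> Obj PS" and y: "sections F V y"
  shows "subpresheaf F (\<lambda>B. {ev F V B y g | g. row B V g})"
proof -
  have V: "\<And>i. i \<in> labels V \<Longrightarrow> summand V i \<in> Obj a" using y by (simp add: sections_def)
  show ?thesis unfolding subpresheaf_def
  proof (intro ballI conjI subsetI)
    fix A assume A: "A \<in> Obj a"
    show "x \<in> el F A" if "x \<in> {ev F V A y g | g. row A V g}" for x
      using that ev_closed[OF F A y] by blast
    show "\<zero>\<^bsub>map_obj F A\<^esub> \<in> {ev F V A y g | g. row A V g}"
      using row_zero[OF A V] ev_zero[OF F A, of V y] by (metis (mono_tags, lifting) mem_Collect_eq)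
    fix x assume "x \<in> {ev F V A y g | g. row A V g}"
    then obtain g where g: "row A V g" "x = ev F V A y g" by blast
    {
      fix w assume "w \<in> {ev F V A y g | g. row A V g}"
      then obtain h where h: "row A V h" "w = ev F V A y h" by blast
      show "x \<oplus>\<^bsub>map_obj F A\<^esub> w \<in> {ev F V A y g | g. row A V g}"
        using ev_add[OF F A y g(1) h(1)] row_add[OF A V g(1) h(1)] g(2) h(2) by (metis (mono_tags, lifting) mem_Collect_eq)
    next
      fix c assume c: "c \<in> carrier K"
      show "c \<odot>\<^bsub>map_obj F A\<^esub> x \<in> {ev F V A y g | g. row A V g}"
        using ev_smult[OF F A y g(1) c] row_smult[OF A V g(1) c] g(2) by (metis (mono_tags, lifting) mem_Collect_eq)
    next
      fix B f assume B: "B \<in> Obj a" and f: "f \<in> Hom a B A"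
      show "map_arr F A B f x \<in> {ev F V B y g | g. row B V g}"
        using ev_act[OF F A B y g(1) f] row_Comp[OF A B V g(1) f] g(2) by (metis (mono_tags, lifting) mem_Collect_eq)
    }
  qed
qed

lemma image_unit:
  assumes "F \<in> Obj PS" "sections F V y" "i \<in> labels V"
  shows "y i \<in> {ev F V (summand V i) y g | g. row (summand V i) V g}"
  using ev_unit[OF assms] row_unit[of V i] assms(2,3) by (force simp: sections_def)

lemma ev_ev:
  assumes F: "F \<in> Obj PS" and B: "B \<in> Obj a" and y: "sections F V y"
      and W: "\<And>k. k \<in> labels W \<Longrightarrow> summand W k \<in> Obj a"
    and p: "\<And>k. k \<in> labels W \<Longrightarrow> row (summand W k) V (p k)" and g: "row B W g"
  defines "h \<equiv> \<lambda>i. ev (Yoneda a (summand V i)) W B (\<lambda>k. p k i) g"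
  shows "row B V h" "ev F V B y h = ev F W B (\<lambda>k. ev F V (summand W k) y (p k)) g"
proof -
  have V: "\<And>i. i \<in> labels V \<Longrightarrow> summand V i \<in> Obj a" using y by (simp add: sections_def)
  interpret FB: module K "map_obj F B" by (rule PSh_module[OF F B])
  let ?S = "{k \<in> labels W. g k \<noteq> \<zero>\<^bsub>HomMod a B (summand W k)\<^esub>}"
  let ?t = "\<lambda>i k. Comp a B (summand W k) (summand V i) (p k i) (g k)"
  let ?h = "\<lambda>S i. finsum (HomMod a B (summand V i)) (?t i) S"
  have gH: "g k \<in> Hom a B (summand W k)" if "k \<in> labels W" for k using g that by (simp add: row_def)
  have pH: "p k i \<in> Hom a (summand W k) (summand V i)" if "k \<in> labels W" "i \<in> labels V" for k i
    using p that by (simp add: row_def)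
  have tH: "?t i k \<in> Hom a B (summand V i)" if "k \<in> labels W" "i \<in> labels V" for k i
    by (rule Comp_closed[OF B W[OF that(1)] V[OF that(2)] gH[OF that(1)] pH[OF that]])
  note evc = ev_closed[OF F W y p]
  have "row B V (?h S) \<and> ev F V B y (?h S) =
      finsum (map_obj F B) (\<lambda>k. map_arr F (summand W k) B (g k) (ev F V (summand W k) y (p k))) S"
    if "finite S" "S \<subseteq> labels W" for S
    using that
  proof (induction S rule: finite_induct)
    case empty
    have e: "?h {} i = \<zero>\<^bsub>HomMod a B (summand V i)\<^esub>" if i: "i \<in> labels V" for i
    proof -
      interpret H: module K "HomMod a B (summand V i)" by (rule module_HomMod[OF B V[OF i]])
      show ?thesis by simp
    qed
    then have r: "row B V (?h {})" using row_zero[OF B V] by (simp add: row_def cong: conj_cong)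
    show ?case using r ev_cong[OF F B y r e refl] ev_zero[OF F B, of V y] by simp
  next
    case (insert k S)
    then have k: "k \<in> labels W" and S: "S \<subseteq> labels W" by auto
    note IH = insert.IH[OF S]
    note rk = row_Comp[OF W[OF k] B V p[OF k] gH[OF k]]
    have e: "?h (insert k S) i = ?t i k \<oplus>\<^bsub>HomMod a B (summand V i)\<^esub> ?h S i" if i: "i \<in> labels V" for i
    proof -
      interpret H: module K "HomMod a B (summand V i)" by (rule module_HomMod[OF B V[OF i]])
      show ?thesis using insert.hyps tH[OF _ i] k S B V[OF i]
        by (intro H.M.finsum_insert) (auto simp: carrier_HomMod)
    qed
    note ra = row_add[OF B V rk conjunct1[OF IH]]
    have r: "row B V (?h (insert k S))" using ra e unfolding row_def by (auto cong: conj_cong)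
    have "ev F V B y (?h (insert k S)) = ev F V B y (\<lambda>i. ?t i k \<oplus>\<^bsub>HomMod a B (summand V i)\<^esub> ?h S i)"
      by (rule ev_cong[OF F B y r e refl])
    also have "\<dots> = ev F V B y (\<lambda>i. ?t i k) \<oplus>\<^bsub>map_obj F B\<^esub> ev F V B y (?h S)"
      by (rule ev_add[OF F B y rk conjunct1[OF IH]])
    also have "ev F V B y (\<lambda>i. ?t i k) = map_arr F (summand W k) B (g k) (ev F V (summand W k) y (p k))"
      by (rule ev_act[OF F W[OF k] B y p[OF k] gH[OF k], symmetric])
    also have "\<dots> \<oplus>\<^bsub>map_obj F B\<^esub> ev F V B y (?h S) =
      finsum (map_obj F B) (\<lambda>k. map_arr F (summand W k) B (g k) (ev F V (summand W k) y (p k))) (insert k S)"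
      unfolding conjunct2[OF IH]
      by (rule FB.M.finsum_insert[symmetric])
        (use insert.hyps k S PSh_closed[OF F W B gH evc] in auto)
    finally show ?case using r by blast
  qed
  note main = this[of ?S]
  have fin: "finite ?S" using g by (simp add: row_def)
  have hh: "h i = ?h ?S i" if i: "i \<in> labels V" for i
  proof -
    interpret H: module K "HomMod a B (summand V i)" by (rule module_HomMod[OF B V[OF i]])
    show ?thesis unfolding h_def ev_def
      using pH i tH B V by (simp, intro H.M.finsum_cong') (auto simp: carrier_HomMod)
  qed
  have r: "row B V (?h ?S)" using main fin by auto
  then show rh: "row B V h" using hh unfolding row_def by (auto cong: conj_cong)
  have "ev F V B y h = ev F V B y (?h ?S)" by (rule ev_cong[OF F B y rh hh refl])
  also have "\<dots> = ev F W B (\<lambda>k. ev F V (summand W k) y (p k)) g" using main fin unfolding ev_def[of F W] by auto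
  finally show "ev F V B y h = ev F W B (\<lambda>k. ev F V (summand W k) y (p k)) g" .
qed

lemma formal_comp_ev:
  assumes "x \<in> labels W" "z \<in> labels Z" "summand W x \<in> Obj a" "summand Z z \<in> Obj a"
    and "row (summand W x) V (f x)" "\<And>y. y \<in> labels V \<Longrightarrow>
        summand V y \<in> Obj a \<and> g y z \<in> Hom a (summand V y) (summand Z z)"
  shows "formal_comp a W V Z g f x z = ev (Yoneda a (summand Z z)) V (summand W x) (\<lambda>y. g y z) (f x)"
proof -
  interpret H: module K "HomMod a (summand W x) (summand Z z)" by (rule module_HomMod[OF assms(3,4)])
  show ?thesis unfolding formal_comp_def ev_def Yoneda_simps(1)
    by (rule H.M.finsum_cong')
      (use assms Comp_closed[of "summand W x" _ "summand Z z"] in \<open>auto simp: row_def carrier_HomMod\<close>)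
qed

lemma ev_single:
  assumes F: "F \<in> Obj PS" and B: "B \<in> Obj a" and A: "A \<in> Obj a" and y: "y () \<in> el F A"
    and g: "g () \<in> Hom a B A"
  shows "row B (single A) g" "ev F (single A) B y g = map_arr F A B (g ()) (y ())"
proof -
  interpret FB: module K "map_obj F B" by (rule PSh_module[OF F B])
  have s: "sections F (single A) y" using A y by (simp add: sections_def one_object_def)
  show r: "row B (single A) g" using g by (simp add: row_def one_object_def)
  have "ev F (single A) B y g = finsum (map_obj F B) (\<lambda>i. map_arr F (summand (single A) i) B (g i) (y i)) {()}"
    by (rule ev_superset[OF F B s r]) (auto simp: one_object_def)
  also have "\<dots> = map_arr F A B (g ()) (y ())"
    using PSh_closed[OF F A B g y] by (simp add: one_object_def)
  finally show "ev F (single A) B y g = map_arr F A B (g ()) (y ())" .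
qed

section \<open>Generated sieves\<close>

lemma subpresheaf_Yoneda_sieve:
  assumes X: "X \<in> Obj a" and N: "subpresheaf (Yoneda a X) N"
  shows "is_sieve K a X (\<lambda>B. if B \<in> Obj a then N B else {})"
proof -
  have NH: "f \<in> Hom a B X" if "B \<in> Obj a" "f \<in> N B" for B f
    using subpresheafD(1)[OF N that] that X by (simp add: carrier_HomMod)
  show ?thesis
    by (rule sieveI[OF X]) (use subpresheafD[OF N] NH in \<open>auto split: if_splits simp: Yoneda_simps(2)[symmetric]
      simp del: Yoneda_simps(2)\<close>)
qed

definition formal_to :: "'o \<Rightarrow> ('l, 'o) family \<Rightarrow> ('l \<Rightarrow> unit \<Rightarrow> 'u) \<Rightarrow> bool" where
  "formal_to X V v \<longleftrightarrow> sections (Yoneda a X) V (\<lambda>l. v l ())"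

lemma generated_sieve:
  assumes X: "X \<in> Obj a" and FV: "formal_to X V v"
  shows sieve_generated: "is_sieve K a X (generated_sieve K a V v X)"
    and generated_least: "\<lbrakk>is_sieve K a X R; (\<And>l. l \<in> labels V \<Longrightarrow>
        v l () \<in> R (summand V l)); f \<in> generated_sieve K a V v X B\<rbrakk> \<Longrightarrow>
      f \<in> R B"
    and generated_mem: "l \<in> labels V \<Longrightarrow> v l () \<in> generated_sieve K a V v X (summand V l)"
    and generated_elem: "f \<in> generated_sieve K a V v X B \<Longrightarrow>
        \<exists>g. row B V g \<and> f = ev (Yoneda a X) V B (\<lambda>l. v l ()) g"
proof -
  note V = FV[unfolded formal_to_def]
  let ?G = "generated_sieve K a V v X"
  have vH: "v l () \<in> Hom a (summand V l) X" "summand V l \<in> Obj a" if "l \<in> labels V" for l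
    using V that X by (auto simp: sections_def carrier_HomMod)
  have least: "f \<in> R B" if "is_sieve K a X R" "\<And>l. l \<in> labels V \<Longrightarrow> v l () \<in> R (summand V l)" "f \<in> ?G B" for R f B
    using that unfolding generated_sieve_def by blast
  have mem: "f \<in> ?G B" if "\<And>R. is_sieve K a X R \<Longrightarrow> (\<And>l. l \<in> labels V \<Longrightarrow>
      v l () \<in> R (summand V l)) \<Longrightarrow> f \<in> R B" for f B
    using that unfolding generated_sieve_def by blast
  have mx: "is_sieve K a X (max_sieve a X)" "\<And>l. l \<in> labels V \<Longrightarrow> v l () \<in> max_sieve a X (summand V l)"
    using sieve_max[OF X] vH by (auto simp: max_sieve_def)
  have in_max: "f \<in> max_sieve a X B" if "f \<in> ?G B" for f B using least[OF mx that] .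
  show "is_sieve K a X ?G"
  proof (rule sieveI[OF X])
    show "B \<in> Obj a" "f \<in> Hom a B X" if "f \<in> ?G B" for B f using in_max[OF that] by (auto simp: max_sieve_def split: if_splits)
    show "\<zero>\<^bsub>HomMod a B X\<^esub> \<in> ?G B" if "B \<in> Obj a" for B by (rule mem) (use sieve_zero[OF _ X that] in blast)
    show "f \<oplus>\<^bsub>HomMod a B X\<^esub> g \<in> ?G B" if f: "f \<in> ?G B" and g: "g \<in> ?G B" for B f g
      by (rule mem) (rule sieve_add[OF _ X least[OF _ _ f] least[OF _ _ g]])
    show "c \<odot>\<^bsub>HomMod a B X\<^esub> f \<in> ?G B" if c: "c \<in> carrier K" and f: "f \<in> ?G B" for B f c
      by (rule mem) (rule sieve_smult[OF _ X c least[OF _ _ f]])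
    show "Comp a D B X f g \<in> ?G D" if "B \<in> Obj a" and D: "D \<in> Obj a" and f: "f \<in> ?G B" and g: "g \<in> Hom a D B" for B D f g
      by (rule mem) (rule sieve_Comp[OF _ X D least[OF _ _ f] g])
  qed
  show "\<lbrakk>is_sieve K a X R; (\<And>l. l \<in> labels V \<Longrightarrow> v l () \<in> R (summand V l)); f \<in> ?G B\<rbrakk> \<Longrightarrow>
      f \<in> R B"
    by (rule least)
  show "l \<in> labels V \<Longrightarrow> v l () \<in> ?G (summand V l)" by (rule mem) blast
  assume f: "f \<in> ?G B"
  let ?N = "\<lambda>B. {ev (Yoneda a X) V B (\<lambda>l. v l ()) g | g. row B V g}"
  have "f \<in> (\<lambda>B. if B \<in> Obj a then ?N B else {}) B"
  proof (rule least[OF subpresheaf_Yoneda_sieve[OF X subpresheaf_image[OF Yoneda_PSh[OF X] V]] _ f])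
    fix l assume l: "l \<in> labels V"
    show "v l () \<in> (if summand V l \<in> Obj a then ?N (summand V l) else {})"
      using image_unit[OF Yoneda_PSh[OF X] V l] vH[OF l] by simp
  qed
  then show "\<exists>g. row B V g \<and> f = ev (Yoneda a X) V B (\<lambda>l. v l ()) g" by (auto split: if_splits)
qed

lemma separated_generated:
  assumes F: "F \<in> Obj PS" and sep: "separated F" and X: "X \<in> Obj a" and V: "formal_to X V v"
    and T: "generated_sieve K a V v X \<in> T X" and x: "x \<in> el F X" and y: "y \<in> el F X"
    and e: "\<And>l. l \<in> labels V \<Longrightarrow> map_arr F X (summand V l) (v l ()) x = map_arr F X (summand V l) (v l ()) y"
  shows "x = y"
proof (rule separatedD[OF F sep X T x y])
  fix B f assume B: "B \<in> Obj a" and f: "f \<in> generated_sieve K a V v X B"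
  let ?R = "\<lambda>B. if B \<in> Obj a then {f \<in> Hom a B X. map_arr F X B f x = map_arr F X B f y} else {}"
  have "f \<in> ?R B"
  proof (rule generated_least[OF X V _ _ f])
    show "is_sieve K a X ?R"
      by (rule sieveI[OF X]) (use X x y in \<open>auto split: if_splits simp: map_arr_zero_hom[OF F] Hom_zero_closed Hom_add_closed
          Hom_smult_closed Comp_closed PSh_hom_add[OF F] PSh_hom_smult[OF F] PSh_Comp[OF F]\<close>)
    show "v l () \<in> ?R (summand V l)" if l: "l \<in> labels V" for l
      using V l X e by (auto simp: formal_to_def sections_def carrier_HomMod)
  qed
  then show "map_arr F X B f x = map_arr F X B f y" using B by simp
qed

end

section \<open>Bounded pretopologies\<close>

lemma single_simps [simp]: "labels (single X) = {()}" "summand (single X) u = X"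
  by (simp_all add: one_object_def)

locale presite = site U K a T + pretopology U a S
  for U :: "'u set set" and K :: "'k ring" and a :: "('o, 'u, 'k) linear_category"
    and T :: "'o \<Rightarrow> ('o \<Rightarrow> 'u set) set" and S :: "('o, 'u, 'u) formal_sequence set" +
  assumes T_eq: "A \<in> Obj a \<Longrightarrow> T A = top_of K a S A"

lemma (in site) sequenceD:
  assumes "is_sequence U a s"
  shows seq_X_Obj: "seq_X s \<in> Obj a"
    and seq_Y_Obj: "\<And>y. y \<in> labels (seq_Y s) \<Longrightarrow> summand (seq_Y s) y \<in> Obj a"
    and seq_Z_Obj: "\<And>z. z \<in> labels (seq_Z s) \<Longrightarrow> summand (seq_Z s) z \<in> Obj a"
    and seq_q_Hom: "\<And>y. y \<in> labels (seq_Y s) \<Longrightarrow> seq_q s y () \<in> Hom a (summand (seq_Y s) y) (seq_X s)"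
    and seq_q_sections: "sections (Yoneda a (seq_X s)) (seq_Y s) (\<lambda>y. seq_q s y ())"
    and seq_q_formal: "formal_to (seq_X s) (seq_Y s) (seq_q s)"
    and seq_p_row: "\<And>z. z \<in> labels (seq_Z s) \<Longrightarrow> row (summand (seq_Z s) z) (seq_Y s) (seq_p s z)"
    and seq_qp: "\<And>z. z \<in> labels (seq_Z s) \<Longrightarrow>
      ev (Yoneda a (seq_X s)) (seq_Y s) (summand (seq_Z s) z) (\<lambda>y. seq_q s y ()) (seq_p s z) =
      \<zero>\<^bsub>HomMod a (summand (seq_Z s) z) (seq_X s)\<^esub>"
proof -
  show X: "seq_X s \<in> Obj a" using assms by (simp add: is_sequence_def)
  show Y: "summand (seq_Y s) y \<in> Obj a" if "y \<in> labels (seq_Y s)" for y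
    using assms that by (auto simp: is_sequence_def small_family_def)
  show Z: "summand (seq_Z s) z \<in> Obj a" if "z \<in> labels (seq_Z s)" for z
    using assms that by (auto simp: is_sequence_def small_family_def)
  show q: "seq_q s y () \<in> Hom a (summand (seq_Y s) y) (seq_X s)" if "y \<in> labels (seq_Y s)" for y
    using assms that by (auto simp: is_sequence_def formal_morphisms_def)
  show "sections (Yoneda a (seq_X s)) (seq_Y s) (\<lambda>y. seq_q s y ())"
    using q Y X by (simp add: sections_def carrier_HomMod)
  then show "formal_to (seq_X s) (seq_Y s) (seq_q s)" by (simp add: formal_to_def)
  show p: "row (summand (seq_Z s) z) (seq_Y s) (seq_p s z)" if "z \<in> labels (seq_Z s)" for z
    using assms that by (simp add: is_sequence_def formal_morphisms_row)
  show "ev (Yoneda a (seq_X s)) (seq_Y s) (summand (seq_Z s) z) (\<lambda>y. seq_q s y ()) (seq_p s z) =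
      \<zero>\<^bsub>HomMod a (summand (seq_Z s) z) (seq_X s)\<^esub>" if z: "z \<in> labels (seq_Z s)" for z
    using assms z formal_comp_ev[of z "seq_Z s" "()" "single (seq_X s)" "seq_Y s" "seq_p s" "seq_q s"] Z X Y p q
    by (simp add: is_sequence_def formal_eq_def formal_zero_def)
qed

lemma (in site) Co_sections:
  assumes seqs: "\<And>s. s \<in> S \<Longrightarrow> is_sequence U a s" and "Co a S i V v X"
  shows "X \<in> Obj a \<and> formal_to X V v"
  using assms(2)
proof induction
  case (Co_0 X)
  then show ?case using Ident_closed[OF Co_0] by (simp add: formal_to_def sections_def one_object_def carrier_HomMod)
next
  case (Co_1 s)
  show ?case using seq_X_Obj[OF seqs[OF Co_1]] seq_Y_Obj[OF seqs[OF Co_1]] seq_q_Hom[OF seqs[OF Co_1]]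
    by (auto simp: formal_to_def sections_def carrier_HomMod)
next
  case (Co_Suc i V v X t)
  then have X: "X \<in> Obj a" and V: "\<And>l. l \<in> labels V \<Longrightarrow> summand V l \<in> Obj a \<and> v l () \<in> Hom a (summand V l) X"
    by (auto simp: formal_to_def sections_def carrier_HomMod)
  have t: "summand (seq_Y (t l)) d \<in> Obj a \<and>
      Comp a (summand (seq_Y (t l)) d) (summand V l) X (v l ()) (seq_q (t l) d ()) \<in> Hom a (summand (seq_Y (t l)) d) X"
    if l: "l \<in> labels V" and d: "d \<in> labels (seq_Y (t l))" for l d
  proof -
    note tl = Co_Suc.hyps(3)[OF l]
    note sq = seqs[OF conjunct1[OF tl]]
    show ?thesis using tl seq_Y_Obj[OF sq d] seq_q_Hom[OF sq d] V[OF l] X by (auto intro!: Comp_closed)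
  qed
  show ?case unfolding formal_to_def sections_def
    using X t by (auto simp: carrier_HomMod)
qed

lemma (in site) Co_card:
  assumes \<kappa>: "Card_order \<kappa>" "cinfinite \<kappa>" "regularCard \<kappa>" and bd: "bounded_sequences \<kappa> S" and "Co a S i V v X"
  shows "|labels V| <o \<kappa>"
  using assms(5)
proof induction
  case (Co_0 X)
  show ?case by (rule finite_ordLess_card[OF \<kappa>(1,2)]) (simp add: one_object_def)
next
  case (Co_1 s)
  have e: "{[y] | y. y \<in> labels (seq_Y s)} = (\<lambda>y. [y]) ` labels (seq_Y s)" by auto
  have "|labels (seq_Y s)| <o \<kappa>" using bd Co_1 by (simp add: bounded_sequences_def)
  then show ?case using ordLeq_ordLess_trans[OF card_of_image] by (simp add: e)
next
  case (Co_Suc i V v X t)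
  have st: "stable \<kappa>" using regularCard_stable[OF \<kappa>(1) _ \<kappa>(3)] \<kappa>(2) by (simp add: cinfinite_def)
  have "|\<Union>l\<in>labels V. (\<lambda>d. l @ [d]) ` labels (seq_Y (t l))| <o \<kappa>"
  proof (rule stable_UNION[OF st Co_Suc.IH])
    fix l assume "l \<in> labels V"
    then have "|labels (seq_Y (t l))| <o \<kappa>" using Co_Suc.hyps(3) bd by (simp add: bounded_sequences_def)
    then show "|(\<lambda>d. l @ [d]) ` labels (seq_Y (t l))| <o \<kappa>" using card_of_image ordLeq_ordLess_trans by blast
  qed
  moreover have "{l @ [d] | l d. l \<in> labels V \<and>
    d \<in> labels (seq_Y (t l))} = (\<Union>l\<in>labels V. (\<lambda>d. l @ [d]) ` labels (seq_Y (t l)))"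
    by auto
  ultimately show ?case by simp
qed

context presite
begin

lemma Co_Obj: "Co a S i V v X \<Longrightarrow> X \<in> Obj a"
  and Co_sec: "Co a S i V v X \<Longrightarrow> formal_to X V v"
  using Co_sections sequences by blast+

lemma Co_Hom:
  assumes "Co a S i V v X" "l \<in> labels V"
  shows "summand V l \<in> Obj a" "v l () \<in> Hom a (summand V l) X"
  using Co_sec[OF assms(1)] Co_Obj[OF assms(1)] assms(2) by (auto simp: formal_to_def sections_def carrier_HomMod)

lemma generated_T:
  assumes "Co a S i V v X"
  shows "generated_sieve K a V v X \<in> T X"
  using assms Co_Obj[OF assms] generated_sieve(1)[OF Co_Obj[OF assms] Co_sec[OF assms]]
  unfolding T_eq[OF Co_Obj[OF assms]] top_of_def by blast

lemma T_Co:
  assumes "X \<in> Obj a" "R \<in> T X"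
  obtains i V v where "Co a S i V v X" "\<And>l. l \<in> labels V \<Longrightarrow> v l () \<in> R (summand V l)"
proof -
  obtain i V v where c: "Co a S i V v X" and g: "\<And>B. generated_sieve K a V v X B \<subseteq> R B"
    using assms(2) unfolding T_eq[OF assms(1)] top_of_def by blast
  then show thesis using that[OF c] generated_mem[OF assms(1) Co_sec[OF c]] by blast
qed

lemma lift_along:
  assumes s: "s \<in> S" and A: "A \<in> Obj a" and f: "f \<in> Hom a A (seq_X s)"
  obtains i V q' f' where "Co a S i V q' A" "\<And>l. l \<in> labels V \<Longrightarrow> row (summand V l) (seq_Y s) (f' l)"
    "\<And>l. l \<in> labels V \<Longrightarrow> Comp a (summand V l) A (seq_X s) f (q' l ()) =
      ev (Yoneda a (seq_X s)) (seq_Y s) (summand V l) (\<lambda>y. seq_q s y ()) (f' l)"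
proof -
  obtain i V q' f' where c: "Co a S i V q' A" and f': "f' \<in> formal_morphisms a V (seq_Y s)"
    and e: "formal_eq V (single (seq_X s))
          (formal_comp a V (seq_Y s) (single (seq_X s)) (seq_q s) f')
          (formal_comp a V (single A) (single (seq_X s)) (\<lambda>_ _. f) q')"
    using PTa[OF s A f] by blast
  note sq = sequences[OF s]
  note X = seq_X_Obj[OF sq]
  show thesis
  proof (rule that[OF c, of f'])
    fix l assume l: "l \<in> labels V"
    note V = Co_Hom[OF c l]
    show r: "row (summand V l) (seq_Y s) (f' l)" using f' l by (simp add: formal_morphisms_row)
    have y: "f \<in> el (Yoneda a (seq_X s)) A" using f A X by (simp add: carrier_HomMod)
    note 1 = ev_single[OF Yoneda_PSh[OF X] V(1) A, of "\<lambda>_. f" "q' l", OF y V(2)]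
    have "formal_comp a V (single A) (single (seq_X s)) (\<lambda>_ _. f) q' l () = Comp a (summand V l) A (seq_X s) f (q' l ())"
      using formal_comp_ev[of l V "()" "single (seq_X s)" "single A" q' "\<lambda>_ _. f"] l V X A f 1 by simp
    moreover have "formal_comp a V (seq_Y s) (single (seq_X s)) (seq_q s) f' l () =
      ev (Yoneda a (seq_X s)) (seq_Y s) (summand V l) (\<lambda>y. seq_q s y ()) (f' l)"
      using formal_comp_ev[of l V "()" "single (seq_X s)" "seq_Y s" f' "seq_q s"] l V X r seq_Y_Obj[OF sq] seq_q_Hom[OF sq] by simp
    ultimately show "Comp a (summand V l) A (seq_X s) f (q' l ()) =
      ev (Yoneda a (seq_X s)) (seq_Y s) (summand V l) (\<lambda>y. seq_q s y ()) (f' l)"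
      using e l by (simp add: formal_eq_def)
  qed
qed

lemma lift_relation:
  assumes s: "s \<in> S" and A: "A \<in> Obj a" and g: "row A (seq_Y s) g"
    and z: "ev (Yoneda a (seq_X s)) (seq_Y s) A (\<lambda>y. seq_q s y ()) g = \<zero>\<^bsub>HomMod a A (seq_X s)\<^esub>"
  obtains i V q' g' where "Co a S i V q' A" "\<And>l. l \<in> labels V \<Longrightarrow> row (summand V l) (seq_Z s) (g' l)"
    "\<And>l y. l \<in> labels V \<Longrightarrow> y \<in> labels (seq_Y s) \<Longrightarrow>
      Comp a (summand V l) A (summand (seq_Y s) y) (g y) (q' l ()) =
      ev (Yoneda a (summand (seq_Y s) y)) (seq_Z s) (summand V l) (\<lambda>z. seq_p s z y) (g' l)"
proof -
  note sq = sequences[OF s]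
  note X = seq_X_Obj[OF sq]
  have "formal_comp a (single A) (seq_Y s) (single (seq_X s)) (seq_q s) (\<lambda>_. g) () () = \<zero>\<^bsub>HomMod a A (seq_X s)\<^esub>"
    using formal_comp_ev[of "()" "single A" "()" "single (seq_X s)" "seq_Y s" "\<lambda>_. g" "seq_q s"]
      A X g z seq_Y_Obj[OF sq] seq_q_Hom[OF sq] by simp
  then obtain i V q' g' where c: "Co a S i V q' A" and g': "g' \<in> formal_morphisms a V (seq_Z s)"
    and e: "formal_eq V (seq_Y s)
          (formal_comp a V (seq_Z s) (seq_Y s) (seq_p s) g')
          (formal_comp a V (single A) (seq_Y s) (\<lambda>_. g) q')"
    using PTb[OF s A, of "\<lambda>_. g"] g by (auto simp: formal_morphisms_row formal_eq_def formal_zero_def)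
  show thesis
  proof (rule that[OF c, of g'])
    fix l assume l: "l \<in> labels V"
    note V = Co_Hom[OF c l]
    show r: "row (summand V l) (seq_Z s) (g' l)" using g' l by (simp add: formal_morphisms_row)
    fix y assume y: "y \<in> labels (seq_Y s)"
    note Yy = seq_Y_Obj[OF sq y]
    have gy: "g y \<in> Hom a A (summand (seq_Y s) y)" using g y by (simp add: row_def)
    have gy': "g y \<in> el (Yoneda a (summand (seq_Y s) y)) A" using gy A Yy by (simp add: carrier_HomMod)
    note 1 = ev_single[OF Yoneda_PSh[OF Yy] V(1) A, of "\<lambda>_. g y" "q' l", OF gy' V(2)]
    have "formal_comp a V (single A) (seq_Y s) (\<lambda>_. g) q' l y = Comp a (summand V l) A (summand (seq_Y s) y) (g y) (q' l ())"
      using formal_comp_ev[of l V y "seq_Y s" "single A" q' "\<lambda>_. g"] l y V Yy A gy 1 by simp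
    moreover have "formal_comp a V (seq_Z s) (seq_Y s) (seq_p s) g' l y =
      ev (Yoneda a (summand (seq_Y s) y)) (seq_Z s) (summand V l) (\<lambda>z. seq_p s z y) (g' l)"
      by (rule formal_comp_ev[of l V y "seq_Y s" "seq_Z s" g' "seq_p s"])
        (use l y V Yy r seq_Z_Obj[OF sq] seq_p_row[OF sq] in \<open>auto simp: row_def\<close>)
    ultimately show "Comp a (summand V l) A (summand (seq_Y s) y) (g y) (q' l ()) =
      ev (Yoneda a (summand (seq_Y s) y)) (seq_Z s) (summand V l) (\<lambda>z. seq_p s z y) (g' l)"
      using e l y by (simp add: formal_eq_def)
  qed
qed

lemma relation_vanishes:
  assumes F: "F \<in> Obj PS" and sep: "separated F" and s: "s \<in> S" and e: "sections F (seq_Y s) e"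
    and p: "\<And>z. z \<in> labels (seq_Z s) \<Longrightarrow>
        ev F (seq_Y s) (summand (seq_Z s) z) e (seq_p s z) = \<zero>\<^bsub>map_obj F (summand (seq_Z s) z)\<^esub>"
    and B: "B \<in> Obj a" and g: "row B (seq_Y s) g"
    and z: "ev (Yoneda a (seq_X s)) (seq_Y s) B (\<lambda>y. seq_q s y ()) g = \<zero>\<^bsub>HomMod a B (seq_X s)\<^esub>"
  shows "ev F (seq_Y s) B e g = \<zero>\<^bsub>map_obj F B\<^esub>"
proof -
  note sq = sequences[OF s]
  obtain i V q' g' where c: "Co a S i V q' B" and g': "\<And>l. l \<in> labels V \<Longrightarrow> row (summand V l) (seq_Z s) (g' l)"
    and eq: "\<And>l y. l \<in> labels V \<Longrightarrow> y \<in> labels (seq_Y s) \<Longrightarrow>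
        Comp a (summand V l) B (summand (seq_Y s) y) (g y) (q' l ()) =
      ev (Yoneda a (summand (seq_Y s) y)) (seq_Z s) (summand V l) (\<lambda>z. seq_p s z y) (g' l)"
    by (rule lift_relation[OF s B g z]) (rule that)
  show ?thesis
  proof (rule separated_generated[OF F sep B Co_sec[OF c] generated_T[OF c] ev_closed[OF F B e g] module_zero_closed[OF PSh_module[OF F B]]])
    fix l assume l: "l \<in> labels V"
    note V = Co_Hom[OF c l]
    have "map_arr F B (summand V l) (q' l ()) (ev F (seq_Y s) B e g) =
      ev F (seq_Y s) (summand V l) e (\<lambda>y. Comp a (summand V l) B (summand (seq_Y s) y) (g y) (q' l ()))"
      by (rule ev_act[OF F B V(1) e g V(2)])
    also have "\<dots> = ev F (seq_Y s) (summand V l) e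
        (\<lambda>y. ev (Yoneda a (summand (seq_Y s) y)) (seq_Z s) (summand V l) (\<lambda>z. seq_p s z y) (g' l))"
      by (rule ev_cong[OF F V(1) e row_Comp[OF B V(1) seq_Y_Obj[OF sq] g V(2)] eq[OF l] refl])
    also have "\<dots> = ev F (seq_Z s) (summand V l) (\<lambda>z. ev F (seq_Y s) (summand (seq_Z s) z) e (seq_p s z)) (g' l)"
      by (rule ev_ev(2)[OF F V(1) e seq_Z_Obj[OF sq] seq_p_row[OF sq] g'[OF l]])
    also have "\<dots> = \<zero>\<^bsub>map_obj F (summand V l)\<^esub>"
      by (rule ev_null[OF F V(1) seq_Z_Obj[OF sq] g'[OF l] p])
    also have "\<dots> = map_arr F B (summand V l) (q' l ()) \<zero>\<^bsub>map_obj F B\<^esub>" by (rule PSh_zero[OF F B V, symmetric])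
    finally show "map_arr F B (summand V l) (q' l ()) (ev F (seq_Y s)
      B e g) = map_arr F B (summand V l) (q' l ()) \<zero>\<^bsub>map_obj F B\<^esub>" .
  qed
qed

lemma sheaf_exact:
  assumes Fs: "is_sheaf U K a T F" and s: "s \<in> S" and T: "generated_sieve K a (seq_Y s) (seq_q s) (seq_X s) \<in> T (seq_X s)"
    and e: "sections F (seq_Y s) e"
    and p: "\<And>z. z \<in> labels (seq_Z s) \<Longrightarrow>
        ev F (seq_Y s) (summand (seq_Z s) z) e (seq_p s z) = \<zero>\<^bsub>map_obj F (summand (seq_Z s) z)\<^esub>"
  obtains x where "x \<in> el F (seq_X s)"
    "\<And>y. y \<in> labels (seq_Y s) \<Longrightarrow> map_arr F (seq_X s) (summand (seq_Y s) y) (seq_q s y ()) x = e y"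
proof -
  note F = sheaf_PSh[OF Fs] and sep = sheaf_separated[OF Fs]
  note sq = sequences[OF s]
  let ?X = "seq_X s" and ?Y = "seq_Y s" and ?q = "\<lambda>y. seq_q s y ()"
  note X = seq_X_Obj[OF sq] and Y = seq_Y_Obj[OF sq] and Q = seq_q_sections[OF sq]
  note YX = Yoneda_PSh[OF X]
  let ?R = "generated_sieve K a ?Y (seq_q s) ?X"
  define r where "r B f = (SOME g. row B ?Y g \<and> f = ev (Yoneda a ?X) ?Y B ?q g)" for B f
  have r: "row B ?Y (r B f)" "f = ev (Yoneda a ?X) ?Y B ?q (r B f)" if "f \<in> ?R B" for B f
    using someI_ex[OF generated_elem[OF X seq_q_formal[OF sq] that]] unfolding r_def by auto
  define t where "t B f = ev F ?Y B e (r B f)" for B f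
  have wd: "t B (ev (Yoneda a ?X) ?Y B ?q g) = ev F ?Y B e g"
    if B: "B \<in> Obj a" and g: "row B ?Y g" and R: "ev (Yoneda a ?X) ?Y B ?q g \<in> ?R B" for B g
  proof -
    let ?f = "ev (Yoneda a ?X) ?Y B ?q g" and ?m = "\<ominus>\<^bsub>K\<^esub> \<one>\<^bsub>K\<^esub>"
    let ?g = "r B ?f"
    note rg = r[OF R]
    have m: "?m \<in> carrier K" by simp
    note rm = row_smult[OF B Y rg(1) m]
    note ra = row_add[OF B Y g rm]
    let ?d = "\<lambda>i. g i \<oplus>\<^bsub>HomMod a B (summand ?Y i)\<^esub> ?m \<odot>\<^bsub>HomMod a B (summand ?Y i)\<^esub> ?g i"
    have d: "ev G ?Y B w ?d = ev G ?Y B w g \<ominus>\<^bsub>map_obj G B\<^esub> ev G ?Y B w ?g" if G: "G \<in> Obj PS"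
        and w: "sections G ?Y w" for G w
    proof -
      interpret GB: module K "map_obj G B" by (rule PSh_module[OF G B])
      show ?thesis
        using ev_add[OF G B w g rm] ev_smult[OF G B w rg(1) m] module_neg_smult[OF GB.module_axioms ev_closed[OF G B w rg(1)]]
        by (simp add: GB.M.minus_eq)
    qed
    interpret YB: module K "map_obj (Yoneda a ?X) B" by (rule PSh_module[OF YX B])
    have "ev (Yoneda a ?X) ?Y B ?q ?d = \<zero>\<^bsub>HomMod a B ?X\<^esub>"
      using d[OF YX Q] rg(2) ev_closed[OF YX B Q g] by (simp add: YB.M.minus_eq YB.M.r_neg del: Yoneda_simps) (simp add: YB.M.r_neg)
    then have "ev F ?Y B e ?d = \<zero>\<^bsub>map_obj F B\<^esub>"
      using relation_vanishes[OF F sep s e p B ra] by blast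
    then show ?thesis
      using d[OF F e] module_diff_eq_zero[OF PSh_module[OF F B] ev_closed[OF F B e g] ev_closed[OF F B e rg(1)]]
      by (simp add: t_def)
  qed
  have sv: "is_sieve K a ?X ?R" by (rule generated_sieve(1)[OF X seq_q_formal[OF sq]])
  have mt: "matching F ?X ?R t"
    unfolding matching_def
  proof (intro ballI conjI)
    fix B f assume B: "B \<in> Obj a" and f: "f \<in> ?R B"
    note rf = r[OF f]
    show "t B f \<in> el F B" unfolding t_def by (rule ev_closed[OF F B e rf(1)])
    show "t B (f \<oplus>\<^bsub>HomMod a B ?X\<^esub> g) = t B f \<oplus>\<^bsub>map_obj F B\<^esub> t B g" if g: "g \<in> ?R B" for g
    proof -
      note rg = r[OF g]
      have eq: "f \<oplus>\<^bsub>HomMod a B ?X\<^esub> g = ev (Yoneda a ?X) ?Y B ?q (\<lambda>i. r B f i \<oplus>\<^bsub>HomMod a B (summand ?Y i)\<^esub> r B g i)"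
        using ev_add[OF YX B Q rf(1) rg(1)] rf(2) rg(2) by simp
      show ?thesis unfolding eq using wd[OF B row_add[OF B Y rf(1) rg(1)]] sieve_add[OF sv X f g] eq
          ev_add[OF F B e rf(1) rg(1)] by (simp add: t_def)
    qed
    show "t B (c \<odot>\<^bsub>HomMod a B ?X\<^esub> f) = c \<odot>\<^bsub>map_obj F B\<^esub> t B f" if c: "c \<in> carrier K" for c
    proof -
      have eq: "c \<odot>\<^bsub>HomMod a B ?X\<^esub> f = ev (Yoneda a ?X) ?Y B ?q (\<lambda>i. c \<odot>\<^bsub>HomMod a B (summand ?Y i)\<^esub> r B f i)"
        using ev_smult[OF YX B Q rf(1) c] rf(2) by simp
      show ?thesis unfolding eq using wd[OF B row_smult[OF B Y rf(1) c]] sieve_smult[OF sv X c f] eq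
          ev_smult[OF F B e rf(1) c] by (simp add: t_def)
    qed
    show "t D (Comp a D B ?X f k) = map_arr F B D k (t B f)" if D: "D \<in> Obj a" and k: "k \<in> Hom a D B" for D k
    proof -
      have eq: "Comp a D B ?X f k = ev (Yoneda a ?X) ?Y D ?q (\<lambda>i. Comp a D B (summand ?Y i) (r B f i) k)"
        using ev_act[OF YX B D Q rf(1) k] rf(2) sieve_Hom[OF sv X f] by simp
      show ?thesis unfolding eq using wd[OF D row_Comp[OF B D Y rf(1) k]] sieve_Comp[OF sv X D f k] eq
          ev_act[OF F B D e rf(1) k] by (simp add: t_def)
    qed
  qed
  obtain x where x: "x \<in> el F ?X" "\<And>B f. B \<in> Obj a \<Longrightarrow> f \<in> ?R B \<Longrightarrow> map_arr F ?X B f x = t B f"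
    using sheaf_glue[OF Fs X T mt] by blast
  show thesis
  proof (rule that[OF x(1)])
    fix y assume y: "y \<in> labels ?Y"
    have q: "seq_q s y () \<in> ?R (summand ?Y y)" by (rule generated_mem[OF X seq_q_formal[OF sq] y])
    have u: "ev (Yoneda a ?X) ?Y (summand ?Y y) ?q (unit_row ?Y y) = seq_q s y ()"
      by (rule ev_unit[OF YX Q y])
    show "map_arr F ?X (summand ?Y y) (seq_q s y ()) x = e y"
      using x(2)[OF Y[OF y] q] wd[OF Y[OF y] row_unit[OF Y y]] u q ev_unit[OF F e y] by simp
  qed
qed

end

locale bounded_diagram = sheaf_diagram U K a T \<kappa> j J + presite U K a T S
  for U :: "'u set set" and K :: "'k ring" and a :: "('o, 'u, 'k) linear_category"
    and T :: "'o \<Rightarrow> ('o \<Rightarrow> 'u set) set" and \<kappa> :: "'c rel" and j :: "('u, 'u) category"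
    and J :: "('u, 'u, ('o, 'k, 'u) presheaf, 'o \<Rightarrow> 'u \<Rightarrow> 'u) functor_data"
    and S :: "('o, 'u, 'u) formal_sequence set" +
  assumes regular: "regularCard \<kappa>" and bounded: "bounded_sequences \<kappa> S"

context presheaf_diagram
begin

lemma bound_over:
  assumes x: "x \<in> Obj j" and y: "y ` I \<subseteq> Obj j" and I: "|I| <o \<kappa>"
  obtains w u v where "w \<in> Obj j" "u \<in> Hom j x w" "\<And>i. i \<in> I \<Longrightarrow> v i \<in> Hom j (y i) w"
proof -
  have "|{x} \<union> y ` I| <o \<kappa>"
    by (rule Un_Cinfinite_bound_strict)
      (use finite_ordLess_card[OF kappa] ordLeq_ordLess_trans[OF card_of_image I] kappa in auto)
  then obtain w where w: "w \<in> Obj j" "\<And>z. z \<in> {x} \<union> y ` I \<Longrightarrow> Hom j z w \<noteq> {}"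
    by (rule bound[rotated]) (use x y in auto)
  obtain u where u: "u \<in> Hom j x w" using w(2)[of x] by auto
  have "\<forall>i\<in>I. \<exists>v. v \<in> Hom j (y i) w" using w(2) by blast
  then obtain v where "\<forall>i\<in>I. v i \<in> Hom j (y i) w" by (rule bchoice[THEN exE])
  then show thesis using that[OF w(1) u] by blast
qed

lemma vanish_at_stage:
  assumes P: "fcolim P p" and x: "x \<in> Obj j" and I: "|I| <o \<kappa>"
    and A: "\<And>i. i \<in> I \<Longrightarrow> A i \<in> Obj a" and e: "\<And>i. i \<in> I \<Longrightarrow> e i \<in> Jel x (A i)"
    and z: "\<And>i. i \<in> I \<Longrightarrow> p x (A i) (e i) = \<zero>\<^bsub>map_obj P (A i)\<^esub>"
  obtains w k where "w \<in> Obj j" "k \<in> Hom j x w"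
    "\<And>i. i \<in> I \<Longrightarrow> map_arr J x w k (A i) (e i) = \<zero>\<^bsub>map_obj (map_obj J w) (A i)\<^esub>"
proof -
  have "\<forall>i\<in>I. \<exists>y u. y \<in> Obj j \<and> u \<in> Hom j x y \<and>
      map_arr J x y u (A i) (e i) = \<zero>\<^bsub>map_obj (map_obj J y) (A i)\<^esub>"
  proof
    fix i assume i: "i \<in> I"
    show "\<exists>y u. y \<in> Obj j \<and> u \<in> Hom j x y \<and>
        map_arr J x y u (A i) (e i) = \<zero>\<^bsub>map_obj (map_obj J y) (A i)\<^esub>"
      using fc_zero[OF P A[OF i] x e[OF i] z[OF i]] by blast
  qed
  then obtain y u where yu: "\<And>i. i \<in> I \<Longrightarrow> y i \<in> Obj j" "\<And>i. i \<in> I \<Longrightarrow> u i \<in> Hom j x (y i)"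
    "\<And>i. i \<in> I \<Longrightarrow> map_arr J x (y i) (u i) (A i) (e i) = \<zero>\<^bsub>map_obj (map_obj J (y i)) (A i)\<^esub>" by metis
  obtain w0 u0 v where w0: "w0 \<in> Obj j" "u0 \<in> Hom j x w0" "\<And>i. i \<in> I \<Longrightarrow> v i \<in> Hom j (y i) w0"
    by (rule bound_over[OF x _ I, of y]) (use yu(1) in blast)+
  let ?c = "\<lambda>i. Comp j x (y i) w0 (v i) (u i)"
  let ?M = "{u0} \<union> ?c ` I"
  have M: "?M \<subseteq> Hom j x w0" using w0 index_Comp_closed[OF x yu(1) w0(1) yu(2) w0(3)] by blast
  have M': "|?M| <o \<kappa>"
    by (rule Un_Cinfinite_bound_strict)
      (use finite_ordLess_card[OF kappa] ordLeq_ordLess_trans[OF card_of_image I] kappa in auto)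
  obtain w h where w: "w \<in> Obj j" "h \<in> Hom j w0 w"
    "\<And>f g. f \<in> ?M \<Longrightarrow> g \<in> ?M \<Longrightarrow> Comp j x w0 w h f = Comp j x w0 w h g"
    by (rule coequalize[OF x w0(1) M M']) (rule that)
  let ?k = "Comp j x w0 w h u0"
  have k: "?k \<in> Hom j x w" by (rule index_Comp_closed[OF x w0(1) w(1) w0(2) w(2)])
  show thesis
  proof (rule that[OF w(1) k])
    fix i assume i: "i \<in> I"
    have hv: "Comp j (y i) w0 w h (v i) \<in> Hom j (y i) w" by (rule index_Comp_closed[OF yu(1)[OF i] w0(1) w(1) w0(3)[OF i] w(2)])
    have "?k = Comp j x w0 w h (?c i)" using w(3)[of u0 "?c i"] i by blast
    also have "\<dots> = Comp j x (y i) w (Comp j (y i) w0 w h (v i)) (u i)"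
      by (rule index_Comp_assoc[OF x yu(1)[OF i] w0(1) w(1) yu(2)[OF i] w0(3)[OF i] w(2)])
    finally have "map_arr J x w ?k (A i) (e i) = map_arr J (y i) w (Comp j (y i) w0 w h (v i)) (A i) (map_arr J x (y i) (u i) (A i) (e i))"
      using J_Comp[OF x yu(1)[OF i] w(1) yu(2)[OF i] hv A[OF i] e[OF i]] by simp
    also have "\<dots> = \<zero>\<^bsub>map_obj (map_obj J w) (A i)\<^esub>"
      unfolding yu(3)[OF i] by (rule J_zero[OF yu(1)[OF i] w(1) hv A[OF i]])
    finally show "map_arr J x w ?k (A i) (e i) = \<zero>\<^bsub>map_obj (map_obj J w) (A i)\<^esub>" .
  qed
qed

lemma common_stage:
  assumes P: "fcolim P p" and I: "|I| <o \<kappa>"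
    and A: "\<And>i. i \<in> I \<Longrightarrow> A i \<in> Obj a" and y: "\<And>i. i \<in> I \<Longrightarrow> y i \<in> el P (A i)"
  obtains x e where "x \<in> Obj j" "\<And>i. i \<in> I \<Longrightarrow> e i \<in> Jel x (A i)"
    "\<And>i. i \<in> I \<Longrightarrow> p x (A i) (e i) = y i"
proof -
  have "\<forall>i\<in>I. \<exists>x d. x \<in> Obj j \<and> d \<in> Jel x (A i) \<and> p x (A i) d = y i"
  proof
    fix i assume i: "i \<in> I"
    show "\<exists>x d. x \<in> Obj j \<and> d \<in> Jel x (A i) \<and> p x (A i) d = y i"
      using fc_surj[OF P A[OF i] y[OF i]] by blast
  qed
  then obtain x d where xd: "\<And>i. i \<in> I \<Longrightarrow> x i \<in> Obj j" "\<And>i. i \<in> I \<Longrightarrow> d i \<in> Jel (x i) (A i)"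
    "\<And>i. i \<in> I \<Longrightarrow> p (x i) (A i) (d i) = y i" by metis
  obtain x0 where x0: "x0 \<in> Obj j" by (rule nonempty)
  obtain w u v where w: "w \<in> Obj j" "u \<in> Hom j x0 w" "\<And>i. i \<in> I \<Longrightarrow> v i \<in> Hom j (x i) w"
    by (rule bound_over[OF x0 _ I, of x]) (use xd(1) in blast)+
  show thesis
  proof (rule that[OF w(1), of "\<lambda>i. map_arr J (x i) w (v i) (A i) (d i)"])
    fix i assume i: "i \<in> I"
    show "map_arr J (x i) w (v i) (A i) (d i) \<in> Jel w (A i)" by (rule JD(2)[OF xd(1)[OF i] w(1) w(3)[OF i] A[OF i] xd(2)[OF i]])
    show "p w (A i) (map_arr J (x i) w (v i) (A i) (d i)) = y i"
      using fc_cocone[OF P xd(1)[OF i] w(1) w(3)[OF i] A[OF i] xd(2)[OF i]] xd(3)[OF i] by simp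
  qed
qed

end

context bounded_diagram
begin

lemmas labels_small = Co_card[OF kappa regular bounded]

lemma fcolim_separated:
  assumes P: "fcolim P p"
  shows "separated P"
  unfolding separated_def
proof (intro ballI impI)
  fix A R y assume A: "A \<in> Obj a" and R: "R \<in> T A" and y: "y \<in> el P A"
    and z: "\<forall>B\<in>Obj a. \<forall>f\<in>R B. map_arr P A B f y = \<zero>\<^bsub>map_obj P B\<^esub>"
  obtain i V v where c: "Co a S i V v A" and vR: "\<And>l. l \<in> labels V \<Longrightarrow> v l () \<in> R (summand V l)"
    by (rule T_Co[OF A R]) (rule that)
  obtain x e where x: "x \<in> Obj j" and e: "e \<in> Jel x A" and ye: "p x A e = y" using fc_surj[OF P A y] by blast
  note V = Co_Hom[OF c]
  note pD = PSh_HomD[OF fc_Hom[OF P]]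
  obtain w k where w: "w \<in> Obj j" "k \<in> Hom j x w" and kz: "\<And>l. l \<in> labels V \<Longrightarrow>
      map_arr J x w k (summand V l) (map_arr (map_obj J x) A (summand V l) (v l ()) e) = \<zero>\<^bsub>map_obj (map_obj J w) (summand V l)\<^esub>"
  proof (rule vanish_at_stage[OF P x labels_small[OF c], of "summand V" "\<lambda>l. map_arr (map_obj J x) A (summand V l) (v l ()) e"])
    fix l assume l: "l \<in> labels V"
    show "summand V l \<in> Obj a" by (rule V(1)[OF l])
    show "map_arr (map_obj J x) A (summand V l) (v l ()) e \<in> Jel x (summand V l)" by (rule PSh_closed[OF J_PSh[OF x] A V[OF l] e])
    show "p x (summand V l) (map_arr (map_obj J x) A (summand V l) (v l ()) e) = \<zero>\<^bsub>map_obj P (summand V l)\<^esub>"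
      using pD(5)[OF x A V[OF l] e] ye z V(1)[OF l] vR[OF l] by simp
  qed (rule that)
  note ke = JD(2)[OF x w A e]
  have "map_arr J x w k A e = \<zero>\<^bsub>Jm w A\<^esub>"
  proof (rule separated_generated[OF J_PSh[OF w(1)] sheaf_separated[OF J_sheaf[OF w(1)]] A Co_sec[OF c] generated_T[OF c] ke
        module_zero_closed[OF PSh_module[OF J_PSh[OF w(1)] A]]])
    fix l assume l: "l \<in> labels V"
    show "map_arr (map_obj J w) A (summand V l) (v l ()) (map_arr J x w k A e) =
      map_arr (map_obj J w) A (summand V l) (v l ()) \<zero>\<^bsub>Jm w A\<^esub>"
      using JD(5)[OF x w A V[OF l] e] kz[OF l] PSh_zero[OF J_PSh[OF w(1)] A V[OF l]] by simp
  qed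
  then show "y = \<zero>\<^bsub>map_obj P A\<^esub>"
    using fc_cocone[OF P x w A e] ye PSh_Hom_zero[OF J_PSh[OF w(1)] fc_PSh[OF P] fc_Hom[OF P w(1)] A] by simp
qed

lemma fcolim_exact:
  assumes P: "fcolim P p" and s: "s \<in> S" and y: "sections P (seq_Y s) y"
    and z: "\<And>z. z \<in> labels (seq_Z s) \<Longrightarrow>
        ev P (seq_Y s) (summand (seq_Z s) z) y (seq_p s z) = \<zero>\<^bsub>map_obj P (summand (seq_Z s) z)\<^esub>"
  obtains x where "x \<in> el P (seq_X s)"
    "\<And>b. b \<in> labels (seq_Y s) \<Longrightarrow> map_arr P (seq_X s) (summand (seq_Y s) b) (seq_q s b ()) x = y b"
proof -
  note sq = sequences[OF s]
  let ?X = "seq_X s" and ?Y = "seq_Y s" and ?Z = "seq_Z s"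
  note X = seq_X_Obj[OF sq] and Y = seq_Y_Obj[OF sq] and Z = seq_Z_Obj[OF sq]
  have cY: "|labels ?Y| <o \<kappa>" and cZ: "|labels ?Z| <o \<kappa>" using bounded s by (auto simp: bounded_sequences_def)
  note PP = fc_PSh[OF P] and pH = fc_Hom[OF P]
  note pD = PSh_HomD[OF pH]
  obtain x e where x: "x \<in> Obj j" and e: "\<And>b. b \<in> labels ?Y \<Longrightarrow> e b \<in> Jel x (summand ?Y b)"
    and ye: "\<And>b. b \<in> labels ?Y \<Longrightarrow> p x (summand ?Y b) (e b) = y b"
    by (rule common_stage[OF P cY, of "summand ?Y" y]) (use y in \<open>auto simp: sections_def\<close>)
  have se: "sections (map_obj J x) ?Y e" using e Y by (simp add: sections_def)
  note ez = ev_closed[OF J_PSh[OF x] Z se seq_p_row[OF sq]]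
  obtain w k where w: "w \<in> Obj j" "k \<in> Hom j x w" and kz: "\<And>c. c \<in> labels ?Z \<Longrightarrow>
      map_arr J x w k (summand ?Z c) (ev (map_obj J x) ?Y (summand ?Z c) e (seq_p s c)) = \<zero>\<^bsub>map_obj (map_obj J w) (summand ?Z c)\<^esub>"
  proof (rule vanish_at_stage[OF P x cZ, of "summand ?Z" "\<lambda>c. ev (map_obj J x) ?Y (summand ?Z c) e (seq_p s c)"])
    fix c assume c: "c \<in> labels ?Z"
    show "summand ?Z c \<in> Obj a" by (rule Z[OF c])
    show "ev (map_obj J x) ?Y (summand ?Z c) e (seq_p s c) \<in> Jel x (summand ?Z c)" by (rule ez[OF c c])
    note h = ev_Hom[OF J_PSh[OF x] PP pH[OF x] Z[OF c] se seq_p_row[OF sq c]]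
    have "ev P ?Y (summand ?Z c) (\<lambda>i. p x (summand ?Y i) (e i)) (seq_p s c) = ev P ?Y (summand ?Z c) y (seq_p s c)"
      by (rule ev_cong[OF PP Z[OF c] h(1) seq_p_row[OF sq c] refl ye])
    then show "p x (summand ?Z c) (ev (map_obj J x) ?Y (summand ?Z c) e (seq_p s c)) = \<zero>\<^bsub>map_obj P (summand ?Z c)\<^esub>"
      using h(2) z[OF c] by simp
  qed (rule that)
  let ?e = "\<lambda>b. map_arr J x w k (summand ?Y b) (e b)"
  have tX: "generated_sieve K a ?Y (seq_q s) ?X \<in> T ?X"
  proof -
    let ?V = "\<lparr>labels = {[y] | y. y \<in> labels ?Y}, summand = \<lambda>l. summand ?Y (last l)\<rparr>"
    let ?v = "\<lambda>l _. seq_q s (last l) ()"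
    note c = Co_1[OF s, of a]
    show ?thesis
    proof (rule T_superset[OF X generated_T[OF c] generated_sieve(1)[OF X seq_q_formal[OF sq]]])
      fix B f assume f: "f \<in> generated_sieve K a ?V ?v ?X B"
      show "f \<in> generated_sieve K a ?Y (seq_q s) ?X B"
        by (rule generated_least[OF X Co_sec[OF c] generated_sieve(1)[OF X seq_q_formal[OF sq]] _ f])
          (use generated_mem[OF X seq_q_formal[OF sq]] in auto)
    qed
  qed
  obtain u where u: "u \<in> Jel w ?X" "\<And>b. b \<in> labels ?Y \<Longrightarrow> map_arr (map_obj J w) ?X (summand ?Y b) (seq_q s b ()) u = ?e b"
  proof (rule sheaf_exact[OF J_sheaf[OF w(1)] s tX, of ?e])
    show "sections (map_obj J w) ?Y ?e" by (rule ev_Hom(1)[OF J_PSh[OF x] J_PSh[OF w(1)] J_Hom[OF x w] X se row_zero[OF X Y]])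
    show "ev (map_obj J w) ?Y (summand ?Z c) ?e (seq_p s c) = \<zero>\<^bsub>map_obj (map_obj J w) (summand ?Z c)\<^esub>" if c: "c \<in> labels ?Z"
        for c
      using ev_Hom(2)[OF J_PSh[OF x] J_PSh[OF w(1)] J_Hom[OF x w] Z[OF c] se seq_p_row[OF sq c]] kz[OF c] by simp
  qed (rule that)
  show thesis
  proof (rule that)
    show "p w ?X u \<in> el P ?X" by (rule pD(2)[OF w(1) X u(1)])
    fix b assume b: "b \<in> labels ?Y"
    show "map_arr P ?X (summand ?Y b) (seq_q s b ()) (p w ?X u) = y b"
      using pD(5)[OF w(1) X Y[OF b] seq_q_Hom[OF sq b] u(1)] u(2)[OF b] fc_cocone[OF P x w Y[OF b] e[OF b]] ye[OF b] by simp
  qed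
qed

lemma fcolim_glue_Co1:
  assumes P: "fcolim P p" and s: "s \<in> S" and R: "R \<in> T (seq_X s)"
    and q: "\<And>b. b \<in> labels (seq_Y s) \<Longrightarrow> seq_q s b () \<in> R (summand (seq_Y s) b)" and m: "matching P (seq_X s) R m"
  obtains x where "x \<in> el P (seq_X s)"
    "\<And>B f. B \<in> Obj a \<Longrightarrow> f \<in> R B \<Longrightarrow> map_arr P (seq_X s) B f x = m B f"
proof -
  note sq = sequences[OF s]
  let ?X = "seq_X s" and ?Y = "seq_Y s" and ?Z = "seq_Z s" and ?q = "\<lambda>b. seq_q s b ()"
  note X = seq_X_Obj[OF sq] and Y = seq_Y_Obj[OF sq] and Z = seq_Z_Obj[OF sq]
  note PP = fc_PSh[OF P] and sep = fcolim_separated[OF P]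
  have sv: "is_sieve K a ?X R" using sieves X R by blast
  note es = ev_sieve[OF PP X sv m _ q]
  have m0: "m B \<zero>\<^bsub>HomMod a B ?X\<^esub> = \<zero>\<^bsub>map_obj P B\<^esub>" if B: "B \<in> Obj a" for B
  proof -
    have z: "\<zero>\<^bsub>HomMod a B ?X\<^esub> \<in> R B" by (rule sieve_zero[OF sv X B])
    interpret H: module K "HomMod a B ?X" by (rule module_HomMod[OF B X])
    have "m B \<zero>\<^bsub>HomMod a B ?X\<^esub> \<oplus>\<^bsub>map_obj P B\<^esub> m B \<zero>\<^bsub>HomMod a B ?X\<^esub> = m B \<zero>\<^bsub>HomMod a B ?X\<^esub>"
      using matchingD(2)[OF m B z z] by simp
    then show ?thesis using module_add_self_zero[OF PSh_module[OF PP B]] matchingD(1)[OF m B z] by blast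
  qed
  let ?y = "\<lambda>b. m (summand ?Y b) (seq_q s b ())"
  have sy: "sections P ?Y ?y" by (rule es(2)[OF X _ row_zero[OF X Y]])
  obtain x where x: "x \<in> el P ?X" "\<And>b. b \<in> labels ?Y \<Longrightarrow> map_arr P ?X (summand ?Y b) (seq_q s b ()) x = ?y b"
  proof (rule fcolim_exact[OF P s sy])
    fix c assume c: "c \<in> labels ?Z"
    show "ev P ?Y (summand ?Z c) ?y (seq_p s c) = \<zero>\<^bsub>map_obj P (summand ?Z c)\<^esub>"
      using es(4)[OF Z[OF c] _ seq_p_row[OF sq c]] seq_qp[OF sq c] m0[OF Z[OF c]] by simp
  qed (rule that)
  show thesis
  proof (rule that[OF x(1)])
    fix B f assume B: "B \<in> Obj a" and f: "f \<in> R B"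
    have fH: "f \<in> Hom a B ?X" by (rule sieve_Hom[OF sv X f])
    obtain i V q' f' where c: "Co a S i V q' B" and f': "\<And>l. l \<in> labels V \<Longrightarrow> row (summand V l) ?Y (f' l)"
      and e: "\<And>l. l \<in> labels V \<Longrightarrow> Comp a (summand V l) B ?X f (q' l ()) = ev (Yoneda a ?X) ?Y (summand V l) ?q (f' l)"
      by (rule lift_along[OF s B fH]) (rule that)
    show "map_arr P ?X B f x = m B f"
    proof (rule separated_generated[OF PP sep B Co_sec[OF c] generated_T[OF c] PSh_closed[OF PP X B fH x(1)] matchingD(1)[OF m B f]])
      fix l assume l: "l \<in> labels V"
      note V = Co_Hom[OF c l]
      have xs: "map_arr P ?X (summand V l) (ev (Yoneda a ?X) ?Y (summand V l) ?q (f' l)) x =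
        ev P ?Y (summand V l) (\<lambda>b. map_arr P ?X (summand ?Y b) (seq_q s b ()) x) (f' l)"
        by (rule ev_sieve(4)[OF PP X sv matching_restrict[OF PP X sv x(1)] V(1) q f'[OF l]])
      have sx: "sections P ?Y (\<lambda>b. map_arr P ?X (summand ?Y b) (seq_q s b ()) x)"
        by (rule ev_sieve(2)[OF PP X sv matching_restrict[OF PP X sv x(1)] V(1) q f'[OF l]])
      have "map_arr P B (summand V l) (q' l ()) (map_arr P ?X B f x) = map_arr P ?X (summand V l) (Comp a (summand V l) B ?X f (q' l ())) x"
        by (rule PSh_Comp[OF PP X B V(1) fH V(2) x(1), symmetric])
      also have "\<dots> = ev P ?Y (summand V l) ?y (f' l)"
        unfolding e[OF l] xs by (rule ev_cong[OF PP V(1) sx f'[OF l] refl x(2)])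
      also have "\<dots> = m (summand V l) (Comp a (summand V l) B ?X f (q' l ()))"
        unfolding e[OF l] by (rule es(4)[OF V(1) _ f'[OF l], symmetric])
      also have "\<dots> = map_arr P B (summand V l) (q' l ()) (m B f)" by (rule matchingD(4)[OF m B f V])
      finally show "map_arr P B (summand V l) (q' l ()) (map_arr P ?X B f x) = map_arr P B (summand V l) (q' l ()) (m B f)" .
    qed
  qed
qed

lemma fcolim_glue:
  assumes P: "fcolim P p" and c: "Co a S i V v X" and R: "R \<in> T X"
      and vR: "\<And>l. l \<in> labels V \<Longrightarrow> v l () \<in> R (summand V l)"
    and m: "matching P X R m"
  shows "\<exists>x\<in>el P X. \<forall>B\<in>Obj a. \<forall>f\<in>R B. map_arr P X B f x = m B f"
  using c R vR m
proof (induction arbitrary: R m)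
  case (Co_0 X)
  have sv: "is_sieve K a X R" using sieves Co_0 by blast
  have id: "Ident a X \<in> R X" using Co_0 by (simp add: one_object_def)
  have "map_arr P X B f (m X (Ident a X)) = m B f" if B: "B \<in> Obj a" and f: "f \<in> R B" for B f
    using matchingD(4)[OF Co_0(4) Co_0(1) id B sieve_Hom[OF sv Co_0(1) f]]
      base_Comp_Ident_left[OF B Co_0(1) sieve_Hom[OF sv Co_0(1) f]] by simp
  then show ?case using matchingD(1)[OF Co_0(4) Co_0(1) id] by blast
next
  case (Co_1 s)
  obtain x where "x \<in> el P (seq_X s)"
    "\<And>B f. B \<in> Obj a \<Longrightarrow> f \<in> R B \<Longrightarrow> map_arr P (seq_X s) B f x = m B f"
    by (rule fcolim_glue_Co1[OF P Co_1(1) Co_1(2) _ Co_1(4)]) (use Co_1(3)[of "[_]"] in auto)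
  then show ?case by blast
next
  case (Co_Suc i V v X t)
  note PP = fc_PSh[OF P] and sep = fcolim_separated[OF P] and X = Co_Obj[OF Co_Suc.hyps(2)] and V = Co_Hom[OF Co_Suc.hyps(2)]
  note RT = Co_Suc.prems(1) and m = Co_Suc.prems(3)
  have sv: "is_sieve K a X R" using sieves X RT by blast
  text \<open>
    The sieve \<open>R'\<close> of all arrows along which the matching family has an amalgamation contains the
    cover \<open>v\<close>, so the family of these amalgamations extends by induction.
  \<close>
  define am where "am B f y \<longleftrightarrow> y \<in> el P B \<and>
    (\<forall>D\<in>Obj a. \<forall>g\<in>Hom a D B. Comp a D B X f g \<in> R D \<longrightarrow> map_arr P B D g y = m D (Comp a D B X f g))"
      for B f y
  define R' where "R' B = {f. B \<in> Obj a \<and> f \<in> Hom a B X \<and> (\<exists>y. am B f y)}" for B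
  define m' where "m' B f = (SOME y. am B f y)" for B f
  have m': "am B f (m' B f)" if "f \<in> R' B" for B f
  proof -
    have "\<exists>y. am B f y" using that by (simp add: R'_def)
    then show ?thesis unfolding m'_def by (rule someI_ex)
  qed
  have amI: "am B f y" if B: "B \<in> Obj a" and f: "f \<in> Hom a B X" and y: "y \<in> el P B" and Q: "Q \<in> T B"
    and e: "\<And>D g. \<lbrakk>D \<in> Obj a; g \<in> Q D; Comp a D B X f g \<in> R D\<rbrakk> \<Longrightarrow>
      map_arr P B D g y = m D (Comp a D B X f g)" for B f y Q
    unfolding am_def
  proof (intro conjI ballI impI y)
    fix D g assume D: "D \<in> Obj a" and g: "g \<in> Hom a D B" and fg: "Comp a D B X f g \<in> R D"
    note gy = PSh_closed[OF PP B D g y]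
    show "map_arr P B D g y = m D (Comp a D B X f g)"
    proof (rule separatedD[OF PP sep D T2[OF B D Q g] gy matchingD(1)[OF m D fg]])
      fix E h assume E: "E \<in> Obj a" and "h \<in> pullback_sieve a D B g Q E"
      then have h: "h \<in> Hom a E D" "Comp a E D B g h \<in> Q E" by (auto simp: pullback_iff)
      have a: "Comp a E B X f (Comp a E D B g h) = Comp a E D X (Comp a D B X f g) h"
        by (rule base_Comp_assoc[OF E D B X h(1) g f])
      have fgh: "Comp a E B X f (Comp a E D B g h) \<in> R E" unfolding a by (rule sieve_Comp[OF sv X E fg h(1)])
      show "map_arr P D E h (map_arr P B D g y) = map_arr P D E h (m D (Comp a D B X f g))"
        using PSh_Comp[OF PP B D E g h(1) y] e[OF E h(2) fgh] matchingD(4)[OF m D fg E h(1)] a by simp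
    qed
  qed
  have am_unique: "y = y'" if B: "B \<in> Obj a" and f: "f \<in> Hom a B X" and y: "am B f y" and y': "am B f y'" for B f y y'
    by (rule separatedD[OF PP sep B T2[OF X B RT f]]) (use y y' in \<open>auto simp: am_def pullback_iff\<close>)
  have R'I: "f \<in> R' B \<and> m' B f = y" if "B \<in> Obj a" "f \<in> Hom a B X" "am B f y" for B f y
  proof -
    have "f \<in> R' B" using that by (auto simp: R'_def)
    then show ?thesis using am_unique[OF that(1,2) m' that(3)] by simp
  qed
  have R'H: "B \<in> Obj a" "f \<in> Hom a B X" if "f \<in> R' B" for B f using that by (auto simp: R'_def)
  have R'c: "m' B f \<in> el P B" if "f \<in> R' B" for B f using m'[OF that] by (simp add: am_def)
  have R'e: "map_arr P B D g (m' B f) = m D (Comp a D B X f g)"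
    if "f \<in> R' B" "D \<in> Obj a" "g \<in> Hom a D B" "Comp a D B X f g \<in> R D" for B f D g
    using m'[OF that(1)] that(2-4) by (simp add: am_def)
  have RR': "f \<in> R' B \<and> m' B f = m B f" if B: "B \<in> Obj a" and f: "f \<in> R B" for B f
  proof (rule R'I[OF B sieve_Hom[OF sv X f]])
    show "am B f (m B f)"
      unfolding am_def using matchingD(1)[OF m B f] matchingD(4)[OF m B f] by simp
  qed
  have add: "f \<oplus>\<^bsub>HomMod a B X\<^esub> g \<in> R' B \<and>
      m' B (f \<oplus>\<^bsub>HomMod a B X\<^esub> g) = m' B f \<oplus>\<^bsub>map_obj P B\<^esub> m' B g"
    if f: "f \<in> R' B" and g: "g \<in> R' B" for B f g
  proof -
    note B = R'H(1)[OF f] and fH = R'H(2)[OF f] and gH = R'H(2)[OF g]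
    let ?Q = "\<lambda>D. pullback_sieve a B X f R D \<inter> pullback_sieve a B X g R D"
    have "am B (f \<oplus>\<^bsub>HomMod a B X\<^esub> g) (m' B f \<oplus>\<^bsub>map_obj P B\<^esub> m' B g)"
    proof (rule amI[OF B Hom_add_closed[OF B X fH gH] module_add_closed[OF PSh_module[OF PP B] R'c[OF f] R'c[OF g]]
          T_Int[OF B T2[OF X B RT fH] T2[OF X B RT gH]]])
      fix D h assume D: "D \<in> Obj a" and "h \<in> ?Q D"
      then have h: "h \<in> Hom a D B" "Comp a D B X f h \<in> R D" "Comp a D B X g h \<in> R D" by (auto simp: pullback_iff)
      show "map_arr P B D h (m' B f \<oplus>\<^bsub>map_obj P B\<^esub> m' B g) = m D (Comp a D B X (f \<oplus>\<^bsub>HomMod a B X\<^esub> g) h)"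
        using PSh_add[OF PP B D h(1) R'c[OF f] R'c[OF g]] R'e[OF f D h(1,2)] R'e[OF g D h(1,3)]
          matchingD(2)[OF m D h(2,3)] Comp_add_left[OF D B X h(1) fH gH] by simp
    qed
    then show ?thesis by (rule R'I[OF B Hom_add_closed[OF B X fH gH]])
  qed
  have smu: "c \<odot>\<^bsub>HomMod a B X\<^esub> f \<in> R' B \<and>
      m' B (c \<odot>\<^bsub>HomMod a B X\<^esub> f) = c \<odot>\<^bsub>map_obj P B\<^esub> m' B f"
    if c: "c \<in> carrier K" and f: "f \<in> R' B" for B f c
  proof -
    note B = R'H(1)[OF f] and fH = R'H(2)[OF f]
    have "am B (c \<odot>\<^bsub>HomMod a B X\<^esub> f) (c \<odot>\<^bsub>map_obj P B\<^esub> m' B f)"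
    proof (rule amI[OF B Hom_smult_closed[OF B X c fH] module_smult_closed[OF PSh_module[OF PP B] c R'c[OF f]] T2[OF X B RT fH]])
      fix D h assume D: "D \<in> Obj a" and "h \<in> pullback_sieve a B X f R D"
      then have h: "h \<in> Hom a D B" "Comp a D B X f h \<in> R D" by (auto simp: pullback_iff)
      show "map_arr P B D h (c \<odot>\<^bsub>map_obj P B\<^esub> m' B f) = m D (Comp a D B X (c \<odot>\<^bsub>HomMod a B X\<^esub> f) h)"
        using PSh_smult[OF PP B D h(1) c R'c[OF f]] R'e[OF f D h] matchingD(3)[OF m D h(2) c]
          Comp_smult_left[OF D B X c h(1) fH] by simp
    qed
    then show ?thesis by (rule R'I[OF B Hom_smult_closed[OF B X c fH]])
  qed
  have act: "Comp a D B X f k \<in> R' D \<and> m' D (Comp a D B X f k) = map_arr P B D k (m' B f)"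
    if f: "f \<in> R' B" and D: "D \<in> Obj a" and k: "k \<in> Hom a D B" for B f D k
  proof -
    note B = R'H(1)[OF f] and fH = R'H(2)[OF f]
    have fk: "Comp a D B X f k \<in> Hom a D X" by (rule base_Comp_closed[OF D B X k fH])
    have "am D (Comp a D B X f k) (map_arr P B D k (m' B f))"
      unfolding am_def
    proof (intro conjI ballI impI)
      show "map_arr P B D k (m' B f) \<in> el P D" by (rule PSh_closed[OF PP B D k R'c[OF f]])
      fix E h assume E: "E \<in> Obj a" and h: "h \<in> Hom a E D" and r: "Comp a E D X (Comp a D B X f k) h \<in> R E"
      note as = base_Comp_assoc[OF E D B X h k fH]
      show "map_arr P D E h (map_arr P B D k (m' B f)) = m E (Comp a E D X (Comp a D B X f k) h)"
        using PSh_Comp[OF PP B D E k h R'c[OF f]] R'e[OF f E base_Comp_closed[OF E D B h k]] r as by simp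
    qed
    then show ?thesis by (rule R'I[OF D fk])
  qed
  have sv': "is_sieve K a X R'"
  proof (rule sieveI[OF X])
    show "B \<in> Obj a" "f \<in> Hom a B X" if "f \<in> R' B" for B f using R'H[OF that] by auto
    show "\<zero>\<^bsub>HomMod a B X\<^esub> \<in> R' B" if "B \<in> Obj a" for B using RR'[OF that sieve_zero[OF sv X that]] by blast
    show "f \<oplus>\<^bsub>HomMod a B X\<^esub> g \<in> R' B" if "f \<in> R' B" "g \<in> R' B" for B f g using add[OF that] by blast
    show "c \<odot>\<^bsub>HomMod a B X\<^esub> f \<in> R' B" if "c \<in> carrier K" "f \<in> R' B" for B f c using smu[OF that] by blast
    show "Comp a D B X f g \<in> R' D" if "B \<in> Obj a" "D \<in> Obj a" "f \<in> R' B" "g \<in> Hom a D B" for B D f g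
      using act[OF that(3,2,4)] by blast
  qed
  have R'T: "R' \<in> T X" by (rule T_superset[OF X RT sv']) (use RR' in blast)
  have mm: "matching P X R' m'" unfolding matching_def by (simp add: R'c add smu act)
  have vR': "v l () \<in> R' (summand V l)" if l: "l \<in> labels V" for l
  proof -
    note tl = Co_Suc.hyps(3)[OF l]
    note Vl = V[OF l]
    let ?W = "seq_Y (t l)"
    note sq = sequences[OF conjunct1[OF tl]]
    let ?Q = "pullback_sieve a (summand V l) X (v l ()) R"
    have Q: "?Q \<in> T (seq_X (t l))" using T2[OF X Vl(1) RT Vl(2)] tl by simp
    have q: "seq_q (t l) b () \<in> ?Q (summand ?W b)" if b: "b \<in> labels ?W" for b
      using Co_Suc.prems(2)[of "l @ [b]"] l b seq_q_Hom[OF sq b] seq_Y_Obj[OF sq b] tl by (auto simp: pullback_iff)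
    have mQ: "matching P (seq_X (t l)) ?Q (\<lambda>D g. m D (Comp a D (summand V l) X (v l ()) g))"
      using matching_pullback[OF PP X Vl m] tl by simp
    obtain y where y: "y \<in> el P (seq_X (t l))"
      "\<And>B f. B \<in> Obj a \<Longrightarrow> f \<in> ?Q B \<Longrightarrow>
        map_arr P (seq_X (t l)) B f y = m B (Comp a B (summand V l) X (v l ()) f)"
      by (rule fcolim_glue_Co1[OF P conjunct1[OF tl] Q q mQ]) (assumption, rule that)
    have "am (summand V l) (v l ()) y" using y tl by (auto simp: am_def pullback_iff)
    then show ?thesis using R'I[OF Vl] by blast
  qed
  obtain x where "x \<in> el P X" "\<forall>B\<in>Obj a. \<forall>f\<in>R' B. map_arr P X B f x = m' B f"
    using Co_Suc.IH[OF R'T vR' mm] by blast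
  then show ?case using RR' by (intro bexI[of _ x]) auto
qed

lemma fcolim_sheaf:
  assumes P: "fcolim P p"
  shows "is_sheaf U K a T P"
  unfolding is_sheaf_iff
proof (intro conjI ballI allI impI)
  show "P \<in> Obj PS" by (rule fc_PSh[OF P])
  show "separated P" by (rule fcolim_separated[OF P])
  fix A R m assume A: "A \<in> Obj a" and R: "R \<in> T A" and m: "matching P A R m"
  obtain i V v where c: "Co a S i V v A" and vR: "\<And>l. l \<in> labels V \<Longrightarrow> v l () \<in> R (summand V l)"
    by (rule T_Co[OF A R]) (rule that)
  show "\<exists>x\<in>el P A. \<forall>B\<in>Obj a. \<forall>f\<in>R B. map_arr P A B f x = m B f"
    by (rule fcolim_glue[OF P c R vR m])
qed

lemma commutes:
  "commutes_with_colimit j (Sh U K a T) PS inclusion_functor J"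
  unfolding commutes_with_colimit_def
proof (intro allI impI)
  fix L l P p assume L: "is_colimit j (Sh U K a T) J L l"
    and "is_colimit j PS (comp_functor inclusion_functor J) P p"
  then have P: "is_colimit j PS J P p" by simp
  have PC: "is_colimit j (Sh U K a T) J P p" by (rule colimit_ShI[OF P fcolim_sheaf[OF colimit_fcolim[OF P]]])
  have JO: "map_obj J x \<in> Obj (Sh U K a T)" if "x \<in> Obj j" for x using J_sheaf[OF that] by (simp add: Sh_Obj_iff)
  obtain h where "is_iso (Sh U K a T) P L h" "\<And>x. x \<in> Obj j \<Longrightarrow> Comp (Sh U K a T) (map_obj J x) P L h (p x) = l x"
    by (rule colimit_iso[OF category_Sh PC L JO]) (assumption, rule that)
  then show "\<exists>h. is_iso PS P (map_obj inclusion_functor L) h \<and>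
      (\<forall>x\<in>Obj j. Comp PS (map_obj inclusion_functor (map_obj J x)) P (map_obj inclusion_functor L) h (p x) =
        map_arr inclusion_functor (map_obj J x) L (l x))"
    by (intro exI[of _ h]) (auto simp: is_iso_def)
qed

end

lemma (in site) pretopology_imp_commutes:
  assumes \<kappa>: "Card_order \<kappa>" "cinfinite \<kappa>" "regularCard \<kappa>" and S: "pretopology U a S" "bounded_sequences \<kappa> S"
    and T: "\<forall>A\<in>Obj a. T A = top_of K a S A"
  shows "commutes_filtered \<kappa>"
  unfolding commutes_filtered_def
proof (intro allI impI)
  fix j :: "('u, 'u) category" and J
  assume j: "small_category U j" "filtered \<kappa> j" "is_functor j (Sh U K a T) J"
  interpret D: sheaf_diagram U K a T \<kappa> j J by (rule sheaf_diagramI[OF \<kappa>(1,2) j])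
  interpret pretopology U a S by (rule S(1))
  interpret bounded_diagram U K a T \<kappa> j J S
    by unfold_locales (use T \<kappa>(3) S(2) in auto)
  show "commutes_with_colimit j (Sh U K a T) (PSh U K a) inclusion_functor J" by (rule commutes)
qed

context site
begin

section \<open>Generated subpresheaves and their sheafified quotients\<close>

lemma subpresheaf_carrier:
  assumes M: "M \<in> Obj PS"
  shows "subpresheaf M (\<lambda>A. el M A)"
  unfolding subpresheaf_def
  by (simp add: module_zero_closed[OF PSh_module[OF M]] module_add_closed[OF PSh_module[OF M]]
      module_smult_closed[OF PSh_module[OF M]] PSh_closed[OF M])

definition subpresheaf_gen :: "('o, 'k, 'u) presheaf \<Rightarrow> ('o \<times> 'u) set \<Rightarrow> 'o \<Rightarrow> 'u set" where
  "subpresheaf_gen M G A = {x \<in> el M A. \<forall>N. subpresheaf M N \<longrightarrow> (\<forall>(B,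
    y)\<in>G. y \<in> N B) \<longrightarrow> x \<in> N A}"

lemma subpresheaf_gen:
  assumes M: "M \<in> Obj PS"
  shows "subpresheaf M (subpresheaf_gen M G)"
  unfolding subpresheaf_def
proof (intro ballI conjI)
  fix A assume A: "A \<in> Obj a"
  note D = subpresheafD[OF subpresheaf_carrier[OF M] A]
  show "subpresheaf_gen M G A \<subseteq> el M A" by (auto simp: subpresheaf_gen_def)
  show "\<zero>\<^bsub>map_obj M A\<^esub> \<in> subpresheaf_gen M G A" using D(2) subpresheafD(2)[OF _ A] by (simp add: subpresheaf_gen_def)
  fix x assume x: "x \<in> subpresheaf_gen M G A"
  show "x \<oplus>\<^bsub>map_obj M A\<^esub> y \<in> subpresheaf_gen M G A" if "y \<in> subpresheaf_gen M G A" for y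
    using x that D(3) subpresheafD(3)[OF _ A] by (simp add: subpresheaf_gen_def)
  show "c \<odot>\<^bsub>map_obj M A\<^esub> x \<in> subpresheaf_gen M G A" if "c \<in> carrier K" for c
    using x that D(4) subpresheafD(4)[OF _ A] by (simp add: subpresheaf_gen_def)
  show "map_arr M A B f x \<in> subpresheaf_gen M G B" if "B \<in> Obj a" "f \<in> Hom a B A" for B f
    using x that D(5) subpresheafD(5)[OF _ A] by (simp add: subpresheaf_gen_def)
qed

lemma subpresheaf_gen_mem: "(B, y) \<in> G \<Longrightarrow> y \<in> el M B \<Longrightarrow> y \<in> subpresheaf_gen M G B"
  by (auto simp: subpresheaf_gen_def)

lemma subpresheaf_gen_least:
  "\<lbrakk>x \<in> subpresheaf_gen M G A; subpresheaf M N; (\<And>B y. (B, y) \<in> G \<Longrightarrow> y \<in> N B)\<rbrakk> \<Longrightarrow>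
      x \<in> N A"
  by (auto simp: subpresheaf_gen_def)

lemma subpresheaf_gen_mono: "G \<subseteq> H \<Longrightarrow> x \<in> subpresheaf_gen M G A \<Longrightarrow> x \<in> subpresheaf_gen M H A"
  unfolding subpresheaf_gen_def by blast

definition sheaf_quotient :: "('o, 'k, 'u) presheaf \<Rightarrow> ('o \<Rightarrow> 'u set) \<Rightarrow> ('o, 'k, 'u)
  presheaf \<Rightarrow> ('o \<Rightarrow> 'u \<Rightarrow> 'u) \<Rightarrow> bool" where
  "sheaf_quotient M N Z u \<longleftrightarrow> is_sheaf U K a T Z \<and> u \<in> Hom PS M Z \<and>
    (\<forall>A\<in>Obj a. \<forall>x\<in>el M A. u A x = \<zero>\<^bsub>map_obj Z A\<^esub> \<longleftrightarrow> x \<in> lclosure M N A) \<and>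
    (\<forall>F g. is_sheaf U K a T F \<longrightarrow> g \<in> Hom PS M F \<longrightarrow>
      (\<forall>A\<in>Obj a. \<forall>x\<in>N A. g A x = \<zero>\<^bsub>map_obj F A\<^esub>) \<longrightarrow>
      (\<exists>!h. h \<in> Hom PS Z F \<and> Comp PS M Z F h u = g))"

lemma sheaf_quotient_exists:
  assumes "M \<in> Obj PS" "subpresheaf M N"
  shows "\<exists>Z u. sheaf_quotient M N Z u"
  unfolding sheaf_quotient_def by (rule sheafify_quotient[OF assms]) blast

lemma sheaf_quotientD:
  assumes "sheaf_quotient M N Z u"
  shows "is_sheaf U K a T Z" "u \<in> Hom PS M Z"
    "A \<in> Obj a \<Longrightarrow> x \<in> el M A \<Longrightarrow>
      u A x = \<zero>\<^bsub>map_obj Z A\<^esub> \<longleftrightarrow> x \<in> lclosure M N A"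
    "\<lbrakk>is_sheaf U K a T F; g \<in> Hom PS M F; (\<And>A x. A \<in> Obj a \<Longrightarrow> x \<in> N A \<Longrightarrow>
      g A x = \<zero>\<^bsub>map_obj F A\<^esub>)\<rbrakk> \<Longrightarrow>
      \<exists>!h. h \<in> Hom PS Z F \<and> Comp PS M Z F h u = g"
  using assms unfolding sheaf_quotient_def by simp_all

text \<open>
  The sheaf associated with \<open>M/N\<close> is the \<open>\<kappa>\<close>-filtered colimit of the sheaves associated with
  \<open>M/N\<^sub>G\<close>, where \<open>G\<close> runs over the sets of fewer than \<open>\<kappa>\<close> elements of \<open>N\<close> over the skeleton.
  If filtered colimits of sheaves are computed in presheaves, this colimit is elementwise.
\<close>

abbreviation bounded_parts :: "'c rel \<Rightarrow> ('o \<Rightarrow> 'u set) \<Rightarrow> ('o \<times> 'u) set set" where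
  "bounded_parts \<kappa> N \<equiv> {G. G \<subseteq> (SIGMA A:skel. N A) \<and> |G| <o \<kappa>}"

end

locale quotient_system = site U K a T
  for U :: "'u set set" and K :: "'k ring" and a :: "('o, 'u, 'k) linear_category"
    and T :: "'o \<Rightarrow> ('o \<Rightarrow> 'u set) set" +
  fixes \<kappa> :: "'c rel" and M :: "('o, 'k, 'u) presheaf" and N :: "'o \<Rightarrow> 'u set"
    and Z :: "('o \<times> 'u) set \<Rightarrow> ('o, 'k, 'u) presheaf"
        and u :: "('o \<times> 'u) set \<Rightarrow> 'o \<Rightarrow> 'u \<Rightarrow> 'u"
    and h :: "('o \<times> 'u) set \<Rightarrow> ('o \<times> 'u) set \<Rightarrow> 'o \<Rightarrow> 'u \<Rightarrow> 'u"
    and L :: "('o, 'k, 'u) presheaf" and w :: "'o \<Rightarrow> 'u \<Rightarrow> 'u"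
        and l :: "('o \<times> 'u) set \<Rightarrow> 'o \<Rightarrow> 'u \<Rightarrow> 'u"
  assumes Zs: "is_sheaf U K a T (Z G)" and uH: "u G \<in> Hom PS M (Z G)"
    and uz: "\<lbrakk>A \<in> Obj a; x \<in> el M A\<rbrakk> \<Longrightarrow>
      u G A x = \<zero>\<^bsub>map_obj (Z G) A\<^esub> \<longleftrightarrow> x \<in> lclosure M (subpresheaf_gen M G) A"
    and hH: "G \<subseteq> H \<Longrightarrow> h G H \<in> Hom PS (Z G) (Z H)"
    and hu: "\<lbrakk>G \<subseteq> H; A \<in> Obj a; x \<in> el M A\<rbrakk> \<Longrightarrow> h G H A (u G A x) = u H A x"
    and Ls: "is_sheaf U K a T L" and wH: "w \<in> Hom PS M L"
    and wz: "\<lbrakk>A \<in> Obj a; x \<in> el M A\<rbrakk> \<Longrightarrow>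
        w A x = \<zero>\<^bsub>map_obj L A\<^esub> \<longleftrightarrow> x \<in> lclosure M N A"
    and lH: "G \<in> bounded_parts \<kappa> N \<Longrightarrow> l G \<in> Hom PS (Z G) L"
    and lu: "\<lbrakk>G \<in> bounded_parts \<kappa> N; A \<in> Obj a; x \<in> el M A\<rbrakk> \<Longrightarrow> l G A (u G A x) = w A x"
    and lsurj: "\<lbrakk>A \<in> Obj a; z \<in> el L A\<rbrakk> \<Longrightarrow>
        \<exists>G\<in>bounded_parts \<kappa> N. \<exists>e\<in>el (Z G) A. l G A e = z"
    and vanish_at_stage: "\<lbrakk>G \<in> bounded_parts \<kappa> N; |I :: 'u set| <o \<kappa>;
      \<forall>i\<in>I. B i \<in> Obj a \<and> e i \<in> el (Z G) (B i) \<and>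
        l G (B i) (e i) = \<zero>\<^bsub>map_obj L (B i)\<^esub>\<rbrakk> \<Longrightarrow>
      \<exists>H\<in>bounded_parts \<kappa> N. G \<subseteq> H \<and>
        (\<forall>i\<in>I. h G H (B i) (e i) = \<zero>\<^bsub>map_obj (Z H) (B i)\<^esub>)"

context site
begin

lemma quotient_colimit:
  assumes \<kappa>: "Card_order \<kappa>" "cinfinite \<kappa>" "regularCard \<kappa>" and com: "commutes_filtered \<kappa>"
    and M: "M \<in> Obj PS" and N: "subpresheaf M N" and El: "small U (Pow (SIGMA A:skel. N A))"
  obtains Z u h L w l where "quotient_system U K a T \<kappa> M N Z u h L w l"
proof -
  define \<G> where "\<G> = bounded_parts \<kappa> N"
  let ?El = "SIGMA A:skel. N A"
  note ND = subpresheafD[OF N]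
  have \<G>D: "G \<subseteq> ?El" "|G| <o \<kappa>" if "G \<in> \<G>" for G using that by (auto simp: \<G>_def)
  note gen = subpresheaf_gen[OF M]
  have "\<forall>G. \<exists>Z u. sheaf_quotient M (subpresheaf_gen M G) Z u" using sheaf_quotient_exists[OF M gen] by blast
  then obtain Z u where Zu: "\<And>G. sheaf_quotient M (subpresheaf_gen M G) (Z G) (u G)" by metis
  note Zs = sheaf_quotientD(1)[OF Zu] and uH = sheaf_quotientD(2)[OF Zu] and uz = sheaf_quotientD(3)[OF Zu]
    and uu = sheaf_quotientD(4)[OF Zu]
  obtain L w where Lw: "sheaf_quotient M N L w" using sheaf_quotient_exists[OF M N] by blast
  note Ls = sheaf_quotientD(1)[OF Lw] and wH = sheaf_quotientD(2)[OF Lw] and wz = sheaf_quotientD(3)[OF Lw]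
    and wu = sheaf_quotientD(4)[OF Lw]
  note ZP = sheaf_PSh[OF Zs]
  have ueq: "f = g" if fg: "f \<in> Hom PS (Z G) F" "g \<in> Hom PS (Z G) F" and F: "is_sheaf U K a T F"
    and e: "\<And>A x. A \<in> Obj a \<Longrightarrow> x \<in> el M A \<Longrightarrow> f A (u G A x) = g A (u G A x)" for G F f g
  proof -
    let ?c = "Comp PS M (Z G) F"
    have c: "?c f (u G) \<in> Hom PS M F" "?c g (u G) \<in> Hom PS M F"
      using PSh_Comp_closed[OF M uH] fg by blast+
    have fg': "?c f (u G) = ?c g (u G)" by (rule PSh_Hom_eqI[OF c]) (simp add: PSh_Comp_apply e)
    have cz: "?c g (u G) A x = \<zero>\<^bsub>map_obj F A\<^esub>" if A: "A \<in> Obj a" and x: "x \<in> subpresheaf_gen M G A" for A x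
    proof -
      note xM = subpresheafD(1)[OF gen A x]
      have "u G A x = \<zero>\<^bsub>map_obj (Z G) A\<^esub>" by (rule uz[OF A xM, THEN iffD2, OF subset_lclosure[OF M gen A x]])
      then show ?thesis using PSh_Hom_zero[OF ZP sheaf_PSh[OF F] fg(2) A] PSh_Comp_apply[OF A xM] by simp
    qed
    have "\<exists>!m. m \<in> Hom PS (Z G) F \<and> ?c m (u G) = ?c g (u G)" by (rule uu[OF F c(2) cz])
    then obtain k where "\<forall>m. m \<in> Hom PS (Z G) F \<and> ?c m (u G) = ?c g (u G) \<longrightarrow> m = k"
      by (elim ex1E) blast
    then have "f = k" "g = k" using fg fg' by blast+
    then show ?thesis by simp
  qed
  have lift: "\<exists>h. h \<in> Hom PS (Z G) F \<and>
      (\<forall>A x. A \<in> Obj a \<longrightarrow> x \<in> el M A \<longrightarrow> h A (u G A x) = g A x)"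
    if F: "is_sheaf U K a T F" and g: "g \<in> Hom PS M F"
      and gz: "\<And>A x. A \<in> Obj a \<Longrightarrow> x \<in> subpresheaf_gen M G A \<Longrightarrow> g A x = \<zero>\<^bsub>map_obj F A\<^esub>"
          for F g G
  proof -
    from uu[OF F g gz] obtain h where h: "h \<in> Hom PS (Z G) F" "Comp PS M (Z G) F h (u G) = g" by blast
    have "h A (u G A x) = g A x" if "A \<in> Obj a" "x \<in> el M A" for A x
      using fun_cong[OF fun_cong[OF h(2), of A], of x] PSh_Comp_apply[OF that] by simp
    then show ?thesis using h(1) by blast
  qed
  have "\<exists>h. h \<in> Hom PS (Z G) (Z H) \<and>
      (\<forall>A x. A \<in> Obj a \<longrightarrow> x \<in> el M A \<longrightarrow> h A (u G A x) = u H A x)"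
    if "G \<subseteq> H" for G H
    by (rule lift[OF Zs uH])
      (use uz subset_lclosure[OF M gen] subpresheaf_gen_mono[OF that] subpresheafD(1)[OF gen] in blast)
  then obtain h where hH: "\<And>G H. G \<subseteq> H \<Longrightarrow> h G H \<in> Hom PS (Z G) (Z H)"
    and hu: "\<And>G H A x. \<lbrakk>G \<subseteq> H; A \<in> Obj a; x \<in> el M A\<rbrakk> \<Longrightarrow> h G H A (u G A x) = u H A x"
    by metis
  have genN: "x \<in> N A" if "G \<subseteq> ?El" "x \<in> subpresheaf_gen M G A" for G A x
    by (rule subpresheaf_gen_least[OF that(2) N]) (use that(1) in auto)
  have "\<exists>l. l \<in> Hom PS (Z G) L \<and> (\<forall>A x. A \<in> Obj a \<longrightarrow> x \<in> el M A \<longrightarrow> l A (u G A x) = w A x)"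
    if "G \<subseteq> ?El" for G
    by (rule lift[OF Ls wH]) (use wz subset_lclosure[OF M N] genN[OF that] ND(1) in blast)
  then obtain l where lH: "\<And>G. G \<subseteq> ?El \<Longrightarrow> l G \<in> Hom PS (Z G) L"
    and lu: "\<And>G A x. \<lbrakk>G \<subseteq> ?El; A \<in> Obj a; x \<in> el M A\<rbrakk> \<Longrightarrow> l G A (u G A x) = w A x"
    by metis
  obtain c :: "('o \<times> 'u) set \<Rightarrow> 'u" where c: "inj_on c (Pow ?El)" "c ` Pow ?El \<in> U"
    by (rule small_embed[OF univ El])
  define d where "d = inv_into (Pow ?El) c"
  have dc: "d (c G) = G" if "G \<subseteq> ?El" for G using c(1) that by (simp add: d_def)
  define j :: "('u, 'u) category" where "j = \<lparr>Obj = c ` \<G>, Hom = \<lambda>x y. if d x \<subseteq> d y then {undefined} else {},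
    Ident = \<lambda>_. undefined, Comp = \<lambda>_ _ _ _ _. undefined\<rparr>"
  have cj: "c G \<in> Obj j" if "G \<in> \<G>" for G using that by (simp add: j_def)
  have dj: "d x \<in> \<G>" "c (d x) = x" if "x \<in> Obj j" for x using that dc \<G>D(1) by (auto simp: j_def)
  have Hj: "Hom j x y = (if d x \<subseteq> d y then {undefined} else {})" for x y by (simp add: j_def)
  have cat: "category j" by unfold_locales (auto simp: j_def split: if_splits)
  have sm: "small_category U j"
    unfolding small_category_def
  proof (intro conjI cat ballI)
    have "c ` \<G> \<subseteq> c ` Pow ?El" by (auto simp: \<G>_def)
    then show "small U (Obj j)" unfolding j_def
      using small_subset[of U "c ` Pow ?El"] small_set_iff[OF univ] c(2) by simp
    show "small U (Hom j x y)" for x y by (rule small_finite[OF univ]) (simp add: Hj)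
  qed
  have st: "stable \<kappa>" using regularCard_stable[OF \<kappa>(1) _ \<kappa>(3)] \<kappa>(2) by (simp add: cinfinite_def)
  have fil: "filtered \<kappa> j"
    unfolding filtered_def
  proof (intro conjI allI impI ballI)
    fix X assume X: "X \<subseteq> Obj j \<and> |X| <o \<kappa>"
    let ?G = "\<Union>x\<in>X. d x"
    have "|?G| <o \<kappa>" by (rule stable_UNION[OF st conjunct2[OF X]]) (use X dj \<G>D in blast)
    moreover have "?G \<subseteq> ?El" using X dj(1) \<G>D(1) by blast
    ultimately have G: "?G \<in> \<G>" by (simp add: \<G>_def)
    show "\<exists>z\<in>Obj j. \<forall>x\<in>X. Hom j x z \<noteq> {}"
      by (rule bexI[OF _ cj[OF G]]) (auto simp: Hj dc[OF \<G>D(1)[OF G]])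
  next
    fix x y Y assume "x \<in> Obj j" and y: "y \<in> Obj j"
    have "Comp j x y y undefined f = Comp j x y y undefined g" for f g by (simp add: j_def)
    then show "\<exists>z\<in>Obj j. \<exists>h\<in>Hom j y z. \<forall>f\<in>Y. \<forall>g\<in>Y. Comp j x y z h f = Comp j x y z h g"
      using y by (intro bexI[of _ y] bexI[of _ undefined]) (auto simp: Hj)
  qed
  define J :: "('u, 'u, ('o, 'k, 'u) presheaf, 'o \<Rightarrow> 'u \<Rightarrow> 'u) functor_data" where
    "J = \<lparr>map_obj = \<lambda>x. Z (d x), map_arr = \<lambda>x y _. h (d x) (d y)\<rparr>"
  have fu: "is_functor j (Sh U K a T) J"
  proof -
    interpret j: category j by (rule cat)
    interpret S: category "Sh U K a T" by (rule category_Sh)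
    show ?thesis
    proof (unfold_locales, goal_cases)
      case (1 A)
      then show ?case using Zs by (simp add: J_def Sh_Obj_iff)
    next
      case (2 A B f)
      then show ?case using hH by (simp add: J_def Hj split: if_splits)
    next
      case (3 A)
      have "h (d A) (d A) = Ident PS (Z (d A))"
      proof (rule ueq[OF hH PSh_Ident_closed[OF ZP] Zs])
        fix B x assume B: "B \<in> Obj a" and x: "x \<in> el M B"
        show "h (d A) (d A) B (u (d A) B x) = Ident PS (Z (d A)) B (u (d A) B x)"
          using hu[OF subset_refl B x, of "d A"] PSh_Ident_apply[OF B PSh_Hom_closed[OF uH B x]] by simp
      qed simp
      then show ?case by (simp add: J_def)
    next
      case (4 A B E f g)
      then have s: "d A \<subseteq> d B" "d B \<subseteq> d E" by (auto simp: Hj split: if_splits)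
      then have s3: "d A \<subseteq> d E" by blast
      have "h (d A) (d E) = Comp PS (Z (d A)) (Z (d B)) (Z (d E)) (h (d B) (d E)) (h (d A) (d B))"
        by (rule ueq[OF hH[OF s3] PSh_Comp_closed[OF ZP hH[OF s(1)] hH[OF s(2)]] Zs])
          (simp add: PSh_Comp_apply PSh_Hom_closed[OF uH] hu s s3)
      then show ?case by (simp add: J_def)
    qed
  qed
  interpret D: sheaf_diagram U K a T \<kappa> j J by (rule sheaf_diagramI[OF \<kappa>(1,2) sm fil fu])
  have Jo: "map_obj J x = Z (d x)" and Ja: "map_arr J x y v = h (d x) (d y)" for x y v by (simp_all add: J_def)
  have dE: "d x \<subseteq> ?El" if "x \<in> Obj j" for x using dj(1)[OF that] \<G>D(1) by blast
  have col: "is_colimit j (Sh U K a T) J L (\<lambda>x. l (d x))"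
    unfolding is_colimit_def
  proof (intro conjI allI impI)
    show "is_cocone j (Sh U K a T) J L (\<lambda>x. l (d x))"
      unfolding is_cocone_def
    proof (intro conjI ballI)
      show "L \<in> Obj (Sh U K a T)" using Ls by (simp add: Sh_Obj_iff)
      show "l (d x) \<in> Hom (Sh U K a T) (map_obj J x) L" if "x \<in> Obj j" for x using lH[OF dE[OF that]] by (simp add: Jo)
      fix x y v assume x: "x \<in> Obj j" and y: "y \<in> Obj j" and v: "v \<in> Hom j x y"
      then have s: "d x \<subseteq> d y" by (auto simp: Hj split: if_splits)
      have "Comp PS (Z (d x)) (Z (d y)) L (l (d y)) (h (d x) (d y)) = l (d x)"
        by (rule ueq[OF PSh_Comp_closed[OF ZP hH[OF s] lH[OF dE[OF y]]] lH[OF dE[OF x]] Ls])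
          (simp add: PSh_Comp_apply PSh_Hom_closed[OF uH] hu s lu dE x y)
      then show "Comp (Sh U K a T) (map_obj J x) (map_obj J y) L (l (d y)) (map_arr J x y v) = l (d x)" by (simp add: Jo Ja)
    qed
    fix F m assume co: "is_cocone j (Sh U K a T) J F m"
    then have F: "is_sheaf U K a T F" and mH: "\<And>x. x \<in> Obj j \<Longrightarrow> m x \<in> Hom PS (Z (d x)) F"
      by (simp_all add: is_cocone_def Sh_Obj_iff Jo)
    have mc: "\<And>x y v. \<lbrakk>x \<in> Obj j; y \<in> Obj j; v \<in> Hom j x y\<rbrakk> \<Longrightarrow>
        Comp PS (Z (d x)) (Z (d y)) F (m y) (h (d x) (d y)) = m x"
      using co unfolding is_cocone_def Sh_simps Jo Ja by blast
    have mu: "m y A (u (d y) A z) = m x A (u (d x) A z)"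
      if x: "x \<in> Obj j" and y: "y \<in> Obj j" and v: "v \<in> Hom j x y" and A: "A \<in> Obj a" and z: "z \<in> el M A" for x y v A z
    proof -
      have s: "d x \<subseteq> d y" using v by (auto simp: Hj split: if_splits)
      show ?thesis using fun_cong[OF fun_cong[OF mc[OF x y v], of A], of "u (d x) A z"]
          PSh_Comp_apply[OF A PSh_Hom_closed[OF uH A z]] hu[OF s A z] by simp
    qed
    have mu2: "m y A (u (d y) A z) = m x A (u (d x) A z)"
      if x: "x \<in> Obj j" and y: "y \<in> Obj j" and A: "A \<in> Obj a" and z: "z \<in> el M A" for x y A z
    proof -
      obtain t v v' where t: "t \<in> Obj j" "v \<in> Hom j x t" "v' \<in> Hom j y t" by (rule D.span[OF x y])
      show ?thesis using mu[OF x t(1,2) A z] mu[OF y t(1,3) A z] by simp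
    qed
    obtain x0 where x0: "x0 \<in> Obj j" by (rule D.nonempty)
    let ?g = "Comp PS M (Z (d x0)) F (m x0) (u (d x0))"
    have gH: "?g \<in> Hom PS M F" by (rule PSh_Comp_closed[OF M uH mH[OF x0]])
    have ga: "?g A z = m x A (u (d x) A z)" if "x \<in> Obj j" "A \<in> Obj a" "z \<in> el M A" for x A z
      using mu2[OF x0 that] PSh_Comp_apply[OF that(2,3)] by simp
    have gz: "?g A n = \<zero>\<^bsub>map_obj F A\<^esub>" if A: "A \<in> Obj a" and n: "n \<in> N A" for A n
    proof -
      note k = sk[OF A]
      let ?n = "map_arr M A (sk A) (ski A) n"
      let ?G = "{(sk A, ?n)}"
      have nM: "n \<in> el M A" by (rule ND(1)[OF A n])
      have n': "?n \<in> N (sk A)" by (rule ND(5)[OF A n k(2,4)])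
      have n'M: "?n \<in> el M (sk A)" by (rule ND(1)[OF k(2) n'])
      have G: "?G \<in> \<G>" unfolding \<G>_def using k(1) n' by (auto intro: finite_ordLess_card[OF \<kappa>(1,2)])
      have "?n \<in> subpresheaf_gen M ?G (sk A)" by (rule subpresheaf_gen_mem[OF _ n'M]) simp
      then have "u ?G (sk A) ?n = \<zero>\<^bsub>map_obj (Z ?G) (sk A)\<^esub>"
        using uz[OF k(2) n'M] subset_lclosure[OF M gen k(2)] by blast
      then have "?g (sk A) ?n = \<zero>\<^bsub>map_obj F (sk A)\<^esub>"
        using ga[OF cj[OF G] k(2) n'M] dc[OF \<G>D(1)[OF G]] PSh_Hom_zero[OF ZP sheaf_PSh[OF F] mH[OF cj[OF G]] k(2)] by simp
      moreover have "n = map_arr M (sk A) A (skj A) ?n"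
        using PSh_Comp[OF M A k(2) A k(4,3) nM] k(5) PSh_Ident[OF M A nM] by simp
      ultimately show ?thesis
        using PSh_Hom_nat[OF gH k(2) A k(3) n'M] PSh_zero[OF sheaf_PSh[OF F] k(2) A k(3)] by simp
    qed
    have eqv: "(\<forall>x\<in>Obj j. Comp PS (Z (d x)) L F k (l (d x)) = m x) \<longleftrightarrow> Comp PS M L F k w = ?g"
      if k: "k \<in> Hom PS L F" for k
    proof
      assume e: "\<forall>x\<in>Obj j. Comp PS (Z (d x)) L F k (l (d x)) = m x"
      show "Comp PS M L F k w = ?g"
      proof (rule PSh_Hom_eqI[OF PSh_Comp_closed[OF M wH k] gH])
        fix A z assume A: "A \<in> Obj a" and z: "z \<in> el M A"
        have "k A (l (d x0) A (u (d x0) A z)) = m x0 A (u (d x0) A z)"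
          using fun_cong[OF fun_cong[OF bspec[OF e x0], of A], of "u (d x0) A z"] PSh_Comp_apply[OF A PSh_Hom_closed[OF uH A z]] by simp
        then show "Comp PS M L F k w A z = ?g A z"
          using lu[OF dE[OF x0] A z] PSh_Comp_apply[OF A z] by simp
      qed
    next
      assume e: "Comp PS M L F k w = ?g"
      show "\<forall>x\<in>Obj j. Comp PS (Z (d x)) L F k (l (d x)) = m x"
      proof
        fix x assume x: "x \<in> Obj j"
        show "Comp PS (Z (d x)) L F k (l (d x)) = m x"
        proof (rule ueq[OF PSh_Comp_closed[OF ZP lH[OF dE[OF x]] k] mH[OF x] F])
          fix A z assume A: "A \<in> Obj a" and z: "z \<in> el M A"
          have "k A (w A z) = ?g A z" using fun_cong[OF fun_cong[OF e, of A], of z] PSh_Comp_apply[OF A z, of U K L F k w] by simp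
          then show "Comp PS (Z (d x)) L F k (l (d x)) A (u (d x) A z) = m x A (u (d x) A z)"
            using ga[OF x A z] PSh_Comp_apply[OF A PSh_Hom_closed[OF uH A z]] lu[OF dE[OF x] A z] by simp
        qed
      qed
    qed
    have "\<exists>!k. k \<in> Hom PS L F \<and> Comp PS M L F k w = ?g" by (rule wu[OF F gH gz])
    moreover have "(k \<in> Hom PS L F \<and> Comp PS M L F k w = ?g) =
      (k \<in> Hom PS L F \<and> (\<forall>x\<in>Obj j. Comp PS (Z (d x)) L F k (l (d x)) = m x))" for k
      using eqv by blast
    ultimately show "\<exists>!k. k \<in> Hom (Sh U K a T) L F \<and> (\<forall>x\<in>Obj j. Comp (Sh U K a T) (map_obj J x) L F k (l (d x)) = m x)"
      by (simp add: Jo)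
  qed
  have f: "D.fcolim L (\<lambda>x. l (d x))"
    by (rule D.fcolim_if_commutes[OF _ col]) (use com sm fil fu in \<open>simp add: commutes_filtered_def\<close>)
  show thesis
  proof (rule that[of Z u h L w l], unfold_locales, fold \<G>_def)
    show "is_sheaf U K a T (Z G)" "u G \<in> Hom PS M (Z G)" for G by (rule Zs, rule uH)
    show "u G A x = \<zero>\<^bsub>map_obj (Z G) A\<^esub> \<longleftrightarrow> x \<in> lclosure M (subpresheaf_gen M G) A"
        if "A \<in> Obj a" "x \<in> el M A" for G A x
      by (rule uz[OF that])
    show "h G H \<in> Hom PS (Z G) (Z H)" if "G \<subseteq> H" for G H by (rule hH[OF that])
    show "h G H A (u G A x) = u H A x" if "G \<subseteq> H" "A \<in> Obj a" "x \<in> el M A" for G H A x by (rule hu[OF that])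
    show "is_sheaf U K a T L" "w \<in> Hom PS M L" by (rule Ls, rule wH)
    show "w A x = \<zero>\<^bsub>map_obj L A\<^esub> \<longleftrightarrow> x \<in> lclosure M N A" if "A \<in> Obj a" "x \<in> el M A"
        for A x by (rule wz[OF that])
    show "l G \<in> Hom PS (Z G) L" if "G \<in> \<G>" for G by (rule lH[OF \<G>D(1)[OF that]])
    show "l G A (u G A x) = w A x" if "G \<in> \<G>" "A \<in> Obj a" "x \<in> el M A" for G A x by (rule lu[OF \<G>D(1)[OF that(1)] that(2,3)])
    show "\<exists>G\<in>\<G>. \<exists>e\<in>el (Z G) A. l G A e = z" if "A \<in> Obj a" "z \<in> el L A" for A z
      using D.fc_surj[OF f that] dj(1) unfolding Jo by blast
    fix G and I :: "'u set" and A e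
    assume G: "G \<in> \<G>" and I: "|I| <o \<kappa>"
      and e: "\<forall>i\<in>I. A i \<in> Obj a \<and> e i \<in> el (Z G) (A i) \<and> l G (A i) (e i) = \<zero>\<^bsub>map_obj L (A i)\<^esub>"
    have dG: "d (c G) = G" by (rule dc[OF \<G>D(1)[OF G]])
    obtain y k where y: "y \<in> Obj j" "k \<in> Hom j (c G) y"
      "\<And>i. i \<in> I \<Longrightarrow> map_arr J (c G) y k (A i) (e i) = \<zero>\<^bsub>map_obj (map_obj J y) (A i)\<^esub>"
    proof (rule D.vanish_at_stage[OF f cj[OF G] I, of A e])
      show "A i \<in> Obj a" if "i \<in> I" for i using e that by blast
      show "e i \<in> D.Jel (c G) (A i)" if "i \<in> I" for i using e that by (simp add: Jo dG)
      show "l (d (c G)) (A i) (e i) = \<zero>\<^bsub>map_obj L (A i)\<^esub>" if "i \<in> I" for i using e that by (simp add: dG)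
    qed (rule that)
    show "\<exists>H\<in>\<G>. G \<subseteq> H \<and> (\<forall>i\<in>I. h G H (A i) (e i) = \<zero>\<^bsub>map_obj (Z H) (A i)\<^esub>)"
      by (rule bexI[OF _ dj(1)[OF y(1)]]) (use y in \<open>auto simp: Hj Jo Ja dG split: if_splits\<close>)
  qed
qed

section \<open>Direct sums of representables\<close>

lemma small_Pow:
  assumes "|X| \<le>o |mors|"
  shows "small U (Pow X)"
proof -
  obtain i where i: "inj_on i X" "i ` X \<subseteq> mors" using card_of_ordLeq[THEN iffD2, OF assms] by blast
  let ?c = "\<lambda>Y e. if e \<in> mors then e \<in> i ` Y else undefined"
  have inj: "inj_on ?c (Pow X)"
  proof (rule inj_onI)
    fix Y Z assume Y: "Y \<in> Pow X" and Z: "Z \<in> Pow X" and e: "?c Y = ?c Z"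
    have "m \<in> i ` Y \<longleftrightarrow> m \<in> i ` Z" if "m \<in> mors" for m using fun_cong[OF e, of m] that by simp
    then have "i ` Y = i ` Z" using Y Z i(2) by blast
    then show "Y = Z" using Y Z i(1) by (simp add: inj_on_image_eq_iff)
  qed
  have sub: "?c ` Pow X \<subseteq> Func mors (UNIV :: bool set)" by (auto simp: Func_def)
  have sm: "small U (Func mors (UNIV :: bool set))" by (rule Func_small[OF small_finite[OF univ finite_UNIV]])
  show ?thesis by (rule small_inj[OF inj small_subset[OF sm sub]])
qed

lemma small_Func:
  assumes I: "|I| \<le>o |mors|" and X: "small U X"
  shows "small U (Func I X)"
proof -
  obtain i where i: "inj_on i I" "i ` I \<subseteq> mors" using card_of_ordLeq[THEN iffD2, OF I] by blast
  let ?c = "\<lambda>f e. if e \<in> mors then (if e \<in> i ` I then Some (f (inv_into I i e)) else None) else undefined"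
  have inj: "inj_on ?c (Func I X)"
  proof (rule inj_onI, rule ext)
    fix f g k assume f: "f \<in> Func I X" and g: "g \<in> Func I X" and e: "?c f = ?c g"
    show "f k = g k"
    proof (cases "k \<in> I")
      case True
      have "i k \<in> mors" using i(2) True by blast
      then show ?thesis using fun_cong[OF e, of "i k"] True i(1) by simp
    next
      case False
      then have "f k = undefined" "g k = undefined" using f g unfolding Func_def by blast+
      then show ?thesis by simp
    qed
  qed
  have sub: "?c ` Func I X \<subseteq> Func mors (insert None (Some ` X))"
    using i(1) by (auto simp: Func_def inv_into_into)
  have "small U (insert None (Some ` X))"
    using small_Un[OF univ small_finite[OF univ, of "{None}"] small_image[OF X]] by simp
  then have sm: "small U (Func mors (insert None (Some ` X)))" by (rule Func_small)
  show ?thesis by (rule small_inj[OF inj small_subset[OF sm sub]])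
qed

lemma ev_unit_column:
  assumes V: "\<And>k. k \<in> labels V \<Longrightarrow> summand V k \<in> Obj a" and B: "B \<in> Obj a" and g: "row B V g" and i: "i \<in> labels V"
  shows "ev (Yoneda a (summand V i)) V B (\<lambda>k. unit_row V k i) g = g i"
proof -
  let ?Y = "Yoneda a (summand V i)"
  note YP = Yoneda_PSh[OF V[OF i]]
  have uH: "unit_row V k i \<in> Hom a (summand V k) (summand V i)" if "k \<in> labels V" for k
    using row_unit[OF V that] i by (simp add: row_def)
  have sec: "sections ?Y V (\<lambda>k. unit_row V k i)" using uH V i by (simp add: sections_def carrier_HomMod)
  have gH: "g k \<in> Hom a B (summand V k)" if "k \<in> labels V" for k using g that by (simp add: row_def)
  interpret H: module K "HomMod a B (summand V i)" by (rule module_HomMod[OF B V[OF i]])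
  let ?S = "insert i {k \<in> labels V. g k \<noteq> \<zero>\<^bsub>HomMod a B (summand V k)\<^esub>}"
  have S: "finite ?S" "?S \<subseteq> labels V" using g i by (auto simp: row_def)
  have t: "map_arr ?Y (summand V k) B (g k) (unit_row V k i) = (if i = k then g i else \<zero>\<^bsub>HomMod a B (summand V i)\<^esub>)"
    if k: "k \<in> labels V" for k
  proof (cases "i = k")
    case True
    then show ?thesis using gH[OF i] V[OF i] B uH[OF i] by (simp add: unit_row_def Comp_Ident_left)
  next
    case False
    then show ?thesis using PSh_zero[OF YP V[OF k] B gH[OF k]] by (simp add: unit_row_def del: Yoneda_simps(2))
  qed
  have "ev ?Y V B (\<lambda>k. unit_row V k i) g = finsum (map_obj ?Y B) (\<lambda>k. map_arr ?Y (summand V k) B (g k) (unit_row V k i)) ?S"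
    by (rule ev_superset[OF YP B sec g S]) auto
  also have "\<dots> = finsum (HomMod a B (summand V i)) (\<lambda>k. if i = k then g i else \<zero>\<^bsub>HomMod a B (summand V i)\<^esub>) ?S"
    unfolding Yoneda_simps(1)
    by (rule H.M.finsum_cong') (use t S gH[OF i] B V[OF i] H.M.zero_closed in \<open>auto simp: carrier_HomMod\<close>)
  also have "\<dots> = g i"
    using H.M.finsum_singleton[of i ?S "\<lambda>_. g i"] S gH[OF i] B V[OF i] by (simp add: carrier_HomMod)
  finally show ?thesis .
qed

lemma direct_sum:
  fixes V :: "('u, 'o) family"
  assumes V: "\<And>i. i \<in> labels V \<Longrightarrow> summand V i \<in> skel" and I: "|labels V| \<le>o |mors|"
  obtains M e pr where "M \<in> Obj PS" "sections M V e"
    "\<And>i. i \<in> labels V \<Longrightarrow> pr i \<in> Hom PS M (Yoneda a (summand V i))"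
    "\<And>B x y. B \<in> Obj a \<Longrightarrow> x \<in> el M B \<Longrightarrow> y \<in> el M B \<Longrightarrow>
      \<forall>i\<in>labels V. pr i B x = pr i B y \<Longrightarrow> x = y"
    "\<And>i k. i \<in> labels V \<Longrightarrow> k \<in> labels V \<Longrightarrow> pr i (summand V k) (e k) = unit_row V k i"
    "\<And>B x. B \<in> Obj a \<Longrightarrow> x \<in> el M B \<Longrightarrow> row B V (\<lambda>i. pr i B x)"
    "\<And>B g. B \<in> Obj a \<Longrightarrow> row B V g \<Longrightarrow> \<exists>x\<in>el M B. \<forall>i\<in>labels V. pr i B x = g i"
    "small U (Pow (SIGMA A:skel. el M A))"
proof -
  have VO: "summand V i \<in> Obj a" if "i \<in> labels V" for i using V[OF that] skel_Obj by blast
  let ?Q = "\<lambda>B. {g. row B V g}"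
  let ?eq = "\<lambda>B g h. \<forall>i\<in>labels V. g i = h i"
  let ?ad = "\<lambda>B g h i. g i \<oplus>\<^bsub>HomMod a B (summand V i)\<^esub> h i"
  let ?sm = "\<lambda>B c g i. c \<odot>\<^bsub>HomMod a B (summand V i)\<^esub> g i"
  let ?ac = "\<lambda>B D k g i. Comp a D B (summand V i) (g i) k"
  have gH: "g i \<in> Hom a B (summand V i)" if "row B V g" "i \<in> labels V" for B g i using that by (simp add: row_def)
  have gC: "g i \<in> carrier (HomMod a B (summand V i))" if "B \<in> Obj a" "row B V g" "i \<in> labels V" for B g i
    using gH[OF that(2,3)] carrier_HomMod[OF that(1) VO[OF that(3)]] by simp
  have mH: "module K (HomMod a B (summand V i))" if "B \<in> Obj a" "i \<in> labels V" for B i by (rule module_HomMod[OF that(1) VO[OF that(2)]])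
  have aH: "abelian_monoid (HomMod a B (summand V i))" if "B \<in> Obj a" "i \<in> labels V" for B i
    by (rule abelian_group.axioms(1)[OF module.axioms(2)[OF mH[OF that]]])
  have Ism: "small U (labels V)" by (rule small_ordLeq[OF mors_small I])
  interpret presheaf_setoid U K a ?Q ?eq ?ad "\<lambda>B i. \<zero>\<^bsub>HomMod a B (summand V i)\<^esub>" ?sm ?ac "\<lambda>B g i. if i \<in> labels V then g i else undefined"
  proof (unfold_locales, goal_cases)
    case (4 A x y)
    then show ?case using row_add[OF _ VO] by simp
  next
    case (6 A)
    then show ?case using row_zero[OF _ VO] by simp
  next
    case (7 A c x)
    then show ?case using row_smult[OF _ VO] by simp
  next
    case (9 A B f x)
    then show ?case using row_Comp[OF _ _ VO] by simp
  next
    case (14 A x)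
    have m: "\<ominus>\<^bsub>K\<^esub> \<one>\<^bsub>K\<^esub> \<in> carrier K" by simp
    have x: "row A V x" using 14 by simp
    have "?ad A (?sm A (\<ominus>\<^bsub>K\<^esub> \<one>\<^bsub>K\<^esub>) x) x i = \<zero>\<^bsub>HomMod a A (summand V i)\<^esub>"
        if i: "i \<in> labels V" for i
      using module_neg_smult[OF mH[OF 14(1) i] gC[OF 14(1) x i]]
        abelian_group.l_neg[OF module.axioms(2)[OF mH[OF 14(1) i]] gC[OF 14(1) x i]] by simp
    then show ?case using row_smult[OF 14(1) VO x m] by (intro bexI[of _ "?sm A (\<ominus>\<^bsub>K\<^esub> \<one>\<^bsub>K\<^esub>) x"]) auto
  next
    case (25 A)
    have "small U (\<Union>i\<in>labels V. Hom a A (summand V i))"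
      by (rule small_Union[OF univ Ism]) (use Hom_mem_U[OF 25 VO] small_set_iff[OF univ] in auto)
    from small_Func[OF I this] show ?case
      by (rule small_subset) (auto simp: Func_def row_def, blast)
  next
    case (26 A x y)
    show ?case
    proof
      fix i assume "i \<in> labels V"
      then show "x i = y i" using fun_cong[OF 26(4), of i] by simp
    qed
  qed (auto simp: gH VO Comp_Ident_right Comp_assoc Comp_add_left Comp_add_right Comp_smult_left Comp_smult_right
      abelian_monoid.a_assoc[OF aH] abelian_monoid.a_comm[OF aH] abelian_monoid.l_zero[OF aH] gC
      module.smult_l_distr[OF mH] module.smult_r_distr[OF mH] module.smult_assoc1[OF mH] module.smult_one[OF mH])
  obtain M :: "('o, 'k, 'u) presheaf" and p where M: "M \<in> Obj PS"
    and pc: "\<And>A x. A \<in> Obj a \<Longrightarrow> x \<in> ?Q A \<Longrightarrow> p A x \<in> el M A"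
    and ps: "\<And>A z. A \<in> Obj a \<Longrightarrow> z \<in> el M A \<Longrightarrow> \<exists>x\<in>?Q A. p A x = z"
    and pe: "\<And>A x y. \<lbrakk>A \<in> Obj a; x \<in> ?Q A; y \<in> ?Q A\<rbrakk> \<Longrightarrow>
      p A x = p A y \<longleftrightarrow> ?eq A x y"
    and pad: "\<And>A x y. \<lbrakk>A \<in> Obj a; x \<in> ?Q A; y \<in> ?Q A\<rbrakk> \<Longrightarrow>
      p A (?ad A x y) = p A x \<oplus>\<^bsub>map_obj M A\<^esub> p A y"
    and pz: "\<And>A. A \<in> Obj a \<Longrightarrow>
        p A (\<lambda>i. \<zero>\<^bsub>HomMod a A (summand V i)\<^esub>) = \<zero>\<^bsub>map_obj M A\<^esub>"
    and psm: "\<And>A c x. \<lbrakk>A \<in> Obj a; c \<in> carrier K; x \<in> ?Q A\<rbrakk> \<Longrightarrow>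
      p A (?sm A c x) = c \<odot>\<^bsub>map_obj M A\<^esub> p A x"
    and pac: "\<And>A B f x. \<lbrakk>A \<in> Obj a; B \<in> Obj a; f \<in> Hom a B A; x \<in> ?Q A\<rbrakk> \<Longrightarrow>
      map_arr M A B f (p A x) = p B (?ac A B f x)"
    by (rule quotient_presheaf) (rule that)
  define sec where "sec B x = (SOME g. g \<in> ?Q B \<and> p B g = x)" for B x
  have sec: "row B V (sec B x)" "p B (sec B x) = x" if "B \<in> Obj a" "x \<in> el M B" for B x
  proof -
    have "\<exists>g. g \<in> ?Q B \<and> p B g = x" using ps[OF that] by blast
    then have "sec B x \<in> ?Q B \<and> p B (sec B x) = x" unfolding sec_def by (rule someI_ex)
    then show "row B V (sec B x)" "p B (sec B x) = x" by auto
  qed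
  have secp: "sec B (p B g) i = g i" if "B \<in> Obj a" "row B V g" "i \<in> labels V" for B g i
    using pe[OF that(1), of "sec B (p B g)" g] sec[OF that(1) pc[OF that(1), of g]] that by simp
  define pr where "pr i = mk_nat a M (\<lambda>B x. sec B x i)" for i
  have pra: "pr i B x = sec B x i" if "B \<in> Obj a" "x \<in> el M B" for i B x
    using mk_nat_apply[OF that] by (simp add: pr_def)
  have prp: "pr i B (p B g) = g i" if "B \<in> Obj a" "row B V g" "i \<in> labels V" for i B g
    using pra[OF that(1) pc[OF that(1), of g]] secp[OF that] that(2) by simp
  have prH: "pr i \<in> Hom PS M (Yoneda a (summand V i))" if i: "i \<in> labels V" for i
    unfolding pr_def
  proof (rule mk_nat_Hom[OF M])
    fix A x assume A: "A \<in> Obj a" and x: "x \<in> el M A"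
    note s = sec[OF A x]
    show "sec A x i \<in> el (Yoneda a (summand V i)) A" using gC[OF A s(1) i] by simp
    show "sec A (x \<oplus>\<^bsub>map_obj M A\<^esub> y) i = sec A x i \<oplus>\<^bsub>map_obj (Yoneda a (summand V i)) A\<^esub> sec A y i"
      if y: "y \<in> el M A" for y
      using pad[OF A, of "sec A x" "sec A y"] s sec[OF A y] secp[OF A row_add[OF A VO s(1) sec(1)[OF A y]] i] by simp
    show "sec A (c \<odot>\<^bsub>map_obj M A\<^esub> x) i = c \<odot>\<^bsub>map_obj (Yoneda a (summand V i)) A\<^esub> sec A x i"
        if c: "c \<in> carrier K" for c
      using psm[OF A c, of "sec A x"] s secp[OF A row_smult[OF A VO s(1) c] i] by simp
    show "sec B (map_arr M A B f x) i = map_arr (Yoneda a (summand V i)) A B f (sec A x i)" if B: "B \<in> Obj a" and f: "f \<in> Hom a B A" for B f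
      using pac[OF A B f, of "sec A x"] s secp[OF B row_Comp[OF A B VO s(1) f] i] gH[OF s(1) i] by simp
  qed
  have prrow: "row B V (\<lambda>i. pr i B x)" if "B \<in> Obj a" "x \<in> el M B" for B x
    using sec(1)[OF that] by (simp add: pra[OF that])
  have inj: "x = y" if B: "B \<in> Obj a" and x: "x \<in> el M B" and y: "y \<in> el M B"
    and e: "\<forall>i\<in>labels V. pr i B x = pr i B y" for B x y
    using pe[OF B, of "sec B x" "sec B y"] sec[OF B x] sec[OF B y] e by (simp add: pra[OF B x] pra[OF B y])
  define e where "e k = p (summand V k) (unit_row V k)" for k
  have "small U (Pow (SIGMA A:skel. el M A))"
  proof (cases "finite mors")
    case True
    have fin: "finite skel" "finite (labels V)"
      using True skel_ordLeq I card_of_ordLeq_finite by blast+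
    have "finite (el M B)" if B: "B \<in> skel" for B
    proof -
      note BO = skel_Obj[OF B]
      have "finite (Hom a B (summand V i))" if "i \<in> labels V" for i
      proof -
        have "(\<lambda>f. (B, summand V i, f)) ` Hom a B (summand V i) \<subseteq> mors" using B V[OF that] by (auto simp: mors_of_def)
        then have "finite ((\<lambda>f. (B, summand V i, f)) ` Hom a B (summand V i))" using True finite_subset by blast
        then show ?thesis by (rule finite_imageD) (simp add: inj_on_def)
      qed
      then have "finite (\<Pi>\<^sub>E i\<in>labels V. Hom a B (summand V i))" using fin by (intro finite_PiE) auto
      moreover have "(\<lambda>x. \<lambda>i\<in>labels V. pr i B x) ` el M B \<subseteq> (\<Pi>\<^sub>E i\<in>labels V. Hom a B (summand V i))"
        using gH[OF prrow[OF BO]] by auto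
      ultimately have "finite ((\<lambda>x. \<lambda>i\<in>labels V. pr i B x) ` el M B)" by (rule finite_subset[rotated])
      moreover have "inj_on (\<lambda>x. \<lambda>i\<in>labels V. pr i B x) (el M B)"
      proof (rule inj_onI)
        fix x y assume x: "x \<in> el M B" and y: "y \<in> el M B"
          and xy: "(\<lambda>i\<in>labels V. pr i B x) = (\<lambda>i\<in>labels V. pr i B y)"
        have "pr i B x = pr i B y" if "i \<in> labels V" for i using fun_cong[OF xy, of i] that by simp
        then show "x = y" by (intro inj[OF BO x y] ballI)
      qed
      ultimately show ?thesis by (rule finite_imageD)
    qed
    then have "finite (SIGMA A:skel. el M A)" using fin by auto
    then show ?thesis by (intro small_finite[OF univ]) simp
  next
    case False
    obtain c where c: "inj_on c (labels V)" "c ` labels V \<subseteq> mors" using card_of_ordLeq[THEN iffD2, OF I] by blast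
    text \<open>A section over the skeleton is recorded by the list of its nonzero components.\<close>
    define supp where "supp B x = {(c i, (B, summand V i, pr i B x)) | i. i \<in> labels V \<and>
      pr i B x \<noteq> \<zero>\<^bsub>HomMod a B (summand V i)\<^esub>}" for B x
    define code where "code B x = (SOME xs. set xs = supp B x)" for B x
    have code: "set (code B x) = supp B x" if B: "B \<in> Obj a" and x: "x \<in> el M B" for B x
    proof -
      have "supp B x = (\<lambda>i. (c i, (B, summand V i,
          pr i B x))) ` {i \<in> labels V. pr i B x \<noteq> \<zero>\<^bsub>HomMod a B (summand V i)\<^esub>}"
        unfolding supp_def by blast
      then have "finite (supp B x)" using prrow[OF B x] by (simp add: row_def)
      then show ?thesis unfolding code_def using someI_ex[OF finite_list] by metis
    qed
    let ?f = "\<lambda>(B, x). ((B, B, Ident a B), code B x)"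
    have "inj_on ?f (SIGMA A:skel. el M A)"
    proof (rule inj_onI, clarsimp)
      fix B x y assume B: "B \<in> skel" and x: "x \<in> el M B" and y: "y \<in> el M B" and e: "code B x = code B y"
      note BO = skel_Obj[OF B]
      have s: "supp B x = supp B y" using code[OF BO x] code[OF BO y] e by simp
      have half: "pr i B x = pr i B y"
        if i: "i \<in> labels V" and nz: "pr i B x \<noteq> \<zero>\<^bsub>HomMod a B (summand V i)\<^esub>" and s: "supp B x = supp B y" for i x y
      proof -
        have "(c i, (B, summand V i, pr i B x)) \<in> supp B y" using i nz s unfolding supp_def by blast
        then obtain k where "k \<in> labels V" "c i = c k" "pr i B x = pr k B y" unfolding supp_def by blast
        then show ?thesis using c(1) i by (metis inj_onD)
      qed
      show "x = y"
      proof (rule inj[OF BO x y], rule ballI)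
        fix i assume i: "i \<in> labels V"
        show "pr i B x = pr i B y"
          using half[OF i _ s] half[OF i _ s[symmetric]] by metis
      qed
    qed
    moreover have "?f ` (SIGMA A:skel. el M A) \<subseteq> mors \<times> lists (mors \<times> mors)"
    proof (rule image_subsetI)
      fix z assume z: "z \<in> (SIGMA A:skel. el M A)"
      then obtain B x where zz: "z = (B, x)" and B: "B \<in> skel" and x: "x \<in> el M B" by blast
      note BO = skel_Obj[OF B]
      have "supp B x \<subseteq> mors \<times> mors"
        using c(2) B V gH[OF prrow[OF BO x]] by (auto simp: supp_def mors_of_def)
      then have "code B x \<in> lists (mors \<times> mors)" using code[OF BO x] by (simp add: lists_eq_set)
      moreover have "(B, B, Ident a B) \<in> mors" using B Ident_closed[OF BO] by (simp add: mors_of_def)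
      ultimately show "?f z \<in> mors \<times> lists (mors \<times> mors)" by (simp add: zz)
    qed
    ultimately have "|SIGMA A:skel. el M A| \<le>o |mors \<times> lists (mors \<times> mors)|" by (rule card_of_ordLeq_inj)
    also have "|mors \<times> lists (mors \<times> mors)| \<le>o |mors \<times> (mors \<times> mors)|"
      using False by (intro card_of_Times_mono2 card_of_lists_infinite) (auto simp: finite_cartesian_product_iff)
    also have "|mors \<times> (mors \<times> mors)| \<le>o |mors \<times> mors|"
      using card_of_Times_same_infinite[OF False] by (intro card_of_Times_mono2) (simp add: ordIso_iff_ordLeq)
    also have "|mors \<times> mors| \<le>o |mors|" using card_of_Times_same_infinite[OF False] by (simp add: ordIso_iff_ordLeq)
    finally show ?thesis by (rule small_Pow)
  qed
  note Psm = this
  show thesis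
  proof (rule that[OF M _ prH inj _ prrow _ Psm, of e])
    show "sections M V e" using pc[OF VO] row_unit[OF VO] VO by (simp add: sections_def e_def)
    show "pr i (summand V k) (e k) = unit_row V k i" if "i \<in> labels V" "k \<in> labels V" for i k
      using prp[OF VO[OF that(2)] row_unit[OF VO that(2)] that(1)] by (simp add: e_def)
    show "\<exists>x\<in>el M B. \<forall>i\<in>labels V. pr i B x = g i" if "B \<in> Obj a" "row B V g" for B g
      using prp[OF that] pc[OF that(1)] that(2) by (intro bexI[of _ "p B g"]) auto
  qed
qed

section \<open>Bounded covers and bounded relations\<close>

lemma index_set:
  assumes G: "small U (G :: ('o \<times> 'u) set)"
  obtains W :: "('u, 'o) family" and y where "labels W \<in> U" "|labels W| \<le>o |G|"
    "G = (\<lambda>i. (summand W i, y i)) ` labels W"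
proof -
  obtain c :: "'o \<times> 'u \<Rightarrow> 'u" where c: "inj_on c G" "c ` G \<in> U" by (rule small_embed[OF univ G])
  let ?W = "\<lparr>labels = c ` G, summand = \<lambda>i. fst (inv_into G c i)\<rparr> :: ('u, 'o) family"
  show thesis
  proof (rule that[of ?W "\<lambda>i. snd (inv_into G c i)"])
    show "G = (\<lambda>i. (summand ?W i, snd (inv_into G c i))) ` labels ?W"
      using c(1) by (simp add: image_image)
  qed (use c card_of_image[of c G] in simp_all)
qed

lemma sieve_subpresheaf:
  assumes X: "X \<in> Obj a" and R: "is_sieve K a X R"
  shows "subpresheaf (Yoneda a X) R"
  unfolding subpresheaf_def
  using sieve_Hom[OF R X] sieve_zero[OF R X] sieve_add[OF R X] sieve_smult[OF R X] sieve_Comp[OF R X] X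
  by (auto simp: carrier_HomMod)

lemma id_lclosure_iff:
  assumes X: "X \<in> Obj a" and R: "is_sieve K a X R"
  shows "Ident a X \<in> lclosure (Yoneda a X) R X \<longleftrightarrow> R \<in> T X"
proof
  have id: "Ident a X \<in> el (Yoneda a X) X" using Ident_closed[OF X] X by (simp add: carrier_HomMod)
  have c: "map_arr (Yoneda a X) X B f (Ident a X) = f" if "B \<in> Obj a" "f \<in> Hom a B X" for B f
    using that X Ident_closed[OF X] by (simp add: Comp_Ident_left)
  {
    assume "Ident a X \<in> lclosure (Yoneda a X) R X"
    then obtain S where S: "S \<in> T X" "\<And>B f. B \<in> Obj a \<Longrightarrow> f \<in> S B \<Longrightarrow>
      map_arr (Yoneda a X) X B f (Ident a X) \<in> R B"
      unfolding lclosure_def by blast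
    show "R \<in> T X"
      by (rule T_superset[OF X S(1) R]) (use S c sieve_Hom[OF sieves[OF X S(1)] X] in auto)
  next
    assume RT: "R \<in> T X"
    then show "Ident a X \<in> lclosure (Yoneda a X) R X"
      unfolding lclosure_def using id c sieve_Hom[OF R X] by (auto intro!: bexI[of _ R])
  }
qed

lemma bounded_cover:
  assumes \<kappa>: "Card_order \<kappa>" "cinfinite \<kappa>" "regularCard \<kappa>" and com: "commutes_filtered \<kappa>"
    and X: "X \<in> Obj a" and R: "R \<in> T X"
  obtains V :: "('u, 'o) family" and q where "labels V \<in> U" "|labels V| <o \<kappa>" "|labels V| \<le>o |mors|"
    "\<And>i. i \<in> labels V \<Longrightarrow> summand V i \<in> skel" "\<And>i. i \<in> labels V \<Longrightarrow> q i () \<in> R (summand V i)"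
    "generated_sieve K a V q X \<in> T X"
proof -
  have sv: "is_sieve K a X R" using sieves X R by blast
  let ?M = "Yoneda a X"
  note M = Yoneda_PSh[OF X] and N = sieve_subpresheaf[OF X sv]
  note RH = sieve_Hom[OF sv X]
  let ?El = "SIGMA A:skel. R A"
  have El: "|?El| \<le>o |mors|"
  proof (rule card_of_ordLeq_inj)
    let ?f = "\<lambda>(B, f). (B, sk X, Comp a B X (sk X) (skj X) f)"
    show "inj_on ?f ?El"
    proof (rule inj_onI, clarsimp)
      fix B f g assume B: "B \<in> skel" and f: "f \<in> R B" and g: "g \<in> R B"
        and e: "Comp a B X (sk X) (skj X) f = Comp a B X (sk X) (skj X) g"
      show "f = g" using ski_skj[OF X skel_Obj[OF B] RH[OF f]] ski_skj[OF X skel_Obj[OF B] RH[OF g]] e by argo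
    qed
    show "?f ` ?El \<subseteq> mors" using sk[OF X] RH X by (auto simp: mors_of_def intro!: Comp_closed[where B = X] skel_Obj)
  qed
  let ?G = "{G. G \<subseteq> ?El \<and> |G| <o \<kappa>}"
  obtain Z u h L w l where "quotient_system U K a T \<kappa> ?M R Z u h L w l"
    by (rule quotient_colimit[OF \<kappa> com M N small_Pow[OF El]])
  then interpret quotient_system U K a T \<kappa> ?M R Z u h L w l .
  note fin = finite_ordLess_card[OF \<kappa>(1,2)]
  have G0: "{} \<in> ?G" using fin by auto
  have id: "Ident a X \<in> el ?M X" using Ident_closed[OF X] X by (simp add: carrier_HomMod)
  have w0: "w X (Ident a X) = \<zero>\<^bsub>map_obj L X\<^esub>" using wz[OF X id] id_lclosure_iff[OF X sv] R by simp
  have "\<exists>H\<in>?G. {} \<subseteq> H \<and>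
      (\<forall>i\<in>{undefined :: 'u}. h {} H X (u {} X (Ident a X)) = \<zero>\<^bsub>map_obj (Z H) X\<^esub>)"
  proof (rule vanish_at_stage[OF G0, of _ "\<lambda>_. X" "\<lambda>_. u {} X (Ident a X)"])
    show "|{undefined :: 'u}| <o \<kappa>" by (rule finite_ordLess_card[OF \<kappa>(1,2)]) simp
    show "\<forall>i\<in>{undefined :: 'u}. X \<in> Obj a \<and> u {} X (Ident a X) \<in> el (Z {}) X \<and>
        l {} X (u {} X (Ident a X)) = \<zero>\<^bsub>map_obj L X\<^esub>"
      using X PSh_Hom_closed[OF uH X id] lu[OF G0 X id] w0 by simp
  qed
  then obtain H where H: "H \<in> ?G" and "h {} H X (u {} X (Ident a X)) = \<zero>\<^bsub>map_obj (Z H) X\<^esub>" by blast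
  then have "u H X (Ident a X) = \<zero>\<^bsub>map_obj (Z H) X\<^esub>" using hu[OF empty_subsetI X id] by simp
  then have cl: "Ident a X \<in> lclosure ?M (subpresheaf_gen ?M H) X" using uz[OF X id] by simp
  have HE: "H \<subseteq> ?El" and Hk: "|H| <o \<kappa>" using H by auto
  have Hm: "|H| \<le>o |mors|" by (rule ordLeq_transitive[OF card_of_mono1[OF HE] El])
  obtain V :: "('u, 'o) family" and y where V: "labels V \<in> U" "|labels V| \<le>o |H|" "H = (\<lambda>i. (summand V i, y i)) ` labels V"
    by (rule index_set[OF small_ordLeq[OF mors_small Hm]])
  define q :: "'u \<Rightarrow> unit \<Rightarrow> 'u" where "q = (\<lambda>i _. y i)"
  have Vi: "summand V i \<in> skel" "q i () \<in> R (summand V i)" if "i \<in> labels V" for i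
    using HE V(3) that by (auto simp: q_def)
  have FV: "formal_to X V q"
    using Vi skel_Obj RH X by (auto simp: formal_to_def sections_def carrier_HomMod)
  let ?S = "generated_sieve K a V q X"
  have S: "is_sieve K a X ?S" by (rule generated_sieve(1)[OF X FV])
  have gen: "x \<in> ?S A" if "x \<in> subpresheaf_gen ?M H A" for A x
    by (rule subpresheaf_gen_least[OF that sieve_subpresheaf[OF X S]]) (use V(3) generated_mem[OF X FV] in \<open>auto simp: q_def\<close>)
  have "Ident a X \<in> lclosure ?M ?S X" using cl gen unfolding lclosure_def by blast
  then have ST: "?S \<in> T X" using id_lclosure_iff[OF X S] by simp
  show thesis
    by (rule that[of V q]) (rule V(1) ordLeq_ordLess_trans[OF V(2) Hk] ordLeq_transitive[OF V(2) Hm] Vi ST | assumption)+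
qed

lemma subpresheaf_kernel:
  assumes M: "M \<in> Obj PS" and F: "F \<in> Obj PS" and t: "t \<in> Hom PS M F"
  shows "subpresheaf M (\<lambda>A. {x \<in> el M A. t A x = \<zero>\<^bsub>map_obj F A\<^esub>})"
proof -
  note tD = PSh_HomD[OF t]
  have "abelian_monoid (map_obj F A)" if "A \<in> Obj a" for A
    by (rule abelian_group.axioms(1)[OF module.axioms(2)[OF PSh_module[OF F that]]])
  then show ?thesis unfolding subpresheaf_def
    by (auto simp: module_zero_closed[OF PSh_module[OF M]] module_zero_closed[OF PSh_module[OF F]] module_add_closed[OF PSh_module[OF M]]
        module_smult_closed[OF PSh_module[OF M]] PSh_closed[OF M] tD abelian_monoid.l_zero
        module.smult_r_null[OF PSh_module[OF F]] PSh_zero[OF F] PSh_Hom_zero[OF M F t])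
qed

lemma bounded_relations:
  fixes V :: "('u, 'o) family"
  assumes \<kappa>: "Card_order \<kappa>" "cinfinite \<kappa>" "regularCard \<kappa>" and com: "commutes_filtered \<kappa>"
    and X: "X \<in> Obj a" and V: "|labels V| <o \<kappa>" "|labels V| \<le>o |mors|"
        "\<And>i. i \<in> labels V \<Longrightarrow> summand V i \<in> skel"
    and FV: "formal_to X V q" and cov: "generated_sieve K a V q X \<in> T X"
  obtains W :: "('u, 'o) family" and p where "labels W \<in> U" "|labels W| <o \<kappa>"
    "\<And>z. z \<in> labels W \<Longrightarrow> summand W z \<in> Obj a" "\<And>z. z \<in> labels W \<Longrightarrow> row (summand W z) V (p z)"
    "\<And>z. z \<in> labels W \<Longrightarrow> ev (Yoneda a X) V (summand W z) (\<lambda>i. q i ()) (p z) = \<zero>\<^bsub>HomMod a (summand W z)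
      X\<^esub>"
    "\<And>A g. \<lbrakk>A \<in> Obj a; row A V g;
      ev (Yoneda a X) V A (\<lambda>i. q i ()) g = \<zero>\<^bsub>HomMod a A X\<^esub>\<rbrakk> \<Longrightarrow>
      \<exists>R\<in>T A. \<forall>B\<in>Obj a. \<forall>f\<in>R B. \<exists>k. row B W k \<and>
        (\<forall>i\<in>labels V. Comp a B A (summand V i) (g i) f = ev (Yoneda a (summand V i)) W B (\<lambda>z. p z i) k)"
proof -
  note VO = skel_Obj[OF V(3)]
  note YX = Yoneda_PSh[OF X] and qs = FV[unfolded formal_to_def]
  obtain M e pr where M: "M \<in> Obj PS" and eM: "sections M V e"
    and prH: "\<And>i. i \<in> labels V \<Longrightarrow> pr i \<in> Hom PS M (Yoneda a (summand V i))"
    and inj: "\<And>B x y. B \<in> Obj a \<Longrightarrow> x \<in> el M B \<Longrightarrow> y \<in> el M B \<Longrightarrow>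
      \<forall>i\<in>labels V. pr i B x = pr i B y \<Longrightarrow> x = y"
    and pre: "\<And>i k. i \<in> labels V \<Longrightarrow> k \<in> labels V \<Longrightarrow> pr i (summand V k) (e k) = unit_row V k i"
    and prr: "\<And>B x. B \<in> Obj a \<Longrightarrow> x \<in> el M B \<Longrightarrow> row B V (\<lambda>i. pr i B x)"
    and prs: "\<And>B g. B \<in> Obj a \<Longrightarrow> row B V g \<Longrightarrow> \<exists>x\<in>el M B. \<forall>i\<in>labels V. pr i B x = g i"
    and Msm: "small U (Pow (SIGMA A:skel. el M A))"
    by (rule direct_sum[OF V(3,2)]) (assumption, rule that)
  note prD = PSh_HomD[OF prH]
  have eC: "e i \<in> el M (summand V i)" if "i \<in> labels V" for i using eM that by (simp add: sections_def)
  have dec: "ev M V B e (\<lambda>i. pr i B x) = x" if B: "B \<in> Obj a" and x: "x \<in> el M B" for B x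
  proof (rule inj[OF B ev_closed[OF M B eM prr[OF B x]] x], rule ballI)
    fix i assume i: "i \<in> labels V"
    note h = ev_Hom[OF M Yoneda_PSh[OF VO[OF i]] prH[OF i] B eM prr[OF B x]]
    have "pr i B (ev M V B e (\<lambda>i. pr i B x)) = ev (Yoneda a (summand V i)) V B (\<lambda>k. unit_row V k i) (\<lambda>i. pr i B x)"
      unfolding h(2) by (rule ev_cong[OF Yoneda_PSh[OF VO[OF i]] B h(1) prr[OF B x] refl pre[OF i]])
    also have "\<dots> = pr i B x" by (rule ev_unit_column[OF VO B prr[OF B x] i])
    finally show "pr i B (ev M V B e (\<lambda>i. pr i B x)) = pr i B x" .
  qed
  let ?q = "\<lambda>i. q i ()"
  define t where "t = mk_nat a M (\<lambda>B x. ev (Yoneda a X) V B ?q (\<lambda>i. pr i B x))"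
  have ta: "t B x = ev (Yoneda a X) V B ?q (\<lambda>i. pr i B x)" if "B \<in> Obj a" "x \<in> el M B" for B x
    using mk_nat_apply[OF that] by (simp add: t_def)
  have tH: "t \<in> Hom PS M (Yoneda a X)"
    unfolding t_def
  proof (rule mk_nat_Hom[OF M])
    fix A x assume A: "A \<in> Obj a" and x: "x \<in> el M A"
    note rx = prr[OF A x]
    show "ev (Yoneda a X) V A ?q (\<lambda>i. pr i A x) \<in> el (Yoneda a X) A" by (rule ev_closed[OF YX A qs rx])
    show "ev (Yoneda a X) V A ?q (\<lambda>i. pr i A (x \<oplus>\<^bsub>map_obj M A\<^esub> y)) =
        ev (Yoneda a X) V A ?q (\<lambda>i. pr i A x) \<oplus>\<^bsub>map_obj (Yoneda a X) A\<^esub> ev (Yoneda a X) V A ?q (\<lambda>i. pr i A y)"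
      if y: "y \<in> el M A" for y
      unfolding ev_add[OF YX A qs rx prr[OF A y], symmetric]
      by (rule ev_cong[OF YX A qs prr[OF A module_add_closed[OF PSh_module[OF M A] x y]] _ refl]) (simp add: prD(3)[OF _ A x y])
    show "ev (Yoneda a X) V A ?q (\<lambda>i. pr i A (c \<odot>\<^bsub>map_obj M A\<^esub> x)) = c \<odot>\<^bsub>map_obj (Yoneda a X)
        A\<^esub> ev (Yoneda a X) V A ?q (\<lambda>i. pr i A x)"
      if c: "c \<in> carrier K" for c
      unfolding ev_smult[OF YX A qs rx c, symmetric]
      by (rule ev_cong[OF YX A qs prr[OF A module_smult_closed[OF PSh_module[OF M A] c x]] _ refl]) (simp add: prD(4)[OF _ A c x])
    show "ev (Yoneda a X) V B ?q (\<lambda>i. pr i B (map_arr M A B f x)) = map_arr (Yoneda a X) A B f (ev (Yoneda a X)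
        V A ?q (\<lambda>i. pr i A x))"
      if B: "B \<in> Obj a" and f: "f \<in> Hom a B A" for B f
      unfolding ev_act[OF YX A B qs rx f]
      by (rule ev_cong[OF YX B qs prr[OF B PSh_closed[OF M A B f x]] _ refl])
        (use rx in \<open>simp add: prD(5)[OF _ A B f x] row_def\<close>)
  qed
  note tD = PSh_HomD[OF tH]
  have te: "t (summand V i) (e i) = ?q i" if i: "i \<in> labels V" for i
  proof -
    have "t (summand V i) (e i) = ev (Yoneda a X) V (summand V i) ?q (unit_row V i)"
      unfolding ta[OF VO[OF i] eC[OF i]]
      by (rule ev_cong[OF YX VO[OF i] qs prr[OF VO[OF i] eC[OF i]] _ refl]) (rule pre[OF _ i])
    also have "\<dots> = ?q i" by (rule ev_unit[OF YX qs i])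
    finally show ?thesis .
  qed
  let ?N = "\<lambda>A. {x \<in> el M A. t A x = \<zero>\<^bsub>map_obj (Yoneda a X) A\<^esub>}"
  note N = subpresheaf_kernel[OF M YX tH]
  let ?El = "SIGMA A:skel. ?N A"
  have El: "small U (Pow ?El)" by (rule small_subset[OF Msm]) auto
  let ?G = "{G. G \<subseteq> ?El \<and> |G| <o \<kappa>}"
  obtain Z u h L w l where "quotient_system U K a T \<kappa> M ?N Z u h L w l"
    by (rule quotient_colimit[OF \<kappa> com M N El])
  then interpret quotient_system U K a T \<kappa> M ?N Z u h L w l .
  note LP = sheaf_PSh[OF Ls] and wD = PSh_HomD[OF wH]
  have w_wd: "w B x = w B y" if B: "B \<in> Obj a" and x: "x \<in> el M B" and y: "y \<in> el M B" and xy: "t B x = t B y" for B x y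
    using wz[OF B] subset_lclosure[OF M N B] PSh_Hom_diff[OF M YX tH B x y] PSh_Hom_diff(3)[OF M LP wH B x y] xy by simp
  text \<open>Since \<open>M/N\<close> is the covering sieve generated by \<open>q\<close>,
    the map \<open>w\<close> glues to a section of \<open>L\<close> over \<open>X\<close>.\<close>
  let ?R = "generated_sieve K a V q X"
  have sv: "is_sieve K a X ?R" by (rule generated_sieve(1)[OF X FV])
  define r where "r B f = (SOME x. x \<in> el M B \<and> t B x = f)" for B f
  have r: "r B f \<in> el M B" "t B (r B f) = f" if f: "f \<in> ?R B" for B f
  proof -
    have B: "B \<in> Obj a" by (rule sieve_Obj[OF sv X f])
    obtain g where g: "row B V g" "f = ev (Yoneda a X) V B ?q g" using generated_elem[OF X FV f] by blast
    obtain x where x: "x \<in> el M B" "\<forall>i\<in>labels V. pr i B x = g i" using prs[OF B g(1)] by blast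
    have "t B x = f" unfolding ta[OF B x(1)] g(2) by (rule ev_cong[OF YX B qs prr[OF B x(1)] _ refl]) (use x(2) in blast)
    then have "\<exists>x. x \<in> el M B \<and> t B x = f" using x(1) by blast
    then have "r B f \<in> el M B \<and> t B (r B f) = f" unfolding r_def by (rule someI_ex)
    then show "r B f \<in> el M B" "t B (r B f) = f" by auto
  qed
  define m where "m B f = w B (r B f)" for B f
  have mt: "m B (t B x) = w B x" if B: "B \<in> Obj a" and x: "x \<in> el M B" and R: "t B x \<in> ?R B" for B x
    unfolding m_def by (rule w_wd[OF B r(1)[OF R] x r(2)[OF R]])
  have mm: "matching L X ?R m"
    unfolding matching_def
  proof (intro ballI conjI)
    fix B f assume B: "B \<in> Obj a" and f: "f \<in> ?R B"
    note rf = r[OF f]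
    show "m B f \<in> el L B" unfolding m_def by (rule wD(2)[OF B rf(1)])
    show "m B (f \<oplus>\<^bsub>HomMod a B X\<^esub> g) = m B f \<oplus>\<^bsub>map_obj L B\<^esub> m B g" if g: "g \<in> ?R B" for g
      using mt[OF B module_add_closed[OF PSh_module[OF M B] rf(1) r(1)[OF g]]] tD(3)[OF B rf(1) r(1)[OF g]]
        rf(2) r(2)[OF g] sieve_add[OF sv X f g] wD(3)[OF B rf(1) r(1)[OF g]] by (simp add: m_def)
    show "m B (c \<odot>\<^bsub>HomMod a B X\<^esub> f) = c \<odot>\<^bsub>map_obj L B\<^esub> m B f" if c: "c \<in> carrier K" for c
      using mt[OF B module_smult_closed[OF PSh_module[OF M B] c rf(1)]] tD(4)[OF B c rf(1)]
        rf(2) sieve_smult[OF sv X c f] wD(4)[OF B c rf(1)] by (simp add: m_def)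
    show "m D (Comp a D B X f k) = map_arr L B D k (m B f)" if D: "D \<in> Obj a" and k: "k \<in> Hom a D B" for D k
      using mt[OF D PSh_closed[OF M B D k rf(1)]] tD(5)[OF B D k rf(1)]
        rf(2) sieve_Comp[OF sv X D f k] sieve_Hom[OF sv X f] wD(5)[OF B D k rf(1)] by (simp add: m_def)
  qed
  obtain s where s: "s \<in> el L X" "\<And>B f. B \<in> Obj a \<Longrightarrow> f \<in> ?R B \<Longrightarrow> map_arr L X B f s = m B f"
    using sheaf_glue[OF Ls X cov mm] by blast
  have sq: "map_arr L X (summand V i) (q i ()) s = w (summand V i) (e i)" if i: "i \<in> labels V" for i
    using s(2)[OF VO[OF i] generated_mem[OF X FV i]] mt[OF VO[OF i] eC[OF i]] te[OF i] generated_mem[OF X FV i] by simp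
  have qH: "q i () \<in> Hom a (summand V i) X" if "i \<in> labels V" for i
    using qs that X by (auto simp: sections_def carrier_HomMod)
  obtain G s0 where G: "G \<in> ?G" and s0: "s0 \<in> el (Z G) X" "l G X s0 = s" using lsurj[OF X s(1)] by blast
  note ZG = sheaf_PSh[OF Zs]
  let ?a = "\<lambda>i. map_arr (Z G) X (summand V i) (q i ()) s0" and ?b = "\<lambda>i. u G (summand V i) (e i)"
  have aC: "?a i \<in> el (Z G) (summand V i)" "?b i \<in> el (Z G) (summand V i)" if i: "i \<in> labels V" for i
    using PSh_closed[OF ZG X VO[OF i] qH[OF i] s0(1)] PSh_Hom_closed[OF uH VO[OF i] eC[OF i]] by auto
  have "\<exists>H\<in>?G. G \<subseteq> H \<and> (\<forall>i\<in>labels V. h G H (summand V i) (?a i \<ominus>\<^bsub>map_obj (Z G) (summand V i)\<^esub> ?b i) = \<zero>\<^bsub>map_obj (Z H) (summand V i)\<^esub>)"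
  proof (rule vanish_at_stage[OF G V(1)], intro ballI conjI)
    fix i assume i: "i \<in> labels V"
    show "summand V i \<in> Obj a" by (rule VO[OF i])
    interpret ZA: module K "map_obj (Z G) (summand V i)" by (rule PSh_module[OF ZG VO[OF i]])
    show "?a i \<ominus>\<^bsub>map_obj (Z G) (summand V i)\<^esub> ?b i \<in> el (Z G) (summand V i)" using aC[OF i] by simp
    have "l G (summand V i) (?a i) = w (summand V i) (e i)"
      using PSh_Hom_nat[OF lH[OF G] X VO[OF i] qH[OF i] s0(1)] s0(2) sq[OF i] by simp
    then show "l G (summand V i) (?a i \<ominus>\<^bsub>map_obj (Z G) (summand V i)\<^esub> ?b i) = \<zero>\<^bsub>map_obj L (summand V i)\<^esub>"
      using PSh_Hom_diff(2)[OF ZG LP lH[OF G] VO[OF i] aC[OF i]] lu[OF G VO[OF i] eC[OF i]]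
        module_diff_eq_zero[OF PSh_module[OF LP VO[OF i]]] wD(2)[OF VO[OF i] eC[OF i]] by simp
  qed
  then obtain H where H: "H \<in> ?G" and GH: "G \<subseteq> H"
    and Hz: "\<And>i. i \<in> labels V \<Longrightarrow>
        h G H (summand V i) (?a i \<ominus>\<^bsub>map_obj (Z G) (summand V i)\<^esub> ?b i) = \<zero>\<^bsub>map_obj (Z H) (summand V i)\<^esub>"
          by blast
  note ZH = sheaf_PSh[OF Zs] and hGH = hH[OF GH]
  let ?z = "h G H X s0"
  have zC: "?z \<in> el (Z H) X" by (rule PSh_Hom_closed[OF hGH X s0(1)])
  have zq: "map_arr (Z H) X (summand V i) (q i ()) ?z = u H (summand V i) (e i)" if i: "i \<in> labels V" for i
  proof -
    have "h G H (summand V i) (?a i) = h G H (summand V i) (?b i)"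
      using Hz[OF i] PSh_Hom_diff(2)[OF ZG ZH hGH VO[OF i] aC[OF i]] module_diff_eq_zero[OF PSh_module[OF ZH VO[OF i]]]
        PSh_Hom_closed[OF hGH VO[OF i]] aC[OF i] by simp
    then show ?thesis
      using PSh_Hom_nat[OF hGH X VO[OF i] qH[OF i] s0(1)] hu[OF GH VO[OF i] eC[OF i]] by simp
  qed
  have uN: "u H B x = \<zero>\<^bsub>map_obj (Z H) B\<^esub>" if B: "B \<in> Obj a" and x: "x \<in> ?N B" for B x
  proof -
    have xM: "x \<in> el M B" and tx: "ev (Yoneda a X) V B ?q (\<lambda>i. pr i B x) = \<zero>\<^bsub>HomMod a B X\<^esub>"
      using x ta[OF B, of x] by auto
    note rx = prr[OF B xM]
    note uh = ev_Hom[OF M ZH uH B eM rx]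
    have qm: "?q i \<in> max_sieve a X (summand V i)" if "i \<in> labels V" for i using qH[OF that] VO[OF that] by (simp add: max_sieve_def)
    note es = ev_sieve[OF ZH X sieve_max[OF X] matching_restrict[OF ZH X sieve_max[OF X] zC] B qm rx]
    have "u H B x = ev (Z H) V B (\<lambda>i. u H (summand V i) (e i)) (\<lambda>i. pr i B x)" using uh(2) dec[OF B xM] by simp
    also have "\<dots> = ev (Z H) V B (\<lambda>i. map_arr (Z H) X (summand V i) (q i ()) ?z) (\<lambda>i. pr i B x)"
      by (rule ev_cong[OF ZH B es(2) rx refl zq, symmetric])
    also have "\<dots> = map_arr (Z H) X B (ev (Yoneda a X) V B ?q (\<lambda>i. pr i B x)) ?z" by (rule es(4)[symmetric])
    also have "\<dots> = \<zero>\<^bsub>map_obj (Z H) B\<^esub>" unfolding tx by (rule map_arr_zero_hom[OF ZH X B zC])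
    finally show ?thesis .
  qed
  have HE: "H \<subseteq> ?El" and Hk: "|H| <o \<kappa>" using H by auto
  have "small U ((\<lambda>x. {x}) ` ?El)" by (rule small_subset[OF El]) auto
  then have "small U ?El" by (rule small_inj[rotated]) simp
  then have "small U H" by (rule small_subset[OF _ HE])
  then obtain W :: "('u, 'o) family" and y where W: "labels W \<in> U" "|labels W| \<le>o |H|" "H = (\<lambda>i. (summand W i, y i)) ` labels W"
    by (rule index_set)
  have Wz: "summand W z \<in> skel" "y z \<in> ?N (summand W z)" if "z \<in> labels W" for z
  proof -
    have "(summand W z, y z) \<in> ?El" using HE W(3) that by blast
    then show "summand W z \<in> skel" "y z \<in> ?N (summand W z)" by auto
  qed
  have WO: "summand W z \<in> Obj a" and yM: "y z \<in> el M (summand W z)" if "z \<in> labels W" for z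
    using Wz[OF that] skel_Obj by auto
  have ys: "sections M W y" using WO yM by (simp add: sections_def)
  define p where "p = (\<lambda>z i. pr i (summand W z) (y z))"
  show thesis
  proof (rule that[OF W(1) ordLeq_ordLess_trans[OF W(2) Hk] WO, of p])
    show "row (summand W z) V (p z)" if "z \<in> labels W" for z unfolding p_def by (rule prr[OF WO[OF that] yM[OF that]])
    show "ev (Yoneda a X) V (summand W z) ?q (p z) = \<zero>\<^bsub>HomMod a (summand W z) X\<^esub>" if "z \<in> labels W" for z
      using Wz(2)[OF that] ta[OF WO[OF that] yM[OF that]] by (simp add: p_def)
    fix A g assume A: "A \<in> Obj a" and g: "row A V g" and gz: "ev (Yoneda a X) V A ?q g = \<zero>\<^bsub>HomMod a A X\<^esub>"
    obtain x where x: "x \<in> el M A" "\<forall>i\<in>labels V. pr i A x = g i" using prs[OF A g] by blast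
    have "t A x = ev (Yoneda a X) V A ?q g"
      unfolding ta[OF A x(1)] by (rule ev_cong[OF YX A qs prr[OF A x(1)] _ refl]) (use x(2) in blast)
    then have "x \<in> ?N A" using x(1) gz by simp
    then have "x \<in> lclosure M (subpresheaf_gen M H) A" by (rule uz[OF A x(1), THEN iffD1, OF uN[OF A]])
    then obtain R where R: "R \<in> T A" "\<And>B f. B \<in> Obj a \<Longrightarrow> f \<in> R B \<Longrightarrow>
      map_arr M A B f x \<in> subpresheaf_gen M H B"
      unfolding lclosure_def by blast
    show "\<exists>R\<in>T A. \<forall>B\<in>Obj a. \<forall>f\<in>R B. \<exists>k. row B W k \<and>
        (\<forall>i\<in>labels V. Comp a B A (summand V i) (g i) f = ev (Yoneda a (summand V i)) W B (\<lambda>z. p z i) k)"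
    proof (rule bexI[OF _ R(1)], intro ballI)
      fix B f assume B: "B \<in> Obj a" and f: "f \<in> R B"
      have fH: "f \<in> Hom a B A" by (rule sieve_Hom[OF sieves[OF A R(1)] A f])
      have "map_arr M A B f x \<in> {ev M W B y k | k. row B W k}"
      proof (rule subpresheaf_gen_least[OF R(2)[OF B f] subpresheaf_image[OF M ys]])
        fix D v assume "(D, v) \<in> H"
        then obtain z where z: "z \<in> labels W" "D = summand W z" "v = y z" using W(3) by auto
        show "v \<in> {ev M W D y k | k. row D W k}" unfolding z(2,3) by (rule image_unit[OF M ys z(1)])
      qed
      then obtain k where k: "row B W k" "map_arr M A B f x = ev M W B y k" by blast
      have "Comp a B A (summand V i) (g i) f = ev (Yoneda a (summand V i)) W B (\<lambda>z. p z i) k" if i: "i \<in> labels V" for i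
      proof -
        have "Comp a B A (summand V i) (g i) f = pr i B (map_arr M A B f x)"
          using prD(5)[OF i A B fH x(1)] x(2) i g by (simp add: row_def)
        also have "\<dots> = ev (Yoneda a (summand V i)) W B (\<lambda>z. p z i) k"
          unfolding k(2) p_def by (rule ev_Hom(2)[OF M Yoneda_PSh[OF VO[OF i]] prH[OF i] B ys k(1)])
        finally show ?thesis .
      qed
      then show "\<exists>k. row B W k \<and> (\<forall>i\<in>labels V. Comp a B A (summand V i) (g i) f = ev (Yoneda a (summand V i))
        W B (\<lambda>z. p z i) k)"
        using k(1) by blast
    qed
  qed
qed

section \<open>The canonical bounded pretopology\<close>

definition exact_sequences :: "'c rel \<Rightarrow> ('o, 'u, 'u) formal_sequence set" where
  "exact_sequences \<kappa> = {s. is_sequence U a s \<and> |labels (seq_Z s)| <o \<kappa> \<and> |labels (seq_Y s)| <o \<kappa> \<and>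
     generated_sieve K a (seq_Y s) (seq_q s) (seq_X s) \<in> T (seq_X s) \<and>
     (\<forall>A\<in>Obj a. \<forall>g. row A (seq_Y s) g \<longrightarrow> ev (Yoneda a (seq_X s)) (seq_Y s) A (\<lambda>y. seq_q s y ())
       g = \<zero>\<^bsub>HomMod a A (seq_X s)\<^esub> \<longrightarrow>
       (\<exists>R\<in>T A. \<forall>B\<in>Obj a. \<forall>f\<in>R B. \<exists>k. row B (seq_Z s) k \<and>
        (\<forall>y\<in>labels (seq_Y s). Comp a B A (summand (seq_Y s) y) (g y) f =
          ev (Yoneda a (summand (seq_Y s) y)) (seq_Z s) B (\<lambda>z. seq_p s z y) k)))}"

lemma exact_sequence_below:
  assumes \<kappa>: "Card_order \<kappa>" "cinfinite \<kappa>" "regularCard \<kappa>" and com: "commutes_filtered \<kappa>"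
    and X: "X \<in> Obj a" and R: "R \<in> T X"
  obtains s where "s \<in> exact_sequences \<kappa>" "seq_X s = X"
    "\<And>y. y \<in> labels (seq_Y s) \<Longrightarrow> seq_q s y () \<in> R (summand (seq_Y s) y)"
proof -
  obtain V :: "('u, 'o) family" and q where V: "labels V \<in> U" "|labels V| <o \<kappa>" "|labels V| \<le>o |mors|"
    "\<And>i. i \<in> labels V \<Longrightarrow> summand V i \<in> skel" "\<And>i. i \<in> labels V \<Longrightarrow> q i () \<in> R (summand V i)"
    "generated_sieve K a V q X \<in> T X"
    by (rule bounded_cover[OF \<kappa> com X R]) (rule that)
  have qH: "q i () \<in> Hom a (summand V i) X" if "i \<in> labels V" for i
    by (rule sieve_Hom[OF sieves[OF X R] X V(5)[OF that]])
  have VO: "summand V i \<in> Obj a" if "i \<in> labels V" for i using V(4)[OF that] skel_Obj by blast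
  have FV: "formal_to X V q" using qH VO X by (simp add: formal_to_def sections_def carrier_HomMod)
  obtain W :: "('u, 'o) family" and p where W: "labels W \<in> U" "|labels W| <o \<kappa>"
    "\<And>z. z \<in> labels W \<Longrightarrow> summand W z \<in> Obj a" "\<And>z. z \<in> labels W \<Longrightarrow> row (summand W z) V (p z)"
    "\<And>z. z \<in> labels W \<Longrightarrow> ev (Yoneda a X) V (summand W z) (\<lambda>i. q i ()) (p z) = \<zero>\<^bsub>HomMod a (summand W z)
      X\<^esub>"
    "\<And>A g. \<lbrakk>A \<in> Obj a; row A V g;
      ev (Yoneda a X) V A (\<lambda>i. q i ()) g = \<zero>\<^bsub>HomMod a A X\<^esub>\<rbrakk> \<Longrightarrow>
      \<exists>R\<in>T A. \<forall>B\<in>Obj a. \<forall>f\<in>R B. \<exists>k. row B W k \<and>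
        (\<forall>i\<in>labels V. Comp a B A (summand V i) (g i) f = ev (Yoneda a (summand V i)) W B (\<lambda>z. p z i) k)"
    by (rule bounded_relations[OF \<kappa> com X V(2-4) FV V(6)]) (assumption, rule that)
  let ?s = "\<lparr>seq_Z = W, seq_p = p, seq_Y = V, seq_q = q, seq_X = X\<rparr>"
  have "row (summand V i) (single X) (q i)" if "i \<in> labels V" for i
    using qH[OF that] by (simp add: row_def single_def one_object_def)
  then have "is_sequence U a ?s"
    unfolding is_sequence_def small_family_def formal_eq_def formal_zero_def
    using V(1) W(1,3-5) VO X qH formal_comp_ev[of _ W "()" "single X" V p q]
    by (auto simp: formal_morphisms_row)
  then have "?s \<in> exact_sequences \<kappa>" using V W by (simp add: exact_sequences_def)
  then show thesis by (rule that) (use V(5) in simp_all)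
qed

lemma Co_exact_T:
  assumes "Co a (exact_sequences \<kappa>) i V v X"
  shows "generated_sieve K a V v X \<in> T X"
  using assms
proof induction
  case (Co_0 X)
  have c: "Co a (exact_sequences \<kappa>) 0 (one_object ([] :: 'u list) X) (\<lambda>_ (_ :: unit). Ident a X) X" by (rule Co.Co_0[OF Co_0])
  have FV: "formal_to X (one_object ([] :: 'u list) X) (\<lambda>_ (_ :: unit). Ident a X)"
    using Ident_closed[OF Co_0] Co_0 by (simp add: formal_to_def sections_def one_object_def carrier_HomMod)
  let ?R = "generated_sieve K a (one_object ([] :: 'u list) X) (\<lambda>_ (_ :: unit). Ident a X) X"
  have sv: "is_sieve K a X ?R" by (rule generated_sieve(1)[OF Co_0 FV])
  have id: "Ident a X \<in> ?R X" using generated_mem[OF Co_0 FV, of "[]"] by (simp add: one_object_def)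
  show ?case
    by (rule T_superset[OF Co_0 T1[OF Co_0] sv])
      (use sieve_Comp[OF sv Co_0 _ id] Comp_Ident_left[OF _ Co_0] in \<open>auto simp: max_sieve_def split: if_splits\<close>)
next
  case (Co_1 s)
  then have sq: "is_sequence U a s" and T: "generated_sieve K a (seq_Y s) (seq_q s) (seq_X s) \<in> T (seq_X s)"
    by (auto simp: exact_sequences_def)
  let ?V = "\<lparr>labels = {[y] | y. y \<in> labels (seq_Y s)}, summand = \<lambda>l. summand (seq_Y s) (last l)\<rparr>"
  note X = seq_X_Obj[OF sq] and FY = seq_q_formal[OF sq]
  have FV: "formal_to (seq_X s) ?V (\<lambda>l _. seq_q s (last l) ())" using FY by (auto simp: formal_to_def sections_def)
  have q: "seq_q s y () \<in> generated_sieve K a ?V (\<lambda>l _. seq_q s (last l) ()) (seq_X s) (summand (seq_Y s) y)"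
      if "y \<in> labels (seq_Y s)" for y
    using generated_mem[OF X FV, of "[y]"] that by simp
  show ?case
    by (rule T_superset[OF X T generated_sieve(1)[OF X FV]])
      (rule generated_least[OF X FY generated_sieve(1)[OF X FV] q])
next
  case (Co_Suc i V v X t)
  have seqs: "is_sequence U a s" if "s \<in> exact_sequences \<kappa>" for s using that by (simp add: exact_sequences_def)
  have X: "X \<in> Obj a" and FV: "formal_to X V v" using Co_sections[OF seqs Co_Suc.hyps(2)] by auto
  let ?W = "\<lparr>labels = {l @ [d] | l d. l \<in> labels V \<and> d \<in> labels (seq_Y (t l))},
       summand = \<lambda>l. summand (seq_Y (t (butlast l))) (last l)\<rparr>"
  let ?w = "\<lambda>l _. Comp a (summand (seq_Y (t (butlast l))) (last l)) (summand V (butlast l)) X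
         (v (butlast l) ()) (seq_q (t (butlast l)) (last l) ())"
  have FW: "formal_to X ?W ?w" using Co_sections[OF seqs Co.Co_Suc[OF Co_Suc.hyps]] by blast
  let ?S = "generated_sieve K a ?W ?w X"
  have S: "is_sieve K a X ?S" by (rule generated_sieve(1)[OF X FW])
  note YX = Yoneda_PSh[OF X] and NS = sieve_subpresheaf[OF X S]
  have vl: "v l () \<in> lclosure (Yoneda a X) ?S (summand V l)" if l: "l \<in> labels V" for l
  proof -
    note tl = Co_Suc.hyps(3)[OF l]
    note sq = seqs[OF conjunct1[OF tl]]
    have V: "summand V l \<in> Obj a" "v l () \<in> Hom a (summand V l) X"
      using FV l X by (auto simp: formal_to_def sections_def carrier_HomMod)
    let ?Y = "seq_Y (t l)" and ?q = "seq_q (t l)"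
    have tT: "generated_sieve K a ?Y ?q (summand V l) \<in> T (summand V l)" using tl by (auto simp: exact_sequences_def)
    have FY: "formal_to (summand V l) ?Y ?q" using seq_q_formal[OF sq] tl by simp
    let ?P = "pullback_sieve a (summand V l) X (v l ()) ?S"
    have "f \<in> ?P B" if f: "f \<in> generated_sieve K a ?Y ?q (summand V l) B" for B f
    proof (rule generated_least[OF V(1) FY sieve_pullback[OF X V S] _ f])
      fix d assume d: "d \<in> labels ?Y"
      have "?w (l @ [d]) () \<in> ?S (summand ?W (l @ [d]))"
        by (rule generated_mem[OF X FW]) (use l d in auto)
      then show "?q d () \<in> ?P (summand ?Y d)"
        using seq_Y_Obj[OF sq d] seq_q_Hom[OF sq d] tl by (simp add: pullback_iff)
    qed
    then have "map_arr (Yoneda a X) (summand V l) B f (v l ()) \<in> ?S B"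
      if "f \<in> generated_sieve K a ?Y ?q (summand V l) B" for B f using that V by (simp add: pullback_iff)
    then show ?thesis unfolding lclosure_def using V X tT by (auto simp: carrier_HomMod)
  qed
  have cl: "is_sieve K a X (\<lambda>B. if B \<in> Obj a then lclosure (Yoneda a X) ?S B else {})"
    by (rule subpresheaf_Yoneda_sieve[OF X subpresheaf_lclosure[OF YX NS]])
  have id: "Ident a X \<in> el (Yoneda a X) X" using Ident_closed[OF X] X by (simp add: carrier_HomMod)
  have "Ident a X \<in> lclosure (Yoneda a X) ?S X"
  proof (rule lclosure_closed[OF YX NS X Co_Suc.IH id])
    fix B f assume B: "B \<in> Obj a" and f: "f \<in> generated_sieve K a V v X B"
    have "f \<in> (\<lambda>B. if B \<in> Obj a then lclosure (Yoneda a X) ?S B else {}) B"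
      by (rule generated_least[OF X FV cl _ f]) (use vl FV in \<open>auto simp: formal_to_def sections_def\<close>)
    then show "map_arr (Yoneda a X) X B f (Ident a X) \<in> lclosure (Yoneda a X) ?S B"
      using B sieve_Hom[OF generated_sieve(1)[OF X FV] X f] X Ident_closed[OF X] by (simp add: Comp_Ident_left)
  qed
  then show ?case using id_lclosure_iff[OF X S] by simp
qed

lemma commutes_imp_pretopology:
  assumes \<kappa>: "Card_order \<kappa>" "cinfinite \<kappa>" "regularCard \<kappa>" and com: "commutes_filtered \<kappa>"
  shows "pretopology U a (exact_sequences \<kappa>)" "bounded_sequences \<kappa> (exact_sequences \<kappa>)"
    "\<forall>A\<in>Obj a. T A = top_of K a (exact_sequences \<kappa>) A"
proof -
  let ?S = "exact_sequences \<kappa>"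
  have seqs: "is_sequence U a s" if "s \<in> ?S" for s using that by (simp add: exact_sequences_def)
  have below: thesis if X: "X \<in> Obj a" and R: "R \<in> T X"
      and r: "\<And>V v. \<lbrakk>Co a ?S 1 V v X; formal_to X V v; (\<And>l. l \<in> labels V \<Longrightarrow>
          v l () \<in> R (summand V l))\<rbrakk> \<Longrightarrow>
      thesis" for X R thesis
  proof -
    obtain s where s: "s \<in> ?S" "seq_X s = X" "\<And>y. y \<in> labels (seq_Y s) \<Longrightarrow> seq_q s y () \<in> R (summand (seq_Y s) y)"
      by (rule exact_sequence_below[OF \<kappa> com X R]) (rule that)
    have c: "Co a ?S 1 \<lparr>labels = {[y] | y. y \<in> labels (seq_Y s)}, summand = \<lambda>l. summand (seq_Y s) (last l)\<rparr>
      (\<lambda>l _. seq_q s (last l) ()) X" using Co_1[OF s(1), of a] s(2) by simp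
    show thesis by (rule r[OF c conjunct2[OF Co_sections[OF seqs c]]]) (use s(3) in auto)
  qed
  show "bounded_sequences \<kappa> ?S" by (simp add: bounded_sequences_def exact_sequences_def)
  show "pretopology U a ?S"
  proof (unfold_locales, goal_cases)
    case (1 s)
    then show ?case by (rule seqs)
  next
    case (2 s A f)
    note sq = seqs[OF 2(1)]
    let ?X = "seq_X s" and ?Y = "seq_Y s"
    note X = seq_X_Obj[OF sq] and FY = seq_q_formal[OF sq]
    let ?R = "generated_sieve K a ?Y (seq_q s) ?X"
    have RT: "?R \<in> T ?X" using 2(1) by (simp add: exact_sequences_def)
    obtain V v where c: "Co a ?S 1 V v A" and FV: "formal_to A V v"
      and vR: "\<And>l. l \<in> labels V \<Longrightarrow> v l () \<in> pullback_sieve a A ?X f ?R (summand V l)"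
      by (rule below[OF 2(2) T2[OF X 2(2) RT 2(3)]]) (rule that)
    have VO: "summand V l \<in> Obj a" "v l () \<in> Hom a (summand V l) A" if "l \<in> labels V" for l
      using FV that 2(2) by (auto simp: formal_to_def sections_def carrier_HomMod)
    have "\<forall>l\<in>labels V. \<exists>g. row (summand V l) ?Y g \<and>
      Comp a (summand V l) A ?X f (v l ()) = ev (Yoneda a ?X) ?Y (summand V l) (\<lambda>y. seq_q s y ()) g"
    proof
      fix l assume "l \<in> labels V"
      then have "Comp a (summand V l) A ?X f (v l ()) \<in> ?R (summand V l)" using vR by (simp add: pullback_iff)
      then show "\<exists>g. row (summand V l) ?Y g \<and>
          Comp a (summand V l) A ?X f (v l ()) = ev (Yoneda a ?X) ?Y (summand V l) (\<lambda>y. seq_q s y ()) g"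
        by (rule generated_elem[OF X FY])
    qed
    then obtain f' where f': "\<forall>l\<in>labels V. row (summand V l) ?Y (f' l) \<and>
      Comp a (summand V l) A ?X f (v l ()) = ev (Yoneda a ?X) ?Y (summand V l) (\<lambda>y. seq_q s y ()) (f' l)"
      by (rule bchoice[THEN exE])
    have "formal_comp a V ?Y (single ?X) (seq_q s) f' l () = formal_comp a V (single A) (single ?X) (\<lambda>_ _. f) v l ()"
      if l: "l \<in> labels V" for l
    proof -
      have fc: "f \<in> el (Yoneda a ?X) A" using 2 X by (simp add: carrier_HomMod)
      note es = ev_single[OF Yoneda_PSh[OF X] VO(1)[OF l] 2(2), of "\<lambda>_. f" "v l", OF fc VO(2)[OF l]]
      have "formal_comp a V ?Y (single ?X) (seq_q s) f' l () = ev (Yoneda a ?X) ?Y (summand V l) (\<lambda>y. seq_q s y ()) (f' l)"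
        using formal_comp_ev[of l V "()" "single ?X" ?Y f' "seq_q s"] l VO X f' seq_Y_Obj[OF sq] seq_q_Hom[OF sq] by simp
      moreover have "formal_comp a V (single A) (single ?X) (\<lambda>_ _. f) v l () = Comp a (summand V l) A ?X f (v l ())"
        using formal_comp_ev[of l V "()" "single ?X" "single A" v "\<lambda>_ _. f"] l VO X 2 es by simp
      ultimately show ?thesis using f' l by simp
    qed
    then show ?case using c f' by (intro exI[of _ 1] exI[of _ V] exI[of _ v] exI[of _ f']) (simp add: formal_morphisms_row formal_eq_def)
  next
    case (3 s A g)
    note sq = seqs[OF 3(1)]
    let ?X = "seq_X s" and ?Y = "seq_Y s" and ?Z = "seq_Z s"
    note X = seq_X_Obj[OF sq]
    have g: "row A ?Y (g ())" using 3(3) by (simp add: formal_morphisms_row)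
    have gz: "ev (Yoneda a ?X) ?Y A (\<lambda>y. seq_q s y ()) (g ()) = \<zero>\<^bsub>HomMod a A ?X\<^esub>"
      using 3(4) formal_comp_ev[of "()" "single A" "()" "single ?X" ?Y g "seq_q s"] 3(2) X g seq_Y_Obj[OF sq] seq_q_Hom[OF sq]
      by (simp add: formal_eq_def formal_zero_def)
    obtain R where R: "R \<in> T A" "\<forall>B\<in>Obj a. \<forall>f\<in>R B. \<exists>k. row B ?Z k \<and>
        (\<forall>y\<in>labels ?Y. Comp a B A (summand ?Y y) (g () y) f = ev (Yoneda a (summand ?Y y)) ?Z B (\<lambda>z. seq_p s z y) k)"
      using 3(1,2) g gz unfolding exact_sequences_def by blast
    obtain V v where c: "Co a ?S 1 V v A" and FV: "formal_to A V v" and vR: "\<And>l. l \<in> labels V \<Longrightarrow> v l () \<in> R (summand V l)"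
      by (rule below[OF 3(2) R(1)]) (rule that)
    have VO: "summand V l \<in> Obj a" "v l () \<in> Hom a (summand V l) A" if "l \<in> labels V" for l
      using FV that 3(2) by (auto simp: formal_to_def sections_def carrier_HomMod)
    have "\<forall>l\<in>labels V. \<exists>k. row (summand V l) ?Z k \<and> (\<forall>y\<in>labels ?Y.
      Comp a (summand V l) A (summand ?Y y) (g () y) (v l ()) = ev (Yoneda a (summand ?Y y)) ?Z (summand V l) (\<lambda>z. seq_p s z y) k)"
      using R(2) VO vR by blast
    then obtain g' where g': "\<forall>l\<in>labels V. row (summand V l) ?Z (g' l) \<and> (\<forall>y\<in>labels ?Y.
      Comp a (summand V l) A (summand ?Y y) (g () y) (v l ()) = ev (Yoneda a (summand ?Y y)) ?Z (summand V l) (\<lambda>z. seq_p s z y) (g' l))"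
      by (rule bchoice[THEN exE])
    have "formal_comp a V ?Z ?Y (seq_p s) g' l y = formal_comp a V (single A) ?Y g v l y"
      if l: "l \<in> labels V" and y: "y \<in> labels ?Y" for l y
    proof -
      note Yy = seq_Y_Obj[OF sq y]
      have gy: "g () y \<in> Hom a A (summand ?Y y)" using g y by (simp add: row_def)
      have gc: "g () y \<in> el (Yoneda a (summand ?Y y)) A" using gy 3(2) Yy by (simp add: carrier_HomMod)
      note es = ev_single[OF Yoneda_PSh[OF Yy] VO(1)[OF l] 3(2), of "\<lambda>u. g u y" "v l", OF gc VO(2)[OF l]]
      have "formal_comp a V ?Z ?Y (seq_p s) g' l y = ev (Yoneda a (summand ?Y y)) ?Z (summand V l) (\<lambda>z. seq_p s z y) (g' l)"
        by (rule formal_comp_ev) (use l y VO Yy g' seq_Z_Obj[OF sq] seq_p_row[OF sq] in \<open>auto simp: row_def\<close>)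
      moreover have "formal_comp a V (single A) ?Y g v l y = Comp a (summand V l) A (summand ?Y y) (g () y) (v l ())"
        using formal_comp_ev[of l V y ?Y "single A" v g] l y VO Yy 3(2) gy es by simp
      ultimately show ?thesis using g' l y by simp
    qed
    then show ?case using c g' by (intro exI[of _ 1] exI[of _ V] exI[of _ v] exI[of _ g']) (simp add: formal_morphisms_row formal_eq_def)
  qed
  show "\<forall>A\<in>Obj a. T A = top_of K a ?S A"
  proof (intro ballI equalityI subsetI)
    fix A R assume A: "A \<in> Obj a" and R: "R \<in> T A"
    obtain V v where c: "Co a ?S 1 V v A" and FV: "formal_to A V v" and vR: "\<And>l. l \<in> labels V \<Longrightarrow> v l () \<in> R (summand V l)"
      by (rule below[OF A R]) (rule that)
    have "generated_sieve K a V v A B \<subseteq> R B" for B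
      using generated_least[OF A FV sieves[OF A R] vR] by blast
    then show "R \<in> top_of K a ?S A" unfolding top_of_def using c sieves[OF A R] by blast
  next
    fix A R assume A: "A \<in> Obj a" and "R \<in> top_of K a ?S A"
    then obtain i V v where sv: "is_sieve K a A R" and c: "Co a ?S i V v A" and s: "\<And>B. generated_sieve K a V v A B \<subseteq> R B"
      unfolding top_of_def by blast
    show "R \<in> T A" by (rule T_superset[OF A Co_exact_T[OF c] sv]) (use s in blast)
  qed
qed

end

theorem theorem3p1p4:
  fixes U :: "'u set set" and K :: "'k ring" and a :: "('o, 'u, 'k) linear_category"
    and \<kappa> :: "'c rel" and T :: "'o \<Rightarrow> ('o \<Rightarrow> 'u set) set"
  assumes "universe U"
    and "cring K"
    and "linear_category K a"
    and "essentially_small U a"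
    and "Card_order \<kappa>" and "cinfinite \<kappa>" and "regularCard \<kappa>"
    and "linear_topology K a T"
  shows "(noetherian_topology U \<kappa> K a T \<longleftrightarrow>
      (\<exists>S. pretopology U a S \<and> bounded_sequences \<kappa> S \<and> (\<forall>A\<in>Obj a. T A = top_of K a S A))) \<and>
    ((\<exists>S. pretopology U a S \<and> bounded_sequences \<kappa> S \<and> (\<forall>A\<in>Obj a. T A = top_of K a S A)) \<longleftrightarrow>
      (\<forall>(j :: ('u, 'u) category) J.
        small_category U j \<longrightarrow> filtered \<kappa> j \<longrightarrow> is_functor j (Sh U K a T) J \<longrightarrow>
        commutes_with_colimit j (Sh U K a T) (PSh U K a) inclusion_functor J))"
proof -
  interpret site U K a T
    by (intro site.intro site_axioms.intro assms)
  have "noetherian_topology U \<kappa> K a T \<longleftrightarrow> commutes_filtered \<kappa>"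
    by (rule noetherian_iff_commutes[OF assms(5,6)])
  moreover have "(\<exists>S. pretopology U a S \<and> bounded_sequences \<kappa> S \<and> (\<forall>A\<in>Obj a. T A = top_of K a S A)) \<longleftrightarrow> commutes_filtered \<kappa>"
    using pretopology_imp_commutes[OF assms(5-7)] commutes_imp_pretopology[OF assms(5-7)] by blast
  ultimately show ?thesis unfolding commutes_filtered_def by blast
qed

end
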